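(* Let $H(x_1,x_2)=h_1(x_1)h_2(x_2)$ with $h_1,h_2\in C^3(\mathbb{T})$ satisfying, for $i=1,2$: $h_i$ has only simple zeros; $h_i'(b)=0$ implies $h_i''(b)\neq 0$; and $h_i(x)h_i''(x)\le 0$ for all $x\in\mathbb{T}$. Assume that $\sigma$ satisfies $\sigma(x)\cdot\nabla H(x)=0$ for all $x\in\mathbb{T}^2$, written as $\sigma=\rho\,\xi$ with $\xi=\nabla^\perp H$ and $\rho\in C^2(\mathbb{T}^2)$, and that $\lambda\in C^2(\mathbb{T}^2)$, $\lambda\ge l_0>0$, and $\rho$ satisfy $\lambda(x)=l(H(x))$, $\rho(x)=r(H(x))$ for all $x\in\mathbb{T}^2$, for some $l,r\in C^2([-1,1])$ with $l\ge l_0>0$ and $r^2\ge r_0>0$. Let $f_0$ be an initial density whose support is disjoint from the set of centers $M_1\times M_2$ of $H$, and for $\alpha>0$, $R_0>0$ let $f_\alpha$ be the unique bounded weak solution of the stochastic transport equation $$df_\alpha+\operatorname{div}\big(f_\alpha\,\lambda^{-1}\sigma\big)\circ dw(t)-\operatorname{div}(f_\alpha\,g_\alpha)\,dt=-R_0\,f_\alpha^2\,dt,\qquad f_\alpha|_{t=0}=f_0 .$$ Then there is a constant $\bar\kappa>0$, independent of $\alpha$ and $R_0$, such that for every $\alpha>0$ there exists $c_\alpha>0$ with $$\mathbb{E}\int_{\mathbb{T}^2}f_\alpha(t,x)\,dx\;\le\;\frac{c_\alpha}{R_0}\,\exp\!\left(-\frac{\alpha\,r^2(0)}{l^2(0)\,(l(0)+\alpha)}\,\bar\kappa\,t\right),\qquad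 t\ge 0 .$$
   Context: $\mathbb{T}=\mathbb{R}/L\mathbb{Z}$ for some $L>0$, $\mathbb{T}^2=\mathbb{T}\times\mathbb{T}$. Throughout, $h_1,h_2$ are normalized by $\max_{\mathbb{T}}|h_i|=1$, so $H$ takes values in $[-1,1]$. $\nabla^\perp H=(-\partial_{x_2}H,\partial_{x_1}H)$. $M_i=\{b\in\mathbb{T}:h_i'(b)=0\}$, and the points of $M_1\times M_2$ are called the centers of $H$. $w$ is a one-dimensional standard Brownian motion on a stochastic basis $(\Omega,\mathcal{F},\{\mathcal{F}_t\}_{t\ge0},\mathbb{P})$; $\circ\,dw$ denotes Stratonovich integration. The inertial drift is $$g_\alpha(x)=\frac{\alpha}{2(\lambda(x)+\alpha)}\,\Gamma(x),\qquad \Gamma(x)=D(\lambda^{-1}\sigma)(x)\,(\lambda^{-1}\sigma)(x)+(\sigma\sigma^t)(x)\,\frac{\nabla\lambda(x)}{\lambda^3(x)} .$$ The initial density $f_0$ is a bounded non-negative function on $\mathbb{T}^2$. $f_\alpha$ is non-negative, adapted, bounded (on bounded time intervals), and solves the equation in the weak sense: for all $\varphi\in C^\infty(\mathbb{T}^2)$, $$\int f_\alpha(t)\varphi\,dx=\int f_0\varphi\,dx+\int_0^t\!\!\int f_\alpha(s)\,\lambda^{-1}\sigma\cdot\nabla\varphi\,dx\circ dw(s)-\int_0^t\!\!\int f_\alpha(s)\,g_\alpha\cdot\nabla\varphi\,dx\,ds-R_0\int_0^t\!\!\int f_\alpha^2(s)\,\varphi\,dx\,ds .$$ Existence and uniqueness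 of such a solution is a known fact that is taken as given. The constant $c_\alpha$ does not depend on $t$. *)

theory Defs
  imports "HOL-Probability.Probability" "HOL-Library.Periodic_Fun"
begin

section \<open>Functions on the torus and differentiability classes\<close>

text \<open>
  A function on the circle of length \<open>L\<close> is an \<open>L\<close>-periodic function on the line; a function on
  the two-dimensional torus is a function on the plane that is \<open>L\<close>-periodic in each coordinate.
\<close>

definition torus_periodic :: "real \<Rightarrow> (real \<times> real \<Rightarrow> real) \<Rightarrow> bool" where
  "torus_periodic L u \<longleftrightarrow>
     (\<forall>x y. u (x + L, y) = u (x, y) \<and> u (x, y + L) = u (x, y))"

definition torus_integral :: "real \<Rightarrow> (real \<times> real \<Rightarrow> real) \<Rightarrow> real" where
  "torus_integral L u = (LINT x:{0..<L} \<times> {0..<L}|lborel. u x)"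

text \<open>
  \<open>Ck_on k S f\<close>: \<open>f\<close> is of class \<open>C^k\<close> on \<open>S\<close>. It is used only for \<open>S = UNIV\<close> and for compact
  intervals (with one-sided derivatives at the end points), where the derivative within \<open>S\<close> is
  unique.
\<close>

primrec Ck_on :: "nat \<Rightarrow> 'a::euclidean_space set \<Rightarrow> ('a \<Rightarrow> real) \<Rightarrow> bool" where
  "Ck_on 0 S f \<longleftrightarrow> continuous_on S f"
| "Ck_on (Suc k) S f \<longleftrightarrow>
     f differentiable_on S \<and> (\<forall>v. Ck_on k S (\<lambda>x. frechet_derivative f (at x within S) v))"

definition smooth_torus :: "real \<Rightarrow> (real \<times> real \<Rightarrow> real) \<Rightarrow> bool" where
  "smooth_torus L \<phi> \<longleftrightarrow> torus_periodic L \<phi> \<and> (\<forall>k. Ck_on k UNIV \<phi>)"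

definition grad :: "(real \<times> real \<Rightarrow> real) \<Rightarrow> real \<times> real \<Rightarrow> real \<times> real" where
  "grad u x = (frechet_derivative u (at x) (1, 0), frechet_derivative u (at x) (0, 1))"

definition grad_perp :: "(real \<times> real \<Rightarrow> real) \<Rightarrow> real \<times> real \<Rightarrow> real \<times> real" where
  "grad_perp u x = (- snd (grad u x), fst (grad u x))"

section \<open>The Hamiltonian and the inertial drift\<close>

definition hamiltonian :: "(real \<Rightarrow> real) \<Rightarrow> (real \<Rightarrow> real) \<Rightarrow> real \<times> real \<Rightarrow> real" where
  "hamiltonian h1 h2 x = h1 (fst x) * h2 (snd x)"

definition critical_points :: "(real \<Rightarrow> real) \<Rightarrow> real set" where
  "critical_points h = {b. deriv h b = 0}"

definition hamiltonian_factor :: "real \<Rightarrow> (real \<Rightarrow> real) \<Rightarrow> bool" where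
  "hamiltonian_factor L h \<longleftrightarrow>
     periodic_fun_simple h L \<and> Ck_on 3 UNIV h \<and>
     (\<forall>x. \<bar>h x\<bar> \<le> 1) \<and> (\<exists>x. \<bar>h x\<bar> = 1) \<and>
     (\<forall>x. h x = 0 \<longrightarrow> deriv h x \<noteq> 0) \<and>
     (\<forall>b. deriv h b = 0 \<longrightarrow> deriv (deriv h) b \<noteq> 0) \<and>
     (\<forall>x. h x * deriv (deriv h) x \<le> 0)"

definition scaled_field ::
  "(real \<times> real \<Rightarrow> real) \<Rightarrow> (real \<times> real \<Rightarrow> real \<times> real) \<Rightarrow> real \<times> real \<Rightarrow> real \<times> real" where
  "scaled_field lam \<sigma> x = (1 / lam x) *\<^sub>R \<sigma> x"

text \<open>The matrix \<open>\<sigma>\<sigma>\<^sup>t\<close> acts on a vector \<open>v\<close> as \<open>(\<sigma> \<bullet> v) \<sigma>\<close>.\<close>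

definition Gamma_field ::
  "(real \<times> real \<Rightarrow> real) \<Rightarrow> (real \<times> real \<Rightarrow> real \<times> real) \<Rightarrow> real \<times> real \<Rightarrow> real \<times> real" where
  "Gamma_field lam \<sigma> x =
     frechet_derivative (scaled_field lam \<sigma>) (at x) (scaled_field lam \<sigma> x)
     + (\<sigma> x \<bullet> ((1 / lam x ^ 3) *\<^sub>R grad lam x)) *\<^sub>R \<sigma> x"

definition inertial_drift ::
  "real \<Rightarrow> (real \<times> real \<Rightarrow> real) \<Rightarrow> (real \<times> real \<Rightarrow> real \<times> real) \<Rightarrow>
   real \<times> real \<Rightarrow> real \<times> real" where
  "inertial_drift \<alpha> lam \<sigma> x = (\<alpha> / (2 * (lam x + \<alpha>))) *\<^sub>R Gamma_field lam \<sigma> x"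

section \<open>Stochastic bases, Brownian motion and the Stratonovich integral\<close>

text \<open>
  Processes and filtrations are indexed by real numbers; only the times \<open>t \<ge> 0\<close> are meaningful.
  The basis satisfies the usual conditions.
\<close>

locale stochastic_basis = prob_space M + complete_measure M
  for M :: "'a measure" +
  fixes F :: "real \<Rightarrow> 'a measure"
  assumes subalg: "0 \<le> t \<Longrightarrow> subalgebra M (F t)"
    and mono: "0 \<le> s \<Longrightarrow> s \<le> t \<Longrightarrow> sets (F s) \<subseteq> sets (F t)"
    and null: "null_sets M \<subseteq> sets (F 0)"
    and right_continuous: "0 \<le> t \<Longrightarrow> sets (F t) = (\<Inter>s\<in>{t<..}. sets (F s))"

definition adapted :: "(real \<Rightarrow> 'a measure) \<Rightarrow> (real \<Rightarrow> 'a \<Rightarrow> real) \<Rightarrow> bool" where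
  "adapted F X \<longleftrightarrow> (\<forall>t\<ge>0. X t \<in> borel_measurable (F t))"

definition continuous_paths :: "'a measure \<Rightarrow> (real \<Rightarrow> 'a \<Rightarrow> real) \<Rightarrow> bool" where
  "continuous_paths M X \<longleftrightarrow> (AE \<omega> in M. continuous_on {0..} (\<lambda>t. X t \<omega>))"

definition brownian_motion ::
  "'a measure \<Rightarrow> (real \<Rightarrow> 'a measure) \<Rightarrow> (real \<Rightarrow> 'a \<Rightarrow> real) \<Rightarrow> bool" where
  "brownian_motion M F w \<longleftrightarrow>
     adapted F w \<and> continuous_paths M w \<and> (AE \<omega> in M. w 0 \<omega> = 0) \<and>
     (\<forall>s t. 0 \<le> s \<longrightarrow> s < t \<longrightarrow>
        distributed M lborel (\<lambda>\<omega>. w t \<omega> - w s \<omega>) (normal_density 0 (sqrt (t - s))) \<and>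
        prob_space.indep_set M (sets (F s))
          {(\<lambda>\<omega>. w t \<omega> - w s \<omega>) -` B \<inter> space M | B. B \<in> sets borel})"

definition martingale ::
  "'a measure \<Rightarrow> (real \<Rightarrow> 'a measure) \<Rightarrow> (real \<Rightarrow> 'a \<Rightarrow> real) \<Rightarrow> bool" where
  "martingale M F X \<longleftrightarrow>
     adapted F X \<and> (\<forall>t\<ge>0. integrable M (X t)) \<and>
     (\<forall>s t. 0 \<le> s \<longrightarrow> s \<le> t \<longrightarrow> (AE \<omega> in M. real_cond_exp M (F s) (X t) \<omega> = X s \<omega>))"

text \<open>Finite-valued localizing times lose no generality: replace \<open>\<tau>\<^sub>n\<close> by \<open>min \<tau>\<^sub>n n\<close>.\<close>

definition continuous_local_martingale ::
  "'a measure \<Rightarrow> (real \<Rightarrow> 'a measure) \<Rightarrow> (real \<Rightarrow> 'a \<Rightarrow> real) \<Rightarrow> bool" where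
  "continuous_local_martingale M F N \<longleftrightarrow>
     adapted F N \<and> continuous_paths M N \<and>
     (\<exists>\<tau>::nat \<Rightarrow> 'a \<Rightarrow> real.
        (\<forall>n. \<forall>\<omega>\<in>space M. 0 \<le> \<tau> n \<omega>) \<and>
        (\<forall>n. \<forall>t\<ge>0. Measurable.pred (F t) (\<lambda>\<omega>. \<tau> n \<omega> \<le> t)) \<and>
        (AE \<omega> in M. incseq (\<lambda>n. \<tau> n \<omega>) \<and> filterlim (\<lambda>n. \<tau> n \<omega>) at_top sequentially) \<and>
        (\<forall>n. martingale M F (\<lambda>t \<omega>. N (min t (\<tau> n \<omega>)) \<omega> - N 0 \<omega>)))"

text \<open>\<open>p 0 \<le> \<dots> \<le> p n\<close> are the points of a partition of \<open>[0, t]\<close>.\<close>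

definition partition_points :: "real \<Rightarrow> nat \<Rightarrow> (nat \<Rightarrow> real) \<Rightarrow> bool" where
  "partition_points t n p \<longleftrightarrow> p 0 = 0 \<and> p n = t \<and> (\<forall>i<n. p i \<le> p (Suc i))"

definition finite_variation :: "(real \<Rightarrow> real) \<Rightarrow> bool" where
  "finite_variation a \<longleftrightarrow>
     (\<forall>t\<ge>0. \<exists>C. \<forall>n p. partition_points t n p \<longrightarrow> (\<Sum>i<n. \<bar>a (p (Suc i)) - a (p i)\<bar>) \<le> C)"

text \<open>\<open>Y\<close> has a modification that is a continuous semimartingale.\<close>

definition continuous_semimartingale ::
  "'a measure \<Rightarrow> (real \<Rightarrow> 'a measure) \<Rightarrow> (real \<Rightarrow> 'a \<Rightarrow> real) \<Rightarrow> bool" where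
  "continuous_semimartingale M F Y \<longleftrightarrow>
     (\<exists>N A. continuous_local_martingale M F N \<and>
            adapted F A \<and> continuous_paths M A \<and> (AE \<omega> in M. finite_variation (\<lambda>t. A t \<omega>)) \<and>
            (\<forall>t\<ge>0. AE \<omega> in M. Y t \<omega> = N t \<omega> + A t \<omega>))"

definition trapezoid_sum ::
  "(real \<Rightarrow> 'a \<Rightarrow> real) \<Rightarrow> (real \<Rightarrow> 'a \<Rightarrow> real) \<Rightarrow> nat \<Rightarrow> (nat \<Rightarrow> real) \<Rightarrow> 'a \<Rightarrow> real" where
  "trapezoid_sum Y w n p \<omega> =
     (\<Sum>i<n. (Y (p i) \<omega> + Y (p (Suc i)) \<omega>) / 2 * (w (p (Suc i)) \<omega> - w (p i) \<omega>))"

text \<open>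
  The random variable \<open>I\<close> is (a version of) the Stratonovich integral of the continuous
  semimartingale \<open>Y\<close> against \<open>w\<close> over \<open>[0, t]\<close>, i.e. the limit in probability of the trapezoidal
  sums as the mesh of the partition tends to zero.
\<close>

definition has_stratonovich_integral ::
  "'a measure \<Rightarrow> (real \<Rightarrow> 'a measure) \<Rightarrow> (real \<Rightarrow> 'a \<Rightarrow> real) \<Rightarrow> (real \<Rightarrow> 'a \<Rightarrow> real) \<Rightarrow>
   real \<Rightarrow> ('a \<Rightarrow> real) \<Rightarrow> bool" where
  "has_stratonovich_integral M F w Y t I \<longleftrightarrow>
     continuous_semimartingale M F Y \<and> I \<in> borel_measurable M \<and>
     (\<forall>\<epsilon>>0. \<exists>\<delta>>0. \<forall>n p.
        partition_points t n p \<and> (\<forall>i<n. p (Suc i) - p i < \<delta>) \<longrightarrow>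
        measure M {\<omega>\<in>space M. \<bar>trapezoid_sum Y w n p \<omega> - I \<omega>\<bar> > \<epsilon>} < \<epsilon>)"

section \<open>Weak solutions of the stochastic transport equation\<close>

text \<open>
  The pointwise conditions hold up to null sets of \<open>\<omega>\<close> and \<open>x\<close> at each fixed time, the bound being
  uniform in \<open>\<omega>\<close>, in \<open>x\<close> and in \<open>t\<close> from a bounded interval.
\<close>

definition bounded_weak_solution ::
  "'a measure \<Rightarrow> (real \<Rightarrow> 'a measure) \<Rightarrow> (real \<Rightarrow> 'a \<Rightarrow> real) \<Rightarrow> real \<Rightarrow>
   (real \<times> real \<Rightarrow> real) \<Rightarrow> (real \<times> real \<Rightarrow> real \<times> real) \<Rightarrow> real \<Rightarrow> real \<Rightarrow>
   (real \<times> real \<Rightarrow> real) \<Rightarrow> (real \<Rightarrow> 'a \<Rightarrow> real \<times> real \<Rightarrow> real) \<Rightarrow> bool" where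
  "bounded_weak_solution M F w L lam \<sigma> \<alpha> R0 f0 f \<longleftrightarrow>
     (\<forall>t\<ge>0. \<forall>\<omega>\<in>space M. torus_periodic L (f t \<omega>)) \<and>
     (\<lambda>(t, \<omega>, x). f t \<omega> x)
        \<in> borel_measurable (restrict_space borel {0..} \<Otimes>\<^sub>M (M \<Otimes>\<^sub>M borel)) \<and>
     (\<forall>t\<ge>0. (\<lambda>(\<omega>, x). f t \<omega> x) \<in> borel_measurable (F t \<Otimes>\<^sub>M borel)) \<and>
     (\<forall>t\<ge>0. AE \<omega> in M. AE x in lborel. 0 \<le> f t \<omega> x) \<and>
     (\<forall>T\<ge>0. \<exists>C. \<forall>t\<in>{0..T}. AE \<omega> in M. AE x in lborel. f t \<omega> x \<le> C) \<and>
     (\<forall>\<phi>. smooth_torus L \<phi> \<longrightarrow> (\<forall>t\<ge>0. \<exists>I.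
        has_stratonovich_integral M F w
          (\<lambda>s \<omega>. torus_integral L (\<lambda>x. f s \<omega> x * (scaled_field lam \<sigma> x \<bullet> grad \<phi> x))) t I \<and>
        (AE \<omega> in M.
          torus_integral L (\<lambda>x. f t \<omega> x * \<phi> x)
          = torus_integral L (\<lambda>x. f0 x * \<phi> x)
            + I \<omega>
            - (LINT s:{0..t}|lborel.
                 torus_integral L (\<lambda>x. f s \<omega> x * (inertial_drift \<alpha> lam \<sigma> x \<bullet> grad \<phi> x)))
            - R0 * (LINT s:{0..t}|lborel. torus_integral L (\<lambda>x. (f s \<omega> x)\<^sup>2 * \<phi> x)))))"

definition unique_bounded_weak_solution ::
  "'a measure \<Rightarrow> (real \<Rightarrow> 'a measure) \<Rightarrow> (real \<Rightarrow> 'a \<Rightarrow> real) \<Rightarrow> real \<Rightarrow>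
   (real \<times> real \<Rightarrow> real) \<Rightarrow> (real \<times> real \<Rightarrow> real \<times> real) \<Rightarrow> real \<Rightarrow> real \<Rightarrow>
   (real \<times> real \<Rightarrow> real) \<Rightarrow> (real \<Rightarrow> 'a \<Rightarrow> real \<times> real \<Rightarrow> real) \<Rightarrow> bool" where
  "unique_bounded_weak_solution M F w L lam \<sigma> \<alpha> R0 f0 f \<longleftrightarrow>
     bounded_weak_solution M F w L lam \<sigma> \<alpha> R0 f0 f \<and>
     (\<forall>f'. bounded_weak_solution M F w L lam \<sigma> \<alpha> R0 f0 f' \<longrightarrow>
        (\<forall>t\<ge>0. AE \<omega> in M. AE x in lborel. f' t \<omega> x = f t \<omega> x))"

end

theory Submission
  imports Defs
begin

text \<open>
  Write \<open>V = \<lambda>\<^sup>-\<^sup>1 \<sigma>\<close>. Since \<open>\<lambda>\<close> and \<open>\<rho>\<close> are functions of \<open>H\<close>, the field \<open>V\<close> is divergence free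
  and tangent to the level sets of \<open>H\<close>, and the inertial drift \<open>g\<close> is a positive multiple of
  \<open>DV V\<close>. The equation is solved pathwise (Doss--Sussmann): the characteristics
  \<open>dX = V(X) \<circ> dw - g(X) dt\<close> become, after composition with the flow of \<open>V\<close> at time \<open>-w(t)\<close>, an
  ordinary differential equation depending continuously on the path of \<open>w\<close>, and the density along
  them solves a Riccati equation. This explicit density is a bounded weak solution, so by uniqueness
  it is \<open>f\<close>. Along the characteristics the noise leaves \<open>H\<close> unchanged and the drift gives
  \<open>d|H|/dt = - rate |H|\<close>, where \<open>rate \<ge> 0\<close> vanishes only at the centers. Characteristics that
  start in the support of \<open>f0\<close> stay away from the centers, so the density is carried by
  \<open>{|H| \<le> exp (- \<kappa>\<^sub>0 t)}\<close>, whose area decays exponentially, while the absorption bounds the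
  density by a multiple of \<open>1 / R0\<close> from time \<open>1\<close> on.
\<close>

text \<open>The drift pulled back by the flow of \<open>V\<close> is handled only as a Lipschitz
  field, so its flow \<open>zeta\<close> is never differentiated; its Jacobian comes from
  compositions of area-preserving maps \<open>Phi\<close> and Euler steps of \<open>g\<close>, which
  is why only the divergence of \<open>g\<close> along \<open>X\<close> appears in it. The
  Stratonovich integral is a limit in probability of trapezoidal sums of a semimartingale, and both
  the limit and the semimartingale property are checked from Gaussian moments: for a test function
  with iterated derivatives along \<open>V\<close> the error over an interval of length h has
  expectation of order h^(3/2), and the martingale part is recognized by a differential equation for
  expectations. Independence of \<kappa> from \<alpha> has two sources: the points visited by
  characteristics lie in a set defined without noise or drift, where the decay rate is bounded below
  up to an explicit function of \<alpha>, and that function is compared with the one in the claim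
  through \<open>l 0 / lmax \<le> (l 0 + \<alpha>) / (lmax + \<alpha>)\<close>. The values of
  \<open>l\<close> and \<open>r\<close> away from 0 enter only through \<open>lmax\<close> and
  \<open>r0\<close>.\<close>

type_synonym plane = "real \<times> real"

abbreviation fderiv :: "('a::real_normed_vector \<Rightarrow> real) \<Rightarrow> 'a \<Rightarrow> 'a \<Rightarrow> real" where
  "fderiv u x \<equiv> frechet_derivative u (at x)"

section \<open>Ordinary differential equations\<close>

text \<open>The norm may fail to be differentiable at zero, so
  \<open>sqrt (e r \<bullet> e r + \<eta>^2)\<close> is compared instead, and \<eta> is sent to 0 at
  the end.\<close>

lemma gronwall_forward:
  fixes e :: "real \<Rightarrow> 'a::real_inner"
  assumes ab: "a \<le> b" and C: "0 \<le> C" and D: "0 \<le> D"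
    and der: "\<And>r. r \<in> {a..b} \<Longrightarrow> (e has_vector_derivative e' r) (at r)"
    and bd: "\<And>r. r \<in> {a..b} \<Longrightarrow> norm (e' r) \<le> C * norm (e r) + D"
  shows "norm (e b) \<le> (norm (e a) + D * (b - a)) * exp (C * (b - a))"
proof -
  have key: "norm (e b) \<le> (norm (e a) + \<eta> + D * (b - a)) * exp (C * (b - a))" if \<eta>: "\<eta> > 0" for \<eta>
  proof -
    define N where "N r = sqrt (e r \<bullet> e r + \<eta>^2)" for r
    have pos: "e r \<bullet> e r + \<eta>^2 > 0" for r
      using \<eta> by (simp add: add_nonneg_pos)
    have Ngt: "N r > 0" for r using pos by (simp add: N_def)
    have Nge: "norm (e r) \<le> N r" for r
      unfolding N_def norm_eq_sqrt_inner using \<eta> by simp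
    have Nder: "(N has_real_derivative (e r \<bullet> e' r) / N r) (at r)" if r: "r \<in> {a..b}" for r
    proof -
      have 1: "((\<lambda>r. e r \<bullet> e r) has_real_derivative (e r \<bullet> e' r + e' r \<bullet> e r)) (at r)"
        using der[OF r] unfolding has_vector_derivative_def has_field_derivative_def
        by (auto intro!: derivative_eq_intros simp: algebra_simps inner_commute)
      show ?thesis unfolding N_def
        by (rule DERIV_cong[OF DERIV_chain2[OF DERIV_real_sqrt[OF pos] DERIV_add[OF 1 DERIV_const]]])
           (simp add: inner_commute field_simps)
    qed
    have Nbd: "(e r \<bullet> e' r) / N r \<le> C * N r + D" if r: "r \<in> {a..b}" for r
    proof -
      have "e r \<bullet> e' r \<le> norm (e r) * norm (e' r)" by (rule norm_cauchy_schwarz)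
      also have "\<dots> \<le> N r * (C * norm (e r) + D)"
        by (intro mult_mono Nge bd r) (auto simp: less_imp_le[OF Ngt] C D)
      also have "\<dots> \<le> N r * (C * N r + D)"
        by (intro mult_left_mono add_right_mono Nge C) (auto simp: less_imp_le[OF Ngt])
      finally show ?thesis using Ngt[of r] by (simp add: divide_le_eq mult.commute)
    qed
    \<comment> \<open>Integrating factor. The source term stands outside the exponential, which only
      enlarges it because \<open>exp (- (C * (r - a))) \<le> 1\<close>.\<close>
    define G where "G r = N r * exp (- (C * (r - a))) - D * (r - a)" for r
    have "G b \<le> G a"
    proof (rule DERIV_nonpos_imp_nonincreasing[OF ab])
      fix r assume r: "a \<le> r" "r \<le> b"
      let ?y = "(e r \<bullet> e' r) / N r * exp (- (C * (r - a))) + N r * (exp (- (C * (r - a))) * (- C)) - D"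
      have "(G has_real_derivative ?y) (at r)" unfolding G_def
        by (rule derivative_eq_intros Nder refl | use r in simp)+
      moreover have "?y \<le> 0"
      proof -
        have "(e r \<bullet> e' r) / N r * exp (- (C * (r - a))) \<le> (C * N r + D) * exp (- (C * (r - a)))"
          using Nbd[of r] r by (intro mult_right_mono) auto
        also have "D * exp (- (C * (r - a))) \<le> D * 1"
          using C r by (intro mult_left_mono D) auto
        then have "(C * N r + D) * exp (- (C * (r - a))) \<le> C * N r * exp (- (C * (r - a))) + D"
          by (simp add: algebra_simps)
        finally show ?thesis by (simp add: algebra_simps)
      qed
      ultimately show "\<exists>y. DERIV G r :> y \<and> y \<le> 0" by blast
    qed
    then have "N b * exp (- (C * (b - a))) \<le> N a + D * (b - a)" by (simp add: G_def)
    then have "N b \<le> (N a + D * (b - a)) * exp (C * (b - a))"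
      by (simp add: exp_minus divide_le_eq flip: divide_inverse)
    moreover have "N a \<le> norm (e a) + \<eta>"
      unfolding N_def by (rule real_le_lsqrt) (use \<eta> in \<open>auto simp: power2_sum power2_norm_eq_inner\<close>)
    then have "(N a + D * (b - a)) * exp (C * (b - a)) \<le> (norm (e a) + \<eta> + D * (b - a)) * exp (C * (b - a))"
      by (intro mult_right_mono) auto
    ultimately show ?thesis using Nge[of b] by linarith
  qed
  show ?thesis
  proof (rule field_le_epsilon)
    fix \<epsilon> :: real assume \<epsilon>: "\<epsilon> > 0"
    show "norm (e b) \<le> (norm (e a) + D * (b - a)) * exp (C * (b - a)) + \<epsilon>"
      using key[of "\<epsilon> / exp (C * (b - a))"] \<epsilon> by (simp add: distrib_right)
  qed
qed

text \<open>Time reversal gives the backward case, which is needed because flows are run for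
  negative times as well: the path value that serves as flow time has no sign.\<close>

lemma gronwall:
  fixes e :: "real \<Rightarrow> 'a::real_inner"
  assumes C: "0 \<le> C" and D: "0 \<le> D"
    and der: "\<And>q. q \<in> {min s r..max s r} \<Longrightarrow> (e has_vector_derivative e' q) (at q)"
    and bd: "\<And>q. q \<in> {min s r..max s r} \<Longrightarrow> norm (e' q) \<le> C * norm (e q) + D"
  shows "norm (e r) \<le> (norm (e s) + D * \<bar>r - s\<bar>) * exp (C * \<bar>r - s\<bar>)"
proof (cases "s \<le> r")
  case True
  then show ?thesis using gronwall_forward[of s r C D e e'] assms by simp
next
  case False
  have der': "((\<lambda>q. e (- q)) has_vector_derivative - e' (- q)) (at q)" if "q \<in> {-s..-r}" for q
  proof -
    have "(e has_vector_derivative e' (- q)) (at (- q))" using that False by (intro der) auto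
    moreover have "(uminus has_vector_derivative (-1::real)) (at q)"
      by (auto intro!: derivative_eq_intros)
    ultimately show ?thesis
      using vector_diff_chain_at[of uminus "-1" q e "e' (- q)"] by (simp add: o_def)
  qed
  show ?thesis
    using gronwall_forward[of "-s" "-r" C D "\<lambda>q. e (- q)" "\<lambda>q. - e' (- q)", OF _ C D der']
      bd False by auto
qed

text \<open>The oriented integral: one of the two terms is over an empty or degenerate interval and
  vanishes. It lets the same integral equation run in both time directions.\<close>

definition signed_integral :: "real \<Rightarrow> real \<Rightarrow> (real \<Rightarrow> 'a::euclidean_space) \<Rightarrow> 'a" where
  "signed_integral s r F = integral {s..r} F - integral {r..s} F"

lemma signed_integral_split:
  fixes F :: "real \<Rightarrow> 'a::euclidean_space"
  assumes F: "continuous_on UNIV F" and "a \<le> s" "a \<le> r"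
  shows "signed_integral s r F = integral {a..r} F - integral {a..s} F"
proof -
  have i: "F integrable_on {x..y}" for x y
    by (rule integrable_continuous_interval) (rule continuous_on_subset[OF F], simp)
  show ?thesis
    using Henstock_Kurzweil_Integration.integral_combine[of a s r F]
      Henstock_Kurzweil_Integration.integral_combine[of a r s F] assms i
    by (cases "s \<le> r"; cases "s = r") (auto simp: signed_integral_def algebra_simps)
qed

lemma signed_integral_refl [simp]: "signed_integral s s F = 0"
  by (simp add: signed_integral_def)

lemma signed_integral_has_vector_derivative:
  fixes F :: "real \<Rightarrow> 'a::euclidean_space"
  assumes F: "continuous_on UNIV F"
  shows "((\<lambda>r. signed_integral s r F) has_vector_derivative F r) (at r)"
proof -
  define a where "a = min s r - 1"
  have "((\<lambda>u. integral {a..u} F) has_vector_derivative F r) (at r within {a..r+1})"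
    by (rule integral_has_vector_derivative) (auto simp: a_def intro: continuous_on_subset[OF F])
  then have "((\<lambda>u. integral {a..u} F) has_vector_derivative F r) (at r)"
    by (rule at_within_Icc_at[THEN subst, rotated 2]) (auto simp: a_def)
  then have "((\<lambda>u. integral {a..u} F - integral {a..s} F) has_vector_derivative F r - 0) (at r)"
    by (intro has_vector_derivative_diff) auto
  moreover have "integral {a..u} F - integral {a..s} F = signed_integral s u F" if "u \<in> {a<..}" for u
    using signed_integral_split[OF F, of a s u] that by (simp add: a_def)
  ultimately show ?thesis
    using has_vector_derivative_transform_within_open[of
        "\<lambda>u. integral {a..u} F - integral {a..s} F" "F r" r "{a<..}" "\<lambda>r. signed_integral s r F"]
    by (simp add: a_def)
qed

lemma has_vector_derivative_imp_continuous:
  assumes "\<And>q. (f has_vector_derivative f' q) (at q)"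
  shows "continuous_on S f"
  by (meson assms continuous_at_imp_continuous_on has_vector_derivative_continuous)

text \<open>In the norm weighted by \<open>exp (k * \<bar>q - s\<bar>)\<close> integration gains a
  factor \<open>1 / k\<close>. Choosing \<open>k\<close> above the Lipschitz constant makes Picard
  iteration contract on any time interval, however long.\<close>

lemma signed_integral_exp_bound:
  fixes F :: "real \<Rightarrow> 'a::euclidean_space"
  assumes F: "continuous_on UNIV F" and k: "k > 0" and c: "c \<ge> 0"
    and bd: "\<And>q. q \<in> {min s r..max s r} \<Longrightarrow> norm (F q) \<le> c * exp (k * \<bar>q - s\<bar>)"
  shows "norm (signed_integral s r F) \<le> c / k * exp (k * \<bar>r - s\<bar>)"
proof -
  have dexp: "((\<lambda>r. c / k * exp (k * (r + \<sigma>))) has_vector_derivative c * exp (k * (q + \<sigma>))) (at q)" for \<sigma> q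
    unfolding has_real_derivative_iff_has_vector_derivative[symmetric]
    by (rule derivative_eq_intros refl)+ (use k in simp)
  have main: "norm (G b) \<le> c / k * exp (k * (b - a))"
    if ab: "a \<le> b" and G: "\<And>q. (G has_vector_derivative G' q) (at q)" "G a = 0"
      and bd: "\<And>q. q \<in> {a..b} \<Longrightarrow> norm (G' q) \<le> c * exp (k * (q - a))"
    for G :: "real \<Rightarrow> 'a" and G' a b
  proof (cases "a = b")
    case True
    then show ?thesis using G k c by simp
  next
    case False
    have "norm (G b - G a) \<le> c / k * exp (k * (b + - a)) - c / k * exp (k * (a + - a))"
    proof (rule differentiable_bound_general[where f' = G' and \<phi>' = "\<lambda>q. c * exp (k * (q + - a))"])
      show "a < b" using ab False by simp
      show "continuous_on {a..b} G" by (rule has_vector_derivative_imp_continuous[OF G(1)])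
      show "continuous_on {a..b} (\<lambda>r. c / k * exp (k * (r + - a)))"
        by (rule has_vector_derivative_imp_continuous[OF dexp])
      show "((\<lambda>r. c / k * exp (k * (r + - a))) has_vector_derivative c * exp (k * (x + - a))) (at x)" for x
        by (rule dexp)
    qed (use G bd in auto)
    moreover have "0 \<le> c / k" using k c by simp
    ultimately show ?thesis using G(2) by simp
  qed
  show ?thesis
  proof (cases "s \<le> r")
    case True
    show ?thesis
      using main[of s r "\<lambda>r. signed_integral s r F" F] True bd
        signed_integral_has_vector_derivative[OF F] by simp
  next
    case False
    have "((\<lambda>q. signed_integral s (- q) F) has_vector_derivative - F (- q)) (at q)" for q
    proof -
      have "(uminus has_vector_derivative (-1::real)) (at q)"
        by (auto intro!: derivative_eq_intros)
      then show ?thesis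
        using vector_diff_chain_at[of uminus "-1" q "\<lambda>r. signed_integral s r F" "F (- q)"]
          signed_integral_has_vector_derivative[OF F, of s "- q"] by (simp add: o_def)
    qed
    moreover have "norm (- F (- q)) \<le> c * exp (k * (q - - s))" if "q \<in> {- s..- r}" for q
      using bd[of "- q"] that False by (simp add: add.commute)
    ultimately show ?thesis
      using main[of "- s" "- r" "\<lambda>q. signed_integral s (- q) F" "\<lambda>q. - F (- q)"] False by simp
  qed
qed

text \<open>Global in space, locally uniform in time. Solutions then exist for all times without a
  continuation argument, while a driving path is allowed to be bounded on compact time intervals
  only.\<close>

definition lipschitz_field :: "(real \<Rightarrow> 'a::euclidean_space \<Rightarrow> 'a) \<Rightarrow> bool" where
  "lipschitz_field B \<longleftrightarrow> continuous_on UNIV (\<lambda>(r, x). B r x) \<and>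
     (\<forall>T. \<exists>C>0. \<forall>r x y. \<bar>r\<bar> \<le> T \<longrightarrow> norm (B r x - B r y) \<le> C * norm (x - y))"

lemma lipschitz_field_continuous:
  assumes "lipschitz_field B" "continuous_on S f" "continuous_on S g"
  shows "continuous_on S (\<lambda>q. B (f q) (g q))"
  using continuous_on_compose2[of UNIV "\<lambda>(r, x). B r x" S "\<lambda>q. (f q, g q)"] assms
  by (auto simp: lipschitz_field_def intro!: continuous_intros)

primrec picard :: "(real \<Rightarrow> 'a::euclidean_space \<Rightarrow> 'a) \<Rightarrow> real \<Rightarrow> 'a \<Rightarrow> nat \<Rightarrow> real \<Rightarrow> 'a" where
  "picard B s x 0 = (\<lambda>r. x)"
| "picard B s x (Suc n) = (\<lambda>r. x + signed_integral s r (\<lambda>q. B q (picard B s x n q)))"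

text \<open>An explicit limit of iterates rather than a choice from an existence statement, so that
  measurability in the field and in the data is inherited from the iterates.\<close>

definition ode_sol :: "(real \<Rightarrow> 'a::euclidean_space \<Rightarrow> 'a) \<Rightarrow> real \<Rightarrow> 'a \<Rightarrow> real \<Rightarrow> 'a" where
  "ode_sol B s x r = lim (\<lambda>n. picard B s x n r)"

lemma signed_integral_continuous:
  "continuous_on UNIV F \<Longrightarrow> continuous_on S (\<lambda>r. signed_integral s r F)"
  by (rule has_vector_derivative_imp_continuous[OF signed_integral_has_vector_derivative])

lemma signed_integral_diff:
  fixes F G :: "real \<Rightarrow> 'a::euclidean_space"
  assumes F: "continuous_on UNIV F" and G: "continuous_on UNIV G"
  shows "signed_integral s r (\<lambda>q. F q - G q) = signed_integral s r F - signed_integral s r G"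
proof -
  have i: "F integrable_on {x..y}" "G integrable_on {x..y}" for x y
    by (rule integrable_continuous_interval, rule continuous_on_subset[OF F] continuous_on_subset[OF G], simp)+
  show ?thesis
    by (simp add: signed_integral_def Henstock_Kurzweil_Integration.integral_diff i)
qed

context
  fixes B :: "real \<Rightarrow> 'a::euclidean_space \<Rightarrow> 'a"
  assumes B: "lipschitz_field B"
begin

lemma picard_continuous: "continuous_on S (picard B s x n)"
proof (induction n arbitrary: S)
  case (Suc n)
  show ?case
    by (simp, intro continuous_intros signed_integral_continuous lipschitz_field_continuous[OF B] Suc)
qed simp

lemma picard_integrand_continuous: "continuous_on UNIV (\<lambda>q. B q (picard B s x n q))"
  by (intro lipschitz_field_continuous[OF B] picard_continuous continuous_intros)

text \<open>With weight \<open>exp (2 * C * \<bar>r - s\<bar>)\<close>, where \<open>C\<close> is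
  the Lipschitz constant, each iteration halves the increment, and a geometric series
  dominates.\<close>

lemma picard_uniform_limit:
  "uniform_limit {-T..T} (\<lambda>n r. picard B s x n r) (ode_sol B s x) sequentially"
proof -
  define T' where "T' = max \<bar>T\<bar> \<bar>s\<bar>"
  obtain C where C: "C > 0" "\<And>r x y. \<bar>r\<bar> \<le> T' \<Longrightarrow> norm (B r x - B r y) \<le> C * norm (x - y)"
    using B unfolding lipschitz_field_def by blast
  have "compact ((\<lambda>q. B q x) ` {-T'..T'})"
    by (intro compact_continuous_image lipschitz_field_continuous[OF B] continuous_intros) auto
  then have "bounded ((\<lambda>q. B q x) ` {-T'..T'})" by (rule compact_imp_bounded)
  then obtain D where "D > 0" "\<forall>q\<in>{-T'..T'}. norm (B q x) \<le> D"
    unfolding bounded_pos by auto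
  then have D: "\<bar>q\<bar> \<le> T' \<Longrightarrow> norm (B q x) \<le> D" "D > 0" for q
    by (auto simp: abs_le_iff minus_le_iff)
  \<comment> \<open>Weighted size of the first Picard increment: a velocity bounded by
    \<open>D\<close> integrates to at most \<open>D / (2 * C)\<close> times the weight.\<close>
  define E where "E = D / (2 * C)"
  have E: "E > 0" using D C by (simp add: E_def)
  have step: "norm (picard B s x (Suc n) r - picard B s x n r) \<le> E * (1/2)^n * exp (2 * C * \<bar>r - s\<bar>)"
    if "\<bar>r\<bar> \<le> T'" for n r
    using that
  proof (induction n arbitrary: r)
    case 0
    have "norm (signed_integral s r (\<lambda>q. B q x)) \<le> D / (2 * C) * exp (2 * C * \<bar>r - s\<bar>)"
    proof (rule signed_integral_exp_bound)
      fix q assume q: "q \<in> {min s r..max s r}"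
      have "norm (B q x) \<le> D" using q 0 by (intro D) (auto simp: T'_def min_def max_def split: if_splits)
      also have "\<dots> \<le> D * exp (2 * C * \<bar>q - s\<bar>)" using D C by simp
      finally show "norm (B q x) \<le> D * exp (2 * C * \<bar>q - s\<bar>)" .
    qed (use C D in \<open>auto intro!: lipschitz_field_continuous[OF B] continuous_intros\<close>)
    then show ?case by (simp add: E_def)
  next
    case (Suc n)
    have "norm (signed_integral s r (\<lambda>q. B q (picard B s x (Suc n) q) - B q (picard B s x n q)))
        \<le> (C * (E * (1/2)^n)) / (2 * C) * exp (2 * C * \<bar>r - s\<bar>)"
    proof (rule signed_integral_exp_bound)
      fix q assume q: "q \<in> {min s r..max s r}"
      have qT: "\<bar>q\<bar> \<le> T'" using q Suc.prems by (auto simp: T'_def min_def max_def split: if_splits)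
      have "norm (B q (picard B s x (Suc n) q) - B q (picard B s x n q))
          \<le> C * norm (picard B s x (Suc n) q - picard B s x n q)"
        by (rule C(2)[OF qT])
      also have "\<dots> \<le> C * (E * (1/2)^n * exp (2 * C * \<bar>q - s\<bar>))"
        by (intro mult_left_mono Suc.IH qT) (use C in auto)
      finally show "norm (B q (picard B s x (Suc n) q) - B q (picard B s x n q))
          \<le> C * (E * (1/2)^n) * exp (2 * C * \<bar>q - s\<bar>)" by (simp add: mult.assoc)
    qed (use C E in \<open>auto intro!: continuous_intros picard_integrand_continuous simp del: picard.simps\<close>)
    moreover have "picard B s x (Suc (Suc n)) r - picard B s x (Suc n) r
        = signed_integral s r (\<lambda>q. B q (picard B s x (Suc n) q) - B q (picard B s x n q))"
      unfolding signed_integral_diff[OF picard_integrand_continuous picard_integrand_continuous]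
      by simp
    ultimately show ?case using C by (simp add: field_simps del: picard.simps)
  qed
  define f where "f n r = picard B s x (Suc n) r - picard B s x n r" for n r
  define M where "M n = E * exp (2 * C * (2 * T')) * (1/2)^n" for n :: nat
  have T'0: "T' \<ge> 0" by (simp add: T'_def)
  have "uniform_limit {-T..T} (\<lambda>n r. \<Sum>i<n. f i r) (\<lambda>r. suminf (\<lambda>i. f i r)) sequentially"
  proof (rule Weierstrass_m_test)
    fix n r assume r: "r \<in> {-T..T}"
    then have rT: "\<bar>r\<bar> \<le> T'" by (auto simp: T'_def)
    have "\<bar>r - s\<bar> \<le> 2 * T'" using rT by (auto simp: T'_def)
    then have "exp (2 * C * \<bar>r - s\<bar>) \<le> exp (2 * C * (2 * T'))" using C by simp
    then have "E * (1/2)^n * exp (2 * C * \<bar>r - s\<bar>) \<le> E * (1/2)^n * exp (2 * C * (2 * T'))"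
      using E by (intro mult_left_mono) auto
    with step[OF rT, of n] show "norm (f n r) \<le> M n"
      unfolding f_def M_def by (simp add: mult.assoc mult.commute mult.left_commute del: picard.simps)
  next
    show "summable M" unfolding M_def by (intro summable_mult summable_geometric) simp
  qed
  then have "uniform_limit {-T..T} (\<lambda>n r. x + (\<Sum>i<n. f i r)) (\<lambda>r. x + suminf (\<lambda>i. f i r)) sequentially"
    by (intro uniform_limit_intros)
  moreover have "x + (\<Sum>i<n. f i r) = picard B s x n r" for n r
    unfolding f_def sum_lessThan_telescope[where f = "\<lambda>i. picard B s x i r"] by simp
  ultimately have u: "uniform_limit {-T..T} (picard B s x) (\<lambda>r. x + suminf (\<lambda>i. f i r)) sequentially"
    by simp
  have eq: "x + suminf (\<lambda>i. f i r) = ode_sol B s x r" if "r \<in> {-T..T}" for r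
    unfolding ode_sol_def using limI[OF tendsto_uniform_limitI[OF u that]] by simp
  show ?thesis
    by (rule iffD1[OF uniform_limit_cong' u]) (auto simp: eq)
qed

lemma picard_tendsto: "(\<lambda>n. picard B s x n r) \<longlonglongrightarrow> ode_sol B s x r"
  proof -
  have "r \<in> {-\<bar>r\<bar>..\<bar>r\<bar>}" by (simp add: abs_le_iff minus_le_iff) linarith
  then show ?thesis using tendsto_uniform_limitI[OF picard_uniform_limit] by blast
qed

lemma ode_sol_continuous: "continuous_on S (ode_sol B s x)"
proof -
  have "continuous (at r) (ode_sol B s x)" for r
  proof -
    have "continuous_on {-(\<bar>r\<bar>+1)..\<bar>r\<bar>+1} (ode_sol B s x)"
      by (rule uniform_limit_theorem[OF _ picard_uniform_limit])
         (auto intro!: always_eventually picard_continuous)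
    then show ?thesis
      by (rule continuous_on_interior) (auto simp: abs_if)
  qed
  then show ?thesis by (simp add: continuous_at_imp_continuous_on)
qed

lemma ode_sol_integrand_continuous: "continuous_on UNIV (\<lambda>q. B q (ode_sol B s x q))"
  by (intro lipschitz_field_continuous[OF B] ode_sol_continuous continuous_intros)

lemma ode_sol_integral:
  "ode_sol B s x r = x + signed_integral s r (\<lambda>q. B q (ode_sol B s x q))"
proof -
  define T where "T = max \<bar>r\<bar> \<bar>s\<bar>"
  obtain C where C: "C > 0" "\<And>r x y. \<bar>r\<bar> \<le> T \<Longrightarrow> norm (B r x - B r y) \<le> C * norm (x - y)"
    using B unfolding lipschitz_field_def by blast
  let ?S = "\<lambda>F. signed_integral s r F"
  have "(\<lambda>n. ?S (\<lambda>q. B q (picard B s x n q)) - ?S (\<lambda>q. B q (ode_sol B s x q))) \<longlonglongrightarrow> 0"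
  proof (rule LIMSEQ_I)
    fix \<epsilon> :: real assume \<epsilon>: "\<epsilon> > 0"
    define d where "d = \<epsilon> / (2 * C * exp \<bar>r - s\<bar>)"
    have d: "d > 0" using \<epsilon> C by (simp add: d_def)
    have "\<forall>\<^sub>F n in sequentially. \<forall>q\<in>{-T..T}. dist (picard B s x n q) (ode_sol B s x q) < d"
      using uniform_limitD[OF picard_uniform_limit d] .
    then obtain n0 where "\<forall>n\<ge>n0. \<forall>q\<in>{-T..T}. norm (picard B s x n q - ode_sol B s x q) < d"
      unfolding eventually_sequentially dist_norm by blast
    then have n0: "n \<ge> n0 \<Longrightarrow> q \<in> {-T..T} \<Longrightarrow> norm (picard B s x n q - ode_sol B s x q) < d" for n q
      by blast
    have "norm (?S (\<lambda>q. B q (picard B s x n q)) - ?S (\<lambda>q. B q (ode_sol B s x q)) - 0) < \<epsilon>" if n: "n \<ge> n0" for n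
    proof -
      have "norm (?S (\<lambda>q. B q (picard B s x n q) - B q (ode_sol B s x q))) \<le> C * d / 1 * exp (1 * \<bar>r - s\<bar>)"
      proof (rule signed_integral_exp_bound)
        fix q assume q: "q \<in> {min s r..max s r}"
        then have qT: "\<bar>q\<bar> \<le> T" by (auto simp: T_def min_def max_def split: if_splits)
        then have "norm (picard B s x n q - ode_sol B s x q) < d" by (intro n0[OF n]) auto
        then have "norm (B q (picard B s x n q) - B q (ode_sol B s x q)) \<le> C * d"
          using C(2)[OF qT, of "picard B s x n q" "ode_sol B s x q"] C(1)
          by (meson less_imp_le mult_left_mono order_trans)
        also have "\<dots> \<le> C * d * exp (1 * \<bar>q - s\<bar>)" using C d by simp
        finally show "norm (B q (picard B s x n q) - B q (ode_sol B s x q)) \<le> C * d * exp (1 * \<bar>q - s\<bar>)" .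
      qed (use C d in \<open>auto intro!: continuous_intros picard_integrand_continuous ode_sol_integrand_continuous\<close>)
      also have "\<dots> < \<epsilon>" using C \<epsilon> by (simp add: d_def)
      finally show ?thesis
        by (simp add: signed_integral_diff picard_integrand_continuous ode_sol_integrand_continuous)
    qed
    then show "\<exists>n0. \<forall>n\<ge>n0. norm (?S (\<lambda>q. B q (picard B s x n q)) - ?S (\<lambda>q. B q (ode_sol B s x q)) - 0) < \<epsilon>" by blast
  qed
  then have "(\<lambda>n. x + ?S (\<lambda>q. B q (picard B s x n q))) \<longlonglongrightarrow> x + ?S (\<lambda>q. B q (ode_sol B s x q))"
    by (intro tendsto_intros) (simp add: LIM_zero_iff)
  then have "(\<lambda>n. picard B s x (Suc n) r) \<longlonglongrightarrow> x + ?S (\<lambda>q. B q (ode_sol B s x q))" by simp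
  moreover have "(\<lambda>n. picard B s x (Suc n) r) \<longlonglongrightarrow> ode_sol B s x r"
    using picard_tendsto by (rule LIMSEQ_Suc)
  ultimately show ?thesis by (rule LIMSEQ_unique[symmetric])
qed

lemma ode_sol_init [simp]: "ode_sol B s x s = x"
  by (subst ode_sol_integral) simp

lemma ode_sol_deriv: "(ode_sol B s x has_vector_derivative B r (ode_sol B s x r)) (at r)"
proof -
  have "((\<lambda>r. x + signed_integral s r (\<lambda>q. B q (ode_sol B s x q))) has_vector_derivative
      0 + B r (ode_sol B s x r)) (at r)"
    by (intro has_vector_derivative_add has_vector_derivative_const
        signed_integral_has_vector_derivative ode_sol_integrand_continuous)
  then show ?thesis by (subst (asm) ode_sol_integral[symmetric]) simp
qed

text \<open>The equation is required between \<open>s\<close> and \<open>r\<close> only, which makes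
  it possible to compare solutions for two paths that coincide on a time interval.\<close>

lemma ode_unique_on:
  assumes y: "\<And>q. q \<in> {min s r..max s r} \<Longrightarrow> (y has_vector_derivative B q (y q)) (at q)"
    and z: "\<And>q. q \<in> {min s r..max s r} \<Longrightarrow> (z has_vector_derivative B q (z q)) (at q)"
    and "y s = z s"
  shows "y r = z r"
proof -
  define T where "T = max \<bar>r\<bar> \<bar>s\<bar>"
  obtain C where C: "C > 0" "\<And>r x y. \<bar>r\<bar> \<le> T \<Longrightarrow> norm (B r x - B r y) \<le> C * norm (x - y)"
    using B unfolding lipschitz_field_def by blast
  have "norm (y r - z r) \<le> (norm (y s - z s) + 0 * \<bar>r - s\<bar>) * exp (C * \<bar>r - s\<bar>)"
  proof (rule gronwall[where e' = "\<lambda>q. B q (y q) - B q (z q)"])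
    fix q assume q: "q \<in> {min s r..max s r}"
    then have "\<bar>q\<bar> \<le> T" by (auto simp: T_def min_def max_def split: if_splits)
    then show "norm (B q (y q) - B q (z q)) \<le> C * norm (y q - z q) + 0" using C(2) by simp
    show "((\<lambda>q. y q - z q) has_vector_derivative B q (y q) - B q (z q)) (at q)"
      by (intro has_vector_derivative_diff y z q)
  qed (use C in auto)
  then show ?thesis using assms(3) by simp
qed

lemma ode_sol_eqI:
  assumes "\<And>q. (y has_vector_derivative B q (y q)) (at q)" and "y s = x"
  shows "y r = ode_sol B s x r"
  by (rule ode_unique_on[where s = s]) (use assms ode_sol_deriv in auto)

lemma ode_sol_trans: "ode_sol B u (ode_sol B s x u) r = ode_sol B s x r"
  by (rule ode_sol_eqI[symmetric]) (auto intro: ode_sol_deriv)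

end

section \<open>Flows of vector fields with Lipschitz derivative\<close>

text \<open>Mean value inequality for \<open>f\<close> minus its linearization at \<open>a\<close>;
  the optimal factor 1/2 is not pursued.\<close>

lemma lipschitz_derivative_remainder:
  fixes f :: "'a::euclidean_space \<Rightarrow> 'b::euclidean_space" and f' :: "'a \<Rightarrow> 'a \<Rightarrow> 'b"
  assumes der: "\<And>x. (f has_derivative f' x) (at x)"
    and lip: "\<And>x v y. norm (f' x v - f' y v) \<le> K * norm (x - y) * norm v" and K: "0 \<le> K"
  shows "norm (f b - f a - f' a (b - a)) \<le> K * norm (b - a) ^ 2"
proof -
  define g where "g x = f x - f' a x" for x
  define g' where "g' x v = f' x v - f' a v" for x v :: 'a
  have "norm (g b - g a) \<le> K * norm (b - a) * norm (b - a)"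
  proof (rule differentiable_bound)
    fix x assume x: "x \<in> closed_segment a b"
    show "(g has_derivative g' x) (at x within closed_segment a b)"
      unfolding g_def[abs_def] g'_def[abs_def]
      by (intro has_derivative_diff has_derivative_at_withinI[OF der]
          bounded_linear_imp_has_derivative has_derivative_bounded_linear[OF der])
    show "onorm (g' x) \<le> K * norm (b - a)"
    proof (rule onorm_le)
      fix v :: 'a
      have "norm (x - a) \<le> norm (b - a)"
        using segment_bound1[OF x] by (simp add: norm_minus_commute)
      then have "K * norm (x - a) * norm v \<le> K * norm (b - a) * norm v"
        using K by (intro mult_right_mono mult_left_mono) auto
      then show "norm (g' x v) \<le> K * norm (b - a) * norm v"
        using lip[of x v a] unfolding g'_def by linarith
    qed
  qed auto
  moreover have "g b - g a = f b - f a - f' a (b - a)"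
    by (simp add: g_def linear_diff[OF has_derivative_linear[OF der]])
  ultimately show ?thesis by (simp add: power2_eq_square mult.assoc)
qed

locale flow =
  fixes V :: "'a::euclidean_space \<Rightarrow> 'a" and DV :: "'a \<Rightarrow> 'a \<Rightarrow> 'a" and K :: real
  assumes K_pos: "0 < K"
    and V_deriv: "(V has_derivative DV x) (at x)"
    and V_bound: "norm (V x) \<le> K"
    and DV_bound: "norm (DV x v) \<le> K * norm v"
    and DV_lipschitz: "norm (DV x v - DV y v) \<le> K * norm (x - y) * norm v"
begin

lemma DV_linear: "linear (DV x)"
  using V_deriv by (rule has_derivative_linear)

lemma V_lipschitz: "norm (V x - V y) \<le> K * norm (x - y)"
  by (rule differentiable_bound[where S = UNIV and f' = DV])
     (auto intro: V_deriv has_derivative_at_withinI onorm_le DV_bound)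

lemma V_continuous: "continuous_on S V"
  by (rule has_derivative_continuous_on[OF has_derivative_at_withinI[OF V_deriv]])

lemma V_field: "lipschitz_field (\<lambda>_. V)"
  unfolding lipschitz_field_def
proof safe
  have "continuous_on UNIV (\<lambda>p. V (snd p :: 'a))"
    by (rule continuous_on_compose2[OF V_continuous]) (auto intro: continuous_intros)
  then show "continuous_on UNIV (\<lambda>(r::real, x). V x)" by (simp add: case_prod_beta)
  show "\<exists>C>0. \<forall>r x y. \<bar>r\<bar> \<le> T \<longrightarrow> norm (V x - V y) \<le> C * norm (x - y)" for T :: real
    using V_lipschitz K_pos by blast
qed

definition Phi :: "real \<Rightarrow> 'a \<Rightarrow> 'a" where "Phi t x = ode_sol (\<lambda>_. V) 0 x t"

lemma Phi_0 [simp]: "Phi 0 x = x"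
  by (simp add: Phi_def ode_sol_init[OF V_field])

lemma Phi_deriv: "((\<lambda>t. Phi t x) has_vector_derivative V (Phi t x)) (at t)"
  unfolding Phi_def by (rule ode_sol_deriv[OF V_field])

lemma has_vector_derivative_shift:
  fixes f :: "real \<Rightarrow> 'b::real_normed_vector"
  assumes "(f has_vector_derivative f') (at (t + s))"
  shows "((\<lambda>t. f (t + s)) has_vector_derivative f') (at t)"
proof -
  have "((\<lambda>t. t + s) has_vector_derivative 1) (at t)" by (auto intro!: derivative_eq_intros)
  then show ?thesis using vector_diff_chain_at[of "\<lambda>t. t + s" 1 t f f'] assms by (simp add: o_def)
qed

lemma Phi_add: "Phi (s + t) x = Phi s (Phi t x)"
  unfolding Phi_def[of s]
  by (rule ode_sol_eqI[OF V_field, where y = "\<lambda>s. Phi (s + t) x"])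
     (auto intro: has_vector_derivative_shift Phi_deriv)

lemma Phi_minus [simp]: "Phi (- t) (Phi t x) = x" "Phi t (Phi (- t) x) = x"
  by (simp_all flip: Phi_add)

lemma Phi_lipschitz: "norm (Phi t x - Phi t y) \<le> norm (x - y) * exp (K * \<bar>t\<bar>)"
proof -
  have "norm (Phi t x - Phi t y) \<le> (norm (Phi 0 x - Phi 0 y) + 0 * \<bar>t - 0\<bar>) * exp (K * \<bar>t - 0\<bar>)"
    by (rule gronwall[where e' = "\<lambda>t. V (Phi t x) - V (Phi t y)"])
       (auto intro!: has_vector_derivative_diff Phi_deriv V_lipschitz simp: less_imp_le[OF K_pos])
  then show ?thesis by simp
qed

lemma Phi_move: "norm (Phi t x - x) \<le> K * \<bar>t\<bar>"
proof -
  have "norm (Phi t x - x) \<le> (norm (Phi 0 x - x) + K * \<bar>t - 0\<bar>) * exp (0 * \<bar>t - 0\<bar>)"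
  proof (rule gronwall)
    show "((\<lambda>t. Phi t x - x) has_vector_derivative V (Phi q x) - 0) (at q)" for q
      by (intro has_vector_derivative_diff has_vector_derivative_const Phi_deriv)
  qed (use K_pos V_bound in auto)
  then show ?thesis by simp
qed

lemma Phi_diff: "norm (Phi s y - Phi t x) \<le> norm (y - x) * exp (K * \<bar>t\<bar>) + K * \<bar>s - t\<bar>"
proof -
  have "Phi s y = Phi (s - t) (Phi t y)" by (simp flip: Phi_add)
  then have "norm (Phi s y - Phi t y) \<le> K * \<bar>s - t\<bar>" using Phi_move by simp
  then show ?thesis using Phi_lipschitz[of t y x] norm_triangle_ineq[of "Phi s y - Phi t y" "Phi t y - Phi t x"]
    by simp
qed

lemma Phi_tendsto:
  assumes "(f \<longlongrightarrow> t) F" "(g \<longlongrightarrow> x) F"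
  shows "((\<lambda>q. Phi (f q) (g q)) \<longlongrightarrow> Phi t x) F"
proof -
  have "((\<lambda>q. norm (g q - x) * exp (K * \<bar>t\<bar>) + K * \<bar>f q - t\<bar>) \<longlongrightarrow> norm (x - x) * exp (K * \<bar>t\<bar>) + K * \<bar>t - t\<bar>) F"
    by (intro tendsto_intros assms)
  then have "((\<lambda>q. Phi (f q) (g q) - Phi t x) \<longlongrightarrow> 0) F"
    by (intro Lim_null_comparison[OF always_eventually[OF allI[OF Phi_diff]]]) simp
  then show ?thesis by (simp add: LIM_zero_iff)
qed

lemma Phi_continuous [continuous_intros]:
  "continuous_on S f \<Longrightarrow> continuous_on S g \<Longrightarrow> continuous_on S (\<lambda>q. Phi (f q) (g q))"
  by (auto simp: continuous_on_def intro: Phi_tendsto)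

lemma DV_diff: "norm (DV y u - DV x v) \<le> K * norm (y - x) * norm v + K * norm (u - v)"
proof -
  have "DV y u - DV x v = DV y (u - v) + (DV y v - DV x v)"
    by (simp add: linear_diff[OF DV_linear])
  then show ?thesis
    using DV_bound[of y "u - v"] DV_lipschitz[of y v x]
      norm_triangle_ineq[of "DV y (u - v)" "DV y v - DV x v"] by (simp only:)
qed

lemma DV_tendsto:
  assumes "(f \<longlongrightarrow> x) F" "(g \<longlongrightarrow> v) F"
  shows "((\<lambda>q. DV (f q) (g q)) \<longlongrightarrow> DV x v) F"
proof -
  have "((\<lambda>q. K * norm (f q - x) * norm v + K * norm (g q - v)) \<longlongrightarrow> K * norm (x - x) * norm v + K * norm (v - v)) F"
    by (intro tendsto_intros assms)
  then have "((\<lambda>q. DV (f q) (g q) - DV x v) \<longlongrightarrow> 0) F"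
    by (intro Lim_null_comparison[OF always_eventually[OF allI[OF DV_diff]]]) simp
  then show ?thesis by (simp add: LIM_zero_iff)
qed

lemma DV_continuous [continuous_intros]:
  "continuous_on S f \<Longrightarrow> continuous_on S g \<Longrightarrow> continuous_on S (\<lambda>q. DV (f q) (g q))"
  by (auto simp: continuous_on_def intro: DV_tendsto)

lemma DV_field: "lipschitz_field (\<lambda>r. DV (Phi r x))"
  unfolding lipschitz_field_def
proof safe
  have "continuous_on UNIV (\<lambda>p. DV (Phi (fst p) x) (snd p))"
    by (intro continuous_intros)
  then show "continuous_on UNIV (\<lambda>(r, v). DV (Phi r x) v)" by (simp add: case_prod_beta)
  have "norm (DV (Phi r x) u - DV (Phi r x) v) \<le> K * norm (u - v)" for r u v
    using DV_bound[of "Phi r x" "u - v"] by (simp add: linear_diff[OF DV_linear])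
  then show "\<exists>C>0. \<forall>r u v. \<bar>r\<bar> \<le> T \<longrightarrow> norm (DV (Phi r x) u - DV (Phi r x) v) \<le> C * norm (u - v)" for T :: real
    using K_pos by blast
qed

text \<open>Solution of the variational equation along the orbit of \<open>x\<close>. That it is the
  space derivative of \<open>Phi\<close> is proved in \<open>Phi_has_derivative\<close>.\<close>

definition DPhi :: "real \<Rightarrow> 'a \<Rightarrow> 'a \<Rightarrow> 'a" where
  "DPhi t x v = ode_sol (\<lambda>r. DV (Phi r x)) 0 v t"

lemma DPhi_0 [simp]: "DPhi 0 x v = v"
  by (simp add: DPhi_def ode_sol_init[OF DV_field])

lemma DPhi_deriv: "((\<lambda>t. DPhi t x v) has_vector_derivative DV (Phi t x) (DPhi t x v)) (at t)"
  unfolding DPhi_def by (rule ode_sol_deriv[OF DV_field])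

lemma DPhi_linear: "linear (DPhi t x)"
proof (rule linearI)
  show "DPhi t x (u + v) = DPhi t x u + DPhi t x v" for u v
    unfolding DPhi_def[of t x "u + v"]
    by (rule ode_sol_eqI[OF DV_field, where y = "\<lambda>t. DPhi t x u + DPhi t x v", symmetric])
       (auto simp: linear_add[OF DV_linear] intro: has_vector_derivative_add DPhi_deriv)
  show "DPhi t x (c *\<^sub>R v) = c *\<^sub>R DPhi t x v" for c v
    unfolding DPhi_def[of t x "c *\<^sub>R v"]
    by (rule ode_sol_eqI[OF DV_field, where y = "\<lambda>t. c *\<^sub>R DPhi t x v", symmetric])
       (auto simp: linear_scale[OF DV_linear] intro: bounded_linear.has_vector_derivative[OF bounded_linear_scaleR_right] DPhi_deriv)
qed

lemma DPhi_bound: "norm (DPhi t x v) \<le> norm v * exp (K * \<bar>t\<bar>)"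
proof -
  have "norm (DPhi t x v) \<le> (norm (DPhi 0 x v) + 0 * \<bar>t - 0\<bar>) * exp (K * \<bar>t - 0\<bar>)"
    by (rule gronwall[where e' = "\<lambda>t. DV (Phi t x) (DPhi t x v)"])
       (auto intro!: DPhi_deriv DV_bound simp: less_imp_le[OF K_pos])
  then show ?thesis by simp
qed

lemma DPhi_move: "norm (DPhi t x v - v) \<le> K * \<bar>t\<bar> * exp (K * \<bar>t\<bar>) * norm v"
proof -
  have "norm (DPhi t x v - v) \<le> (norm (DPhi 0 x v - v) + (K * norm v) * \<bar>t - 0\<bar>) * exp (K * \<bar>t - 0\<bar>)"
  proof (rule gronwall)
    fix q
    show "((\<lambda>t. DPhi t x v - v) has_vector_derivative DV (Phi q x) (DPhi q x v) - 0) (at q)"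
      by (intro has_vector_derivative_diff has_vector_derivative_const DPhi_deriv)
    have "DV (Phi q x) (DPhi q x v) = DV (Phi q x) (DPhi q x v - v) + DV (Phi q x) v"
      by (simp add: linear_diff[OF DV_linear])
    then show "norm (DV (Phi q x) (DPhi q x v) - 0) \<le> K * norm (DPhi q x v - v) + K * norm v"
      using DV_bound[of "Phi q x" "DPhi q x v - v"] DV_bound[of "Phi q x" v]
        norm_triangle_ineq[of "DV (Phi q x) (DPhi q x v - v)" "DV (Phi q x) v"] by simp
  qed (use K_pos in auto)
  then show ?thesis by (simp add: ac_simps)
qed

lemma exp_twice: "exp (2 * a * b) = exp (a * b) * exp (a * b :: real)"
  by (simp flip: exp_add)

text \<open>Gronwall for the difference of two variational equations, whose source is the change of
  \<open>DV\<close> from one orbit to the other. This takes the place of a bound on second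
  derivatives of the flow.\<close>

lemma DPhi_lipschitz:
  "norm (DPhi t x v - DPhi t y v) \<le> K * \<bar>t\<bar> * exp (3 * K * \<bar>t\<bar>) * norm (x - y) * norm v"
proof -
  define D where "D = K * norm (x - y) * norm v * exp (2 * K * \<bar>t\<bar>)"
  have "norm (DPhi t x v - DPhi t y v) \<le> (norm (DPhi 0 x v - DPhi 0 y v) + D * \<bar>t - 0\<bar>) * exp (K * \<bar>t - 0\<bar>)"
  proof (rule gronwall[where e' = "\<lambda>t. DV (Phi t x) (DPhi t x v) - DV (Phi t y) (DPhi t y v)"])
    fix q assume q: "q \<in> {min 0 t..max 0 t}"
    then have qt: "\<bar>q\<bar> \<le> \<bar>t\<bar>" by (auto simp: min_def max_def split: if_splits)
    have "K * norm (Phi q x - Phi q y) * norm (DPhi q y v)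
        \<le> K * (norm (x - y) * exp (K * \<bar>q\<bar>)) * (norm v * exp (K * \<bar>q\<bar>))"
      by (intro mult_mono Phi_lipschitz DPhi_bound) (use K_pos in auto)
    also have "\<dots> = K * norm (x - y) * norm v * exp (2 * K * \<bar>q\<bar>)"
      unfolding exp_twice by (simp add: ac_simps)
    also have "\<dots> \<le> D" unfolding D_def using qt K_pos by (intro mult_left_mono) auto
    finally show "norm (DV (Phi q x) (DPhi q x v) - DV (Phi q y) (DPhi q y v))
        \<le> K * norm (DPhi q x v - DPhi q y v) + D"
      using DV_diff[of "Phi q x" "DPhi q x v" "Phi q y" "DPhi q y v"] by linarith
  qed (use K_pos in \<open>auto intro!: has_vector_derivative_diff DPhi_deriv simp: D_def\<close>)
  also have "\<dots> = K * \<bar>t\<bar> * (exp (2 * K * \<bar>t\<bar>) * exp (K * \<bar>t\<bar>)) * norm (x - y) * norm v"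
    by (simp add: D_def mult.commute mult.left_commute)
  also have "exp (2 * K * \<bar>t\<bar>) * exp (K * \<bar>t\<bar>) = exp (3 * K * \<bar>t\<bar>)" by (simp flip: exp_add)
  finally show ?thesis .
qed

text \<open>The linearization error solves the variational equation up to the quadratic Taylor
  remainder of \<open>V\<close>, so Gronwall bounds it by a multiple of
  \<open>norm h ^ 2\<close>.\<close>

lemma Phi_has_derivative: "(Phi t has_derivative DPhi t x) (at x)"
  unfolding has_derivative_at
proof
  show "bounded_linear (DPhi t x)" by (simp add: DPhi_linear linear_conv_bounded_linear[symmetric])
  define c where "c = K * exp (2 * K * \<bar>t\<bar>) * \<bar>t\<bar> * exp (K * \<bar>t\<bar>)"
  have bd: "norm (Phi t (x + h) - Phi t x - DPhi t x h) \<le> c * norm h ^ 2" for h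
  proof -
    define D where "D = K * norm h ^ 2 * exp (2 * K * \<bar>t\<bar>)"
    have "norm (Phi t (x + h) - Phi t x - DPhi t x h)
        \<le> (norm (Phi 0 (x + h) - Phi 0 x - DPhi 0 x h) + D * \<bar>t - 0\<bar>) * exp (K * \<bar>t - 0\<bar>)"
    proof (rule gronwall[where e' = "\<lambda>t. V (Phi t (x + h)) - V (Phi t x) - DV (Phi t x) (DPhi t x h)"])
      fix q assume q: "q \<in> {min 0 t..max 0 t}"
      then have qt: "\<bar>q\<bar> \<le> \<bar>t\<bar>" by (auto simp: min_def max_def split: if_splits)
      let ?a = "Phi q x" and ?b = "Phi q (x + h)"
      have "norm (?b - ?a) ^ 2 \<le> (norm h * exp (K * \<bar>q\<bar>)) ^ 2"
        using Phi_lipschitz[of q "x + h" x] by (intro power_mono) auto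
      also have "\<dots> = norm h ^ 2 * exp (2 * K * \<bar>q\<bar>)"
        unfolding exp_twice by (simp add: power2_eq_square ac_simps)
      also have "\<dots> \<le> norm h ^ 2 * exp (2 * K * \<bar>t\<bar>)"
        using qt K_pos by (intro mult_left_mono) auto
      finally have "K * norm (?b - ?a) ^ 2 \<le> D"
        using K_pos by (simp add: D_def)
      then have 1: "norm (V ?b - V ?a - DV ?a (?b - ?a)) \<le> D"
        using lipschitz_derivative_remainder[OF V_deriv DV_lipschitz, of ?b ?a] K_pos by linarith
      have "V ?b - V ?a - DV ?a (DPhi q x h) = (V ?b - V ?a - DV ?a (?b - ?a)) + DV ?a (?b - ?a - DPhi q x h)"
        by (simp add: linear_diff[OF DV_linear])
      then show "norm (V ?b - V ?a - DV ?a (DPhi q x h)) \<le> K * norm (?b - ?a - DPhi q x h) + D"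
        using 1 DV_bound[of ?a "?b - ?a - DPhi q x h"]
          norm_triangle_ineq[of "V ?b - V ?a - DV ?a (?b - ?a)" "DV ?a (?b - ?a - DPhi q x h)"] by (simp only:)
    qed (use K_pos in \<open>auto intro!: has_vector_derivative_diff DPhi_deriv Phi_deriv simp: D_def\<close>)
    then show ?thesis by (simp add: D_def c_def ac_simps)
  qed
  show "((\<lambda>h. norm (Phi t (x + h) - Phi t x - DPhi t x h) / norm h) \<longlongrightarrow> 0) (at 0)"
  proof (rule Lim_null_comparison[where g = "\<lambda>h. c * norm h"])
    show "\<forall>\<^sub>F h in at 0. norm (norm (Phi t (x + h) - Phi t x - DPhi t x h) / norm h) \<le> c * norm h"
      using bd by (intro always_eventually) (simp add: divide_le_eq power2_eq_square mult.assoc)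
    show "((\<lambda>h. c * norm h) \<longlongrightarrow> 0) (at (0::'a))"
      by (auto intro!: tendsto_eq_intros)
  qed
qed

lemma DPhi_add: "DPhi (s + t) x v = DPhi s (Phi t x) (DPhi t x v)"
  unfolding DPhi_def[of s]
proof (rule ode_sol_eqI[OF DV_field, where y = "\<lambda>s. DPhi (s + t) x v"])
  show "((\<lambda>s. DPhi (s + t) x v) has_vector_derivative DV (Phi q (Phi t x)) (DPhi (q + t) x v)) (at q)" for q
    using has_vector_derivative_shift[OF DPhi_deriv[of x v "q + t"]] by (simp add: Phi_add)
qed simp

lemma DPhi_tendsto:
  assumes "(f \<longlongrightarrow> t) F" "(g \<longlongrightarrow> x) F" "(h \<longlongrightarrow> v) F"
  shows "((\<lambda>q. DPhi (f q) (g q) (h q)) \<longlongrightarrow> DPhi t x v) F"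
proof -
  have 1: "((\<lambda>q. DPhi (f q) x v) \<longlongrightarrow> DPhi t x v) F"
    using isCont_tendsto_compose[OF has_vector_derivative_continuous[OF DPhi_deriv] assms(1)] .
  have "((\<lambda>q. K * \<bar>f q\<bar> * exp (3 * K * \<bar>f q\<bar>) * norm (g q - x) * norm v + norm (h q - v) * exp (K * \<bar>f q\<bar>))
      \<longlongrightarrow> K * \<bar>t\<bar> * exp (3 * K * \<bar>t\<bar>) * norm (x - x) * norm v + norm (v - v) * exp (K * \<bar>t\<bar>)) F"
    by (intro tendsto_intros assms)
  then have 2: "((\<lambda>q. K * \<bar>f q\<bar> * exp (3 * K * \<bar>f q\<bar>) * norm (g q - x) * norm v + norm (h q - v) * exp (K * \<bar>f q\<bar>)) \<longlongrightarrow> 0) F"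
    by simp
  have "norm (DPhi (f q) (g q) (h q) - DPhi (f q) x v)
      \<le> K * \<bar>f q\<bar> * exp (3 * K * \<bar>f q\<bar>) * norm (g q - x) * norm v + norm (h q - v) * exp (K * \<bar>f q\<bar>)" for q
  proof -
    have "DPhi (f q) (g q) (h q) - DPhi (f q) x v
        = (DPhi (f q) (g q) v - DPhi (f q) x v) + DPhi (f q) (g q) (h q - v)"
      by (simp add: linear_diff[OF DPhi_linear])
    then show ?thesis
      using DPhi_lipschitz[of "f q" "g q" v x] DPhi_bound[of "f q" "g q" "h q - v"]
        norm_triangle_ineq[of "DPhi (f q) (g q) v - DPhi (f q) x v" "DPhi (f q) (g q) (h q - v)"] by (simp only:)
  qed
  then have "((\<lambda>q. DPhi (f q) (g q) (h q) - DPhi (f q) x v) \<longlongrightarrow> 0) F"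
    by (intro Lim_null_comparison[OF always_eventually[OF allI] 2])
  from tendsto_add[OF this 1] show ?thesis by simp
qed

lemma DPhi_continuous [continuous_intros]:
  "continuous_on S f \<Longrightarrow> continuous_on S g \<Longrightarrow> continuous_on S h \<Longrightarrow>
   continuous_on S (\<lambda>q. DPhi (f q) (g q) (h q))"
  by (auto simp: continuous_on_def intro: DPhi_tendsto)

lemma Phi_translate:
  assumes "\<And>x. V (x + k) = V x"
  shows "Phi t (x + k) = Phi t x + k"
  unfolding Phi_def[of t "x + k"]
proof (rule ode_sol_eqI[OF V_field, where y = "\<lambda>t. Phi t x + k", symmetric])
  show "((\<lambda>t. Phi t x + k) has_vector_derivative V (Phi q x + k)) (at q)" for q
    using has_vector_derivative_add[OF Phi_deriv has_vector_derivative_const] by (simp add: assms)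
qed simp

lemma DPhi_translate:
  assumes V: "\<And>x. V (x + k) = V x"
  shows "DPhi t (x + k) v = DPhi t x v"
proof -
  have "((\<lambda>y. y + k) has_derivative (\<lambda>h. h)) (at x)"
    by (auto intro!: derivative_eq_intros)
  from has_derivative_compose[OF this Phi_has_derivative]
  have "((\<lambda>y. Phi t (y + k)) has_derivative DPhi t (x + k)) (at x)" by simp
  moreover have "((\<lambda>y. Phi t (y + k)) has_derivative DPhi t x) (at x)"
    unfolding Phi_translate[OF V] using has_derivative_add[OF Phi_has_derivative has_derivative_const] by simp
  ultimately have "DPhi t (x + k) = DPhi t x" by (rule has_derivative_unique)
  then show ?thesis by simp
qed

end

section \<open>Change of variables along limits of one-step methods\<close>

text \<open>The measure with density \<open>j\<close> is carried to Lebesgue measure by \<open>S\<close>.\<close>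

definition cov :: "('a::euclidean_space \<Rightarrow> 'a) \<Rightarrow> ('a \<Rightarrow> real) \<Rightarrow> bool" where
  "cov S j \<longleftrightarrow> S \<in> borel_measurable borel \<and> j \<in> borel_measurable borel \<and> (\<forall>z. 0 \<le> j z) \<and>
     (\<forall>G\<in>borel_measurable borel. (\<integral>\<^sup>+z. G (S z) * ennreal (j z) \<partial>lborel) = (\<integral>\<^sup>+z. G z \<partial>lborel))"

lemma cov_measurable: "cov S j \<Longrightarrow> S \<in> borel_measurable borel" "cov S j \<Longrightarrow> j \<in> borel_measurable borel"
  and cov_nonneg: "cov S j \<Longrightarrow> 0 \<le> j z"
  and covD: "cov S j \<Longrightarrow> G \<in> borel_measurable borel \<Longrightarrow>
    (\<integral>\<^sup>+z. G (S z) * ennreal (j z) \<partial>lborel) = (\<integral>\<^sup>+z. G z \<partial>lborel)"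
  by (auto simp: cov_def)

lemma cov_comp:
  assumes 1: "cov S1 j1" and 2: "cov S2 j2"
  shows "cov (\<lambda>z. S2 (S1 z)) (\<lambda>z. j1 z * j2 (S1 z))"
  unfolding cov_def
proof (intro conjI ballI allI)
  note [measurable] = cov_measurable[OF 1] cov_measurable[OF 2]
  show "(\<lambda>z. S2 (S1 z)) \<in> borel_measurable borel" "(\<lambda>z. j1 z * j2 (S1 z)) \<in> borel_measurable borel"
    by measurable
  show "0 \<le> j1 z * j2 (S1 z)" for z using cov_nonneg[OF 1] cov_nonneg[OF 2] by simp
  fix G :: "'a \<Rightarrow> ennreal" assume [measurable]: "G \<in> borel_measurable borel"
  have "(\<integral>\<^sup>+z. G (S2 (S1 z)) * ennreal (j1 z * j2 (S1 z)) \<partial>lborel)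
      = (\<integral>\<^sup>+z. (\<lambda>y. G (S2 y) * ennreal (j2 y)) (S1 z) * ennreal (j1 z) \<partial>lborel)"
    using cov_nonneg[OF 1] cov_nonneg[OF 2] by (simp add: ennreal_mult ac_simps)
  also have "\<dots> = (\<integral>\<^sup>+y. G (S2 y) * ennreal (j2 y) \<partial>lborel)"
    by (rule covD[OF 1]) measurable
  also have "\<dots> = (\<integral>\<^sup>+z. G z \<partial>lborel)" by (rule covD[OF 2]) measurable
  finally show "(\<integral>\<^sup>+z. G (S2 (S1 z)) * ennreal (j1 z * j2 (S1 z)) \<partial>lborel) = (\<integral>\<^sup>+z. G z \<partial>lborel)" .
qed

lemma cov_id: "cov (\<lambda>z. z) (\<lambda>_. 1)"
  by (simp add: cov_def)

text \<open>Lebesgue measure is determined by its values on boxes, so the formula for indicators of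
  boxes extends to all measurable integrands.\<close>

lemma covI_measure:
  assumes [measurable]: "S \<in> borel_measurable borel" "j \<in> borel_measurable borel" and j: "\<And>z. 0 \<le> j z"
    and eq: "\<And>l u. (\<And>b. b \<in> Basis \<Longrightarrow> l \<bullet> b \<le> u \<bullet> b) \<Longrightarrow>
      (\<integral>\<^sup>+z. indicator (box l u) (S z) * ennreal (j z) \<partial>lborel) = emeasure lborel (box l u)"
  shows "cov S j"
  unfolding cov_def
proof (intro conjI ballI allI assms)
  fix G :: "'a \<Rightarrow> ennreal" assume [measurable]: "G \<in> borel_measurable borel"
  have "lborel = distr (density lborel (\<lambda>z. ennreal (j z))) borel S"
  proof (rule lborel_eqI)
    fix l u :: 'a assume lu: "\<And>b. b \<in> Basis \<Longrightarrow> l \<bullet> b \<le> u \<bullet> b"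
    have "emeasure (distr (density lborel (\<lambda>z. ennreal (j z))) borel S) (box l u)
        = (\<integral>\<^sup>+z. ennreal (j z) * indicator (S -` box l u) z \<partial>lborel)"
      using measurable_sets_borel[OF assms(1), of "box l u"]
      by (subst emeasure_distr) (simp_all add: emeasure_density)
    also have "\<dots> = (\<integral>\<^sup>+z. indicator (box l u) (S z) * ennreal (j z) \<partial>lborel)"
      by (intro nn_integral_cong) (auto split: split_indicator)
    also have "\<dots> = emeasure lborel (box l u)" by (rule eq[OF lu])
    also have "\<dots> = (\<Prod>b\<in>Basis. (u - l) \<bullet> b)" by (simp add: emeasure_lborel_box_eq lu)
    finally show "emeasure (distr (density lborel (\<lambda>z. ennreal (j z))) borel S) (box l u)
        = (\<Prod>b\<in>Basis. (u - l) \<bullet> b)" .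
  qed simp
  then have "(\<integral>\<^sup>+z. G z \<partial>lborel) = (\<integral>\<^sup>+z. G z \<partial>distr (density lborel (\<lambda>z. ennreal (j z))) borel S)"
    by simp
  also have "\<dots> = (\<integral>\<^sup>+z. G (S z) * ennreal (j z) \<partial>lborel)"
    by (subst nn_integral_distr) (auto simp: nn_integral_density mult.commute)
  finally show "(\<integral>\<^sup>+z. G (S z) * ennreal (j z) \<partial>lborel) = (\<integral>\<^sup>+z. G z \<partial>lborel)" by simp
qed

text \<open>Pointwise convergence of the maps survives under continuous integrands only, so the
  indicator of an open box is approximated from below by continuous functions. The uniform
  displacement bound \<open>R\<close> provides the integrable majorant for the limit in
  \<open>n\<close>; monotone convergence then restores the box.\<close>

lemma cov_limit:
  fixes S :: "nat \<Rightarrow> 'a::euclidean_space \<Rightarrow> 'a"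
  assumes cov: "\<And>n. cov (S n) (j n)"
    and lim: "\<And>z. (\<lambda>n. S n z) \<longlonglongrightarrow> T z" "\<And>z. (\<lambda>n. j n z) \<longlonglongrightarrow> i z"
    and bd: "\<And>n z. j n z \<le> C" "\<And>n z. norm (S n z - z) \<le> R"
  shows "cov T i"
proof -
  note [measurable] = cov_measurable[OF cov]
  have T[measurable]: "T \<in> borel_measurable borel"
    by (rule borel_measurable_LIMSEQ_metric[OF _ lim(1)]) measurable
  have i[measurable]: "i \<in> borel_measurable borel"
    by (rule borel_measurable_LIMSEQ_real[OF lim(2)]) measurable
  have i0: "0 \<le> i z" for z
    by (rule LIMSEQ_le_const[OF lim(2)]) (auto intro: cov_nonneg[OF cov])
  have C0: "0 \<le> C" using bd(1)[of 0 0] cov_nonneg[OF cov, of 0 0] by linarith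
  show ?thesis
  proof (rule covI_measure[OF T i i0])
    fix l u :: 'a
    define A where "A = box l u"
    have [measurable]: "A \<in> sets borel" by (simp add: A_def)
    obtain r where r: "A \<subseteq> cball 0 r"
      using bounded_box[of l u] unfolding A_def bounded_iff by (metis mem_cball_0 subsetI)
    \<comment> \<open>The distance to the empty set is 0 by convention, which would make all
      functions \<open>G k\<close> vanish.\<close>
    have ne: "- A \<noteq> {}"
    proof
      assume "- A = {}"
      then have "A = UNIV" by auto
      then show False using bounded_box[of l u] not_bounded_UNIV by (simp add: A_def)
    qed
    define G where "G k x = min 1 (real k * infdist x (- A))" for k x
    have Gc: "continuous_on UNIV (G k)" for k unfolding G_def by (intro continuous_intros)
    have Gm[measurable]: "G k \<in> borel_measurable borel" for k
      by (rule borel_measurable_continuous_onI[OF Gc])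
    have G0: "0 \<le> G k x" and G1: "G k x \<le> 1" for k x by (auto simp: G_def infdist_nonneg)
    have Gout: "G k x = 0" if "x \<notin> A" for k x using that by (simp add: G_def)
    have Gmono: "G k x \<le> G (Suc k) x" for k x
      unfolding G_def by (intro min.mono mult_right_mono) (auto simp: infdist_nonneg)
    have Glim: "(\<lambda>k. G k x) \<longlonglongrightarrow> indicator A x" for x
    proof (cases "x \<in> A")
      case True
      have "infdist x (- A) > 0"
        using in_closed_iff_infdist_zero[of "- A" x] ne True infdist_nonneg[of x "- A"]
        by (auto simp: A_def closed_Compl less_le)
      then obtain n :: nat where n: "1 < n * infdist x (- A)"
        using reals_Archimedean3 by metis
      have "G k x = 1" if "k \<ge> n" for k
      proof -
        have "n * infdist x (- A) \<le> k * infdist x (- A)"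
          using that by (intro mult_right_mono) (auto simp: infdist_nonneg)
        then show ?thesis using n by (simp add: G_def)
      qed
      then have "\<forall>\<^sub>F k in sequentially. G k x = 1" by (auto simp: eventually_sequentially)
      then show ?thesis using True by (simp add: tendsto_eventually)
    qed (simp add: Gout)
    have step: "(\<integral>\<^sup>+z. ennreal (G k (T z)) * ennreal (i z) \<partial>lborel) = (\<integral>\<^sup>+z. ennreal (G k z) \<partial>lborel)" for k
    proof -
      have "(\<lambda>n. \<integral>\<^sup>+z. ennreal (G k (S n z)) * ennreal (j n z) \<partial>lborel)
          \<longlonglongrightarrow> (\<integral>\<^sup>+z. ennreal (G k (T z)) * ennreal (i z) \<partial>lborel)"
      proof (rule nn_integral_dominated_convergence)
        \<comment> \<open>A point moved by at most \<open>R\<close> into a set of radius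
          \<open>r\<close> lies in the ball of radius \<open>r + R\<close>, whatever the index
          \<open>n\<close>.\<close>
        let ?w = "\<lambda>z::'a. ennreal C * indicator (cball 0 (r + R)) z"
        have "(\<integral>\<^sup>+z. ?w z \<partial>lborel) = ennreal C * emeasure lborel (cball (0::'a) (r + R))"
          by (subst nn_integral_cmult_indicator) auto
        also have "\<dots> < \<infinity>"
          using emeasure_bounded_finite[of "cball (0::'a) (r + R)"] by (simp add: ennreal_mult_less_top)
        finally show "(\<integral>\<^sup>+z. ?w z \<partial>lborel) < \<infinity>" .
        have [measurable]: "cball (0::'a) (r + R) \<in> sets borel" by simp
        show "?w \<in> borel_measurable lborel" by measurable
        show "AE z in lborel. ennreal (G k (S n z)) * ennreal (j n z) \<le> ?w z" for n
        proof (rule AE_I2)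
          fix z
          show "ennreal (G k (S n z)) * ennreal (j n z) \<le> ?w z"
          proof (cases "S n z \<in> A")
            case True
            then have "norm z \<le> r + R"
              using r bd(2)[of n z] norm_triangle_ineq[of "S n z" "z - S n z"]
              by (force simp: norm_minus_commute)
            moreover have "G k (S n z) * j n z \<le> 1 * C"
              by (intro mult_mono G1 bd G0 cov_nonneg[OF cov]) auto
            ultimately show ?thesis
              using C0 by (simp add: G0 cov_nonneg[OF cov] ennreal_leI flip: ennreal_mult)
          qed (simp add: Gout)
        qed
        show "AE z in lborel. (\<lambda>n. ennreal (G k (S n z)) * ennreal (j n z)) \<longlonglongrightarrow> ennreal (G k (T z)) * ennreal (i z)"
        proof (rule AE_I2)
          fix z
          have "(\<lambda>n. G k (S n z)) \<longlonglongrightarrow> G k (T z)"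
            using continuous_on_tendsto_compose[OF Gc lim(1)] by simp
          then have "(\<lambda>n. ennreal (G k (S n z) * j n z)) \<longlonglongrightarrow> ennreal (G k (T z) * i z)"
            by (intro tendsto_intros lim)
          then show "(\<lambda>n. ennreal (G k (S n z)) * ennreal (j n z)) \<longlonglongrightarrow> ennreal (G k (T z)) * ennreal (i z)"
            by (simp add: ennreal_mult G0 cov_nonneg[OF cov] i0)
        qed
      qed measurable
      moreover have "(\<integral>\<^sup>+z. ennreal (G k (S n z)) * ennreal (j n z) \<partial>lborel) = (\<integral>\<^sup>+z. ennreal (G k z) \<partial>lborel)" for n
        by (rule covD[OF cov]) measurable
      ultimately show ?thesis by (simp add: LIMSEQ_const_iff)
    qed
    have "(\<lambda>k. \<integral>\<^sup>+z. ennreal (G k (T z)) * ennreal (i z) \<partial>lborel)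
        \<longlonglongrightarrow> (\<integral>\<^sup>+z. indicator A (T z) * ennreal (i z) \<partial>lborel)"
    proof (rule nn_integral_LIMSEQ)
      show "incseq (\<lambda>k z. ennreal (G k (T z)) * ennreal (i z))"
        by (intro incseq_SucI le_funI mult_right_mono ennreal_leI Gmono) auto
      show "(\<lambda>k. ennreal (G k (T z)) * ennreal (i z)) \<longlonglongrightarrow> indicator A (T z) * ennreal (i z)" for z
      proof -
        have "(\<lambda>k. ennreal (G k (T z) * i z)) \<longlonglongrightarrow> ennreal (indicator A (T z) * i z)"
          by (intro tendsto_intros Glim)
        then show ?thesis by (simp add: ennreal_mult G0 i0 flip: ennreal_indicator)
      qed
    qed measurable
    moreover have "(\<lambda>k. \<integral>\<^sup>+z. ennreal (G k z) \<partial>lborel) \<longlonglongrightarrow> (\<integral>\<^sup>+z. indicator A z \<partial>lborel)"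
    proof (rule nn_integral_LIMSEQ)
      show "incseq (\<lambda>k z. ennreal (G k z))"
        by (intro incseq_SucI le_funI ennreal_leI Gmono)
      show "(\<lambda>k. ennreal (G k z)) \<longlonglongrightarrow> indicator A z" for z
        using tendsto_ennrealI[OF Glim[of z]] by (simp add: ennreal_indicator)
    qed measurable
    ultimately have "(\<integral>\<^sup>+z. indicator A (T z) * ennreal (i z) \<partial>lborel) = (\<integral>\<^sup>+z. indicator A z \<partial>lborel)"
      unfolding step by (rule LIMSEQ_unique)
    then show "(\<integral>\<^sup>+z. indicator (box l u) (T z) * ennreal (i z) \<partial>lborel) = emeasure lborel (box l u)"
      by (simp add: A_def)
  qed
qed

section \<open>The Jacobian of a differentiable bijection of the plane\<close>

definition det2 :: "(plane \<Rightarrow> plane) \<Rightarrow> real" where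
  "det2 f = fst (f (1, 0)) * snd (f (0, 1)) - fst (f (0, 1)) * snd (f (1, 0))"

text \<open>The measure of the image of the preimage of a box is the integral of the Jacobian over
  that preimage, and by bijectivity this image is the box itself.\<close>

lemma cov_vec2:
  fixes S T :: "real^2 \<Rightarrow> real^2"
  assumes der: "\<And>x. (S has_derivative S' x) (at x)"
    and inv: "\<And>x. T (S x) = x" "\<And>x. S (T x) = x"
    and [measurable]: "(\<lambda>x. \<bar>det (matrix (S' x))\<bar>) \<in> borel_measurable borel"
  shows "cov S (\<lambda>x. \<bar>det (matrix (S' x))\<bar>)"
proof -
  have [measurable]: "S \<in> borel_measurable borel"
    by (rule borel_measurable_continuous_onI)
       (rule has_derivative_continuous_on[OF has_derivative_at_withinI[OF der]])
  show ?thesis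
  proof (rule covI_measure)
    fix l u :: "real^2"
    define A where "A = S -` box l u"
    have A[measurable]: "A \<in> sets borel"
      using measurable_sets_borel[of S borel "box l u"] by (simp add: A_def)
    then have AL: "A \<in> sets lebesgue" by auto
    have im: "S ` A = box l u"
      unfolding A_def using inv(2) by (intro surj_image_vimage_eq surjI)
    have inj: "inj_on S A" by (metis inj_onI inv(1))
    have der': "(S has_derivative S' x) (at x within A)" for x by (rule has_derivative_at_withinI[OF der])
    have int: "(\<lambda>x. \<bar>det (matrix (S' x))\<bar>) integrable_on A"
      using measurable_differentiable_image_eq[OF AL der' inj] by (simp add: im)
    have "(\<integral>\<^sup>+z. ennreal \<bar>det (matrix (S' z))\<bar> * indicator A z \<partial>lborel)
        = ennreal (integral A (\<lambda>x. \<bar>det (matrix (S' x))\<bar>))"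
      by (rule nn_integral_has_integral_lebesgue'[OF _ integrable_integral[OF int]]) auto
    also have "integral A (\<lambda>x. \<bar>det (matrix (S' x))\<bar>) = measure lebesgue (box l u)"
      using measure_differentiable_image_eq[OF AL der' inj int] by (simp add: im)
    also have "ennreal (measure lebesgue (box l u)) = emeasure lborel (box l u)"
      using emeasure_lborel_box_finite[of l u]
      by (simp add: emeasure_eq_ennreal_measure measure_completion less_top)
    finally show "(\<integral>\<^sup>+z. indicator (box l u) (S z) * ennreal \<bar>det (matrix (S' z))\<bar> \<partial>lborel) = emeasure lborel (box l u)"
      by (simp add: A_def indicator_def mult.commute)
  qed auto
qed

text \<open>Transfer from \<open>real^2\<close> to pairs: the coordinate identification
  \<open>P\<close> carries boxes to boxes of equal area, hence preserves Lebesgue measure.\<close>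

lemma cov_plane:
  fixes S T :: "plane \<Rightarrow> plane"
  assumes der: "\<And>x. (S has_derivative S' x) (at x)"
    and inv: "\<And>x. T (S x) = x" "\<And>x. S (T x) = x"
    and m[measurable]: "(\<lambda>x. \<bar>det2 (S' x)\<bar>) \<in> borel_measurable borel"
  shows "cov S (\<lambda>x. \<bar>det2 (S' x)\<bar>)"
proof -
  define P :: "real^2 \<Rightarrow> plane" where "P v = (v $ 1, v $ 2)" for v
  define Q :: "plane \<Rightarrow> real^2" where "Q p = (\<chi> i. if i = 1 then fst p else snd p)" for p
  have PQ[simp]: "P (Q p) = p" "Q (P v) = v" for p v
    by (auto simp: P_def Q_def vec_eq_iff forall_2)
  have linP: "bounded_linear P" and linQ: "bounded_linear Q"
    by (auto intro!: linearI simp: linear_conv_bounded_linear[symmetric] P_def Q_def vec_eq_iff)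
  have [measurable]: "P \<in> borel_measurable borel" "Q \<in> borel_measurable borel"
    by (auto intro!: borel_measurable_continuous_onI linear_continuous_on linP linQ)
  have [measurable]: "S \<in> borel_measurable borel"
    by (rule borel_measurable_continuous_onI)
       (rule has_derivative_continuous_on[OF has_derivative_at_withinI[OF der]])
  have dist: "lborel = distr lborel borel P"
  proof (rule lborel_eqI)
    fix l u :: "plane" assume lu: "\<And>b. b \<in> Basis \<Longrightarrow> l \<bullet> b \<le> u \<bullet> b"
    have lu': "fst l \<le> fst u" "snd l \<le> snd u" using lu[of "(1,0)"] lu[of "(0,1)"] by (auto simp: Basis_prod_def inner_prod_def)
    have "P -` box l u = box (Q l) (Q u)"
      unfolding set_eq_iff vimage_eq mem_box_cart forall_2
      by (auto simp: mem_box Basis_prod_def ball_Un P_def Q_def inner_prod_def)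
    then have "emeasure (distr lborel borel P) (box l u) = emeasure lborel (box (Q l) (Q u))"
      by (simp add: emeasure_distr)
    also have "\<dots> = (\<Prod>b\<in>Basis. (Q u - Q l) \<bullet> b)"
    proof -
      have "Q l \<bullet> b \<le> Q u \<bullet> b" if "b \<in> Basis" for b
        using that lu' by (force simp: Q_def Basis_vec_def inner_axis)
      then show ?thesis by (simp add: emeasure_lborel_box_eq)
    qed
    also have "(\<Prod>b\<in>Basis. (Q u - Q l) \<bullet> b) = (fst u - fst l) * (snd u - snd l)"
    proof -
      have B: "(Basis :: (real^2) set) = {axis 1 1, axis 2 1}"
      proof -
        have "(Basis :: (real^2) set) = (\<lambda>i. axis i 1) ` {1, 2}"
          unfolding Basis_vec_def Basis_real_def using UNIV_2 by auto
        then show ?thesis by simp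
      qed
      moreover have "axis 1 1 \<noteq> (axis 2 1 :: real^2)" by (simp add: axis_eq_axis)
      ultimately show ?thesis unfolding B by (simp add: Q_def inner_axis)
    qed
    also have "\<dots> = (\<Prod>b\<in>Basis. (u - l) \<bullet> b)"
      by (simp add: Basis_prod_def inner_prod_def mult.commute)
    finally show "emeasure (distr lborel borel P) (box l u) = (\<Prod>b\<in>Basis. (u - l) \<bullet> b)" .
  qed simp
  define R where "R v = Q (S (P v))" for v
  define R' where "R' v = (\<lambda>h. Q (S' (P v) (P h)))" for v
  have derR: "(R has_derivative R' v) (at v)" for v
    unfolding R_def[abs_def] R'_def
    by (intro bounded_linear.has_derivative[OF linQ] has_derivative_compose[OF bounded_linear_imp_has_derivative[OF linP] der])
  have det: "det (matrix (R' v)) = det2 (S' (P v))" for v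
    by (simp add: det_2 matrix_def R'_def P_def Q_def axis_def det2_def)
  have "cov R (\<lambda>v. \<bar>det (matrix (R' v))\<bar>)"
    by (rule cov_vec2[OF derR, where T = "\<lambda>v. Q (T (P v))"])
       (auto simp: R_def inv det)
  then have covR: "cov R (\<lambda>v. \<bar>det2 (S' (P v))\<bar>)" by (simp add: det)
  show ?thesis
    unfolding cov_def
  proof (intro conjI ballI allI)
    fix G :: "plane \<Rightarrow> ennreal" assume [measurable]: "G \<in> borel_measurable borel"
    have "(\<integral>\<^sup>+z. G (S z) * ennreal \<bar>det2 (S' z)\<bar> \<partial>lborel)
        = (\<integral>\<^sup>+v. G (S (P v)) * ennreal \<bar>det2 (S' (P v))\<bar> \<partial>lborel)"
      by (subst dist, subst nn_integral_distr) auto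
    also have "\<dots> = (\<integral>\<^sup>+v. G (P (R v)) * ennreal \<bar>det2 (S' (P v))\<bar> \<partial>lborel)"
      by (simp add: R_def)
    also have "\<dots> = (\<integral>\<^sup>+v. G (P v) \<partial>lborel)"
      using covD[OF covR, of "\<lambda>v. G (P v)"] by simp
    also have "\<dots> = (\<integral>\<^sup>+z. G z \<partial>lborel)"
      using arg_cong[OF dist, of "\<lambda>M. integral\<^sup>N M G"] by (simp add: nn_integral_distr)
    finally show "(\<integral>\<^sup>+z. G (S z) * ennreal \<bar>det2 (S' z)\<bar> \<partial>lborel) = (\<integral>\<^sup>+z. G z \<partial>lborel)" .
  qed auto
qed

section \<open>Convergence of one-step methods and of their Jacobians\<close>

lemma discrete_gronwall:
  fixes e :: "nat \<Rightarrow> real"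
  assumes "e 0 \<le> 0" and a: "0 \<le> a" and b: "0 \<le> b"
    and step: "\<And>i. i < N \<Longrightarrow> e (Suc i) \<le> (1 + a) * e i + b"
  shows "i \<le> N \<Longrightarrow> e i \<le> i * b * exp (i * a)"
proof (induction i)
  case (Suc i)
  have "e (Suc i) \<le> (1 + a) * e i + b" using Suc by (intro step) auto
  also have "(1 + a) * e i \<le> (1 + a) * (i * b * exp (i * a))"
    using Suc a by (intro mult_left_mono) auto
  also have "\<dots> \<le> exp a * (i * b * exp (i * a))"
    using b by (intro mult_right_mono exp_ge_add_one_self) auto
  also have "\<dots> = i * b * exp (Suc i * a)"
    by (simp add: exp_add distrib_right)
  finally have 1: "e (Suc i) \<le> i * b * exp (Suc i * a) + b" by simp
  have "b * 1 \<le> b * exp (Suc i * a)" using a b by (intro mult_left_mono) auto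
  moreover have "Suc i * b * exp (Suc i * a) = i * b * exp (Suc i * a) + b * exp (Suc i * a)"
    by (simp add: algebra_simps)
  ultimately show ?case using 1 by linarith
qed (use assms in simp)

lemma divide_mult_cancel_nonzero: "(b::real) \<noteq> 0 \<Longrightarrow> a / b * b = a"
  by simp

text \<open>The truncation error of an Euler step is o(h) uniformly in the starting time, by uniform
  continuity of the derivative. No power of h is available, because the driving path is merely
  continuous in time.\<close>

lemma uniform_taylor1:
  fixes y :: "real \<Rightarrow> 'a::euclidean_space"
  assumes der: "\<And>q. (y has_vector_derivative F q) (at q)" and F: "continuous_on {0..t} F"
    and \<epsilon>: "\<epsilon> > 0"
  obtains h0 where "h0 > 0"
    "\<And>a b. 0 \<le> a \<Longrightarrow> a \<le> b \<Longrightarrow> b \<le> t \<Longrightarrow> b - a < h0 \<Longrightarrow>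
       norm (y b - y a - (b - a) *\<^sub>R F a) \<le> \<epsilon> * (b - a)"
proof -
  have "uniformly_continuous_on {0..t} F" by (rule compact_uniformly_continuous[OF F]) simp
  then obtain h0 where h0: "h0 > 0"
    "\<And>q q'. q \<in> {0..t} \<Longrightarrow> q' \<in> {0..t} \<Longrightarrow> dist q' q < h0 \<Longrightarrow> dist (F q') (F q) < \<epsilon>"
    unfolding uniformly_continuous_on_def using \<epsilon> by blast
  have "norm (y b - y a - (b - a) *\<^sub>R F a) \<le> \<epsilon> * (b - a)"
    if ab: "0 \<le> a" "a \<le> b" "b \<le> t" "b - a < h0" for a b
  proof -
    have "norm (y b - y a - (b - a) *\<^sub>R F a)
        \<le> (norm (y a - y a - (a - a) *\<^sub>R F a) + \<epsilon> * (b - a)) * exp (0 * (b - a))"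
    proof (rule gronwall_forward)
      fix q assume q: "q \<in> {a..b}"
      have "((\<lambda>q. (q - a) *\<^sub>R F a) has_vector_derivative F a) (at q)"
        by (auto intro!: derivative_eq_intros)
      then show "((\<lambda>q. y q - y a - (q - a) *\<^sub>R F a) has_vector_derivative F q - 0 - F a) (at q)"
        by (intro has_vector_derivative_diff der has_vector_derivative_const)
      show "norm (F q - 0 - F a) \<le> 0 * norm (y q - y a - (q - a) *\<^sub>R F a) + \<epsilon>"
        using h0(2)[of a q] q ab by (auto simp: dist_norm abs_if less_imp_le)
    qed (use ab \<epsilon> in auto)
    then show ?thesis by simp
  qed
  with h0(1) show ?thesis by (rule that)
qed

text \<open>Passing to the limit of one-step approximations gives the Jacobian of the flow of \<open>B\<close> without
  differentiating the flow.\<close>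

locale one_step_method =
  fixes B :: "real \<Rightarrow> 'a::euclidean_space \<Rightarrow> 'a" and d :: "real \<Rightarrow> 'a \<Rightarrow> real" and t c :: real
    and step :: "nat \<Rightarrow> nat \<Rightarrow> 'a \<Rightarrow> 'a" and jac :: "nat \<Rightarrow> nat \<Rightarrow> 'a \<Rightarrow> real" and n0 :: nat
  assumes B: "lipschitz_field B" and t: "0 \<le> t" and c: "0 \<le> c" and n0: "0 < n0"
    and d_cont: "continuous_on UNIV (\<lambda>(r, z). d r z)" and d_bd: "\<bar>d r z\<bar> \<le> c"
    and cov_step: "n0 \<le> N \<Longrightarrow> i < N \<Longrightarrow> cov (step N i) (jac N i)"
    and step_err: "n0 \<le> N \<Longrightarrow> i < N \<Longrightarrow>
      norm (step N i z - z - (t / N) *\<^sub>R B (i * (t / N)) z) \<le> c * (t / N)\<^sup>2"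
    and step_move: "n0 \<le> N \<Longrightarrow> i < N \<Longrightarrow> norm (step N i z - z) \<le> c * (t / N)"
    and jac_err: "n0 \<le> N \<Longrightarrow> i < N \<Longrightarrow>
      \<bar>jac N i z - 1 + (t / N) * d (i * (t / N)) z\<bar> \<le> c * (t / N)\<^sup>2"
begin

primrec iterate :: "nat \<Rightarrow> nat \<Rightarrow> 'a \<Rightarrow> 'a" where
  "iterate N 0 z = z" | "iterate N (Suc i) z = step N i (iterate N i z)"

primrec jacobian :: "nat \<Rightarrow> nat \<Rightarrow> 'a \<Rightarrow> real" where
  "jacobian N 0 z = 1" | "jacobian N (Suc i) z = jacobian N i z * jac N i (iterate N i z)"

lemma cov_iterate: "n0 \<le> N \<Longrightarrow> i \<le> N \<Longrightarrow> cov (iterate N i) (jacobian N i)"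
proof (induction i)
  case (Suc i)
  then show ?case using cov_comp[OF Suc.IH cov_step[of N i]] by simp
next
  case 0
  have "iterate N 0 = (\<lambda>z. z)" "jacobian N 0 = (\<lambda>_. 1)" by auto
  then show ?case by (simp only: cov_id)
qed

lemma step_size: "n0 \<le> N \<Longrightarrow> 0 \<le> t / N" "n0 \<le> N \<Longrightarrow> t / N \<le> t" "n0 \<le> N \<Longrightarrow> N * (t / N) = t"
  using n0 t by (auto simp: divide_le_eq mult_le_cancel_left1)

lemma iterate_move: "n0 \<le> N \<Longrightarrow> i \<le> N \<Longrightarrow> norm (iterate N i z - z) \<le> i * (c * (t / N))"
proof (induction i)
  case (Suc i)
  have "norm (iterate N (Suc i) z - z) \<le> norm (step N i (iterate N i z) - iterate N i z) + norm (iterate N i z - z)"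
    using norm_triangle_ineq[of "step N i (iterate N i z) - iterate N i z" "iterate N i z - z"] by simp
  also have "\<dots> \<le> c * (t / N) + i * (c * (t / N))"
    using Suc by (intro add_mono step_move) auto
  also have "\<dots> = Suc i * (c * (t / N))" by (simp only: of_nat_Suc distrib_right mult_1)
  finally show ?case .
qed simp

lemma jacobian_bound: "n0 \<le> N \<Longrightarrow> i \<le> N \<Longrightarrow> jacobian N i z \<le> exp (i * ((t / N) * (c + c * t)))"
proof (induction i)
  case (Suc i)
  let ?h = "t / N" and ?E = "iterate N i z"
  have "jac N i ?E \<le> 1 + ?h * \<bar>d (i * ?h) ?E\<bar> + c * ?h\<^sup>2"
  proof -
    have "?h * - d (i * ?h) ?E \<le> ?h * \<bar>d (i * ?h) ?E\<bar>"
      using step_size[of N] Suc.prems by (intro mult_left_mono) auto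
    moreover have "\<bar>jac N i ?E - 1 + ?h * d (i * ?h) ?E\<bar> \<le> c * ?h\<^sup>2"
      using Suc.prems by (intro jac_err) auto
    ultimately show ?thesis using abs_le_D1 unfolding mult_minus_right by fastforce
  qed
  also have "\<dots> \<le> 1 + ?h * c + c * (?h * t)"
    unfolding power2_eq_square using step_size[of N] Suc.prems c
    by (intro add_mono mult_left_mono d_bd) auto
  also have "\<dots> = 1 + ?h * (c + c * t)" by (simp add: algebra_simps)
  also have "\<dots> \<le> exp (?h * (c + c * t))" by (rule exp_ge_add_one_self)
  finally have "jacobian N (Suc i) z \<le> exp (i * (?h * (c + c * t))) * exp (?h * (c + c * t))"
    using Suc cov_nonneg[OF cov_iterate[of N i]] cov_nonneg[OF cov_step[of N i]]
    by (auto intro!: mult_mono)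
  also have "\<dots> = exp (Suc i * (?h * (c + c * t)))" by (simp only: exp_add[symmetric] of_nat_Suc distrib_right mult_1 add.commute)
  finally show ?case .
qed simp

definition "sol z = ode_sol B 0 z"
definition "lnJ z q = signed_integral 0 q (\<lambda>s. d s (sol z s))"

lemma d_sol_continuous: "continuous_on S (\<lambda>q. d q (sol z q))"
proof -
  have "continuous_on S (\<lambda>q. (q, sol z q))"
    unfolding sol_def by (intro continuous_intros ode_sol_continuous B)
  from continuous_on_compose2[OF d_cont this] show ?thesis by simp
qed

lemma sol_deriv: "(sol z has_vector_derivative B q (sol z q)) (at q)"
  unfolding sol_def by (rule ode_sol_deriv[OF B])

lemma J_deriv: "((\<lambda>q. exp (- lnJ z q)) has_vector_derivative - (d q (sol z q) * exp (- lnJ z q))) (at q)"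
proof -
  have "(lnJ z has_real_derivative d q (sol z q)) (at q)"
    unfolding has_real_derivative_iff_has_vector_derivative lnJ_def
    by (rule signed_integral_has_vector_derivative) (rule d_sol_continuous)
  then show ?thesis
    unfolding has_real_derivative_iff_has_vector_derivative[symmetric]
    by (auto intro!: derivative_eq_intros)
qed

lemma lnJ_continuous: "continuous_on S (lnJ z)"
  unfolding lnJ_def[abs_def] by (intro signed_integral_continuous d_sol_continuous)

lemma eventually_step_size:
  assumes "h0 > 0" shows "\<forall>\<^sub>F N in sequentially. n0 \<le> N \<and> t / N < h0"
proof -
  have "(\<lambda>N. t / real N) \<longlonglongrightarrow> 0" by (rule lim_const_over_n)
  then have "\<forall>\<^sub>F N in sequentially. t / real N < h0" using assms by (rule order_tendstoD)
  then show ?thesis using eventually_ge_at_top[of n0] by eventually_elim auto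
qed

text \<open>Consistency and stability: each step adds at most \<open>2 * \<delta> * h\<close> to the
  error, and the discrete Gronwall inequality amplifies the sum by at most
  \<open>exp (C * t)\<close>. The value of \<delta> absorbs both factors.\<close>

lemma iterate_uniform:
  assumes \<epsilon>: "\<epsilon> > 0"
  shows "\<forall>\<^sub>F N in sequentially. \<forall>i\<le>N. norm (iterate N i z - sol z (i * (t / N))) \<le> \<epsilon>"
proof -
  obtain C where C: "C > 0" "\<And>r x y. \<bar>r\<bar> \<le> t \<Longrightarrow> norm (B r x - B r y) \<le> C * norm (x - y)"
    using B unfolding lipschitz_field_def by blast
  define \<delta> where "\<delta> = \<epsilon> / (2 * (1 + t) * exp (C * t))"
  have \<delta>: "\<delta> > 0" using \<epsilon> t by (simp add: \<delta>_def)
  obtain h0 where h0: "h0 > 0" "\<And>a b. 0 \<le> a \<Longrightarrow> a \<le> b \<Longrightarrow> b \<le> t \<Longrightarrow> b - a < h0 \<Longrightarrow>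
       norm (sol z b - sol z a - (b - a) *\<^sub>R B a (sol z a)) \<le> \<delta> * (b - a)"
    by (rule uniform_taylor1[OF sol_deriv[of z] _ \<delta>, of t])
       (auto simp: sol_def intro!: lipschitz_field_continuous[OF B] ode_sol_continuous[OF B] continuous_intros)
  have "\<forall>\<^sub>F N in sequentially. n0 \<le> N \<and> t / N < min h0 (\<delta> / (c + 1))"
    using h0(1) \<delta> c by (intro eventually_step_size) auto
  then show ?thesis
  proof eventually_elim
    case (elim N)
    define h where "h = t / N"
    have N: "n0 \<le> N" and hh: "h < h0" "h < \<delta> / (c + 1)" using elim by (auto simp: h_def)
    have h: "0 \<le> h" "N * h = t" using step_size[OF N] by (auto simp: h_def)
    have ch: "c * h \<le> \<delta>" using hh(2) c h(1) by (simp add: field_simps)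
    have ih: "i * h \<le> t" if "i \<le> N" for i
      using that h mult_right_mono[of "real i" "real N" h] by simp
    define e where "e i = norm (iterate N i z - sol z (i * h))" for i
    have "e i \<le> i * (2 * \<delta> * h) * exp (i * (C * h))" if "i \<le> N" for i
    proof (rule discrete_gronwall[OF _ _ _ _ that])
      show "e 0 \<le> 0" by (simp add: e_def sol_def ode_sol_init[OF B])
      fix i assume i: "i < N"
      let ?E = "iterate N i z" and ?y = "sol z (i * h)" and ?y' = "sol z (Suc i * h)"
      have 1: "norm (step N i ?E - ?E - h *\<^sub>R B (i * h) ?E) \<le> \<delta> * h"
      proof -
        have "c * h\<^sup>2 \<le> \<delta> * h" using ch h(1) by (simp add: power2_eq_square mult_right_mono mult.assoc[symmetric])
        then show ?thesis using step_err[OF N i, of ?E] unfolding h_def by linarith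
      qed
      have "Suc i * h - i * h = h" by (simp add: algebra_simps)
      then have 2: "norm (?y' - ?y - h *\<^sub>R B (i * h) ?y) \<le> \<delta> * h"
        using h0(2)[of "i * h" "Suc i * h"] ih[of "Suc i"] i h(1) hh(1) by (simp add: mult_right_mono)
      have 3: "norm (B (i * h) ?E - B (i * h) ?y) \<le> C * e i"
        unfolding e_def by (rule C(2)) (use ih[of i] i h(1) in auto)
      have "iterate N (Suc i) z - ?y' = (?E - ?y) + h *\<^sub>R (B (i * h) ?E - B (i * h) ?y)
          + (step N i ?E - ?E - h *\<^sub>R B (i * h) ?E) - (?y' - ?y - h *\<^sub>R B (i * h) ?y)"
        by (simp add: algebra_simps)
      then have "e (Suc i) \<le> e i + h * norm (B (i * h) ?E - B (i * h) ?y) + \<delta> * h + \<delta> * h"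
        unfolding e_def using h(1) 1 2
        by (smt (verit) norm_triangle_ineq norm_triangle_ineq4 norm_scaleR abs_of_nonneg)
      also have "\<dots> \<le> e i + h * (C * e i) + \<delta> * h + \<delta> * h"
        using 3 h(1) by (intro add_right_mono add_left_mono mult_left_mono)
      finally show "e (Suc i) \<le> (1 + C * h) * e i + 2 * \<delta> * h" by (simp add: algebra_simps)
    qed (use C \<delta> h in auto)
    also have "i * (2 * \<delta> * h) * exp (i * (C * h)) \<le> \<epsilon>" if "i \<le> N" for i
    proof -
      have "i * (2 * \<delta> * h) * exp (i * (C * h)) = (2 * \<delta>) * (i * h) * exp (C * (i * h))" by (simp add: ac_simps)
      also have "\<dots> \<le> (2 * \<delta>) * (1 + t) * exp (C * t)"
        using ih[OF that] \<delta> C h(1) t by (intro mult_mono) auto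
      also have "\<dots> = \<epsilon>"
      proof -
        have "2 * (1 + t) * exp (C * t) \<noteq> 0" using t by simp
        then have "\<delta> * (2 * (1 + t) * exp (C * t)) = \<epsilon>"
          unfolding \<delta>_def by (rule divide_mult_cancel_nonzero)
        then show ?thesis by (simp only: ac_simps)
      qed
      finally show ?thesis .
    qed
    finally show ?case by (auto simp: e_def h_def)
  qed
qed

text \<open>The product of the step Jacobians is an Euler scheme for J' = - d J along the numerical
  orbit. Uniform continuity of \<open>d\<close> on a compact set allows the numerical orbit to be
  replaced by the true one.\<close>

lemma jacobian_limit: "(\<lambda>N. jacobian N N z) \<longlonglongrightarrow> exp (- lnJ z t)"
proof (rule metric_LIMSEQ_I)
  fix \<epsilon> :: real assume \<epsilon>: "\<epsilon> > 0"
  define A where "A = exp (t * (c + c * t))"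
  define \<delta> where "\<delta> = \<epsilon> / (2 * (2 * A + 1) * (1 + t) * exp (c * t))"
  have A: "A > 0" by (simp add: A_def)
  have \<delta>: "\<delta> > 0" using \<epsilon> t A by (simp add: \<delta>_def)
  define g where "g q = exp (- lnJ z q)" for q
  obtain h0 where h0: "h0 > 0" "\<And>a b. 0 \<le> a \<Longrightarrow> a \<le> b \<Longrightarrow> b \<le> t \<Longrightarrow> b - a < h0 \<Longrightarrow>
       norm (g b - g a - (b - a) *\<^sub>R - (d a (sol z a) * g a)) \<le> \<delta> * (b - a)"
    unfolding g_def
    by (rule uniform_taylor1[OF J_deriv[of z] _ \<delta>, of t])
       (auto intro!: d_sol_continuous lnJ_continuous continuous_intros)
  \<comment> \<open>Iterates stay within \<open>c * t\<close> of \<open>z\<close>, and the solution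
    is eventually within 1 of the iterates; both therefore remain in this compact set.\<close>
  define S where "S = {0..t} \<times> cball z (c * t + 1)"
  have "uniformly_continuous_on S (\<lambda>(r, z). d r z)"
    by (rule compact_uniformly_continuous[OF continuous_on_subset[OF d_cont]])
       (auto simp: S_def intro!: compact_Times)
  then obtain \<eta> where \<eta>: "\<eta> > 0" "\<And>r x y. (r, x) \<in> S \<Longrightarrow> (r, y) \<in> S \<Longrightarrow> dist (r, x) (r, y) < \<eta> \<Longrightarrow> dist (d r x) (d r y) < \<delta>"
    unfolding uniformly_continuous_on_def using \<delta> by fastforce
  have "\<forall>\<^sub>F N in sequentially. n0 \<le> N \<and> t / N < min h0 (\<delta> / (c + 1))"
    using h0(1) \<delta> c by (intro eventually_step_size) auto
  moreover have "\<forall>\<^sub>F N in sequentially. \<forall>i\<le>N. norm (iterate N i z - sol z (i * (t / N))) \<le> min 1 (\<eta> / 2)"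
    using \<eta> by (intro iterate_uniform) auto
  ultimately have "\<forall>\<^sub>F N in sequentially. \<bar>jacobian N N z - g t\<bar> < \<epsilon>"
  proof eventually_elim
    case (elim N)
    define h where "h = t / N"
    have N: "n0 \<le> N" and hh: "h < h0" "h < \<delta> / (c + 1)" using elim by (auto simp: h_def)
    have h: "0 \<le> h" "N * h = t" using step_size[OF N] by (auto simp: h_def)
    have ch: "c * h \<le> \<delta>" using hh(2) c h(1) by (simp add: field_simps)
    have ih: "i * h \<le> t" if "i \<le> N" for i
      using that h mult_right_mono[of "real i" "real N" h] by simp
    define e where "e i = \<bar>jacobian N i z - g (i * h)\<bar>" for i
    have JA: "\<bar>jacobian N i z\<bar> \<le> A" if "i \<le> N" for i
    proof -
      have "jacobian N i z \<le> exp (i * (h * (c + c * t)))"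
        using jacobian_bound[OF N that] by (simp add: h_def)
      also have "\<dots> \<le> A" unfolding A_def using ih[OF that] c t
        by (simp add: mult.assoc[symmetric] mult_right_mono)
      finally show ?thesis using cov_nonneg[OF cov_iterate[OF N that], of z] by simp
    qed
    have "e i \<le> i * ((2 * A + 1) * \<delta> * h) * exp (i * (c * h))" if "i \<le> N" for i
    proof (rule discrete_gronwall[OF _ _ _ _ that])
      show "e 0 \<le> 0" by (simp add: e_def g_def lnJ_def)
      fix i assume i: "i < N"
      let ?E = "iterate N i z" and ?y = "sol z (i * h)" and ?J = "jacobian N i z"
      have 1: "\<bar>jac N i ?E - 1 + h * d (i * h) ?E\<bar> \<le> \<delta> * h"
      proof -
        have "c * h\<^sup>2 \<le> \<delta> * h" using ch h(1) by (simp add: power2_eq_square mult_right_mono mult.assoc[symmetric])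
        then show ?thesis using jac_err[OF N i, of ?E] unfolding h_def by linarith
      qed
      have "Suc i * h - i * h = h" by (simp add: algebra_simps)
      then have 2: "\<bar>g (Suc i * h) - g (i * h) + h * (d (i * h) ?y * g (i * h))\<bar> \<le> \<delta> * h"
        using h0(2)[of "i * h" "Suc i * h"] ih[of "Suc i"] i h(1) hh(1) by (simp add: mult_right_mono)
      have Ey: "norm (?E - ?y) \<le> min 1 (\<eta> / 2)" using elim(2) i by (simp add: h_def)
      have Ez: "norm (?E - z) \<le> c * t"
      proof -
        have "norm (?E - z) \<le> c * (i * h)" using iterate_move[OF N, of i z] i by (simp add: h_def ac_simps)
        also have "\<dots> \<le> c * t" using ih[of i] i c by (intro mult_left_mono) auto
        finally show ?thesis .
      qed
      have "norm (?y - z) \<le> c * t + 1"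
        using Ez Ey norm_triangle_ineq4[of "?E - z" "?E - ?y"] by auto
      then have 3: "\<bar>d (i * h) ?E - d (i * h) ?y\<bar> \<le> \<delta>"
        using \<eta>(2)[of "i * h" ?E ?y] Ez Ey ih[of i] i h(1) \<eta>(1)
        by (auto simp: S_def dist_norm norm_minus_commute dist_Pair_Pair)
      \<comment> \<open>Five contributions: the old error, its propagation by \<open>d\<close>, the
        error of the step Jacobian, the evaluation of \<open>d\<close> at the iterate instead of the
        solution, and the truncation error of the exact Jacobian \<open>g\<close>.\<close>
      have "jacobian N (Suc i) z - g (Suc i * h)
          = (?J - g (i * h)) - h * d (i * h) ?y * (?J - g (i * h))
            + ?J * (jac N i ?E - 1 + h * d (i * h) ?E) - h * ?J * (d (i * h) ?E - d (i * h) ?y)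
            - (g (Suc i * h) - g (i * h) + h * (d (i * h) ?y * g (i * h)))"
        by (simp add: algebra_simps)
      moreover have "\<bar>h * d (i * h) ?y * (?J - g (i * h))\<bar> \<le> h * c * e i"
        unfolding abs_mult e_def using h(1) d_bd c by (intro mult_mono) auto
      moreover have "\<bar>?J * (jac N i ?E - 1 + h * d (i * h) ?E)\<bar> \<le> A * (\<delta> * h)"
        unfolding abs_mult using JA[of i] i 1 A by (intro mult_mono) auto
      moreover have "\<bar>h * ?J * (d (i * h) ?E - d (i * h) ?y)\<bar> \<le> h * A * \<delta>"
        unfolding abs_mult using JA[of i] i 3 h(1) A by (intro mult_mono) auto
      ultimately have "e (Suc i) \<le> e i + h * c * e i + A * (\<delta> * h) + h * A * \<delta> + \<delta> * h"
        using 2 unfolding e_def by linarith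
      then show "e (Suc i) \<le> (1 + c * h) * e i + (2 * A + 1) * \<delta> * h" by (simp add: algebra_simps)
    qed (use c \<delta> h A in auto)
    from this[of N] have "e N \<le> ((2 * A + 1) * \<delta>) * (N * h) * exp (c * (N * h))" by (simp add: ac_simps)
    also have "\<dots> \<le> ((2 * A + 1) * \<delta>) * (1 + t) * exp (c * t)"
      unfolding h(2) using A \<delta> t by (intro mult_mono) auto
    also have "\<dots> = \<epsilon> / 2"
    proof -
      have "2 * (2 * A + 1) * (1 + t) * exp (c * t) \<noteq> 0" using A t by simp
      then have "\<delta> * (2 * (2 * A + 1) * (1 + t) * exp (c * t)) = \<epsilon>"
        unfolding \<delta>_def by (rule divide_mult_cancel_nonzero)
      then have "(2 * A + 1) * \<delta> * (1 + t) * exp (c * t) * 2 = \<epsilon>" by (simp only: ac_simps)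
      then show ?thesis by simp
    qed
    also have "\<dots> < \<epsilon>" using \<epsilon> by simp
    finally show ?case by (simp add: e_def h(2))
  qed
  then show "\<exists>no. \<forall>n\<ge>no. dist (jacobian n n z) (exp (- lnJ z t)) < \<epsilon>"
    by (simp add: eventually_sequentially dist_norm g_def)
qed

lemma iterate_limit: "(\<lambda>N. iterate N N z) \<longlonglongrightarrow> sol z t"
proof (rule metric_LIMSEQ_I)
  fix \<epsilon> :: real assume \<epsilon>: "\<epsilon> > 0"
  have "\<forall>\<^sub>F N in sequentially. \<forall>i\<le>N. norm (iterate N i z - sol z (i * (t / N))) \<le> \<epsilon> / 2"
    using \<epsilon> by (intro iterate_uniform) auto
  moreover have "\<forall>\<^sub>F N in sequentially. n0 \<le> N" by (rule eventually_ge_at_top)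
  ultimately have "\<forall>\<^sub>F N in sequentially. dist (iterate N N z) (sol z t) < \<epsilon>"
  proof eventually_elim
    case (elim N)
    then have "norm (iterate N N z - sol z (N * (t / N))) \<le> \<epsilon> / 2" by blast
    then show ?case unfolding step_size(3)[OF elim(2)] using \<epsilon> by (simp add: dist_norm)
  qed
  then show "\<exists>no. \<forall>n\<ge>no. dist (iterate n n z) (sol z t) < \<epsilon>" by (simp add: eventually_sequentially)
qed

theorem cov_ode_sol:
  "cov (\<lambda>z. ode_sol B 0 z t) (\<lambda>z. exp (- signed_integral 0 t (\<lambda>s. d s (ode_sol B 0 z s))))"
proof -
  have "cov (\<lambda>z. sol z t) (\<lambda>z. exp (- lnJ z t))"
  proof (rule cov_limit)
    fix n z
    \<comment> \<open>The steps are controlled from \<open>n0\<close> on only, so the sequence is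
      shifted by \<open>n0\<close> before the limit is taken.\<close>
    have n: "n0 \<le> n + n0" by simp
    show "cov (iterate (n + n0) (n + n0)) (jacobian (n + n0) (n + n0))" by (rule cov_iterate) auto
    show "(\<lambda>n. iterate (n + n0) (n + n0) z) \<longlonglongrightarrow> sol z t"
      by (rule LIMSEQ_ignore_initial_segment[OF iterate_limit])
    show "(\<lambda>n. jacobian (n + n0) (n + n0) z) \<longlonglongrightarrow> exp (- lnJ z t)"
      by (rule LIMSEQ_ignore_initial_segment[OF jacobian_limit])
    show "jacobian (n + n0) (n + n0) z \<le> exp (t * (c + c * t))"
      using jacobian_bound[OF n order_refl, of z] step_size(3)[OF n] by (simp only: mult.assoc[symmetric])
    show "norm (iterate (n + n0) (n + n0) z - z) \<le> c * t"
      using iterate_move[OF n order_refl, of z] step_size(3)[OF n] by (simp only: mult.left_commute[of _ c])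
  qed
  then show ?thesis by (simp add: sol_def lnJ_def)
qed

end

section \<open>Integrals over the torus\<close>

lemma periodic_int_multiple:
  fixes u :: "'a::real_vector \<Rightarrow> 'b"
  assumes "\<And>x. u (x + v) = u x"
  shows "u (x + real_of_int n *\<^sub>R v) = u x"
proof (induction n rule: int_induct[where k = 0])
  case (step1 i)
  have "u (x + real_of_int (i + 1) *\<^sub>R v) = u ((x + real_of_int i *\<^sub>R v) + v)"
    by (simp add: algebra_simps)
  then show ?case using step1 assms by simp
next
  case (step2 i)
  have "u (x + real_of_int (i - 1) *\<^sub>R v) = u ((x + real_of_int (i - 1) *\<^sub>R v) + v)"
    by (simp add: assms)
  also have "\<dots> = u (x + real_of_int i *\<^sub>R v)" by (simp add: algebra_simps)
  finally show ?case using step2 by simp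
qed simp

definition lattice :: "real \<Rightarrow> int \<times> int \<Rightarrow> plane" where
  "lattice L k = (real_of_int (fst k) * L, real_of_int (snd k) * L)"

definition periodic2 :: "real \<Rightarrow> (plane \<Rightarrow> 'b) \<Rightarrow> bool" where
  "periodic2 L u \<longleftrightarrow> (\<forall>x. u (x + (L, 0)) = u x) \<and> (\<forall>x. u (x + (0, L)) = u x)"

lemma periodic2_lattice:
  assumes "periodic2 L u" shows "u (x + lattice L k) = u x"
proof -
  have "lattice L k = real_of_int (fst k) *\<^sub>R (L, 0) + real_of_int (snd k) *\<^sub>R (0, L)"
    by (simp add: lattice_def)
  then have "u (x + lattice L k) = u ((x + real_of_int (fst k) *\<^sub>R (L, 0)) + real_of_int (snd k) *\<^sub>R (0, L))"
    by (simp add: add.assoc)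
  also have "\<dots> = u (x + real_of_int (fst k) *\<^sub>R (L, 0))"
    using assms unfolding periodic2_def by (intro periodic_int_multiple) blast
  also have "\<dots> = u x"
    using assms unfolding periodic2_def by (intro periodic_int_multiple) blast
  finally show ?thesis .
qed

lemma torus_periodic_iff: "torus_periodic L u \<longleftrightarrow> periodic2 L u"
  by (auto simp: torus_periodic_def periodic2_def)

definition torus_square :: "real \<Rightarrow> (plane) set" where
  "torus_square L = {0..<L} \<times> {0..<L}"

lemma torus_square_borel [measurable]: "torus_square L \<in> sets borel"
  unfolding torus_square_def by (intro borel_Times) auto

lemma lattice_unique:
  assumes L: "L > 0"
  shows "z + lattice L k \<in> torus_square L \<longleftrightarrow> k = (- \<lfloor>fst z / L\<rfloor>, - \<lfloor>snd z / L\<rfloor>)"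
proof -
  have 1: "0 \<le> x + real_of_int i * L \<and> x + real_of_int i * L < L \<longleftrightarrow> i = - \<lfloor>x / L\<rfloor>" for x i
  proof -
    have "0 \<le> x + real_of_int i * L \<and> x + real_of_int i * L < L
        \<longleftrightarrow> real_of_int (- i) \<le> x / L \<and> x / L < real_of_int (- i) + 1"
      using L by (auto simp: field_simps)
    also have "\<dots> \<longleftrightarrow> \<lfloor>x / L\<rfloor> = - i" by (simp add: floor_eq_iff)
    finally show ?thesis by auto
  qed
  show ?thesis
    by (cases z; cases k) (use 1 in \<open>auto simp: torus_square_def lattice_def\<close>)
qed

lemma nn_integral_lattice_indicator:
  assumes L: "L > 0"
  shows "(\<integral>\<^sup>+k. indicator (torus_square L) (z + lattice L k) \<partial>count_space UNIV) = (1::ennreal)"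
proof -
  have "(\<lambda>k. indicator (torus_square L) (z + lattice L k) :: ennreal)
      = indicator {(- \<lfloor>fst z / L\<rfloor>, - \<lfloor>snd z / L\<rfloor>)}"
    using lattice_unique[OF L, of z] by (auto simp: indicator_def fun_eq_iff)
  then show ?thesis by simp
qed

text \<open>As \<open>S\<close> commutes with lattice translations, the preimage of the square is
  again a fundamental domain. The indicators of the translated squares sum to 1; inserting this sum,
  shifting each term by its lattice vector, and summing the indicators of \<open>S z\<close> instead
  exchanges the two domains.\<close>

lemma nn_integral_fundamental_domain:
  fixes F :: "plane \<Rightarrow> ennreal"
  assumes L: "L > 0" and [measurable]: "S \<in> borel_measurable borel" "F \<in> borel_measurable borel"
    and F: "periodic2 L F" and S: "periodic2 L (\<lambda>z. S z - z)"
  shows "(\<integral>\<^sup>+z. indicator (torus_square L) (S z) * F z \<partial>lborel)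
       = (\<integral>\<^sup>+z. indicator (torus_square L) z * F z \<partial>lborel)"
proof -
  let ?Q = "torus_square L" and ?C = "count_space (UNIV :: (int \<times> int) set)"
  have shift: "(\<integral>\<^sup>+z. h (z + c) \<partial>lborel) = (\<integral>\<^sup>+z. h z \<partial>lborel)"
    if [measurable]: "h \<in> borel_measurable borel" for h :: "plane \<Rightarrow> ennreal" and c
    by (subst (2) lborel_distr_plus[symmetric, of c]) (simp add: nn_integral_distr add.commute)
  have Sk: "S (z + lattice L k) = S z + lattice L k" for z k
    using periodic2_lattice[OF S, of z k] by (simp add: algebra_simps)
  have Fk: "F (z + lattice L k) = F z" for z k by (rule periodic2_lattice[OF F])
  have "(\<integral>\<^sup>+z. indicator ?Q (S z) * F z \<partial>lborel)
      = (\<integral>\<^sup>+z. (\<integral>\<^sup>+k. indicator ?Q (z + lattice L k) * (indicator ?Q (S z) * F z) \<partial>?C) \<partial>lborel)"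
    by (simp add: nn_integral_multc nn_integral_lattice_indicator[OF L])
  also have "\<dots> = (\<integral>\<^sup>+k. (\<integral>\<^sup>+z. indicator ?Q (z + lattice L k) * (indicator ?Q (S z) * F z) \<partial>lborel) \<partial>?C)"
    by (rule nn_integral_count_space_nn_integral) auto
  also have "\<dots> = (\<integral>\<^sup>+k. (\<integral>\<^sup>+z. indicator ?Q z * (indicator ?Q (S z + lattice L (- k)) * F z) \<partial>lborel) \<partial>?C)"
  proof (rule nn_integral_cong)
    fix k
    have mk: "z - lattice L k = z + lattice L (- k)" for z by (simp add: lattice_def)
    have kk: "z + lattice L k + lattice L (- k) = z" for z by (simp add: lattice_def zero_prod_def[symmetric])
    show "(\<integral>\<^sup>+z. indicator ?Q (z + lattice L k) * (indicator ?Q (S z) * F z) \<partial>lborel)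
        = (\<integral>\<^sup>+z. indicator ?Q z * (indicator ?Q (S z + lattice L (- k)) * F z) \<partial>lborel)"
      using shift[of "\<lambda>z. indicator ?Q z * (indicator ?Q (S (z - lattice L k)) * F (z - lattice L k))" "lattice L k"]
      by (simp add: mk Sk Fk kk)
  qed
  also have "\<dots> = (\<integral>\<^sup>+z. (\<integral>\<^sup>+k. indicator ?Q z * (indicator ?Q (S z + lattice L (- k)) * F z) \<partial>?C) \<partial>lborel)"
    by (rule nn_integral_count_space_nn_integral[symmetric]) auto
  also have "\<dots> = (\<integral>\<^sup>+z. indicator ?Q z * F z \<partial>lborel)"
  proof (rule nn_integral_cong)
    fix z
    have "bij (uminus :: int \<times> int \<Rightarrow> int \<times> int)"
      by (rule bij_uminus)
    then have "(\<integral>\<^sup>+k. indicator ?Q (S z + lattice L (- k)) \<partial>?C) = (1::ennreal)"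
      using nn_integral_bij_count_space[of uminus UNIV UNIV "\<lambda>k. indicator ?Q (S z + lattice L k) :: ennreal"]
        nn_integral_lattice_indicator[OF L, of "S z"] by simp
    then show "(\<integral>\<^sup>+k. indicator ?Q z * (indicator ?Q (S z + lattice L (- k)) * F z) \<partial>?C) = indicator ?Q z * F z"
      by (simp add: nn_integral_cmult nn_integral_multc)
  qed
  finally show ?thesis .
qed

section \<open>The finite measure on the torus and its change of variables\<close>

abbreviation torus_measure :: "real \<Rightarrow> (plane) measure" where
  "torus_measure L \<equiv> restrict_space lborel (torus_square L)"

lemma torus_integral_eq: "torus_integral L u = (\<integral>x. u x \<partial>torus_measure L)"
  unfolding torus_integral_def torus_square_def[symmetric] set_lebesgue_integral_def
  by (subst integral_restrict_space) auto

lemma finite_torus_measure: "finite_measure (torus_measure L)"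
proof
  have "emeasure lborel (torus_square L) \<le> emeasure lborel (cbox (0,0) (L,L))"
    by (intro emeasure_mono) (auto simp: torus_square_def mem_box Basis_prod_def inner_prod_def)
  also have "\<dots> < \<infinity>" using emeasure_lborel_cbox_finite[of "(0,0)" "(L,L)"] by simp
  finally show "emeasure (torus_measure L) (space (torus_measure L)) \<noteq> \<infinity>"
    by (simp add: emeasure_restrict_space space_restrict_space)
qed

lemma measure_torus: "0 \<le> L \<Longrightarrow> measure (torus_measure L) (space (torus_measure L)) = L\<^sup>2"
proof -
  assume L: "0 \<le> L"
  have "emeasure lborel (torus_square L) = emeasure (lborel \<Otimes>\<^sub>M lborel) ({0..<L} \<times> {0..<L})"
    by (simp add: torus_square_def lborel_prod)
  also have "\<dots> = ennreal L * ennreal L"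
    using L by (subst lborel.emeasure_pair_measure_Times) auto
  also have "\<dots> = ennreal (L\<^sup>2)" using L by (simp add: power2_eq_square ennreal_mult)
  finally show ?thesis
    by (simp add: measure_def emeasure_restrict_space space_restrict_space)
qed

lemma torus_integrable:
  fixes u :: "plane \<Rightarrow> real"
  assumes "u \<in> borel_measurable borel" "\<And>x. \<bar>u x\<bar> \<le> C"
  shows "integrable (torus_measure L) u"
  by (rule finite_measure.integrable_const_bound[OF finite_torus_measure, where B = C])
     (use assms in \<open>auto intro: measurable_restrict_space1\<close>)

lemma torus_integral_bound:
  fixes u :: "plane \<Rightarrow> real"
  assumes L: "L > 0" and u: "u \<in> borel_measurable borel" "\<And>x. \<bar>u x\<bar> \<le> C"
  shows "\<bar>torus_integral L u\<bar> \<le> C * L\<^sup>2"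
proof -
  interpret finite_measure "torus_measure L" by (rule finite_torus_measure)
  have "\<bar>torus_integral L u\<bar> \<le> (\<integral>x. \<bar>u x\<bar> \<partial>torus_measure L)"
    unfolding torus_integral_eq by (rule integral_abs_bound)
  also have "\<dots> \<le> (\<integral>x. C \<partial>torus_measure L)"
  proof (rule integral_mono)
    show "integrable (torus_measure L) (\<lambda>x. \<bar>u x\<bar>)" using torus_integrable[OF u] by (rule integrable_abs)
    show "integrable (torus_measure L) (\<lambda>x. C)" by (rule integrable_const)
  qed (rule u)
  also have "\<dots> = C * L\<^sup>2" using measure_torus[of L] L by (simp add: mult.commute)
  finally show ?thesis .
qed

text \<open>The plane formula is applied to the integrand cut off to the square; the preimage of the
  square that results is exchanged for the square itself. Positive and negative parts are treated
  separately.\<close>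

lemma torus_integral_cov:
  fixes u :: "plane \<Rightarrow> real"
  assumes L: "L > 0" and cov: "cov S j" and S: "periodic2 L (\<lambda>z. S z - z)" and j: "periodic2 L j" "\<And>z. j z \<le> Cj"
    and u: "periodic2 L u" "u \<in> borel_measurable borel" "\<And>x. \<bar>u x\<bar> \<le> C"
  shows "torus_integral L u = torus_integral L (\<lambda>z. u (S z) * j z)"
proof -
  note [measurable] = cov_measurable[OF cov] u(2)
  have main: "(\<integral>\<^sup>+x. ennreal (v x) \<partial>torus_measure L) = (\<integral>\<^sup>+z. ennreal (v (S z) * j z) \<partial>torus_measure L)"
    if [measurable]: "v \<in> borel_measurable borel" and v: "periodic2 L v" for v
  proof -
    have "(\<integral>\<^sup>+x. ennreal (v x) \<partial>torus_measure L) = (\<integral>\<^sup>+x. ennreal (v x) * indicator (torus_square L) x \<partial>lborel)"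
      by (subst nn_integral_restrict_space) auto
    also have "\<dots> = (\<integral>\<^sup>+z. (ennreal (v (S z)) * indicator (torus_square L) (S z)) * ennreal (j z) \<partial>lborel)"
      by (rule covD[OF cov, symmetric]) measurable
    also have "\<dots> = (\<integral>\<^sup>+z. indicator (torus_square L) (S z) * (ennreal (v (S z)) * ennreal (j z)) \<partial>lborel)"
      by (simp add: ac_simps)
    also have "\<dots> = (\<integral>\<^sup>+z. indicator (torus_square L) z * (ennreal (v (S z)) * ennreal (j z)) \<partial>lborel)"
    proof (rule nn_integral_fundamental_domain[OF L])
      have "v (S (z + k)) = v (S z)" if k: "k = (L, 0) \<or> k = (0, L)" for z k
      proof -
        have "S (z + k) - (z + k) = S z - z" using S k unfolding periodic2_def by blast
        then have "S (z + k) = S z + k" by (simp add: algebra_simps)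
        then show ?thesis using v k unfolding periodic2_def by metis
      qed
      then show "periodic2 L (\<lambda>z. ennreal (v (S z)) * ennreal (j z))"
        using j(1) unfolding periodic2_def by metis
    qed (use S in measurable)
    also have "\<dots> = (\<integral>\<^sup>+z. ennreal (v (S z) * j z) \<partial>torus_measure L)"
      unfolding ennreal_mult''[OF cov_nonneg[OF cov]]
      by (subst nn_integral_restrict_space) (auto simp: ac_simps)
    finally show ?thesis .
  qed
  have jb: "\<bar>u (S z) * j z\<bar> \<le> C * Cj" for z
    unfolding abs_mult using u(3) j(2) cov_nonneg[OF cov, of z]
    by (intro mult_mono) (auto intro: order_trans[OF abs_ge_zero u(3)])
  have "torus_integral L u
      = enn2real (\<integral>\<^sup>+x. ennreal (u x) \<partial>torus_measure L) - enn2real (\<integral>\<^sup>+x. ennreal (- u x) \<partial>torus_measure L)"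
    unfolding torus_integral_eq by (rule real_lebesgue_integral_def[OF torus_integrable[OF u(2,3)]])
  also have "\<dots> = enn2real (\<integral>\<^sup>+z. ennreal (u (S z) * j z) \<partial>torus_measure L)
      - enn2real (\<integral>\<^sup>+z. ennreal (- (u (S z) * j z)) \<partial>torus_measure L)"
    using main[of u] main[of "\<lambda>x. - u x"] u by (simp add: periodic2_def)
  also have "\<dots> = torus_integral L (\<lambda>z. u (S z) * j z)"
    unfolding torus_integral_eq
    by (rule real_lebesgue_integral_def[symmetric], rule torus_integrable[OF _ jb]) measurable
  finally show ?thesis .
qed

section \<open>Explicit Euler steps\<close>

text \<open>For \<open>h * K \<le> 1/4\<close> the equation \<open>z = y + h *\<^sub>R G z\<close>
  has a unique solution by Banach's theorem, so the Euler map is a bijection. Its determinant is 1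
  minus \<open>h\<close> times the divergence plus \<open>h\<^sup>2\<close> times the determinant of
  \<open>DG\<close>.\<close>

lemma euler_step_cov:
  fixes G :: "plane \<Rightarrow> plane"
  assumes der: "\<And>x. (G has_derivative DG x) (at x)" and bd: "\<And>x v. norm (DG x v) \<le> K * norm v"
    and cont: "\<And>v. continuous_on UNIV (\<lambda>x. DG x v)" and h: "0 \<le> h" "h * K \<le> 1/4"
  obtains j where "cov (\<lambda>z. z - h *\<^sub>R G z) j"
    "\<And>z. \<bar>j z - 1 + h * (fst (DG z (1, 0)) + snd (DG z (0, 1)))\<bar> \<le> 2 * K\<^sup>2 * h\<^sup>2"
proof -
  define S where "S z = z - h *\<^sub>R G z" for z
  define S' where "S' z = (\<lambda>v. v - h *\<^sub>R DG z v)" for z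
  have lip: "norm (G x - G y) \<le> K * norm (x - y)" for x y
    by (rule differentiable_bound[where S = UNIV and f' = DG])
       (auto intro: der has_derivative_at_withinI onorm_le bd)
  have "\<exists>!z. y + h *\<^sub>R G z = z" for y
  proof (rule banach_fix_type)
    show "\<forall>a b. dist (y + h *\<^sub>R G a) (y + h *\<^sub>R G b) \<le> 1/4 * dist a b"
    proof (intro allI)
      fix a b
      have "dist (y + h *\<^sub>R G a) (y + h *\<^sub>R G b) = h * norm (G a - G b)"
        using h by (simp add: dist_norm flip: scaleR_diff_right)
      also have "\<dots> \<le> h * (K * norm (a - b))" by (intro mult_left_mono lip h)
      also have "\<dots> \<le> 1/4 * norm (a - b)"
        unfolding mult.assoc[symmetric] by (intro mult_right_mono h) auto
      finally show "dist (y + h *\<^sub>R G a) (y + h *\<^sub>R G b) \<le> 1/4 * dist a b" by (simp add: dist_norm)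
    qed
  qed auto
  then have uniq: "\<exists>!z. S z = y" for y
    by (metis (no_types, lifting) S_def add_diff_cancel diff_add_cancel)
  define T where "T y = (THE z. S z = y)" for y
  have T1: "S (T y) = y" for y unfolding T_def by (rule theI'[OF uniq])
  have T2: "T (S z) = z" for z using uniq T1 by metis
  define det where "det z = 1 - h * (fst (DG z (1, 0)) + snd (DG z (0, 1))) + h\<^sup>2 * det2 (DG z)" for z
  have detS: "det2 (S' z) = det z" for z
    by (simp add: det2_def S'_def det_def algebra_simps power2_eq_square)
  have K: "0 \<le> K" using bd[of 0 "(1,0)"] norm_ge_zero[of "DG 0 (1,0)"] by (simp del: norm_ge_zero)
  have e: "\<bar>fst (DG z (1, 0))\<bar> \<le> K" "\<bar>snd (DG z (1, 0))\<bar> \<le> K" "\<bar>fst (DG z (0, 1))\<bar> \<le> K" "\<bar>snd (DG z (0, 1))\<bar> \<le> K" for z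
    using bd[of z "(1,0)"] bd[of z "(0,1)"] norm_fst_le[of "fst (DG z (1, 0))" "snd (DG z (1, 0))"]
      norm_snd_le[of "snd (DG z (1, 0))" "fst (DG z (1, 0))"]
      norm_fst_le[of "fst (DG z (0, 1))" "snd (DG z (0, 1))"]
      norm_snd_le[of "snd (DG z (0, 1))" "fst (DG z (0, 1))"] by auto
  have d2: "\<bar>det2 (DG z)\<bar> \<le> 2 * K\<^sup>2" for z
  proof -
    have "\<bar>fst (DG z (1, 0)) * snd (DG z (0, 1))\<bar> \<le> K * K" "\<bar>fst (DG z (0, 1)) * snd (DG z (1, 0))\<bar> \<le> K * K"
      unfolding abs_mult by (intro mult_mono e K abs_ge_zero)+
    then show ?thesis by (simp add: det2_def power2_eq_square)
  qed
  have err: "\<bar>det z - 1 + h * (fst (DG z (1, 0)) + snd (DG z (0, 1)))\<bar> \<le> 2 * K\<^sup>2 * h\<^sup>2" for z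
  proof -
    have "\<bar>h\<^sup>2 * det2 (DG z)\<bar> \<le> h\<^sup>2 * (2 * K\<^sup>2)" unfolding abs_mult using d2 by (intro mult_mono) auto
    then show ?thesis by (simp add: det_def ac_simps)
  qed
  have pos: "0 \<le> det z" for z
  proof -
    have "\<bar>h * (fst (DG z (1, 0)) + snd (DG z (0, 1)))\<bar> \<le> h * (K + K)"
      unfolding abs_mult using e[of z] h by (intro mult_mono) auto
    also have "\<dots> \<le> 1/2" using h(2) by (simp add: distrib_left)
    finally have 1: "\<bar>h * (fst (DG z (1, 0)) + snd (DG z (0, 1)))\<bar> \<le> 1/2" .
    have "2 * K\<^sup>2 * h\<^sup>2 = 2 * (h * K)\<^sup>2" by (simp add: power_mult_distrib mult.commute)
    also have "\<dots> \<le> 2 * (1/4)\<^sup>2" using h K by (intro mult_left_mono power_mono) auto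
    finally have 2: "2 * K\<^sup>2 * h\<^sup>2 \<le> 1/8" by (simp add: power2_eq_square)
    from 1 2 err[of z] show ?thesis by linarith
  qed
  have "cov S (\<lambda>z. \<bar>det2 (S' z)\<bar>)"
  proof (rule cov_plane[where T = T])
    show "(S has_derivative S' x) (at x)" for x
      unfolding S_def[abs_def] S'_def
      by (intro has_derivative_diff has_derivative_ident has_derivative_scaleR_right der)
    show "(\<lambda>x. \<bar>det2 (S' x)\<bar>) \<in> borel_measurable borel"
      unfolding det2_def S'_def
      by (rule borel_measurable_continuous_onI) (intro continuous_intros cont)
  qed (use T1 T2 in auto)
  then have "cov S det" using pos by (simp add: detS)
  then show ?thesis using err by (intro that[of det]) (simp_all add: S_def[abs_def])
qed

section \<open>The transport equation along a path\<close>

text \<open>Rescaling to the fixed interval from 0 to 1 turns the end point into a parameter of the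
  integrand, so joint continuity follows from continuity of parameter integrals.\<close>

lemma signed_integral_scaled:
  fixes F :: "real \<Rightarrow> real"
  assumes F: "continuous_on UNIV F"
  shows "signed_integral 0 s F = s * integral {0..1} (\<lambda>u. F (s * u))"
proof -
  have "((\<lambda>u. s *\<^sub>R F (s * u)) has_integral (signed_integral 0 (s * 1) F - signed_integral 0 (s * 0) F)) {0..1}"
  proof (rule fundamental_theorem_of_calculus)
    fix u
    have "((\<lambda>u. s * u) has_vector_derivative s) (at u)" by (auto intro!: derivative_eq_intros)
    then have "((\<lambda>u. signed_integral 0 (s * u) F) has_vector_derivative s *\<^sub>R F (s * u)) (at u)"
      using vector_diff_chain_at[of "\<lambda>u. s * u" s u "\<lambda>r. signed_integral 0 r F"]
        signed_integral_has_vector_derivative[OF F] by (simp add: o_def)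
    then show "((\<lambda>u. signed_integral 0 (s * u) F) has_vector_derivative s *\<^sub>R F (s * u)) (at u within {0..1})"
      by (rule has_vector_derivative_at_within)
  qed simp
  from integral_unique[OF this] show ?thesis by simp
qed

lemma continuous_on_uncurry:
  assumes "continuous_on UNIV (\<lambda>(a, b). F a b)" "continuous_on S f" "continuous_on S h"
  shows "continuous_on S (\<lambda>q. F (f q) (h q))"
  using continuous_on_compose2[OF assms(1) continuous_on_Pair[OF assms(2,3)]] by simp

lemma signed_integral_continuous2:
  fixes F :: "real \<Rightarrow> 'a::metric_space \<Rightarrow> real"
  assumes F: "continuous_on UNIV (\<lambda>(q, z). F q z)"
  shows "continuous_on UNIV (\<lambda>(s, z). signed_integral 0 s (\<lambda>q. F q z))"
proof -
  have Fz: "continuous_on UNIV (\<lambda>q. F q z)" for z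
    by (intro continuous_on_uncurry[OF F] continuous_intros)
  have "continuous_on (UNIV \<times> cbox 0 1) (\<lambda>(x, u). F (fst x * u) (snd x))"
    unfolding case_prod_beta by (intro continuous_on_uncurry[OF F] continuous_intros)
  then have "continuous_on UNIV (\<lambda>x. integral (cbox 0 1) (\<lambda>u. F (fst x * u) (snd x)))"
    by (rule integral_continuous_on_param)
  then have "continuous_on UNIV (\<lambda>x. fst x * integral {0..1} (\<lambda>u. F (fst x * u) (snd x)))"
    by (intro continuous_intros) simp
  then show ?thesis by (simp add: signed_integral_scaled[OF Fz] case_prod_beta)
qed

lemma signed_integral_cong:
  assumes "\<And>q. q \<in> {min s r..max s r} \<Longrightarrow> F q = G q"
  shows "signed_integral s r F = signed_integral s r G"
  unfolding signed_integral_def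
  by (intro arg_cong2[where f = minus] Henstock_Kurzweil_Integration.integral_cong assms) auto

text \<open>Gronwall gives a Lipschitz bound in the initial value that is uniform for times near
  \<open>s\<close>; continuity in time of the single solution through \<open>z\<close> does the
  rest.\<close>

lemma ode_sol_continuous2:
  fixes B :: "real \<Rightarrow> 'a::euclidean_space \<Rightarrow> 'a"
  assumes B: "lipschitz_field B"
  shows "continuous_on UNIV (\<lambda>(s, z). ode_sol B 0 z s)"
proof -
  have "((\<lambda>p. ode_sol B 0 (snd p) (fst p)) \<longlongrightarrow> ode_sol B 0 z s) (at (s, z))" for s and z :: 'a
  proof -
    obtain C where C: "C > 0" "\<And>r x y. \<bar>r\<bar> \<le> \<bar>s\<bar> + 1 \<Longrightarrow> norm (B r x - B r y) \<le> C * norm (x - y)"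
      using B unfolding lipschitz_field_def by blast
    have bd: "norm (ode_sol B 0 x r - ode_sol B 0 z r) \<le> norm (x - z) * exp (C * (\<bar>s\<bar> + 1))"
      if r: "\<bar>r\<bar> \<le> \<bar>s\<bar> + 1" for x r
    proof -
      have "norm (ode_sol B 0 x r - ode_sol B 0 z r)
          \<le> (norm (ode_sol B 0 x 0 - ode_sol B 0 z 0) + 0 * \<bar>r - 0\<bar>) * exp (C * \<bar>r - 0\<bar>)"
      proof (rule gronwall[where e' = "\<lambda>q. B q (ode_sol B 0 x q) - B q (ode_sol B 0 z q)"])
        fix q assume "q \<in> {min 0 r..max 0 r}"
        then have "\<bar>q\<bar> \<le> \<bar>s\<bar> + 1" using r by (auto simp: min_def max_def split: if_splits)
        then show "norm (B q (ode_sol B 0 x q) - B q (ode_sol B 0 z q)) \<le> C * norm (ode_sol B 0 x q - ode_sol B 0 z q) + 0"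
          using C(2) by simp
      qed (use C in \<open>auto intro: has_vector_derivative_diff ode_sol_deriv[OF B]\<close>)
      also have "\<dots> \<le> norm (x - z) * exp (C * (\<bar>s\<bar> + 1))"
        using r C by (simp add: ode_sol_init[OF B] mult_left_mono)
      finally show ?thesis .
    qed
    have fst_lim: "((\<lambda>p. fst p) \<longlongrightarrow> s) (at (s, z))" and snd_lim: "((\<lambda>p. snd p) \<longlongrightarrow> z) (at (s, z))"
      using tendsto_fst[OF tendsto_ident_at, of "(s, z)"] tendsto_snd[OF tendsto_ident_at, of "(s, z)"] by auto
    have ev: "\<forall>\<^sub>F p in at (s, z). norm (ode_sol B 0 (snd p) (fst p) - ode_sol B 0 z (fst p))
        \<le> norm (snd p - z) * exp (C * (\<bar>s\<bar> + 1))"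
    proof -
      have "\<forall>\<^sub>F p in at (s, z). dist (fst p) s < 1" using tendstoD[OF fst_lim, of 1] by simp
      then show ?thesis by eventually_elim (rule bd, auto simp: dist_real_def)
    qed
    have "((\<lambda>p. norm (snd p - z) * exp (C * (\<bar>s\<bar> + 1))) \<longlongrightarrow> norm (z - z) * exp (C * (\<bar>s\<bar> + 1))) (at (s, z))"
      by (intro tendsto_intros snd_lim)
    then have "((\<lambda>p. ode_sol B 0 (snd p) (fst p) - ode_sol B 0 z (fst p)) \<longlongrightarrow> 0) (at (s, z))"
      by (intro Lim_null_comparison[OF ev]) simp
    moreover have "((\<lambda>p. ode_sol B 0 z (fst p)) \<longlongrightarrow> ode_sol B 0 z s) (at (s, z))"
      by (rule isCont_tendsto_compose[OF has_vector_derivative_continuous[OF ode_sol_deriv[OF B]] fst_lim])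
    ultimately show ?thesis using tendsto_add[of _ 0 _ _ "ode_sol B 0 z s"] by fastforce
  qed
  then show ?thesis
    by (auto simp: continuous_on_def case_prod_beta intro: tendsto_within_subset)
qed

section \<open>Characteristics and the explicit density along a path\<close>

locale transport = flow V DV K
  for V :: "plane \<Rightarrow> plane" and DV K +
  fixes g :: "plane \<Rightarrow> plane" and Dg L and f0 :: "plane \<Rightarrow> real" and F0 R0 :: real
  assumes L_pos: "L > 0"
    and V_periodic: "periodic2 L V" and g_periodic: "periodic2 L g" and f0_periodic: "periodic2 L f0"
    and V_divergence_free: "fst (DV x (1, 0)) + snd (DV x (0, 1)) = 0"
    and g_deriv: "(g has_derivative Dg x) (at x)"
    and g_bound: "norm (g x) \<le> K" and Dg_bound: "norm (Dg x v) \<le> K * norm v"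
    and Dg_continuous: "continuous_on UNIV (\<lambda>x. Dg x v)"
    and f0_borel [measurable]: "f0 \<in> borel_measurable borel"
    and f0_nonneg: "0 \<le> f0 x" and f0_bound: "f0 x \<le> F0"
    and R0_pos: "R0 > 0"
begin

lemma F0_nonneg: "0 \<le> F0" using f0_nonneg[of 0] f0_bound[of 0] by linarith

text \<open>Euler steps along \<open>V\<close>, written for \<open>- V\<close> because
  \<open>euler_step_cov\<close> subtracts the field. Zero divergence leaves a Jacobian error of
  order \<open>(t / N)\<^sup>2\<close> per step, which disappears in the limit: Liouville's
  theorem.\<close>

lemma Phi_cov_nonneg:
  assumes t: "0 \<le> t" shows "cov (Phi t) (\<lambda>_. 1)"
proof -
  \<comment> \<open>From \<open>n0\<close> on the step \<open>t / N\<close> meets the smallness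
    condition \<open>t / N * K \<le> 1/4\<close>; the summand 1 keeps \<open>N\<close>
    positive.\<close>
  define n0 where "n0 = nat \<lceil>4 * K * t\<rceil> + 1"
  have n0: "4 * K * t \<le> real N" if "n0 \<le> N" for N
    using that unfolding n0_def by linarith
  have hK: "t / N * K \<le> 1/4" if "n0 \<le> N" for N
  proof -
    have "real N > 0" using that by (simp add: n0_def)
    then show ?thesis using n0[OF that] by (simp add: field_simps)
  qed
  have ex: "\<exists>j. cov (\<lambda>z. z - (t / N) *\<^sub>R - V z) j \<and> (\<forall>z. \<bar>j z - 1\<bar> \<le> 2 * K\<^sup>2 * (t / N)\<^sup>2)" if N: "n0 \<le> N" for N :: nat
  proof -
    obtain j where "cov (\<lambda>z. z - (t / N) *\<^sub>R - V z) j"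
      "\<And>z. \<bar>j z - 1 + (t / N) * (fst (- DV z (1, 0)) + snd (- DV z (0, 1)))\<bar> \<le> 2 * K\<^sup>2 * (t / N)\<^sup>2"
      by (rule euler_step_cov[of "\<lambda>z. - V z" "\<lambda>z v. - DV z v" K "t / N"])
         (use t hK[OF N] DV_bound in \<open>auto intro!: has_derivative_minus V_deriv continuous_intros\<close>)
    moreover have "fst (- DV z (1, 0)) + snd (- DV z (0, 1)) = 0" for z
      using V_divergence_free[of z] by simp
    ultimately show ?thesis by (intro exI[of _ j]) simp
  qed
  then obtain j where j: "\<And>N. n0 \<le> N \<Longrightarrow> cov (\<lambda>z. z - (t / real N) *\<^sub>R - V z) (j N)"
    "\<And>N z. n0 \<le> N \<Longrightarrow> \<bar>j N z - 1\<bar> \<le> 2 * K\<^sup>2 * (t / N)\<^sup>2"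
    by metis
  interpret S: one_step_method "\<lambda>_. V" "\<lambda>_ _. 0" t "K + 2 * K\<^sup>2"
      "\<lambda>N i z. z - (t / N) *\<^sub>R - V z" "\<lambda>N i. j N" n0
  proof
    show "0 < n0" by (simp add: n0_def)
    fix N i z assume N: "n0 \<le> N"
    have "2 * K\<^sup>2 * (t / N)\<^sup>2 \<le> (K + 2 * K\<^sup>2) * (t / N)\<^sup>2" using K_pos by (intro mult_right_mono) auto
    then show "\<bar>j N z - 1 + (t / N) * 0\<bar> \<le> (K + 2 * K\<^sup>2) * (t / N)\<^sup>2" using j(2)[OF N, of z] by simp
    have "t / N * norm (V z) \<le> t / N * (K + 2 * K\<^sup>2)"
      using V_bound[of z] t K_pos by (intro mult_left_mono) (auto intro: add_increasing2)
    then show "norm (z - (t / N) *\<^sub>R - V z - z) \<le> (K + 2 * K\<^sup>2) * (t / N)"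
      using t by (simp add: mult.commute)
  qed (use t K_pos j in \<open>auto intro: V_field\<close>)
  show ?thesis using S.cov_ode_sol by (simp add: Phi_def[abs_def] signed_integral_def)
qed

lemma Phi_cov: "cov (Phi t) (\<lambda>_. 1)"
proof (cases "0 \<le> t")
  case False
  have m: "Phi t \<in> borel_measurable borel"
    by (rule borel_measurable_continuous_onI) (intro continuous_intros)
  have "cov (Phi (- t)) (\<lambda>_. 1)" using False by (intro Phi_cov_nonneg) simp
  note c = covD[OF this]
  show ?thesis
    unfolding cov_def
  proof (intro conjI ballI allI m)
    fix G :: "plane \<Rightarrow> ennreal" assume [measurable]: "G \<in> borel_measurable borel"
    note m[measurable]
    show "(\<integral>\<^sup>+z. G (Phi t z) * ennreal 1 \<partial>lborel) = (\<integral>\<^sup>+z. G z \<partial>lborel)"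
      using c[of "\<lambda>z. G (Phi t z)"] by simp
  qed auto
qed (rule Phi_cov_nonneg)

text \<open>The drift pulled back by the flow of \<open>V\<close>: for a smooth path \<open>p\<close> the curve \<open>X p s z\<close> below solves
  \<open>dX = V(X) dp - g(X) ds\<close>, and it makes sense for every continuous \<open>p\<close>.\<close>

definition drift :: "real \<Rightarrow> plane \<Rightarrow> plane" where
  "drift t z = - DPhi (- t) (Phi t z) (g (Phi t z))"

definition zeta :: "(real \<Rightarrow> real) \<Rightarrow> real \<Rightarrow> plane \<Rightarrow> plane" where
  "zeta p s z = ode_sol (\<lambda>r. drift (p r)) 0 z s"

definition X :: "(real \<Rightarrow> real) \<Rightarrow> real \<Rightarrow> plane \<Rightarrow> plane" where
  "X p s z = Phi (p s) (zeta p s z)"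

definition dvg :: "plane \<Rightarrow> real" where
  "dvg z = fst (Dg z (1, 0)) + snd (Dg z (0, 1))"

definition Dint :: "(real \<Rightarrow> real) \<Rightarrow> real \<Rightarrow> plane \<Rightarrow> real" where
  "Dint p s z = signed_integral 0 s (\<lambda>q. dvg (X p q z))"

text \<open>Accumulated inverse Jacobian along a characteristic: the strength with which absorption
  has acted, since the density there is \<open>amp * exp Dint\<close>.\<close>

definition Aint :: "(real \<Rightarrow> real) \<Rightarrow> real \<Rightarrow> plane \<Rightarrow> real" where
  "Aint p s z = signed_integral 0 s (\<lambda>q. exp (Dint p q z))"

text \<open>Solution of the Riccati equation \<open>amp' = - R0 amp\<^sup>2 exp Dint\<close>.\<close>

definition amp :: "(real \<Rightarrow> real) \<Rightarrow> real \<Rightarrow> plane \<Rightarrow> real" where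
  "amp p s z = f0 z / (1 + R0 * f0 z * Aint p s z)"

definition Xinv :: "(real \<Rightarrow> real) \<Rightarrow> real \<Rightarrow> plane \<Rightarrow> plane" where
  "Xinv p s x = ode_sol (\<lambda>r. drift (p r)) s (Phi (- p s) x) 0"

text \<open>The amplitude of the characteristic through \<open>x\<close>, divided by the Jacobian
  \<open>exp (- Dint)\<close> of the map \<open>X p s\<close>.\<close>

definition sol :: "(real \<Rightarrow> real) \<Rightarrow> real \<Rightarrow> plane \<Rightarrow> real" where
  "sol p s x = amp p s (Xinv p s x) * exp (Dint p s (Xinv p s x))"

lemma g_lipschitz: "norm (g x - g y) \<le> K * norm (x - y)"
  by (rule differentiable_bound[where S = UNIV and f' = Dg])
     (auto intro: g_deriv has_derivative_at_withinI onorm_le Dg_bound)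

lemma g_continuous: "continuous_on S g"
  by (rule has_derivative_continuous_on[OF has_derivative_at_withinI[OF g_deriv]])

lemma g_continuous_compose [continuous_intros]:
  "continuous_on S f \<Longrightarrow> continuous_on S (\<lambda>q. g (f q))"
  by (rule continuous_on_compose2[OF g_continuous]) auto

lemma dvg_continuous: "continuous_on S dvg"
  unfolding dvg_def[abs_def] by (intro continuous_intros continuous_on_subset[OF Dg_continuous]) auto

lemma dvg_continuous_compose [continuous_intros]:
  "continuous_on S f \<Longrightarrow> continuous_on S (\<lambda>q. dvg (f q))"
  by (rule continuous_on_compose2[OF dvg_continuous]) auto

lemma dvg_bound: "\<bar>dvg z\<bar> \<le> 2 * K"
proof -
  have "\<bar>fst (Dg z (1, 0))\<bar> \<le> K" "\<bar>snd (Dg z (0, 1))\<bar> \<le> K"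
    using Dg_bound[of z "(1,0)"] Dg_bound[of z "(0,1)"]
      norm_fst_le[of "fst (Dg z (1, 0))" "snd (Dg z (1, 0))"]
      norm_snd_le[of "snd (Dg z (0, 1))" "fst (Dg z (0, 1))"] by auto
  then show ?thesis by (simp add: dvg_def)
qed

lemma drift_continuous [continuous_intros]:
  "continuous_on S f \<Longrightarrow> continuous_on S h \<Longrightarrow> continuous_on S (\<lambda>q. drift (f q) (h q))"
  unfolding drift_def by (intro continuous_intros)

text \<open>The first summand of the constant is the variation of \<open>DPhi\<close> between the
  two base points, the second the variation of \<open>g\<close>. It is uniform in flow times bounded
  by \<open>R\<close>, which is what a bounded piece of path supplies.\<close>

lemma drift_lipschitz:
  assumes t: "\<bar>t\<bar> \<le> R"
  shows "norm (drift t x - drift t y)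
    \<le> (K * (K * R * exp (3 * K * R)) * exp (K * R) + exp (K * R) * K * exp (K * R)) * norm (x - y)"
proof -
  have R: "0 \<le> R" using t by linarith
  let ?a = "Phi t x" and ?b = "Phi t y"
  have e: "exp (K * \<bar>t\<bar>) \<le> exp (K * R)" "exp (3 * K * \<bar>t\<bar>) \<le> exp (3 * K * R)"
    using t K_pos by auto
  have ab: "norm (?a - ?b) \<le> exp (K * R) * norm (x - y)"
    using Phi_lipschitz[of t x y] mult_left_mono[OF e(1), of "norm (x - y)"] by (simp add: mult.commute)
  have "norm (drift t x - drift t y) = norm ((DPhi (- t) ?a (g ?a) - DPhi (- t) ?b (g ?a)) + DPhi (- t) ?b (g ?a - g ?b))"
    by (simp add: drift_def linear_diff[OF DPhi_linear] norm_minus_commute)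
  also have "\<dots> \<le> norm (DPhi (- t) ?a (g ?a) - DPhi (- t) ?b (g ?a)) + norm (DPhi (- t) ?b (g ?a - g ?b))"
    by (rule norm_triangle_ineq)
  also have "\<dots> \<le> K * \<bar>t\<bar> * exp (3 * K * \<bar>t\<bar>) * norm (?a - ?b) * norm (g ?a) + norm (g ?a - g ?b) * exp (K * \<bar>t\<bar>)"
    using DPhi_lipschitz[of "- t" ?a "g ?a" ?b] DPhi_bound[of "- t" ?b "g ?a - g ?b"] by simp
  also have "\<dots> \<le> K * R * exp (3 * K * R) * (exp (K * R) * norm (x - y)) * K + (K * (exp (K * R) * norm (x - y))) * exp (K * R)"
    using t R K_pos e ab g_bound order_trans[OF g_lipschitz mult_left_mono[OF ab]]
    by (intro add_mono mult_mono) auto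
  finally show ?thesis by (simp add: algebra_simps)
qed

lemma drift_translate:
  assumes k: "k = (L, 0) \<or> k = (0, L)"
  shows "drift t (z + k) = drift t z"
proof -
  have V: "V (x + k) = V x" and g: "g (x + k) = g x" for x
    using V_periodic g_periodic k unfolding periodic2_def by metis+
  show ?thesis by (simp add: drift_def Phi_translate[OF V] DPhi_translate[OF V] g)
qed

context
  fixes p :: "real \<Rightarrow> real"
  assumes p: "continuous_on UNIV p"
begin

lemma path_bounded: obtains R where "R > 0" "\<And>r. \<bar>r\<bar> \<le> T \<Longrightarrow> \<bar>p r\<bar> \<le> R"
proof -
  have "bounded (p ` {-T..T})"
    by (intro compact_imp_bounded compact_continuous_image continuous_on_subset[OF p]) auto
  then obtain R where "R > 0" "\<forall>x\<in>{-T..T}. \<bar>p x\<bar> \<le> R" unfolding bounded_pos by auto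
  then show ?thesis by (intro that[of R]) (auto simp: abs_le_iff minus_le_iff)
qed

lemma drift_field: "lipschitz_field (\<lambda>r. drift (p r))"
  unfolding lipschitz_field_def
proof (intro conjI allI)
  show "continuous_on UNIV (\<lambda>(r, z). drift (p r) z)"
    unfolding case_prod_beta
    by (intro continuous_intros continuous_on_compose2[OF p]) auto
  fix T
  obtain R where R: "R > 0" "\<And>r. \<bar>r\<bar> \<le> T \<Longrightarrow> \<bar>p r\<bar> \<le> R" using path_bounded by blast
  let ?C = "K * (K * R * exp (3 * K * R)) * exp (K * R) + exp (K * R) * K * exp (K * R)"
  have "?C > 0" using K_pos R by (simp add: add_pos_pos)
  then show "\<exists>C>0. \<forall>r x y. \<bar>r\<bar> \<le> T \<longrightarrow> norm (drift (p r) x - drift (p r) y) \<le> C * norm (x - y)"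
    using drift_lipschitz R(2) by (intro exI[of _ ?C]) auto
qed

lemma zeta_0 [simp]: "zeta p 0 z = z"
  by (simp add: zeta_def ode_sol_init[OF drift_field])

lemma zeta_deriv: "((\<lambda>s. zeta p s z) has_vector_derivative drift (p s) (zeta p s z)) (at s)"
  unfolding zeta_def by (rule ode_sol_deriv[OF drift_field])

lemma zeta_continuous: "continuous_on UNIV (\<lambda>(s, z). zeta p s z)"
  unfolding zeta_def by (rule ode_sol_continuous2[OF drift_field])

lemma X_continuous: "continuous_on UNIV (\<lambda>(s, z). X p s z)"
  unfolding X_def case_prod_beta
  by (intro continuous_intros continuous_on_uncurry[OF zeta_continuous] continuous_on_compose2[OF p]) auto

lemma X_continuous_compose [continuous_intros]:
  "continuous_on S f \<Longrightarrow> continuous_on S h \<Longrightarrow> continuous_on S (\<lambda>q. X p (f q) (h q))"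
  by (rule continuous_on_uncurry[OF X_continuous])

lemma Dint_continuous: "continuous_on UNIV (\<lambda>(s, z). Dint p s z)"
  unfolding Dint_def
  by (rule signed_integral_continuous2) (auto simp: case_prod_beta intro!: continuous_intros)

lemma Dint_continuous_compose [continuous_intros]:
  "continuous_on S f \<Longrightarrow> continuous_on S h \<Longrightarrow> continuous_on S (\<lambda>q. Dint p (f q) (h q))"
  by (rule continuous_on_uncurry[OF Dint_continuous])

lemma Aint_continuous: "continuous_on UNIV (\<lambda>(s, z). Aint p s z)"
  unfolding Aint_def
  by (rule signed_integral_continuous2) (auto simp: case_prod_beta intro!: continuous_intros)

lemma Aint_continuous_compose [continuous_intros]:
  "continuous_on S f \<Longrightarrow> continuous_on S h \<Longrightarrow> continuous_on S (\<lambda>q. Aint p (f q) (h q))"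
  by (rule continuous_on_uncurry[OF Aint_continuous])

lemma Dint_deriv: "((\<lambda>s. Dint p s z) has_real_derivative dvg (X p s z)) (at s)"
  unfolding has_real_derivative_iff_has_vector_derivative Dint_def
  by (rule signed_integral_has_vector_derivative) (intro continuous_intros)

lemma Aint_deriv: "((\<lambda>s. Aint p s z) has_real_derivative exp (Dint p s z)) (at s)"
  unfolding has_real_derivative_iff_has_vector_derivative Aint_def
  by (rule signed_integral_has_vector_derivative) (intro continuous_intros)

lemma Dint_0 [simp]: "Dint p 0 z = 0" and Aint_0 [simp]: "Aint p 0 z = 0"
  by (simp_all add: Dint_def Aint_def)

lemma Dint_lipschitz: "\<bar>Dint p s z - Dint p r z\<bar> \<le> 2 * K * \<bar>s - r\<bar>"
proof -
  have "norm (Dint p s z - Dint p r z) \<le> 2 * K * norm (s - r)"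
    by (rule field_differentiable_bound[where S = UNIV and f' = "\<lambda>s. dvg (X p s z)"])
       (use dvg_bound Dint_deriv in \<open>auto intro: DERIV_subset\<close>)
  then show ?thesis by simp
qed

lemma Dint_bound: "0 \<le> s \<Longrightarrow> Dint p s z \<le> 2 * K * s"
  using Dint_lipschitz[of s z 0] by auto

lemma Aint_mono: "r \<le> s \<Longrightarrow> Aint p r z \<le> Aint p s z"
  by (rule DERIV_nonneg_imp_nondecreasing[of r s "\<lambda>s. Aint p s z"]) (blast intro: Aint_deriv exp_ge_zero)+

lemma Aint_nonneg: "0 \<le> s \<Longrightarrow> 0 \<le> Aint p s z"
  using Aint_mono[of 0 s z] by simp

lemma amp_denominator: "0 \<le> s \<Longrightarrow> 1 \<le> 1 + R0 * f0 z * Aint p s z"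
  using Aint_nonneg[of s z] R0_pos f0_nonneg[of z] by simp

lemma amp_nonneg: "0 \<le> s \<Longrightarrow> 0 \<le> amp p s z"
  using amp_denominator[of s z] f0_nonneg[of z] unfolding amp_def by (intro divide_nonneg_nonneg) auto

lemma amp_bound: assumes s: "0 \<le> s" shows "amp p s z \<le> F0"
proof -
  have "amp p s z \<le> f0 z / 1"
    unfolding amp_def using amp_denominator[OF s, of z] f0_nonneg[of z] by (intro divide_left_mono) auto
  then show ?thesis using f0_bound[of z] by simp
qed

lemma amp_0 [simp]: "amp p 0 z = f0 z" by (simp add: amp_def)

lemma amp_deriv:
  assumes s: "0 \<le> s"
  shows "((\<lambda>s. amp p s z) has_real_derivative - (R0 * (amp p s z)\<^sup>2 * exp (Dint p s z))) (at s)"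
proof -
  have nz: "1 + R0 * f0 z * Aint p s z \<noteq> 0" using amp_denominator[OF s, of z] by linarith
  have "((\<lambda>s. f0 z / (1 + R0 * f0 z * Aint p s z)) has_real_derivative
      (0 * (1 + R0 * f0 z * Aint p s z) - f0 z * (0 + R0 * f0 z * exp (Dint p s z)))
       / ((1 + R0 * f0 z * Aint p s z) * (1 + R0 * f0 z * Aint p s z))) (at s)"
    by (intro DERIV_divide DERIV_const DERIV_add DERIV_cmult Aint_deriv nz)
  moreover have "(0 * (1 + R0 * f0 z * Aint p s z) - f0 z * (0 + R0 * f0 z * exp (Dint p s z)))
       / ((1 + R0 * f0 z * Aint p s z) * (1 + R0 * f0 z * Aint p s z)) = - (R0 * (amp p s z)\<^sup>2 * exp (Dint p s z))"
    by (simp add: amp_def power2_eq_square)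
  ultimately show ?thesis unfolding amp_def by simp
qed

lemma zeta_translate:
  assumes k: "k = (L, 0) \<or> k = (0, L)"
  shows "zeta p s (z + k) = zeta p s z + k"
  unfolding zeta_def[of p s "z + k"]
proof (rule ode_sol_eqI[OF drift_field, where y = "\<lambda>s. zeta p s z + k", symmetric])
  show "((\<lambda>s. zeta p s z + k) has_vector_derivative drift (p q) (zeta p q z + k)) (at q)" for q
    using has_vector_derivative_add[OF zeta_deriv[of z q] has_vector_derivative_const]
    by (simp add: drift_translate[OF k])
qed simp

lemma X_translate:
  assumes k: "k = (L, 0) \<or> k = (0, L)"
  shows "X p s (z + k) = X p s z + k"
proof -
  have V: "V (x + k) = V x" for x using V_periodic k unfolding periodic2_def by metis
  show ?thesis by (simp add: X_def zeta_translate[OF k] Phi_translate[OF V])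
qed

lemma dvg_translate:
  assumes k: "k = (L, 0) \<or> k = (0, L)"
  shows "dvg (x + k) = dvg x"
proof -
  have g: "g (y + k) = g y" for y using g_periodic k unfolding periodic2_def by metis
  have "((\<lambda>y. y + k) has_derivative (\<lambda>h. h)) (at x)"
    by (auto intro!: derivative_eq_intros)
  from has_derivative_compose[OF this g_deriv] have "(g has_derivative Dg (x + k)) (at x)"
    by (simp add: g)
  with g_deriv have "Dg (x + k) = Dg x" using has_derivative_unique by blast
  then show ?thesis by (simp add: dvg_def)
qed

lemma Dint_translate: "k = (L, 0) \<or> k = (0, L) \<Longrightarrow> Dint p s (z + k) = Dint p s z"
  by (simp add: Dint_def X_translate dvg_translate)

lemma Aint_translate: "k = (L, 0) \<or> k = (0, L) \<Longrightarrow> Aint p s (z + k) = Aint p s z"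
  by (simp add: Aint_def Dint_translate)

lemma amp_translate:
  assumes k: "k = (L, 0) \<or> k = (0, L)" shows "amp p s (z + k) = amp p s z"
proof -
  have "f0 (z + k) = f0 z" using f0_periodic k unfolding periodic2_def by metis
  then show ?thesis by (simp add: amp_def Aint_translate[OF k])
qed

lemma Xinv_X [simp]: "Xinv p s (X p s z) = z"
  by (simp add: Xinv_def X_def zeta_def ode_sol_trans[OF drift_field] ode_sol_init[OF drift_field])

lemma X_Xinv [simp]: "X p s (Xinv p s x) = x"
  by (simp add: Xinv_def X_def zeta_def ode_sol_trans[OF drift_field] ode_sol_init[OF drift_field])

lemma Xinv_translate:
  assumes k: "k = (L, 0) \<or> k = (0, L)" shows "Xinv p s (x + k) = Xinv p s x + k"
proof -
  have "x + k = X p s (Xinv p s x + k)" by (simp add: X_translate[OF k])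
  then show ?thesis by (metis Xinv_X)
qed

lemma sol_X: "sol p s (X p s z) = amp p s z * exp (Dint p s z)"
  by (simp add: sol_def)

lemma sol_0 [simp]: "sol p 0 x = f0 (Phi (- p 0) x)"
  by (simp add: sol_def Xinv_def ode_sol_init[OF drift_field])

lemma sol_periodic: "periodic2 L (sol p s)"
  unfolding periodic2_def sol_def by (simp add: Xinv_translate Dint_translate amp_translate)

lemma sol_nonneg: "0 \<le> s \<Longrightarrow> 0 \<le> sol p s x"
  unfolding sol_def by (intro mult_nonneg_nonneg amp_nonneg) auto

lemma sol_bound:
  assumes s: "0 \<le> s" shows "sol p s x \<le> F0 * exp (2 * K * s)"
  unfolding sol_def using s by (intro mult_mono amp_bound F0_nonneg) (auto intro: Dint_bound)

text \<open>The Riccati equation forgets its initial value: \<open>amp\<close> is at most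
  \<open>1 / (R0 * Aint)\<close>. Over the last unit of time alone \<open>Aint\<close> grows by at
  least \<open>exp (Dint p s z - 2 * K)\<close>, because \<open>Dint\<close> is Lipschitz in time
  with constant \<open>2 * K\<close>; the factor \<open>exp (Dint p s z)\<close> in
  \<open>sol\<close> cancels.\<close>

lemma sol_absorption_bound:
  assumes s: "1 \<le> s" shows "sol p s x \<le> exp (2 * K) / R0"
proof -
  define z where "z = Xinv p s x"
  have "\<exists>q. s - 1 < q \<and> q < s \<and> Aint p s z - Aint p (s - 1) z = (s - (s - 1)) * exp (Dint p q z)"
    by (rule MVT2) (auto intro: Aint_deriv)
  then obtain q where q: "s - 1 < q" "q < s" "Aint p s z - Aint p (s - 1) z = exp (Dint p q z)" by auto
  have "2 * K * \<bar>s - q\<bar> \<le> 2 * K * 1" using q K_pos by (intro mult_left_mono) auto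
  then have "Dint p s z - 2 * K \<le> Dint p q z" using Dint_lipschitz[of s z q] by linarith
  then have "exp (Dint p s z - 2 * K) \<le> Aint p s z"
    using q(3) Aint_nonneg[of "s - 1" z] s by (smt (verit) exp_le_cancel_iff)
  then have A: "exp (Dint p s z) \<le> exp (2 * K) * Aint p s z"
    by (simp add: exp_diff divide_le_eq mult.commute)
  have den: "0 < 1 + R0 * f0 z * Aint p s z" using amp_denominator[of s z] s by linarith
  have "sol p s x = f0 z * exp (Dint p s z) / (1 + R0 * f0 z * Aint p s z)"
    by (simp add: sol_def z_def amp_def)
  also have "\<dots> \<le> exp (2 * K) / R0"
  proof -
    have "f0 z * exp (Dint p s z) * R0 \<le> f0 z * (exp (2 * K) * Aint p s z) * R0"
      using A f0_nonneg[of z] R0_pos by (intro mult_right_mono mult_left_mono) auto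
    also have "\<dots> \<le> exp (2 * K) * (1 + R0 * f0 z * Aint p s z)" by (simp add: algebra_simps)
    finally show ?thesis using den R0_pos by (simp add: divide_le_eq le_divide_eq mult.commute)
  qed
  finally show ?thesis .
qed

text \<open>Splitting: an Euler step of \<open>- g\<close> conjugated by \<open>Phi\<close> at the
  current path value. As \<open>Phi\<close> preserves area, the Jacobian of the step is that of the
  Euler step at the moved point, with first-order term \<open>dvg\<close>; the divergence of
  \<open>drift\<close> need not be computed.\<close>

lemma X_cov:
  assumes t: "0 \<le> t"
  shows "cov (X p t) (\<lambda>z. exp (- Dint p t z))"
proof -
  obtain R where R: "R > 0" "\<And>r. \<bar>r\<bar> \<le> t \<Longrightarrow> \<bar>p r\<bar> \<le> R" using path_bounded by blast
  define n0 where "n0 = nat \<lceil>4 * K * t\<rceil> + 1"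
  have n0: "4 * K * t \<le> real N" if "n0 \<le> N" for N
    using that unfolding n0_def by linarith
  have hK: "t / N * K \<le> 1/4" if "n0 \<le> N" for N
  proof -
    have "real N > 0" using that by (simp add: n0_def)
    then show ?thesis using n0[OF that] by (simp add: field_simps)
  qed
  have ex: "\<exists>j. cov (\<lambda>z. z - (t / N) *\<^sub>R g z) j \<and> (\<forall>z. \<bar>j z - 1 + (t / N) * dvg z\<bar> \<le> 2 * K\<^sup>2 * (t / N)\<^sup>2)"
    if N: "n0 \<le> N" for N :: nat
  proof -
    obtain j where "cov (\<lambda>z. z - (t / N) *\<^sub>R g z) j"
      "\<And>z. \<bar>j z - 1 + (t / N) * (fst (Dg z (1, 0)) + snd (Dg z (0, 1)))\<bar> \<le> 2 * K\<^sup>2 * (t / N)\<^sup>2"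
      by (rule euler_step_cov[where h = "t / N", OF g_deriv Dg_bound Dg_continuous])
         (use t hK[OF N] in \<open>auto simp del: times_divide_eq_left\<close>)
    then show ?thesis unfolding dvg_def by (intro exI[of _ j] conjI allI)
  qed
  then obtain j where j: "\<And>N. n0 \<le> N \<Longrightarrow> cov (\<lambda>z. z - (t / real N) *\<^sub>R g z) (j N)"
    "\<And>N z. n0 \<le> N \<Longrightarrow> \<bar>j N z - 1 + (t / N) * dvg z\<bar> \<le> 2 * K\<^sup>2 * (t / N)\<^sup>2"
    by metis
  define \<tau> where "\<tau> N i = p (real i * (t / real N))" for N i :: nat
  have tau: "\<bar>\<tau> N i\<bar> \<le> R" if "n0 \<le> N" "i < N" for N i
  proof -
    have "real i * (t / real N) \<le> real N * (t / real N)" using that t by (intro mult_right_mono) auto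
    also have "\<dots> = t" using that by simp
    finally show ?thesis unfolding \<tau>_def using t by (intro R(2)) auto
  qed
  \<comment> \<open>The four summands serve in turn for the bound on \<open>dvg\<close>, the
    Jacobian error, the displacement of a step, and the consistency error from the Taylor remainder
    of \<open>Phi\<close>.\<close>
  define c where "c = 2 * K + 2 * K\<^sup>2 + exp (K * R) * K + K * R * exp (3 * K * R) * K\<^sup>2"
  have c: "0 \<le> 2 * K" "0 \<le> 2 * K\<^sup>2" "0 \<le> exp (K * R) * K" "0 \<le> K * R * exp (3 * K * R) * K\<^sup>2"
    using K_pos R by auto
  interpret S: one_step_method "\<lambda>r. drift (p r)" "\<lambda>r z. dvg (Phi (p r) z)" t c
      "\<lambda>N i z. Phi (- \<tau> N i) (Phi (\<tau> N i) z - (t / N) *\<^sub>R g (Phi (\<tau> N i) z))"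
      "\<lambda>N i z. j N (Phi (\<tau> N i) z)" n0
  proof
    show "0 < n0" by (simp add: n0_def)
    show "0 \<le> c" using c unfolding c_def by linarith
    show "continuous_on UNIV (\<lambda>(r, z). dvg (Phi (p r) z))"
      unfolding case_prod_beta by (intro continuous_intros continuous_on_compose2[OF p]) auto
    show "\<bar>dvg (Phi (p r) z)\<bar> \<le> c" for r z using dvg_bound[of "Phi (p r) z"] c unfolding c_def by linarith
    fix N i assume N: "n0 \<le> N" "i < N"
    show "cov (\<lambda>z. Phi (- \<tau> N i) (Phi (\<tau> N i) z - (t / N) *\<^sub>R g (Phi (\<tau> N i) z))) (\<lambda>z. j N (Phi (\<tau> N i) z))"
      using cov_comp[OF cov_comp[OF Phi_cov[of "\<tau> N i"] j(1)[OF N(1)]] Phi_cov[of "- \<tau> N i"]] by simp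
    fix z
    define h where "h = t / N"
    have h: "0 \<le> h" using t by (simp add: h_def)
    let ?y = "Phi (\<tau> N i) z"
    have "norm (Phi (- \<tau> N i) (?y - h *\<^sub>R g ?y) - Phi (- \<tau> N i) ?y - DPhi (- \<tau> N i) ?y (?y - h *\<^sub>R g ?y - ?y))
        \<le> (K * \<bar>- \<tau> N i\<bar> * exp (3 * K * \<bar>- \<tau> N i\<bar>)) * norm (?y - h *\<^sub>R g ?y - ?y) ^ 2"
      by (rule lipschitz_derivative_remainder[OF Phi_has_derivative DPhi_lipschitz]) (use K_pos in auto)
    also have "\<dots> \<le> (K * R * exp (3 * K * R)) * (h * K) ^ 2"
      using tau[OF N] R K_pos h g_bound[of ?y] by (intro mult_mono power_mono) (auto intro!: mult_mono)
    also have "\<dots> \<le> c * h\<^sup>2"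
      using c mult_right_mono[of "K * R * exp (3 * K * R) * K\<^sup>2" c "h\<^sup>2"]
      unfolding c_def by (simp add: power_mult_distrib ac_simps)
    finally have "norm (Phi (- \<tau> N i) (?y - h *\<^sub>R g ?y) - z - h *\<^sub>R drift (\<tau> N i) z) \<le> c * h\<^sup>2"
      by (simp add: drift_def linear_neg[OF DPhi_linear] linear_scale[OF DPhi_linear])
    then show "norm (Phi (- \<tau> N i) (?y - (t / N) *\<^sub>R g ?y) - z - (t / N) *\<^sub>R drift (p (real i * (t / real N))) z) \<le> c * (t / N)\<^sup>2"
      by (simp add: h_def \<tau>_def)
    have "norm (Phi (- \<tau> N i) (?y - h *\<^sub>R g ?y) - Phi (- \<tau> N i) ?y) \<le> norm (?y - h *\<^sub>R g ?y - ?y) * exp (K * \<bar>- \<tau> N i\<bar>)"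
      by (rule Phi_lipschitz)
    also have "\<dots> \<le> (h * K) * exp (K * R)"
      using tau[OF N] K_pos h g_bound[of ?y] by (intro mult_mono) (auto intro!: mult_left_mono)
    also have "\<dots> \<le> c * h"
      using c h mult_right_mono[of "exp (K * R) * K" c h] unfolding c_def by (simp add: ac_simps)
    finally show "norm (Phi (- \<tau> N i) (?y - (t / N) *\<^sub>R g ?y) - z) \<le> c * (t / N)"
      by (simp add: h_def)
    have "2 * K\<^sup>2 * (t / N)\<^sup>2 \<le> c * (t / N)\<^sup>2" using c unfolding c_def by (intro mult_right_mono) auto
    then show "\<bar>j N ?y - 1 + (t / N) * dvg (Phi (p (real i * (t / real N))) z)\<bar> \<le> c * (t / N)\<^sup>2"
      using j(2)[OF N(1), of ?y] by (simp add: \<tau>_def)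
  qed (use t drift_field in auto)
  have "cov (\<lambda>z. zeta p t z) (\<lambda>z. exp (- Dint p t z))"
    using S.cov_ode_sol by (simp add: zeta_def Dint_def X_def)
  from cov_comp[OF this Phi_cov, of "p t"] show ?thesis by (simp add: X_def[abs_def])
qed

lemma X_measurable [measurable]: "X p t \<in> borel_measurable borel"
  by (rule borel_measurable_continuous_onI) (intro continuous_intros)

lemma Dint_measurable [measurable]: "Dint p t \<in> borel_measurable borel"
  by (rule borel_measurable_continuous_onI) (intro continuous_intros)

lemma Aint_measurable [measurable]: "Aint p t \<in> borel_measurable borel"
  by (rule borel_measurable_continuous_onI) (intro continuous_intros)

lemma amp_measurable [measurable]: "amp p t \<in> borel_measurable borel"
  unfolding amp_def[abs_def] by measurable

lemma torus_integral_sol: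
  assumes t: "0 \<le> t" and u: "periodic2 L u" "u \<in> borel_measurable borel" "\<And>x. \<bar>u x\<bar> \<le> C"
  shows "torus_integral L u = torus_integral L (\<lambda>z. u (X p t z) * exp (- Dint p t z))"
proof (rule torus_integral_cov[OF L_pos X_cov[OF t] _ _ _ u])
  show "periodic2 L (\<lambda>z. X p t z - z)" by (simp add: periodic2_def X_translate)
  show "periodic2 L (\<lambda>z. exp (- Dint p t z))" by (simp add: periodic2_def Dint_translate)
  show "exp (- Dint p t z) \<le> exp (2 * K * t)" for z using Dint_lipschitz[of t z 0] t by auto
qed

end

end

section \<open>Measurable dependence on the path\<close>

text \<open>A random continuous path over an arbitrary measurable space. Taking the full event space
  or the one known at time \<open>t\<close> yields joint measurability and adaptedness from the same
  lemmas.\<close>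

definition path_family :: "'b measure \<Rightarrow> ('b \<Rightarrow> real \<Rightarrow> real) \<Rightarrow> bool" where
  "path_family N P \<longleftrightarrow> (\<forall>y\<in>space N. continuous_on UNIV (P y)) \<and> (\<forall>r. (\<lambda>y. P y r) \<in> borel_measurable N)"

text \<open>The time is rounded down to a multiple of \<open>1 / (real n + 1)\<close>; only
  countably many evaluations then occur for each \<open>n\<close>, and path continuity gives the
  limit.\<close>

lemma path_family_measurable2:
  assumes P: "path_family N P"
  shows "(\<lambda>w. P (fst w) (snd w)) \<in> borel_measurable (N \<Otimes>\<^sub>M borel)"
proof (rule borel_measurable_LIMSEQ_metric)
  define a where "a n q = \<lfloor>(real n + 1) * q\<rfloor>" for n q
  fix n
  have [measurable]: "(\<lambda>y. P y r) \<in> borel_measurable N" for r using P by (auto simp: path_family_def)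
  show "(\<lambda>w. P (fst w) (a n (snd w) / (real n + 1))) \<in> borel_measurable (N \<Otimes>\<^sub>M borel)"
  proof (rule measurable_compose_countable[where g = "\<lambda>w. a n (snd w)" and f = "\<lambda>i w. P (fst w) (real_of_int i / (real n + 1))"])
    show "(\<lambda>w. P (fst w) (real_of_int i / (real n + 1))) \<in> borel_measurable (N \<Otimes>\<^sub>M borel)" for i by measurable
    show "(\<lambda>w. a n (snd w)) \<in> measurable (N \<Otimes>\<^sub>M borel) (count_space UNIV)" unfolding a_def by measurable
  qed
  fix w assume "w \<in> space (N \<Otimes>\<^sub>M (borel :: real measure))"
  then have "fst w \<in> space N" by (auto simp: space_pair_measure)
  then have c: "continuous_on UNIV (P (fst w))" using P by (auto simp: path_family_def)
  have "(\<lambda>n. a n (snd w) / (real n + 1)) \<longlonglongrightarrow> snd w"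
  proof (rule LIM_zero_cancel, rule Lim_null_comparison)
    show "(\<lambda>n. 1 / (real n + 1)) \<longlonglongrightarrow> 0"
      using LIMSEQ_inverse_real_of_nat by (simp add: inverse_eq_divide add.commute)
    have "\<bar>a n q / (real n + 1) - q\<bar> \<le> 1 / (real n + 1)" for n q
    proof -
      have "\<bar>a n q - (real n + 1) * q\<bar> \<le> 1" unfolding a_def by linarith
      then have "\<bar>a n q - (real n + 1) * q\<bar> / (real n + 1) \<le> 1 / (real n + 1)" by (intro divide_right_mono) auto
      moreover have "\<bar>a n q / (real n + 1) - q\<bar> = \<bar>a n q - (real n + 1) * q\<bar> / (real n + 1)"
      proof -
        have "real n + 1 > 0" by simp
        then have "a n q / (real n + 1) - q = (a n q - (real n + 1) * q) / (real n + 1)" by (simp add: field_simps)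
        then show ?thesis by (simp add: abs_divide)
      qed
      ultimately show ?thesis by simp
    qed
    then show "\<forall>\<^sub>F n in sequentially. norm (a n (snd w) / (real n + 1) - snd w) \<le> 1 / (real n + 1)"
      by (intro always_eventually allI) simp
  qed
  then show "(\<lambda>n. P (fst w) (a n (snd w) / (real n + 1))) \<longlonglongrightarrow> P (fst w) (snd w)"
    using continuous_on_tendsto_compose[OF c] by auto
qed

lemma path_family_compose:
  assumes P: "path_family N P" and q: "q \<in> borel_measurable N"
  shows "(\<lambda>y. P y (q y)) \<in> borel_measurable N"
proof -
  have "(\<lambda>y. (y, q y)) \<in> measurable N (N \<Otimes>\<^sub>M borel)" using q by measurable
  from measurable_compose[OF this path_family_measurable2[OF P]] show ?thesis by simp
qed

lemma path_family_fst: "path_family N P \<Longrightarrow> path_family (N \<Otimes>\<^sub>M N') (\<lambda>w. P (fst w))"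
  by (auto simp: path_family_def space_pair_measure intro: measurable_compose[OF measurable_fst])

lemma signed_integral_lebesgue:
  fixes F :: "real \<Rightarrow> 'a::euclidean_space"
  assumes F: "continuous_on UNIV F"
  shows "signed_integral s r F = (\<integral>q. (indicator {s..r} q - indicator {r..s} q) *\<^sub>R F q \<partial>lborel)"
proof -
  have i: "set_integrable lborel {a..b} F" for a b
    by (rule borel_integrable_atLeastAtMost') (rule continuous_on_subset[OF F], simp)
  have "integral {a..b} F = (\<integral>q. indicator {a..b} q *\<^sub>R F q \<partial>lborel)" for a b
    using set_borel_integral_eq_integral(2)[OF i[of a b]] by (simp add: set_lebesgue_integral_def)
  then have "signed_integral s r F
      = (\<integral>q. indicator {s..r} q *\<^sub>R F q \<partial>lborel) - (\<integral>q. indicator {r..s} q *\<^sub>R F q \<partial>lborel)"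
    by (simp add: signed_integral_def)
  also have "\<dots> = (\<integral>q. indicator {s..r} q *\<^sub>R F q - indicator {r..s} q *\<^sub>R F q \<partial>lborel)"
    using i by (intro Bochner_Integration.integral_diff[symmetric]) (auto simp: set_integrable_def)
  finally show ?thesis by (simp add: scaleR_diff_left)
qed

lemma signed_integral_measurable:
  fixes F :: "'b \<Rightarrow> real \<Rightarrow> 'a::euclidean_space"
  assumes F: "\<And>y. y \<in> space N \<Longrightarrow> continuous_on UNIV (F y)"
    and [measurable]: "(\<lambda>w. F (fst w) (snd w)) \<in> borel_measurable (N \<Otimes>\<^sub>M borel)"
      "s \<in> borel_measurable N" "r \<in> borel_measurable N"
  shows "(\<lambda>y. signed_integral (s y) (r y) (F y)) \<in> borel_measurable N"
proof -
  have "(\<lambda>y. \<integral>q. (indicator {s y..r y} q - indicator {r y..s y} q) *\<^sub>R F y q \<partial>lborel) \<in> borel_measurable N"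
  proof (rule lborel.borel_measurable_lebesgue_integral)
    have 1: "(\<lambda>w. F (fst w) (snd w)) \<in> borel_measurable (N \<Otimes>\<^sub>M lborel)"
      using assms(2) by (simp cong: measurable_cong_sets)
    have 2: "(\<lambda>w. indicator {f (fst w)..h (fst w)} (snd w) :: real) \<in> borel_measurable (N \<Otimes>\<^sub>M lborel)"
      if [measurable]: "f \<in> borel_measurable N" "h \<in> borel_measurable N" for f h :: "'b \<Rightarrow> real"
      unfolding indicator_def atLeastAtMost_iff by measurable
    show "(\<lambda>(y, q). (indicator {s y..r y} q - indicator {r y..s y} q) *\<^sub>R F y q) \<in> borel_measurable (N \<Otimes>\<^sub>M lborel)"
      unfolding case_prod_beta
      by (intro borel_measurable_scaleR borel_measurable_diff 1 2 assms)
  qed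
  then show ?thesis
    by (subst measurable_cong[OF signed_integral_lebesgue[OF F]]) auto
qed

lemma picard_measurable:
  fixes B :: "'b \<Rightarrow> real \<Rightarrow> 'a::euclidean_space \<Rightarrow> 'a"
  assumes lip: "\<And>y. y \<in> space N \<Longrightarrow> lipschitz_field (B y)"
    and B: "(\<lambda>w. B (fst w) (fst (snd w)) (snd (snd w))) \<in> borel_measurable (N \<Otimes>\<^sub>M (borel \<Otimes>\<^sub>M borel))"
    and s[measurable]: "s \<in> borel_measurable N" and x[measurable]: "x \<in> borel_measurable N"
  shows "(\<lambda>w. picard (B (fst w)) (s (fst w)) (x (fst w)) n (snd w)) \<in> borel_measurable (N \<Otimes>\<^sub>M borel)"
proof (induction n)
  case (Suc n)
  have "(\<lambda>w. signed_integral (s (fst w)) (snd w) (\<lambda>q. B (fst w) q (picard (B (fst w)) (s (fst w)) (x (fst w)) n q)))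
      \<in> borel_measurable (N \<Otimes>\<^sub>M borel)"
  proof (rule signed_integral_measurable)
    fix w assume "w \<in> space (N \<Otimes>\<^sub>M (borel :: real measure))"
    then have "fst w \<in> space N" by (auto simp: space_pair_measure)
    then show "continuous_on UNIV (\<lambda>q. B (fst w) q (picard (B (fst w)) (s (fst w)) (x (fst w)) n q))"
      by (intro picard_integrand_continuous lip)
  next
    have m: "(\<lambda>v. (fst (fst v), snd v)) \<in> measurable ((N \<Otimes>\<^sub>M borel) \<Otimes>\<^sub>M borel) (N \<Otimes>\<^sub>M borel)" by measurable
    have "(\<lambda>v. picard (B (fst (fst v))) (s (fst (fst v))) (x (fst (fst v))) n (snd v))
        \<in> borel_measurable ((N \<Otimes>\<^sub>M (borel :: real measure)) \<Otimes>\<^sub>M borel)"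
      using measurable_compose[OF m Suc] by simp
    then have m2: "(\<lambda>v. (fst (fst v), (snd v, picard (B (fst (fst v))) (s (fst (fst v))) (x (fst (fst v))) n (snd v))))
        \<in> measurable ((N \<Otimes>\<^sub>M (borel :: real measure)) \<Otimes>\<^sub>M borel) (N \<Otimes>\<^sub>M (borel \<Otimes>\<^sub>M borel))"
      by measurable
    show "(\<lambda>v. B (fst (fst v)) (snd v) (picard (B (fst (fst v))) (s (fst (fst v))) (x (fst (fst v))) n (snd v)))
        \<in> borel_measurable ((N \<Otimes>\<^sub>M (borel :: real measure)) \<Otimes>\<^sub>M borel)"
      using measurable_compose[OF m2 B] by simp
  qed measurable
  then show ?case by simp
qed simp

text \<open>The pointwise limit of Picard iterates, each of which is an integral of a jointly
  measurable function.\<close>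

lemma ode_sol_measurable:
  fixes B :: "'b \<Rightarrow> real \<Rightarrow> 'a::euclidean_space \<Rightarrow> 'a"
  assumes lip: "\<And>y. y \<in> space N \<Longrightarrow> lipschitz_field (B y)"
    and B: "(\<lambda>w. B (fst w) (fst (snd w)) (snd (snd w))) \<in> borel_measurable (N \<Otimes>\<^sub>M (borel \<Otimes>\<^sub>M borel))"
    and s: "s \<in> borel_measurable N" and x: "x \<in> borel_measurable N" and r: "r \<in> borel_measurable N"
  shows "(\<lambda>y. ode_sol (B y) (s y) (x y) (r y)) \<in> borel_measurable N"
proof (rule borel_measurable_LIMSEQ_metric)
  have m: "(\<lambda>y. (y, r y)) \<in> measurable N (N \<Otimes>\<^sub>M borel)" using r by measurable
  show "(\<lambda>y. picard (B y) (s y) (x y) n (r y)) \<in> borel_measurable N" for n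
    using measurable_compose[OF m picard_measurable[OF lip B s x]] by simp
  show "(\<lambda>n. picard (B y) (s y) (x y) n (r y)) \<longlonglongrightarrow> ode_sol (B y) (s y) (x y) (r y)" if "y \<in> space N" for y
    by (rule picard_tendsto[OF lip[OF that]])
qed

lemma measurable_continuous2:
  fixes F :: "'a::{second_countable_topology} \<Rightarrow> 'b::second_countable_topology \<Rightarrow> 'c::topological_space"
  assumes F: "continuous_on UNIV (\<lambda>(a, b). F a b)"
    and f: "f \<in> borel_measurable N" and h: "h \<in> borel_measurable N"
  shows "(\<lambda>y. F (f y) (h y)) \<in> borel_measurable N"
proof -
  have 1: "(\<lambda>(a, b). F a b) \<in> borel_measurable borel" by (rule borel_measurable_continuous_onI[OF F])
  have 2: "(\<lambda>y. (f y, h y)) \<in> borel_measurable N"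
    using measurable_Pair[OF f h] by (simp add: borel_prod)
  from measurable_compose[OF 2 1] show ?thesis by simp
qed

section \<open>Measurability of the density in path, time and position\<close>

context transport
begin

lemma Phi_measurable2 [measurable (raw)]:
  "f \<in> borel_measurable N \<Longrightarrow> h \<in> borel_measurable N \<Longrightarrow> (\<lambda>y. Phi (f y) (h y)) \<in> borel_measurable N"
  by (rule measurable_continuous2) (auto simp: case_prod_beta intro!: continuous_intros)

lemma drift_measurable2 [measurable (raw)]:
  "f \<in> borel_measurable N \<Longrightarrow> h \<in> borel_measurable N \<Longrightarrow> (\<lambda>y. drift (f y) (h y)) \<in> borel_measurable N"
  by (rule measurable_continuous2) (auto simp: case_prod_beta intro!: continuous_intros)

lemma dvg_measurable [measurable]: "dvg \<in> borel_measurable borel"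
  by (rule borel_measurable_continuous_onI) (rule dvg_continuous)

lemma drift_ode_measurable:
  assumes P: "path_family N P"
    and s: "s \<in> borel_measurable N" and x: "x \<in> borel_measurable N" and r: "r \<in> borel_measurable N"
  shows "(\<lambda>y. ode_sol (\<lambda>q. drift (P y q)) (s y) (x y) (r y)) \<in> borel_measurable N"
proof (rule ode_sol_measurable[OF _ _ s x r])
  show "lipschitz_field (\<lambda>q. drift (P y q))" if "y \<in> space N" for y
    using that P by (intro drift_field) (auto simp: path_family_def)
  have m: "(\<lambda>w. (fst w, fst (snd w))) \<in> measurable (N \<Otimes>\<^sub>M (borel \<Otimes>\<^sub>M (borel :: (plane) measure))) (N \<Otimes>\<^sub>M (borel :: real measure))"
    by measurable
  have [measurable]: "(\<lambda>w. P (fst w) (fst (snd w))) \<in> borel_measurable (N \<Otimes>\<^sub>M ((borel :: real measure) \<Otimes>\<^sub>M (borel :: (plane) measure)))"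
    using measurable_compose[OF m path_family_measurable2[OF P]] by simp
  show "(\<lambda>w. drift (P (fst w) (fst (snd w))) (snd (snd w))) \<in> borel_measurable (N \<Otimes>\<^sub>M (borel \<Otimes>\<^sub>M borel))"
    by measurable
qed

lemma X_family_measurable:
  assumes P: "path_family N P" and s: "s \<in> borel_measurable N" and z: "z \<in> borel_measurable N"
  shows "(\<lambda>y. X (P y) (s y) (z y)) \<in> borel_measurable N"
  unfolding X_def zeta_def
  by (intro Phi_measurable2 path_family_compose[OF P s] drift_ode_measurable[OF P _ z s]) auto

lemma Dint_family_measurable:
  assumes P: "path_family N P" and s: "s \<in> borel_measurable N" and z[measurable]: "z \<in> borel_measurable N"
  shows "(\<lambda>y. Dint (P y) (s y) (z y)) \<in> borel_measurable N"
  unfolding Dint_def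
proof (rule signed_integral_measurable[OF _ _ _ s])
  show "continuous_on UNIV (\<lambda>q. dvg (X (P y) q (z y)))" if "y \<in> space N" for y
    using that P by (intro dvg_continuous_compose X_continuous_compose continuous_intros) (auto simp: path_family_def)
  have "(\<lambda>w. X (P (fst w)) (snd w) (z (fst w))) \<in> borel_measurable (N \<Otimes>\<^sub>M borel)"
    by (rule X_family_measurable[OF path_family_fst[OF P]]) measurable
  then show "(\<lambda>w. dvg (X (P (fst w)) (snd w) (z (fst w)))) \<in> borel_measurable (N \<Otimes>\<^sub>M borel)"
    by measurable
qed simp

lemma Aint_family_measurable:
  assumes P: "path_family N P" and s: "s \<in> borel_measurable N" and z[measurable]: "z \<in> borel_measurable N"
  shows "(\<lambda>y. Aint (P y) (s y) (z y)) \<in> borel_measurable N"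
  unfolding Aint_def
proof (rule signed_integral_measurable[OF _ _ _ s])
  show "continuous_on UNIV (\<lambda>q. exp (Dint (P y) q (z y)))" if "y \<in> space N" for y
    using that P by (intro continuous_on_exp Dint_continuous_compose continuous_intros) (auto simp: path_family_def)
  have "(\<lambda>w. Dint (P (fst w)) (snd w) (z (fst w))) \<in> borel_measurable (N \<Otimes>\<^sub>M borel)"
    by (rule Dint_family_measurable[OF path_family_fst[OF P]]) measurable
  then show "(\<lambda>w. exp (Dint (P (fst w)) (snd w) (z (fst w)))) \<in> borel_measurable (N \<Otimes>\<^sub>M borel)"
    by measurable
qed simp

lemma sol_family_measurable:
  assumes P: "path_family N P" and s[measurable]: "s \<in> borel_measurable N" and x[measurable]: "x \<in> borel_measurable N"
  shows "(\<lambda>y. sol (P y) (s y) (x y)) \<in> borel_measurable N"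
proof -
  note [measurable] = path_family_compose[OF P s]
  have z[measurable]: "(\<lambda>y. Xinv (P y) (s y) (x y)) \<in> borel_measurable N"
    unfolding Xinv_def by (rule drift_ode_measurable[OF P s]) measurable
  note [measurable] = Dint_family_measurable[OF P s z] Aint_family_measurable[OF P s z]
  show ?thesis unfolding sol_def amp_def by measurable
qed

lemma path_family_const: "continuous_on UNIV p \<Longrightarrow> path_family N (\<lambda>_. p)"
  by (simp add: path_family_def)

lemma sol_measurable [measurable (raw)]:
  assumes p: "continuous_on UNIV p" and s: "s \<in> borel_measurable N" and x: "x \<in> borel_measurable N"
  shows "(\<lambda>y. sol p (s y) (x y)) \<in> borel_measurable N"
  by (rule sol_family_measurable[OF path_family_const[OF p] s x])

text \<open>The density at time \<open>s\<close> sees only the past of the path. This is the source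
  of adaptedness.\<close>

lemma sol_path_cong:
  assumes p: "continuous_on UNIV p" and p': "continuous_on UNIV p'"
    and eq: "\<And>r. r \<in> {0..t} \<Longrightarrow> p r = p' r" and s: "s \<in> {0..t}"
  shows "sol p s x = sol p' s x"
proof -
  have z: "zeta p q z = zeta p' q z" if "q \<in> {0..t}" for q z
  proof (rule ode_unique_on[OF drift_field[OF p], where s = 0])
    fix r assume "r \<in> {min 0 q..max 0 q}"
    then have "p r = p' r" using that by (intro eq) auto
    then show "((\<lambda>q. zeta p' q z) has_vector_derivative drift (p r) (zeta p' r z)) (at r)"
      using zeta_deriv[OF p', of z r] by simp
  qed (simp_all add: zeta_deriv[OF p] zeta_0[OF p] zeta_0[OF p'])
  have X: "X p q z = X p' q z" if "q \<in> {0..t}" for q z using that by (simp add: X_def z eq)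
  have D: "Dint p q z = Dint p' q z" if "q \<in> {0..t}" for q z
    unfolding Dint_def using that by (intro signed_integral_cong) (auto simp: X)
  have A: "Aint p q z = Aint p' q z" if "q \<in> {0..t}" for q z
    unfolding Aint_def using that by (intro signed_integral_cong) (auto simp: D)
  \<comment> \<open>The inverses are not compared through their backward equations: both starting
    points lead to \<open>x\<close> under the same forward map, which is injective.\<close>
  have "X p s (Xinv p s x) = X p s (Xinv p' s x)"
    by (simp add: X[OF s, of "Xinv p' s x"] X_Xinv[OF p] X_Xinv[OF p'])
  then have "Xinv p s x = Xinv p' s x" by (metis Xinv_X[OF p])
  then show ?thesis by (simp add: sol_def amp_def A[OF s] D[OF s])
qed

end

lemma torus_integral_measurable:
  assumes u: "(\<lambda>w. u (fst w) (snd w)) \<in> borel_measurable (N \<Otimes>\<^sub>M borel)"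
  shows "(\<lambda>y. torus_integral L (u y)) \<in> borel_measurable N"
  unfolding torus_integral_def set_lebesgue_integral_def torus_square_def[symmetric]
proof (rule lborel.borel_measurable_lebesgue_integral)
  have 1: "(\<lambda>w. u (fst w) (snd w)) \<in> borel_measurable (N \<Otimes>\<^sub>M lborel)"
    using u by (simp cong: measurable_cong_sets)
  have 2: "(\<lambda>w. indicat_real (torus_square L) (snd w)) \<in> borel_measurable (N \<Otimes>\<^sub>M lborel)"
    by measurable
  show "(\<lambda>(y, x). indicat_real (torus_square L) x *\<^sub>R u y x) \<in> borel_measurable (N \<Otimes>\<^sub>M lborel)"
    unfolding case_prod_beta by (intro borel_measurable_scaleR 1 2)
qed

section \<open>Weak form of the equation along a path\<close>

lemma torus_integral_continuous:
  fixes k :: "real \<Rightarrow> plane \<Rightarrow> real"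
  assumes cont: "\<And>z. continuous_on {0..} (\<lambda>s. k s z)" and meas: "\<And>s. 0 \<le> s \<Longrightarrow> k s \<in> borel_measurable borel"
    and bd: "\<And>T s z. 0 \<le> s \<Longrightarrow> s \<le> T \<Longrightarrow> \<bar>k s z\<bar> \<le> C T"
  shows "continuous_on {0..} (\<lambda>s. torus_integral L (k s))"
proof (rule continuous_on_sequentiallyI)
  fix a :: "nat \<Rightarrow> real" and s assume a: "\<forall>n. a n \<in> {0..}" and s: "s \<in> {0..}" and lim: "a \<longlonglongrightarrow> s"
  have "Bseq a" using lim by (intro convergent_imp_Bseq) (auto simp: convergent_def)
  then obtain T where T: "\<And>n. \<bar>a n\<bar> \<le> T" unfolding Bseq_def by auto
  have aT: "0 \<le> a n" "a n \<le> T" for n using a T[of n] by auto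
  have sT: "s \<le> T" by (rule LIMSEQ_le_const2[OF lim]) (use aT in auto)
  interpret finite_measure "torus_measure L" by (rule finite_torus_measure)
  show "(\<lambda>n. torus_integral L (k (a n))) \<longlonglongrightarrow> torus_integral L (k s)"
    unfolding torus_integral_eq
  proof (rule integral_dominated_convergence[where w = "\<lambda>_. C T"])
    show "AE z in torus_measure L. (\<lambda>n. k (a n) z) \<longlonglongrightarrow> k s z"
      using a s by (intro AE_I2 continuous_on_tendsto_compose[OF cont lim]) auto
    show "AE z in torus_measure L. norm (k (a n) z) \<le> C T" for n using bd[OF aT] by auto
  qed (use s aT meas in \<open>auto intro!: measurable_restrict_space1\<close>)
qed

lemma set_integral_fubini:
  fixes k :: "real \<Rightarrow> 'b \<Rightarrow> real"
  assumes N: "finite_measure N" and meas: "(\<lambda>w. k (fst w) (snd w)) \<in> borel_measurable (borel \<Otimes>\<^sub>M N)"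
    and bd: "\<And>s z. s \<in> {u..v} \<Longrightarrow> z \<in> space N \<Longrightarrow> \<bar>k s z\<bar> \<le> C"
  shows "(LINT s:{u..v}|lborel. (\<integral>z. k s z \<partial>N)) = (\<integral>z. (LINT s:{u..v}|lborel. k s z) \<partial>N)"
proof -
  let ?M = "restrict_space lborel {u..v}"
  have r: "(LINT s:{u..v}|lborel. h s) = (\<integral>s. h s \<partial>?M)" for h :: "real \<Rightarrow> real"
    unfolding set_lebesgue_integral_def by (subst integral_restrict_space) auto
  interpret M: finite_measure ?M
  proof
    have "emeasure lborel {u..v} < \<infinity>" by (rule emeasure_bounded_finite) simp
    then show "emeasure ?M (space ?M) \<noteq> \<infinity>" by (simp add: emeasure_restrict_space space_restrict_space)
  qed
  interpret N: finite_measure N by (rule N)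
  interpret P: pair_sigma_finite ?M N
    by (rule pair_sigma_finite.intro) (rule M.sigma_finite_measure_axioms N.sigma_finite_measure_axioms)+
  interpret MN: finite_measure "?M \<Otimes>\<^sub>M N"
    by (rule finite_measure_pair_measure) (rule M.finite_measure_axioms N.finite_measure_axioms)+
  have id: "(\<lambda>w. (fst w, snd w)) \<in> measurable (?M \<Otimes>\<^sub>M N) (borel \<Otimes>\<^sub>M N)"
  proof (rule measurable_Pair[OF _ measurable_snd])
    show "fst \<in> borel_measurable (?M \<Otimes>\<^sub>M N)"
      by (rule measurable_compose[OF measurable_fst, where g = "\<lambda>x. x"], rule measurable_restrict_space1) simp
  qed
  have int: "integrable (?M \<Otimes>\<^sub>M N) (\<lambda>(s, z). k s z)"
  proof (rule MN.integrable_const_bound[where B = C])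
    show "AE w in ?M \<Otimes>\<^sub>M N. norm (case w of (s, z) \<Rightarrow> k s z) \<le> C"
      using bd by (intro AE_I2) (auto simp: space_pair_measure space_restrict_space)
    show "(\<lambda>(s, z). k s z) \<in> borel_measurable (?M \<Otimes>\<^sub>M N)"
      using measurable_compose[OF id meas] by (simp add: case_prod_beta)
  qed
  show ?thesis unfolding r using P.Fubini_integral[OF int] by simp
qed

lemma torus_fubini:
  fixes k :: "real \<Rightarrow> plane \<Rightarrow> real"
  assumes meas[measurable]: "(\<lambda>w. k (fst w) (snd w)) \<in> borel_measurable (borel \<Otimes>\<^sub>M borel)"
    and bd: "\<And>s z. s \<in> {u..v} \<Longrightarrow> \<bar>k s z\<bar> \<le> C"
  shows "(LINT s:{u..v}|lborel. torus_integral L (k s)) = torus_integral L (\<lambda>z. LINT s:{u..v}|lborel. k s z)"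
proof -
  have "(\<lambda>w. (fst w, snd w)) \<in> measurable (borel \<Otimes>\<^sub>M torus_measure L) (borel \<Otimes>\<^sub>M borel)"
  proof (rule measurable_Pair[OF measurable_fst])
    show "snd \<in> borel_measurable (borel \<Otimes>\<^sub>M torus_measure L)"
      by (rule measurable_compose[OF measurable_snd, where g = "\<lambda>x. x"], rule measurable_restrict_space1) simp
  qed
  from measurable_compose[OF this meas] show ?thesis
    unfolding torus_integral_eq by (intro set_integral_fubini[OF finite_torus_measure _ bd]) simp_all
qed

section \<open>Means against test functions and their drift\<close>

context transport
begin

definition mean :: "(real \<Rightarrow> real) \<Rightarrow> (plane \<Rightarrow> real) \<Rightarrow> real \<Rightarrow> real" where
  "mean p \<kappa> s = torus_integral L (\<lambda>x. sol p s x * \<kappa> x)"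

definition mean2 :: "(real \<Rightarrow> real) \<Rightarrow> (plane \<Rightarrow> real) \<Rightarrow> real \<Rightarrow> real" where
  "mean2 p \<kappa> s = torus_integral L (\<lambda>x. (sol p s x)\<^sup>2 * \<kappa> x)"

text \<open>Bounded with Lipschitz derivative, one constant for everything. Smoothness would be too
  much: the derivative of a smooth function along \<open>V\<close> is only as regular as
  \<open>V\<close>.\<close>

definition test_function ::
  "(plane \<Rightarrow> real) \<Rightarrow> (plane \<Rightarrow> plane \<Rightarrow> real) \<Rightarrow> real \<Rightarrow> bool" where
  "test_function \<psi> D\<psi> C \<longleftrightarrow> 0 < C \<and> periodic2 L \<psi> \<and> (\<forall>x. (\<psi> has_derivative D\<psi> x) (at x)) \<and>
     (\<forall>x. \<bar>\<psi> x\<bar> \<le> C) \<and> (\<forall>x v. \<bar>D\<psi> x v\<bar> \<le> C * norm v) \<and>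
     (\<forall>x y v. \<bar>D\<psi> x v - D\<psi> y v\<bar> \<le> C * norm (x - y) * norm v)"

text \<open>The contribution of drift and absorption to the rate of change of
  \<open>mean p \<psi>\<close>, without that of the noise.\<close>

definition gen ::
  "(plane \<Rightarrow> real) \<Rightarrow> (plane \<Rightarrow> plane \<Rightarrow> real) \<Rightarrow> (real \<Rightarrow> real) \<Rightarrow> real \<Rightarrow> real" where
  "gen \<psi> D\<psi> p s = - mean p (\<lambda>x. D\<psi> x (g x)) s - R0 * mean2 p \<psi> s"

text \<open>Up to constants, a common bound for how far \<open>Phi d\<close> and
  \<open>DPhi d\<close> are from the identity; the exponential stems from the growth of
  \<open>DPhi\<close>.\<close>

definition eta :: "real \<Rightarrow> real" where "eta d = \<bar>d\<bar> * exp (K * \<bar>d\<bar>)"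

lemma eta_continuous_compose [continuous_intros]:
  "continuous_on S f \<Longrightarrow> continuous_on S (\<lambda>q. eta (f q))"
  unfolding eta_def by (intro continuous_intros)

lemma eta_nonneg: "0 \<le> eta d" by (simp add: eta_def)

definition drift_const :: "real \<Rightarrow> real \<Rightarrow> real" where
  "drift_const C T = F0 * (2 * C * K\<^sup>2) + R0 * F0\<^sup>2 * exp (2 * K * T) * (C * K)"

lemma drift_const_nonneg: "0 < C \<Longrightarrow> 0 \<le> drift_const C T"
  unfolding drift_const_def using F0_nonneg R0_pos K_pos by simp

context
  fixes p :: "real \<Rightarrow> real"
  assumes p: "continuous_on UNIV p"
begin

lemma amp_square_bound: assumes "0 \<le> s" "s \<le> T" shows "(amp p s z)\<^sup>2 * exp (Dint p s z) \<le> F0\<^sup>2 * exp (2 * K * T)"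
proof (intro mult_mono power_mono)
  have "2 * K * s \<le> 2 * K * T" using assms K_pos by (intro mult_left_mono) auto
  then show "exp (Dint p s z) \<le> exp (2 * K * T)" using Dint_bound[OF p assms(1), of z] by simp
qed (use amp_bound[OF p assms(1)] amp_nonneg[OF p assms(1)] in auto)

text \<open>Lagrangian form: the Jacobian \<open>exp (- Dint)\<close> of the characteristics cancels
  the factor \<open>exp Dint\<close> of the density.\<close>

lemma mean_eq:
  assumes s: "0 \<le> s" and \<kappa>: "periodic2 L \<kappa>" "\<kappa> \<in> borel_measurable borel" "\<And>x. \<bar>\<kappa> x\<bar> \<le> C"
  shows "mean p \<kappa> s = torus_integral L (\<lambda>z. amp p s z * \<kappa> (X p s z))"
proof -
  note [measurable] = \<kappa>(2) sol_measurable[OF p measurable_const measurable_ident_sets[OF refl]]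
  have "mean p \<kappa> s = torus_integral L (\<lambda>z. (sol p s (X p s z) * \<kappa> (X p s z)) * exp (- Dint p s z))"
    unfolding mean_def
  proof (rule torus_integral_sol[OF p s])
    show "periodic2 L (\<lambda>x. sol p s x * \<kappa> x)" using \<kappa>(1) sol_periodic[OF p] unfolding periodic2_def by metis
    show "\<bar>sol p s x * \<kappa> x\<bar> \<le> F0 * exp (2 * K * s) * C" for x
      unfolding abs_mult using sol_nonneg[OF p s] sol_bound[OF p s] \<kappa>(3) F0_nonneg by (intro mult_mono) auto
    show "(\<lambda>x. sol p s x * \<kappa> x) \<in> borel_measurable borel" by measurable
  qed
  then show ?thesis by (simp add: sol_X[OF p] exp_minus field_simps)
qed

lemma mean2_eq:
  assumes s: "0 \<le> s" and \<kappa>: "periodic2 L \<kappa>" "\<kappa> \<in> borel_measurable borel" "\<And>x. \<bar>\<kappa> x\<bar> \<le> C"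
  shows "mean2 p \<kappa> s = torus_integral L (\<lambda>z. (amp p s z)\<^sup>2 * exp (Dint p s z) * \<kappa> (X p s z))"
proof -
  note [measurable] = \<kappa>(2) sol_measurable[OF p measurable_const measurable_ident_sets[OF refl]]
  have "mean2 p \<kappa> s = torus_integral L (\<lambda>z. ((sol p s (X p s z))\<^sup>2 * \<kappa> (X p s z)) * exp (- Dint p s z))"
    unfolding mean2_def
  proof (rule torus_integral_sol[OF p s])
    show "periodic2 L (\<lambda>x. (sol p s x)\<^sup>2 * \<kappa> x)" using \<kappa>(1) sol_periodic[OF p] unfolding periodic2_def by metis
    show "\<bar>(sol p s x)\<^sup>2 * \<kappa> x\<bar> \<le> (F0 * exp (2 * K * s))\<^sup>2 * C" for x
      unfolding abs_mult using sol_nonneg[OF p s] sol_bound[OF p s] \<kappa>(3) F0_nonneg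
      by (intro mult_mono) (auto intro!: power_mono)
    show "(\<lambda>x. (sol p s x)\<^sup>2 * \<kappa> x) \<in> borel_measurable borel" by measurable
  qed
  then show ?thesis by (simp add: sol_X[OF p] exp_minus power2_eq_square field_simps)
qed

lemma mean_bound:
  assumes s: "0 \<le> s" and \<kappa>: "periodic2 L \<kappa>" "\<kappa> \<in> borel_measurable borel" "\<And>x. \<bar>\<kappa> x\<bar> \<le> C"
  shows "\<bar>mean p \<kappa> s\<bar> \<le> F0 * C * L\<^sup>2"
proof -
  note [measurable] = \<kappa>(2) amp_measurable[OF p] X_measurable[OF p]
  show ?thesis unfolding mean_eq[OF s \<kappa>]
  proof (rule torus_integral_bound[OF L_pos])
    show "\<bar>amp p s z * \<kappa> (X p s z)\<bar> \<le> F0 * C" for z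
      unfolding abs_mult using amp_nonneg[OF p s] amp_bound[OF p s] \<kappa>(3) F0_nonneg by (intro mult_mono) auto
  qed measurable
qed

lemma mean_diff:
  assumes s: "0 \<le> s" and \<kappa>: "periodic2 L \<kappa>" "\<kappa> \<in> borel_measurable borel" "\<And>x. \<bar>\<kappa> x\<bar> \<le> C"
    and \<mu>: "periodic2 L \<mu>" "\<mu> \<in> borel_measurable borel" "\<And>x. \<bar>\<mu> x\<bar> \<le> C'"
  shows "mean p (\<lambda>x. a * \<kappa> x + b * \<mu> x) s = a * mean p \<kappa> s + b * mean p \<mu> s"
proof -
  note [measurable] = \<kappa>(2) \<mu>(2) sol_measurable[OF p measurable_const measurable_ident_sets[OF refl]]
  have i: "integrable (torus_measure L) (\<lambda>x. sol p s x * \<nu> x)"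
    if [measurable]: "\<nu> \<in> borel_measurable borel" and "\<And>x. \<bar>\<nu> x\<bar> \<le> B" for \<nu> B
  proof (rule torus_integrable)
    show "\<bar>sol p s x * \<nu> x\<bar> \<le> F0 * exp (2 * K * s) * B" for x
      unfolding abs_mult using sol_nonneg[OF p s] sol_bound[OF p s] that(2) F0_nonneg by (intro mult_mono) auto
  qed measurable
  have "mean p (\<lambda>x. a * \<kappa> x + b * \<mu> x) s
      = (\<integral>x. a * (sol p s x * \<kappa> x) + b * (sol p s x * \<mu> x) \<partial>torus_measure L)"
    unfolding mean_def torus_integral_eq by (intro Bochner_Integration.integral_cong) (auto simp: algebra_simps)
  also have "\<dots> = a * mean p \<kappa> s + b * mean p \<mu> s"
    unfolding mean_def torus_integral_eq using i[OF \<kappa>(2,3)] i[OF \<mu>(2,3)] by simp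
  finally show ?thesis .
qed

lemma amp_continuous: "continuous_on {0..} (\<lambda>s. amp p s z)"
  by (intro continuous_at_imp_continuous_on ballI DERIV_isCont) (auto intro: amp_deriv[OF p])

lemma mean_continuous:
  assumes \<kappa>: "periodic2 L \<kappa>" "continuous_on UNIV \<kappa>" "\<And>x. \<bar>\<kappa> x\<bar> \<le> C"
  shows "continuous_on {0..} (mean p \<kappa>)"
proof -
  note m = borel_measurable_continuous_onI[OF \<kappa>(2)]
  note [measurable] = m amp_measurable[OF p] X_measurable[OF p]
  have "continuous_on {0..} (\<lambda>s. torus_integral L (\<lambda>z. amp p s z * \<kappa> (X p s z)))"
  proof (rule torus_integral_continuous[where C = "\<lambda>_. F0 * C"])
    show "continuous_on {0..} (\<lambda>s. amp p s z * \<kappa> (X p s z))" for z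
      by (intro continuous_intros amp_continuous continuous_on_compose2[OF \<kappa>(2)] X_continuous_compose[OF p]) auto
    show "\<bar>amp p s z * \<kappa> (X p s z)\<bar> \<le> F0 * C" if "0 \<le> s" for s z
      unfolding abs_mult using amp_nonneg[OF p that] amp_bound[OF p that] \<kappa>(3) F0_nonneg by (intro mult_mono) auto
  qed measurable
  then show ?thesis by (rule continuous_on_eq) (simp add: mean_eq[OF _ \<kappa>(1) m \<kappa>(3)])
qed

lemma mean2_continuous:
  assumes \<kappa>: "periodic2 L \<kappa>" "continuous_on UNIV \<kappa>" "\<And>x. \<bar>\<kappa> x\<bar> \<le> C"
  shows "continuous_on {0..} (mean2 p \<kappa>)"
proof -
  note m = borel_measurable_continuous_onI[OF \<kappa>(2)]
  note [measurable] = m amp_measurable[OF p] X_measurable[OF p] Dint_measurable[OF p]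
  have "continuous_on {0..} (\<lambda>s. torus_integral L (\<lambda>z. (amp p s z)\<^sup>2 * exp (Dint p s z) * \<kappa> (X p s z)))"
  proof (rule torus_integral_continuous[where C = "\<lambda>T. F0\<^sup>2 * exp (2 * K * T) * C"])
    show "continuous_on {0..} (\<lambda>s. (amp p s z)\<^sup>2 * exp (Dint p s z) * \<kappa> (X p s z))" for z
      by (intro continuous_intros amp_continuous continuous_on_compose2[OF \<kappa>(2)] X_continuous_compose[OF p] Dint_continuous_compose[OF p]) auto
    show "\<bar>(amp p s z)\<^sup>2 * exp (Dint p s z) * \<kappa> (X p s z)\<bar> \<le> F0\<^sup>2 * exp (2 * K * T) * C" if "0 \<le> s" "s \<le> T" for s T z
      using amp_square_bound[OF that, of z] \<kappa>(3)[of "X p s z"] F0_nonneg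
      unfolding abs_mult[of _ "\<kappa> (X p s z)"] by (intro mult_mono) auto
  qed measurable
  then show ?thesis by (rule continuous_on_eq) (simp add: mean2_eq[OF _ \<kappa>(1) m \<kappa>(3)])
qed

context
  fixes \<psi> D\<psi> C
  assumes \<psi>: "test_function \<psi> D\<psi> C"
begin

lemma test_C: "0 < C" and test_periodic: "periodic2 L \<psi>" and test_deriv: "(\<psi> has_derivative D\<psi> x) (at x)"
  and test_bound: "\<bar>\<psi> x\<bar> \<le> C" and test_deriv_bound: "\<bar>D\<psi> x v\<bar> \<le> C * norm v"
  and test_deriv_lipschitz: "\<bar>D\<psi> x v - D\<psi> y v\<bar> \<le> C * norm (x - y) * norm v"
  using \<psi> unfolding test_function_def by blast+

lemma test_continuous: "continuous_on S \<psi>"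
  by (rule has_derivative_continuous_on[OF has_derivative_at_withinI[OF test_deriv]])

lemma test_lipschitz: "\<bar>\<psi> x - \<psi> y\<bar> \<le> C * norm (x - y)"
proof -
  have "norm (\<psi> x - \<psi> y) \<le> C * norm (x - y)"
  proof (rule differentiable_bound[where S = UNIV and f' = D\<psi>])
    show "onorm (D\<psi> x) \<le> C" for x by (rule onorm_le) (simp add: test_deriv_bound)
  qed (auto intro: test_deriv has_derivative_at_withinI)
  then show ?thesis by simp
qed

lemma test_deriv_continuous:
  assumes f: "continuous_on S f" and h: "continuous_on S h"
  shows "continuous_on S (\<lambda>q. D\<psi> (f q) (h q))"
  unfolding continuous_on_def
proof
  fix q assume q: "q \<in> S"
  have lim: "(f \<longlongrightarrow> f q) (at q within S)" "(h \<longlongrightarrow> h q) (at q within S)"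
    using f h q by (auto simp: continuous_on_def)
  have a: "((\<lambda>r. C * norm (f r - f q) * norm (h q) + C * norm (h r - h q)) \<longlongrightarrow>
      C * norm (f q - f q) * norm (h q) + C * norm (h q - h q)) (at q within S)"
    by (intro tendsto_intros lim)
  have b: "norm (D\<psi> (f r) (h r) - D\<psi> (f q) (h q)) \<le> C * norm (f r - f q) * norm (h q) + C * norm (h r - h q)" for r
  proof -
    have "D\<psi> (f r) (h r) - D\<psi> (f r) (h q) = D\<psi> (f r) (h r - h q)"
      by (simp add: linear_diff[OF has_derivative_linear[OF test_deriv]])
    then show ?thesis
      using test_deriv_lipschitz[of "f r" "h q" "f q"] test_deriv_bound[of "f r" "h r - h q"] by (simp only: real_norm_def)
  qed
  have "((\<lambda>r. D\<psi> (f r) (h r) - D\<psi> (f q) (h q)) \<longlongrightarrow> 0) (at q within S)"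
    by (rule Lim_null_comparison[OF always_eventually[OF allI[OF b]]]) (use a in simp)
  then show "((\<lambda>r. D\<psi> (f r) (h r)) \<longlongrightarrow> D\<psi> (f q) (h q)) (at q within S)" by (simp add: LIM_zero_iff)
qed

lemma test_g_continuous: "continuous_on S (\<lambda>x. D\<psi> x (g x))"
  by (rule test_deriv_continuous[OF continuous_on_id g_continuous])

lemma test_g_bound: "\<bar>D\<psi> x (g x)\<bar> \<le> C * K"
  by (rule order_trans[OF test_deriv_bound mult_left_mono[OF g_bound less_imp_le[OF test_C]]])

lemma test_g_periodic: "periodic2 L (\<lambda>x. D\<psi> x (g x))"
proof -
  have "D\<psi> (x + k) (g (x + k)) = D\<psi> x (g x)" if k: "k = (L, 0) \<or> k = (0, L)" for x k
  proof -
    have g: "g (y + k) = g y" and p: "\<psi> (y + k) = \<psi> y" for y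
      using g_periodic test_periodic k unfolding periodic2_def by metis+
    have "((\<lambda>y. y + k) has_derivative (\<lambda>h. h)) (at x)"
      by (auto intro!: derivative_eq_intros)
    from has_derivative_compose[OF this test_deriv] have "(\<psi> has_derivative D\<psi> (x + k)) (at x)"
      by (simp add: p)
    with test_deriv have "D\<psi> (x + k) = D\<psi> x" using has_derivative_unique by blast
    then show ?thesis by (simp add: g)
  qed
  then show ?thesis by (simp add: periodic2_def)
qed

lemma gen_continuous: "continuous_on {0..} (gen \<psi> D\<psi> p)"
  unfolding gen_def
  by (intro continuous_intros mean_continuous[OF test_g_periodic test_g_continuous test_g_bound]
      mean2_continuous[OF test_periodic test_continuous test_bound])

text \<open>What the time derivative of \<open>\<psi> (X p s z) * amp p s z\<close> would be if the
  path were at rest; its torus integral is \<open>gen\<close>.\<close>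

definition "weak_integrand s z = - (D\<psi> (X p s z) (g (X p s z)) * amp p s z)
  - \<psi> (X p s z) * (R0 * (amp p s z)\<^sup>2 * exp (Dint p s z))"

lemma weak_integrand_bound:
  assumes "0 \<le> s" "s \<le> T"
  shows "\<bar>weak_integrand s z\<bar> \<le> C * K * F0 + C * (R0 * (F0\<^sup>2 * exp (2 * K * T)))"
proof -
  have 1: "\<bar>D\<psi> (X p s z) (g (X p s z)) * amp p s z\<bar> \<le> C * K * F0"
    unfolding abs_mult using test_g_bound[of "X p s z"] amp_nonneg[OF p assms(1), of z] amp_bound[OF p assms(1), of z] test_C K_pos
    by (intro mult_mono) auto
  have "\<bar>\<psi> (X p s z) * (R0 * ((amp p s z)\<^sup>2 * exp (Dint p s z)))\<bar> \<le> C * (R0 * (F0\<^sup>2 * exp (2 * K * T)))"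
    unfolding abs_mult[of "\<psi> (X p s z)"] using test_bound[of "X p s z"] amp_square_bound[OF assms, of z] R0_pos test_C
    by (intro mult_mono) (auto simp: abs_mult)
  then show ?thesis using 1 unfolding weak_integrand_def by (simp add: mult.assoc)
qed

lemma weak_integrand_measurable: "(\<lambda>w. weak_integrand (fst w) (snd w)) \<in> borel_measurable (borel \<Otimes>\<^sub>M borel)"
proof -
  note c = continuous_on_fst[OF continuous_on_id] continuous_on_snd[OF continuous_on_id]
  note X = X_continuous_compose[OF p c]
  have [measurable]: "(\<lambda>w. X p (fst w) (snd w)) \<in> borel_measurable (borel \<Otimes>\<^sub>M borel)"
    unfolding borel_prod by (rule borel_measurable_continuous_onI[OF X])
  have [measurable]: "(\<lambda>w. Dint p (fst w) (snd w)) \<in> borel_measurable (borel \<Otimes>\<^sub>M borel)"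
    unfolding borel_prod by (rule borel_measurable_continuous_onI[OF Dint_continuous_compose[OF p c]])
  have [measurable]: "(\<lambda>w. Aint p (fst w) (snd w)) \<in> borel_measurable (borel \<Otimes>\<^sub>M borel)"
    unfolding borel_prod by (rule borel_measurable_continuous_onI[OF Aint_continuous_compose[OF p c]])
  have [measurable]: "(\<lambda>w. D\<psi> (X p (fst w) (snd w)) (g (X p (fst w) (snd w)))) \<in> borel_measurable (borel \<Otimes>\<^sub>M borel)"
    unfolding borel_prod by (rule borel_measurable_continuous_onI[OF test_deriv_continuous[OF X g_continuous_compose[OF X]]])
  have [measurable]: "(\<lambda>w. \<psi> (X p (fst w) (snd w))) \<in> borel_measurable (borel \<Otimes>\<^sub>M borel)"
    unfolding borel_prod by (rule borel_measurable_continuous_onI[OF continuous_on_compose2[OF test_continuous X]]) auto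
  show ?thesis unfolding weak_integrand_def amp_def by measurable
qed

lemma gen_eq:
  assumes s: "0 \<le> s"
  shows "gen \<psi> D\<psi> p s = torus_integral L (weak_integrand s)"
proof -
  note mg = borel_measurable_continuous_onI[OF test_g_continuous] and mt = borel_measurable_continuous_onI[OF test_continuous]
  note [measurable] = mg mt amp_measurable[OF p] X_measurable[OF p] Dint_measurable[OF p]
  have i1: "integrable (torus_measure L) (\<lambda>z. amp p s z * D\<psi> (X p s z) (g (X p s z)))"
  proof (rule torus_integrable)
    show "(\<lambda>z. amp p s z * D\<psi> (X p s z) (g (X p s z))) \<in> borel_measurable borel"
      using measurable_compose[OF X_measurable[OF p] mg] by measurable
    show "\<bar>amp p s z * D\<psi> (X p s z) (g (X p s z))\<bar> \<le> F0 * (C * K)" for z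
      unfolding abs_mult using test_g_bound[of "X p s z"] amp_nonneg[OF p s, of z] amp_bound[OF p s, of z] F0_nonneg
      by (intro mult_mono) auto
  qed
  have i2: "integrable (torus_measure L) (\<lambda>z. (amp p s z)\<^sup>2 * exp (Dint p s z) * \<psi> (X p s z))"
  proof (rule torus_integrable)
    show "\<bar>(amp p s z)\<^sup>2 * exp (Dint p s z) * \<psi> (X p s z)\<bar> \<le> F0\<^sup>2 * exp (2 * K * s) * C" for z
      unfolding abs_mult[of _ "\<psi> (X p s z)"] using amp_square_bound[OF s order_refl, of z] test_bound[of "X p s z"] F0_nonneg
      by (intro mult_mono) auto
  qed measurable
  have "gen \<psi> D\<psi> p s = - torus_integral L (\<lambda>z. amp p s z * D\<psi> (X p s z) (g (X p s z)))
      - R0 * torus_integral L (\<lambda>z. (amp p s z)\<^sup>2 * exp (Dint p s z) * \<psi> (X p s z))"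
    unfolding gen_def mean_eq[OF s test_g_periodic mg test_g_bound] mean2_eq[OF s test_periodic mt test_bound] ..
  also have "\<dots> = (\<integral>z. - (amp p s z * D\<psi> (X p s z) (g (X p s z)))
      - R0 * ((amp p s z)\<^sup>2 * exp (Dint p s z) * \<psi> (X p s z)) \<partial>torus_measure L)"
    unfolding torus_integral_eq using i1 i2 by simp
  also have "\<dots> = torus_integral L (weak_integrand s)"
    unfolding torus_integral_eq weak_integrand_def
    by (intro Bochner_Integration.integral_cong) (auto simp: algebra_simps)
  finally show ?thesis .
qed

lemma gen_bound:
  assumes "0 \<le> s" "s \<le> T"
  shows "\<bar>gen \<psi> D\<psi> p s\<bar> \<le> (C * K * F0 + C * (R0 * (F0\<^sup>2 * exp (2 * K * T)))) * L\<^sup>2"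
proof -
  have "(\<lambda>z. (s, z)) \<in> measurable borel (borel \<Otimes>\<^sub>M borel)" by measurable
  from measurable_compose[OF this weak_integrand_measurable]
  have "weak_integrand s \<in> borel_measurable borel" by simp
  then show ?thesis unfolding gen_eq[OF assms(1)]
    by (intro torus_integral_bound L_pos weak_integrand_bound assms)
qed

text \<open>The curve \<open>X\<close> is not differentiable for a merely continuous path, but
  \<open>zeta\<close> is. Freezing the outer flow at the final value \<open>p v\<close> gives a
  differentiable function whose end values are the first two terms here, and whose derivative
  differs from \<open>weak_integrand\<close> by a multiple of
  \<open>eta (p v - p s)\<close>.\<close>

lemma pointwise_drift_estimate:
  assumes uv: "0 \<le> u" "u \<le> v" "v \<le> T"
  shows "\<bar>\<psi> (X p v z) * amp p v z - \<psi> (Phi (p v - p u) (X p u z)) * amp p u z - (LINT s:{u..v}|lborel. weak_integrand s z)\<bar>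
    \<le> drift_const C T * (LINT s:{u..v}|lborel. eta (p v - p s))"
proof -
  \<comment> \<open>At \<open>s = v\<close> this is the true value at \<open>X p v z\<close>; at
    \<open>s = u\<close> it is the value after moving \<open>X p u z\<close> by the noise increment
    alone.\<close>
  define h where "h s = \<psi> (Phi (p v) (zeta p s z)) * amp p s z" for s
  define h' where "h' s = - (D\<psi> (Phi (p v - p s) (X p s z)) (DPhi (p v - p s) (X p s z) (g (X p s z))) * amp p s z)
    - \<psi> (Phi (p v - p s) (X p s z)) * (R0 * (amp p s z)\<^sup>2 * exp (Dint p s z))" for s
  have Phi_z: "Phi (p v) (zeta p s z) = Phi (p v - p s) (X p s z)" for s
    by (simp add: X_def flip: Phi_add)
  have hder: "(h has_vector_derivative h' s) (at s)" if s: "0 \<le> s" for s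
  proof -
    have "((\<lambda>s. Phi (p v) (zeta p s z)) has_vector_derivative DPhi (p v) (zeta p s z) (drift (p s) (zeta p s z))) (at s)"
      using vector_derivative_diff_chain_within[OF zeta_deriv[OF p, of z s], of "Phi (p v)" "DPhi (p v) (zeta p s z)"]
        has_derivative_at_withinI[OF Phi_has_derivative] by (simp add: o_def)
    moreover have "DPhi (p v) (zeta p s z) (drift (p s) (zeta p s z)) = - DPhi (p v - p s) (X p s z) (g (X p s z))"
    proof -
      have "DPhi (p v) (zeta p s z) (DPhi (- p s) (X p s z) (g (X p s z))) = DPhi (p v + - p s) (X p s z) (g (X p s z))"
        by (subst DPhi_add) (simp add: X_def)
      then show ?thesis by (simp add: drift_def linear_neg[OF DPhi_linear] X_def[of p s z, symmetric])
    qed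
    ultimately have "((\<lambda>s. Phi (p v) (zeta p s z)) has_vector_derivative - DPhi (p v - p s) (X p s z) (g (X p s z))) (at s)" by simp
    from vector_derivative_diff_chain_within[OF this, of \<psi> "D\<psi> (Phi (p v) (zeta p s z))"]
    have d1: "((\<lambda>s. \<psi> (Phi (p v) (zeta p s z))) has_real_derivative
        - D\<psi> (Phi (p v - p s) (X p s z)) (DPhi (p v - p s) (X p s z) (g (X p s z)))) (at s)"
      using has_derivative_at_withinI[OF test_deriv]
      by (simp add: o_def has_real_derivative_iff_has_vector_derivative linear_neg[OF has_derivative_linear[OF test_deriv]] Phi_z)
    have "(h has_real_derivative h' s) (at s)"
      unfolding h_def[abs_def]
      by (rule DERIV_cong[OF DERIV_mult[OF d1 amp_deriv[OF p s, of z]]]) (simp add: h'_def Phi_z)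
    then show ?thesis by (simp only: has_real_derivative_iff_has_vector_derivative)
  qed
  have close: "\<bar>h' s - weak_integrand s z\<bar> \<le> drift_const C T * eta (p v - p s)" if s: "s \<in> {u..v}" for s
  proof -
    define \<delta> where "\<delta> = p v - p s"
    define x where "x = X p s z"
    have s0: "0 \<le> s" "s \<le> T" using s uv by auto
    have e1: "1 \<le> exp (K * \<bar>\<delta>\<bar>)" using K_pos by simp
    have d_eta: "\<bar>\<delta>\<bar> \<le> eta \<delta>" unfolding eta_def using mult_left_mono[OF e1, of "\<bar>\<delta>\<bar>"] by simp
    have "\<bar>D\<psi> (Phi \<delta> x) (DPhi \<delta> x (g x)) - D\<psi> x (g x)\<bar>
        \<le> \<bar>D\<psi> (Phi \<delta> x) (DPhi \<delta> x (g x) - g x)\<bar> + \<bar>D\<psi> (Phi \<delta> x) (g x) - D\<psi> x (g x)\<bar>"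
      by (simp add: linear_diff[OF has_derivative_linear[OF test_deriv]])
    also have "\<dots> \<le> C * (K * \<bar>\<delta>\<bar> * exp (K * \<bar>\<delta>\<bar>) * K) + C * (K * \<bar>\<delta>\<bar>) * K"
    proof (intro add_mono order_trans[OF test_deriv_bound] order_trans[OF test_deriv_lipschitz] mult_left_mono mult_mono)
      have "norm (DPhi \<delta> x (g x) - g x) \<le> K * \<bar>\<delta>\<bar> * exp (K * \<bar>\<delta>\<bar>) * norm (g x)" by (rule DPhi_move)
      also have "\<dots> \<le> K * \<bar>\<delta>\<bar> * exp (K * \<bar>\<delta>\<bar>) * K" using K_pos by (intro mult_left_mono g_bound) auto
      finally show "norm (DPhi \<delta> x (g x) - g x) \<le> K * \<bar>\<delta>\<bar> * exp (K * \<bar>\<delta>\<bar>) * K" .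
    qed (use test_C K_pos Phi_move g_bound in auto)
    also have "\<dots> \<le> 2 * C * K\<^sup>2 * eta \<delta>"
    proof -
      have "C * (K * \<bar>\<delta>\<bar> * exp (K * \<bar>\<delta>\<bar>) * K) = C * K\<^sup>2 * eta \<delta>" by (simp add: eta_def power2_eq_square)
      moreover have "C * (K * \<bar>\<delta>\<bar>) * K \<le> C * K\<^sup>2 * eta \<delta>"
        using mult_left_mono[OF d_eta, of "C * K\<^sup>2"] test_C by (simp add: power2_eq_square ac_simps)
      ultimately show ?thesis by linarith
    qed
    finally have 1: "\<bar>D\<psi> (Phi \<delta> x) (DPhi \<delta> x (g x)) - D\<psi> x (g x)\<bar> \<le> 2 * C * K\<^sup>2 * eta \<delta>" .
    have "\<bar>\<psi> (Phi \<delta> x) - \<psi> x\<bar> \<le> C * norm (Phi \<delta> x - x)" by (rule test_lipschitz)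
    also have "\<dots> \<le> C * (K * eta \<delta>)"
      using test_C K_pos order_trans[OF Phi_move mult_left_mono[OF d_eta]] by (intro mult_left_mono) auto
    finally have 2: "\<bar>\<psi> (Phi \<delta> x) - \<psi> x\<bar> \<le> C * (K * eta \<delta>)" .
    have "h' s - weak_integrand s z = - ((D\<psi> (Phi \<delta> x) (DPhi \<delta> x (g x)) - D\<psi> x (g x)) * amp p s z)
        - (\<psi> (Phi \<delta> x) - \<psi> x) * (R0 * ((amp p s z)\<^sup>2 * exp (Dint p s z)))"
      by (simp add: h'_def weak_integrand_def \<delta>_def x_def algebra_simps)
    moreover have "\<bar>(D\<psi> (Phi \<delta> x) (DPhi \<delta> x (g x)) - D\<psi> x (g x)) * amp p s z\<bar> \<le> (2 * C * K\<^sup>2 * eta \<delta>) * F0"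
      unfolding abs_mult using 1 amp_nonneg[OF p s0(1), of z] amp_bound[OF p s0(1), of z] test_C eta_nonneg
      by (intro mult_mono) auto
    moreover have "\<bar>(\<psi> (Phi \<delta> x) - \<psi> x) * (R0 * ((amp p s z)\<^sup>2 * exp (Dint p s z)))\<bar>
        \<le> (C * (K * eta \<delta>)) * (R0 * (F0\<^sup>2 * exp (2 * K * T)))"
      unfolding abs_mult[of "\<psi> (Phi \<delta> x) - \<psi> x"] using 2 amp_square_bound[OF s0, of z] R0_pos
      by (intro mult_mono) (auto simp: abs_mult)
    ultimately have "\<bar>h' s - weak_integrand s z\<bar>
        \<le> (2 * C * K\<^sup>2 * eta \<delta>) * F0 + (C * (K * eta \<delta>)) * (R0 * (F0\<^sup>2 * exp (2 * K * T)))" by linarith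
    also have "\<dots> = drift_const C T * eta \<delta>" by (simp add: drift_const_def algebra_simps)
    finally show ?thesis by (simp add: \<delta>_def)
  qed
  have wc: "continuous_on {u..v} (\<lambda>s. weak_integrand s z)"
    unfolding weak_integrand_def
    by (intro continuous_intros test_deriv_continuous X_continuous_compose[OF p] Dint_continuous_compose[OF p]
        continuous_on_compose2[OF test_continuous] continuous_on_subset[OF amp_continuous]) (use uv in auto)
  have ec: "continuous_on {u..v} (\<lambda>s. eta (p v - p s))"
    by (intro continuous_intros continuous_on_subset[OF p]) auto
  have "(h' has_integral (h v - h u)) {u..v}"
    by (rule fundamental_theorem_of_calculus) (use uv hder in \<open>auto intro: has_vector_derivative_at_within\<close>)
  then have "((\<lambda>s. h' s - weak_integrand s z) has_integral (h v - h u - integral {u..v} (\<lambda>s. weak_integrand s z))) {u..v}"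
    by (intro has_integral_diff integrable_integral integrable_continuous_interval wc)
  moreover have "((\<lambda>s. drift_const C T * eta (p v - p s)) has_integral (drift_const C T * integral {u..v} (\<lambda>s. eta (p v - p s)))) {u..v}"
    by (intro has_integral_mult_right integrable_integral integrable_continuous_interval ec)
  ultimately have "norm (h v - h u - integral {u..v} (\<lambda>s. weak_integrand s z)) \<le> drift_const C T * integral {u..v} (\<lambda>s. eta (p v - p s))"
    using integral_norm_bound_integral[of "\<lambda>s. h' s - weak_integrand s z" "{u..v}" "\<lambda>s. drift_const C T * eta (p v - p s)"] close
    by (auto simp: has_integral_iff)
  moreover have "integral {u..v} f = (LINT s:{u..v}|lborel. f s)" if "continuous_on {u..v} f" for f :: "real \<Rightarrow> real"
    using set_borel_integral_eq_integral(2)[OF borel_integrable_atLeastAtMost'[OF that]] by simp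
  ultimately show ?thesis using wc ec
    by (simp add: h_def Phi_z)
qed

text \<open>Separates noise from drift over a short interval: the noise acts by the deterministic
  shift \<open>Phi (p v - p u)\<close>, the drift by the integral of \<open>gen\<close>, and their
  interaction is controlled by the integral of \<open>eta\<close>.\<close>

lemma drift_estimate:
  assumes uv: "0 \<le> u" "u \<le> v" "v \<le> T"
  shows "\<bar>mean p \<psi> v - mean p (\<lambda>x. \<psi> (Phi (p v - p u) x)) u - (LINT s:{u..v}|lborel. gen \<psi> D\<psi> p s)\<bar>
    \<le> drift_const C T * (LINT s:{u..v}|lborel. eta (p v - p s)) * L\<^sup>2"
proof -
  define \<delta> where "\<delta> = p v - p u"
  have pc: "continuous_on UNIV (\<lambda>x. \<psi> (Phi \<delta> x))"
    by (intro continuous_on_compose2[OF test_continuous] continuous_intros) auto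
  have pp: "periodic2 L (\<lambda>x. \<psi> (Phi \<delta> x))"
  proof -
    have "Phi \<delta> (x + k) = Phi \<delta> x + k" if "k = (L, 0) \<or> k = (0, L)" for x k
      by (rule Phi_translate) (use V_periodic that in \<open>unfold periodic2_def, metis\<close>)
    then show ?thesis using test_periodic unfolding periodic2_def by metis
  qed
  note mt = borel_measurable_continuous_onI[OF test_continuous] and mp = borel_measurable_continuous_onI[OF pc]
  note [measurable] = mt mp amp_measurable[OF p] X_measurable[OF p]
  define w where "w z = (LINT s:{u..v}|lborel. weak_integrand s z)" for z
  have wm[measurable]: "w \<in> borel_measurable borel"
    unfolding w_def[abs_def] set_lebesgue_integral_def
  proof (rule lborel.borel_measurable_lebesgue_integral)
    have sw: "(\<lambda>v. (snd v, fst v)) \<in> measurable (borel \<Otimes>\<^sub>M lborel) (borel \<Otimes>\<^sub>M borel)" by measurable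
    have "(\<lambda>v. weak_integrand (snd v) (fst v)) \<in> borel_measurable (borel \<Otimes>\<^sub>M lborel)"
      using measurable_compose[OF sw weak_integrand_measurable] by simp
    then show "(\<lambda>(z, s). indicat_real {u..v} s *\<^sub>R weak_integrand s z) \<in> borel_measurable (borel \<Otimes>\<^sub>M lborel)"
      by measurable
  qed
  have bd: "\<bar>\<psi> (X p v z) * amp p v z - \<psi> (Phi \<delta> (X p u z)) * amp p u z - w z\<bar>
      \<le> drift_const C T * (LINT s:{u..v}|lborel. eta (p v - p s))" for z
    using pointwise_drift_estimate[OF uv, of z] by (simp add: \<delta>_def w_def)
  have aa: "\<bar>\<kappa> (X p s z) * amp p s z\<bar> \<le> C * F0" if "0 \<le> s" "\<And>x. \<bar>\<kappa> x\<bar> \<le> C" for s z \<kappa>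
    unfolding abs_mult using amp_nonneg[OF p that(1), of z] amp_bound[OF p that(1), of z] that(2) test_C
    by (intro mult_mono) auto
  have i1: "integrable (torus_measure L) (\<lambda>z. \<psi> (X p v z) * amp p v z)"
    by (rule torus_integrable[OF _ aa]) (use uv test_bound in auto)
  have i2: "integrable (torus_measure L) (\<lambda>z. \<psi> (Phi \<delta> (X p u z)) * amp p u z)"
    by (rule torus_integrable[OF _ aa[where \<kappa> = "\<lambda>x. \<psi> (Phi \<delta> x)"]]) (use uv test_bound in auto)
  have "\<bar>w z\<bar> \<le> drift_const C T * (LINT s:{u..v}|lborel. eta (p v - p s)) + C * F0 + C * F0" for z
    using bd[of z] aa[of v \<psi> z] aa[of u "\<lambda>x. \<psi> (Phi \<delta> x)" z] uv test_bound by (simp add: abs_le_iff)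
  then have i3: "integrable (torus_measure L) w" by (rule torus_integrable[OF wm])
  have "(LINT s:{u..v}|lborel. gen \<psi> D\<psi> p s) = (LINT s:{u..v}|lborel. torus_integral L (weak_integrand s))"
    using uv by (intro set_lebesgue_integral_cong) (auto simp: gen_eq)
  also have "\<dots> = torus_integral L w"
    unfolding w_def by (rule torus_fubini[OF weak_integrand_measurable weak_integrand_bound]) (use uv in auto)
  finally have "mean p \<psi> v - mean p (\<lambda>x. \<psi> (Phi \<delta> x)) u - (LINT s:{u..v}|lborel. gen \<psi> D\<psi> p s)
      = torus_integral L (\<lambda>z. \<psi> (X p v z) * amp p v z - \<psi> (Phi \<delta> (X p u z)) * amp p u z - w z)"
    using i1 i2 i3 uv
    by (simp add: mean_eq[OF _ test_periodic mt test_bound] mean_eq[OF _ pp mp test_bound] torus_integral_eq mult.commute)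
  moreover have "\<bar>\<dots>\<bar> \<le> drift_const C T * (LINT s:{u..v}|lborel. eta (p v - p s)) * L\<^sup>2"
    by (rule torus_integral_bound[OF L_pos _ bd]) measurable
  ultimately show ?thesis by (simp add: \<delta>_def)
qed

end

end

end

section \<open>Taylor and trapezoidal remainders\<close>

lemma taylor_remainder_order2:
  fixes E :: "real \<Rightarrow> real"
  assumes "\<And>q. (E has_real_derivative E' q) (at q)" "\<And>q. (E' has_real_derivative E'' q) (at q)"
    and "E 0 = 0" "E' 0 = 0" and D: "\<And>q. \<bar>q\<bar> \<le> \<bar>t\<bar> \<Longrightarrow> \<bar>E'' q\<bar> \<le> D" "0 \<le> D"
  shows "\<bar>E t\<bar> \<le> D * t\<^sup>2"
proof -
  have qt: "\<bar>q\<bar> \<le> \<bar>t\<bar>" if "q \<in> {min 0 t..max 0 t}" for q :: real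
    using that by (auto simp: min_def max_def split: if_splits)
  have 1: "\<bar>E' q\<bar> \<le> D * \<bar>q\<bar>" if q: "\<bar>q\<bar> \<le> \<bar>t\<bar>" for q
  proof -
    have "norm (E' q) \<le> (norm (E' 0) + D * \<bar>q - 0\<bar>) * exp (0 * \<bar>q - 0\<bar>)"
    proof (rule gronwall[where e' = E''])
      fix r assume "r \<in> {min 0 q..max 0 q}"
      then have "\<bar>r\<bar> \<le> \<bar>t\<bar>" using q by (auto simp: min_def max_def split: if_splits)
      then show "norm (E'' r) \<le> 0 * norm (E' r) + D" using D by simp
    qed (use assms in \<open>auto simp flip: has_real_derivative_iff_has_vector_derivative\<close>)
    then show ?thesis using assms by simp
  qed
  have "norm (E t) \<le> (norm (E 0) + (D * \<bar>t\<bar>) * \<bar>t - 0\<bar>) * exp (0 * \<bar>t - 0\<bar>)"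
  proof (rule gronwall[where e' = E'])
    fix r assume "r \<in> {min 0 t..max 0 t}"
    then have r: "\<bar>r\<bar> \<le> \<bar>t\<bar>" by (rule qt)
    have "D * \<bar>r\<bar> \<le> D * \<bar>t\<bar>" using r D by (intro mult_left_mono) auto
    then show "norm (E' r) \<le> 0 * norm (E r) + D * \<bar>t\<bar>" using 1[OF r] by simp
  qed (use assms in \<open>auto simp flip: has_real_derivative_iff_has_vector_derivative\<close>)
  then show ?thesis using assms by (simp add: power2_eq_square mult.assoc)
qed

text \<open>The error vanishes together with its first derivative at 0, and its second derivative is
  \<open>- (t / 2 * u3 t)\<close>; hence third order, without the sharp constant.\<close>

lemma trapezoid_remainder:
  fixes u :: "real \<Rightarrow> real"
  assumes u: "\<And>q. (u has_real_derivative u1 q) (at q)" "\<And>q. (u1 has_real_derivative u2 q) (at q)"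
      "\<And>q. (u2 has_real_derivative u3 q) (at q)" and bd: "\<And>q. \<bar>u3 q\<bar> \<le> C"
  shows "\<bar>u t - u 0 - t / 2 * (u1 0 + u1 t)\<bar> \<le> C * \<bar>t\<bar> ^ 3"
proof -
  have C: "0 \<le> C" using bd[of 0] by linarith
  define E where "E t = u t - u 0 - t / 2 * (u1 0 + u1 t)" for t
  define E' where "E' t = u1 t - (1/2) * (u1 0 + u1 t) - t / 2 * u2 t" for t
  define E'' where "E'' t = - (t / 2 * u3 t)" for t
  have "\<bar>E t\<bar> \<le> (\<bar>t\<bar> * C) * t\<^sup>2"
  proof (rule taylor_remainder_order2[where E' = E' and E'' = E''])
    show "(E has_real_derivative E' q) (at q)" for q
      unfolding E_def[abs_def] E'_def by (auto intro!: derivative_eq_intros u simp: field_simps)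
    show "(E' has_real_derivative E'' q) (at q)" for q
      unfolding E'_def[abs_def] E''_def by (auto intro!: derivative_eq_intros u simp: field_simps)
    show "\<bar>E'' q\<bar> \<le> \<bar>t\<bar> * C" if "\<bar>q\<bar> \<le> \<bar>t\<bar>" for q
    proof -
      have "\<bar>q\<bar> / 2 * \<bar>u3 q\<bar> \<le> \<bar>t\<bar> * C" using that bd C by (intro mult_mono) auto
      then show ?thesis by (simp add: E''_def abs_mult)
    qed
  qed (use C in \<open>auto simp: E_def E'_def\<close>)
  then show ?thesis by (simp add: E_def power3_eq_cube power2_eq_square ac_simps)
qed

lemma taylor2_remainder:
  fixes u :: "real \<Rightarrow> real"
  assumes u: "\<And>q. (u has_real_derivative u1 q) (at q)" "\<And>q. (u1 has_real_derivative u2 q) (at q)"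
    and bd: "\<And>q. \<bar>q\<bar> \<le> \<bar>t\<bar> \<Longrightarrow> \<bar>u2 q - u2 0\<bar> \<le> D" "0 \<le> D"
  shows "\<bar>u t - u 0 - t * u1 0 - t\<^sup>2 / 2 * u2 0\<bar> \<le> D * t\<^sup>2"
proof (rule taylor_remainder_order2[where E' = "\<lambda>t. u1 t - u1 0 - t * u2 0" and E'' = "\<lambda>t. u2 t - u2 0"])
  show "((\<lambda>t. u t - u 0 - t * u1 0 - t\<^sup>2 / 2 * u2 0) has_real_derivative u1 q - u1 0 - q * u2 0) (at q)" for q
    by (auto intro!: derivative_eq_intros u)
  show "((\<lambda>t. u1 t - u1 0 - t * u2 0) has_real_derivative u2 q - u2 0) (at q)" for q
    by (auto intro!: derivative_eq_intros u)
qed (use bd in auto)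

section \<open>Gaussian moments\<close>

definition gauss_exp :: "real \<Rightarrow> real" where
  "gauss_exp a = exp (a\<^sup>2) * sqrt 2"

text \<open>Completing the square gives \<open>a * \<bar>z\<bar> - z\<^sup>2 / 2 \<le> a\<^sup>2 -
  z\<^sup>2 / 4\<close>, a comparison with the normal density of variance 2. This is the origin of
  the factor \<open>sqrt 2\<close> in \<open>gauss_exp\<close>.\<close>

lemma gauss_exp_bound:
  "(\<integral>\<^sup>+z. ennreal (exp (a * \<bar>z\<bar>) * std_normal_density z) \<partial>lborel) \<le> ennreal (gauss_exp a)"
proof -
  have pt: "exp (a * \<bar>z\<bar>) * std_normal_density z \<le> gauss_exp a * normal_density 0 (sqrt 2) z" for z
  proof -
    have "0 \<le> (\<bar>z\<bar> / 2 - a)\<^sup>2" by simp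
    then have "a * \<bar>z\<bar> - z\<^sup>2 / 2 \<le> a\<^sup>2 - z\<^sup>2 / 4"
      by (simp add: power2_diff power_divide field_simps)
    then have "exp (a * \<bar>z\<bar>) * exp (- z\<^sup>2 / 2) \<le> exp (a\<^sup>2) * exp (- z\<^sup>2 / 4)"
      by (simp flip: exp_add)
    then have "exp (a * \<bar>z\<bar>) * exp (- z\<^sup>2 / 2) / sqrt (2 * pi) \<le> exp (a\<^sup>2) * exp (- z\<^sup>2 / 4) / sqrt (2 * pi)"
      by (rule divide_right_mono) simp
    then show ?thesis
      by (simp add: normal_density_def gauss_exp_def real_sqrt_mult field_simps)
         (simp add: mult.assoc[symmetric])
  qed
  have "(\<integral>\<^sup>+z. ennreal (exp (a * \<bar>z\<bar>) * std_normal_density z) \<partial>lborel)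
      \<le> (\<integral>\<^sup>+z. ennreal (gauss_exp a) * ennreal (normal_density 0 (sqrt 2) z) \<partial>lborel)"
    using pt by (intro nn_integral_mono) (simp add: ennreal_leI gauss_exp_def flip: ennreal_mult)
  also have "\<dots> = ennreal (gauss_exp a) * (\<integral>\<^sup>+z. ennreal (normal_density 0 (sqrt 2) z) \<partial>lborel)"
    by (rule nn_integral_cmult) simp
  also have "(\<integral>\<^sup>+z. ennreal (normal_density 0 (sqrt 2) z) \<partial>lborel) = 1"
    using prob_space.emeasure_space_1[OF prob_space_normal_density[of "sqrt 2" 0]]
    by (simp add: emeasure_density)
  finally show ?thesis by simp
qed

text \<open>Moments are bounded as extended nonnegative integrals, so no integrability has to be
  known beforehand; rescaling by \<sigma> extracts the power of the time step.\<close>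

lemma (in prob_space) normal_nn_bound:
  assumes D: "distributed M lborel X (normal_density 0 \<sigma>)" and \<sigma>: "0 < \<sigma>"
    and [measurable]: "h \<in> borel_measurable borel" and h: "\<And>z. h (\<sigma> * z) \<le> b * exp (a * \<bar>z\<bar>)" and b: "0 \<le> b"
  shows "(\<integral>\<^sup>+\<omega>. ennreal (h (X \<omega>)) \<partial>M) \<le> ennreal (b * gauss_exp a)"
proof -
  have "(\<integral>\<^sup>+\<omega>. ennreal (h (X \<omega>)) \<partial>M) = (\<integral>\<^sup>+x. ennreal (normal_density 0 \<sigma> x) * ennreal (h x) \<partial>lborel)"
    by (rule distributed_nn_integral[OF D, symmetric]) simp
  also have "\<dots> = ennreal \<bar>\<sigma>\<bar> * (\<integral>\<^sup>+z. ennreal (normal_density 0 \<sigma> (0 + \<sigma> * z)) * ennreal (h (0 + \<sigma> * z)) \<partial>lborel)"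
    by (rule nn_integral_real_affine) (use \<sigma> in auto)
  also have "\<dots> = (\<integral>\<^sup>+z. ennreal \<bar>\<sigma>\<bar> * (ennreal (normal_density 0 \<sigma> (\<sigma> * z)) * ennreal (h (\<sigma> * z))) \<partial>lborel)"
    by (subst nn_integral_cmult) auto
  also have "\<dots> \<le> (\<integral>\<^sup>+z. ennreal b * ennreal (exp (a * \<bar>z\<bar>) * std_normal_density z) \<partial>lborel)"
  proof (rule nn_integral_mono)
    fix z
    have n: "\<sigma> * normal_density 0 \<sigma> (\<sigma> * z) = std_normal_density z"
      using \<sigma> by (simp add: normal_density_def real_sqrt_mult power_mult_distrib field_simps)
    have "ennreal \<bar>\<sigma>\<bar> * (ennreal (normal_density 0 \<sigma> (\<sigma> * z)) * ennreal (h (\<sigma> * z)))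
        = ennreal (std_normal_density z) * ennreal (h (\<sigma> * z))"
      using \<sigma> by (simp add: n mult.assoc[symmetric] flip: ennreal_mult)
    also have "\<dots> \<le> ennreal (std_normal_density z) * ennreal (b * exp (a * \<bar>z\<bar>))"
      by (intro mult_left_mono ennreal_leI h) auto
    also have "\<dots> = ennreal b * ennreal (exp (a * \<bar>z\<bar>) * std_normal_density z)"
      using b by (simp add: ac_simps flip: ennreal_mult)
    finally show "ennreal \<bar>\<sigma>\<bar> * (ennreal (normal_density 0 \<sigma> (\<sigma> * z)) * ennreal (h (\<sigma> * z)))
        \<le> ennreal b * ennreal (exp (a * \<bar>z\<bar>) * std_normal_density z)" .
  qed
  also have "\<dots> = ennreal b * (\<integral>\<^sup>+z. ennreal (exp (a * \<bar>z\<bar>) * std_normal_density z) \<partial>lborel)"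
    by (rule nn_integral_cmult) simp
  also have "\<dots> \<le> ennreal b * ennreal (gauss_exp a)" by (intro mult_left_mono gauss_exp_bound) auto
  also have "\<dots> = ennreal (b * gauss_exp a)" using b by (simp add: ennreal_mult' )
  finally show ?thesis .
qed

lemma abs_le_exp_abs: "\<bar>z\<bar> \<le> exp \<bar>z :: real\<bar>"
  using exp_ge_add_one_self[of "\<bar>z\<bar>"] by linarith

lemma abs_power_le_exp: "\<bar>z\<bar> ^ n \<le> exp (real n * \<bar>z\<bar>)"
  using power_mono[OF abs_le_exp_abs abs_ge_zero, of z n] by (simp add: exp_of_nat_mult)

section \<open>The solution driven by a Brownian motion\<close>

text \<open>A version with every path continuous and starting at 0, so that the pathwise
  construction makes sense for each \<omega> and not only almost surely.\<close>

locale continuous_brownian = stochastic_basis M \<F>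
  for M :: "'a measure" and \<F> :: "real \<Rightarrow> 'a measure" +
  fixes W :: "real \<Rightarrow> 'a \<Rightarrow> real"
  assumes W_continuous: "\<omega> \<in> space M \<Longrightarrow> continuous_on {0..} (\<lambda>t. W t \<omega>)"
    and W_adapted: "0 \<le> t \<Longrightarrow> W t \<in> borel_measurable (\<F> t)"
    and W_0: "\<omega> \<in> space M \<Longrightarrow> W 0 \<omega> = 0"
    and W_normal: "0 \<le> s \<Longrightarrow> s < t \<Longrightarrow>
      distributed M lborel (\<lambda>\<omega>. W t \<omega> - W s \<omega>) (normal_density 0 (sqrt (t - s)))"
    and W_indep: "0 \<le> s \<Longrightarrow> s < t \<Longrightarrow>
      indep_set (sets (\<F> s)) {(\<lambda>\<omega>. W t \<omega> - W s \<omega>) -` B \<inter> space M | B. B \<in> sets borel}"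

locale stochastic_transport = transport V DV K g Dg L f0 F0 R0 + continuous_brownian M \<F> W
  for V DV K g Dg L f0 F0 R0 and M :: "'a measure" and \<F> :: "real \<Rightarrow> 'a measure" and W
begin

lemma space_F: "0 \<le> t \<Longrightarrow> space (\<F> t) = space M"
  using subalg[of t] by (simp add: subalgebra_def)

lemma F_measurable_M: "0 \<le> t \<Longrightarrow> h \<in> measurable (\<F> t) N \<Longrightarrow> h \<in> measurable M N"
  using measurable_from_subalg[OF subalg] by blast

lemma F_mono_measurable: "0 \<le> s \<Longrightarrow> s \<le> t \<Longrightarrow> h \<in> measurable (\<F> s) N \<Longrightarrow> h \<in> measurable (\<F> t) N"
  using mono[of s t] by (auto simp: measurable_def space_F)

lemma W_measurable: "0 \<le> t \<Longrightarrow> W t \<in> borel_measurable M"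
  by (rule F_measurable_M[OF _ W_adapted])

definition bpath :: "'a \<Rightarrow> real \<Rightarrow> real" where "bpath \<omega> r = W (max 0 r) \<omega>"

text \<open>Agrees with \<open>bpath\<close> on times from 0 to \<open>t\<close> and is measurable
  with respect to the information at time \<open>t\<close>. Negative times receive the initial
  value, as the differential equations are posed on the whole line.\<close>

definition stopped_path :: "real \<Rightarrow> 'a \<Rightarrow> real \<Rightarrow> real" where
  "stopped_path t \<omega> r = W (min t (max 0 r)) \<omega>"

lemma bpath_continuous: "\<omega> \<in> space M \<Longrightarrow> continuous_on UNIV (bpath \<omega>)"
  unfolding bpath_def[abs_def]
  by (rule continuous_on_compose2[OF W_continuous]) (auto intro!: continuous_intros)

lemma stopped_path_continuous: "0 \<le> t \<Longrightarrow> \<omega> \<in> space M \<Longrightarrow> continuous_on UNIV (stopped_path t \<omega>)"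
  unfolding stopped_path_def[abs_def]
  by (rule continuous_on_compose2[OF W_continuous]) (auto intro!: continuous_intros)

lemma bpath_nonneg: "0 \<le> r \<Longrightarrow> bpath \<omega> r = W r \<omega>"
  by (simp add: bpath_def)

lemma path_family_path: "path_family M bpath"
  unfolding path_family_def
proof (intro conjI ballI allI)
  show "(\<lambda>\<omega>. bpath \<omega> r) \<in> borel_measurable M" for r
    unfolding bpath_def using W_measurable[of "max 0 r"] by simp
qed (rule bpath_continuous)

lemma path_family_stopped: "0 \<le> t \<Longrightarrow> path_family (\<F> t) (stopped_path t)"
  unfolding path_family_def
proof (intro conjI ballI allI)
  assume t: "0 \<le> t"
  show "continuous_on UNIV (stopped_path t \<omega>)" if "\<omega> \<in> space (\<F> t)" for \<omega>
    using that t by (intro stopped_path_continuous) (auto simp: space_F)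
  show "(\<lambda>\<omega>. stopped_path t \<omega> r) \<in> borel_measurable (\<F> t)" for r
    unfolding stopped_path_def
    by (rule F_mono_measurable[OF _ _ W_adapted, of "min t (max 0 r)"]) (use t in auto)
qed

definition particle_density :: "real \<Rightarrow> 'a \<Rightarrow> plane \<Rightarrow> real" where
  "particle_density t \<omega> x = sol (bpath \<omega>) t x"

lemma particle_density_stopped:
  assumes "0 \<le> s" "s \<le> t" "\<omega> \<in> space M"
  shows "particle_density s \<omega> x = sol (stopped_path t \<omega>) s x"
  unfolding particle_density_def
  by (rule sol_path_cong[OF bpath_continuous stopped_path_continuous, where t = t])
     (use assms in \<open>auto simp: bpath_def stopped_path_def min_def\<close>)

lemma particle_density_measurable:
  "(\<lambda>(t, \<omega>, x). particle_density t \<omega> x) \<in> borel_measurable (restrict_space borel {0..} \<Otimes>\<^sub>M (M \<Otimes>\<^sub>M borel))"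
proof -
  let ?N = "restrict_space borel {0::real..} \<Otimes>\<^sub>M (M \<Otimes>\<^sub>M (borel :: (plane) measure))"
  have P: "path_family ?N (\<lambda>y. bpath (fst (snd y)))"
    unfolding path_family_def
  proof (intro conjI ballI allI)
    show "continuous_on UNIV (bpath (fst (snd y)))" if "y \<in> space ?N" for y
      using that by (intro bpath_continuous) (auto simp: space_pair_measure)
    have "(\<lambda>\<omega>. bpath \<omega> r) \<in> borel_measurable M" for r
      using path_family_path by (simp add: path_family_def)
    from measurable_compose[OF measurable_compose[OF measurable_snd measurable_fst] this]
    show "(\<lambda>y. bpath (fst (snd y)) r) \<in> borel_measurable ?N" for r .
  qed
  have m1: "fst \<in> borel_measurable ?N"
    by (rule measurable_compose[OF measurable_fst, where g = "\<lambda>x. x"], rule measurable_restrict_space1) simp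
  have m2: "(\<lambda>y. snd (snd y)) \<in> borel_measurable ?N" by measurable
  show ?thesis
    using sol_family_measurable[OF P m1 m2] by (simp add: particle_density_def case_prod_beta)
qed

lemma sol_stopped_measurable:
  assumes t: "0 \<le> t"
  shows "(\<lambda>y. sol (stopped_path t (fst (fst y))) (snd (fst y)) (snd y)) \<in> borel_measurable ((\<F> t \<Otimes>\<^sub>M borel) \<Otimes>\<^sub>M borel)"
  by (rule sol_family_measurable[OF path_family_fst[OF path_family_fst[OF path_family_stopped[OF t]]]]) measurable

lemma particle_density_adapted:
  assumes t: "0 \<le> t"
  shows "(\<lambda>(\<omega>, x). particle_density t \<omega> x) \<in> borel_measurable (\<F> t \<Otimes>\<^sub>M borel)"
proof -
  have "(\<lambda>y. sol (stopped_path t (fst y)) t (snd y)) \<in> borel_measurable (\<F> t \<Otimes>\<^sub>M borel)"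
    by (rule sol_family_measurable[OF path_family_fst[OF path_family_stopped[OF t]]]) measurable
  then show ?thesis
    by (rule measurable_cong[THEN iffD1, rotated])
       (use t in \<open>auto simp: space_pair_measure space_F particle_density_stopped[OF t order_refl]\<close>)
qed

subsection \<open>Adapted functionals\<close>

definition process :: "(plane \<Rightarrow> real) \<Rightarrow> real \<Rightarrow> 'a \<Rightarrow> real" where
  "process \<kappa> t \<omega> = mean (bpath \<omega>) \<kappa> t"

lemma mean_stopped:
  assumes "0 \<le> s" "s \<le> t" "\<omega> \<in> space M"
  shows "mean (bpath \<omega>) \<kappa> s = mean (stopped_path t \<omega>) \<kappa> s" "mean2 (bpath \<omega>) \<kappa> s = mean2 (stopped_path t \<omega>) \<kappa> s"
  using particle_density_stopped[OF assms] by (simp_all add: mean_def mean2_def particle_density_def)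

lemma mean_stopped_measurable:
  assumes t: "0 \<le> t" and [measurable]: "\<kappa> \<in> borel_measurable borel"
  shows "(\<lambda>y. mean (stopped_path t (fst y)) \<kappa> (snd y)) \<in> borel_measurable (\<F> t \<Otimes>\<^sub>M borel)"
    "(\<lambda>y. mean2 (stopped_path t (fst y)) \<kappa> (snd y)) \<in> borel_measurable (\<F> t \<Otimes>\<^sub>M borel)"
proof -
  note [measurable] = sol_stopped_measurable[OF t]
  show "(\<lambda>y. mean (stopped_path t (fst y)) \<kappa> (snd y)) \<in> borel_measurable (\<F> t \<Otimes>\<^sub>M borel)"
    unfolding mean_def by (rule torus_integral_measurable) measurable
  show "(\<lambda>y. mean2 (stopped_path t (fst y)) \<kappa> (snd y)) \<in> borel_measurable (\<F> t \<Otimes>\<^sub>M borel)"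
    unfolding mean2_def by (rule torus_integral_measurable) measurable
qed

lemma slice_measurable:
  assumes t: "0 \<le> t" and H: "(\<lambda>y. H (fst y) (snd y)) \<in> borel_measurable (\<F> t \<Otimes>\<^sub>M borel)"
    and eq: "\<And>\<omega>. \<omega> \<in> space M \<Longrightarrow> h \<omega> = H \<omega> t"
  shows "h \<in> borel_measurable (\<F> t)"
proof -
  have "(\<lambda>\<omega>. (\<omega>, t)) \<in> measurable (\<F> t) (\<F> t \<Otimes>\<^sub>M borel)" by measurable
  from measurable_compose[OF this H] have "(\<lambda>\<omega>. H \<omega> t) \<in> borel_measurable (\<F> t)" by simp
  then show ?thesis
    by (rule measurable_cong[THEN iffD1, rotated]) (use t eq in \<open>simp add: space_F\<close>)
qed

lemma set_integral_adapted:
  fixes H :: "'a \<Rightarrow> real \<Rightarrow> real"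
  assumes t: "0 \<le> t" and H: "(\<lambda>y. H (fst y) (snd y)) \<in> borel_measurable (\<F> t \<Otimes>\<^sub>M borel)"
    and eq: "\<And>\<omega> s. \<omega> \<in> space M \<Longrightarrow> s \<in> {u..t} \<Longrightarrow> h s \<omega> = H \<omega> s"
  shows "(\<lambda>\<omega>. LINT s:{u..t}|lborel. h s \<omega>) \<in> borel_measurable (\<F> t)"
proof -
  have H': "(\<lambda>y. H (fst y) (snd y)) \<in> borel_measurable (\<F> t \<Otimes>\<^sub>M lborel)"
    using H by (simp cong: measurable_cong_sets)
  have i: "(\<lambda>y. indicat_real {u..t} (snd y)) \<in> borel_measurable (\<F> t \<Otimes>\<^sub>M lborel)" by measurable
  have "(\<lambda>\<omega>. LINT s:{u..t}|lborel. H \<omega> s) \<in> borel_measurable (\<F> t)"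
    unfolding set_lebesgue_integral_def
    by (rule lborel.borel_measurable_lebesgue_integral)
       (unfold case_prod_beta, intro borel_measurable_scaleR H' i)
  then show ?thesis
  proof (rule measurable_cong[THEN iffD1, rotated])
    fix \<omega> assume "\<omega> \<in> space (\<F> t)"
    then have "\<omega> \<in> space M" using t by (simp add: space_F)
    then show "(LINT s:{u..t}|lborel. H \<omega> s) = (LINT s:{u..t}|lborel. h s \<omega>)"
      by (intro set_lebesgue_integral_cong) (auto simp: eq)
  qed
qed

lemma process_adapted:
  assumes t: "0 \<le> t" and \<kappa>: "\<kappa> \<in> borel_measurable borel"
  shows "process \<kappa> t \<in> borel_measurable (\<F> t)"
  by (rule slice_measurable[OF t mean_stopped_measurable(1)[OF t \<kappa>]])
     (simp add: process_def mean_stopped[OF t order_refl])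

lemma process_joint:
  assumes [measurable]: "\<kappa> \<in> borel_measurable borel"
  shows "(\<lambda>y. process \<kappa> (snd y) (fst y)) \<in> borel_measurable (M \<Otimes>\<^sub>M borel)"
proof -
  have [measurable]: "(\<lambda>y. sol (bpath (fst (fst y))) (snd (fst y)) (snd y)) \<in> borel_measurable ((M \<Otimes>\<^sub>M borel) \<Otimes>\<^sub>M borel)"
    by (rule sol_family_measurable[OF path_family_fst[OF path_family_fst[OF path_family_path]]]) measurable
  show ?thesis unfolding process_def mean_def by (rule torus_integral_measurable) measurable
qed

lemma gen_integral_adapted:
  assumes u: "0 \<le> u" "u \<le> t" and "\<psi> \<in> borel_measurable borel" "(\<lambda>x. D\<psi> x (g x)) \<in> borel_measurable borel"
  shows "(\<lambda>\<omega>. LINT s:{u..t}|lborel. gen \<psi> D\<psi> (bpath \<omega>) s) \<in> borel_measurable (\<F> t)"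
proof (rule set_integral_adapted[where H = "\<lambda>\<omega> s. gen \<psi> D\<psi> (stopped_path t \<omega>) s"])
  show "0 \<le> t" using u by simp
  then show "(\<lambda>y. gen \<psi> D\<psi> (stopped_path t (fst y)) (snd y)) \<in> borel_measurable (\<F> t \<Otimes>\<^sub>M borel)"
    unfolding gen_def using assms by (intro borel_measurable_diff borel_measurable_uminus borel_measurable_times mean_stopped_measurable) auto
qed (use u in \<open>auto simp: gen_def mean_stopped[where t = t]\<close>)

lemma process_integral_adapted:
  assumes u: "0 \<le> u" "u \<le> t" and \<kappa>: "\<kappa> \<in> borel_measurable borel"
  shows "(\<lambda>\<omega>. LINT s:{u..t}|lborel. process \<kappa> s \<omega>) \<in> borel_measurable (\<F> t)"
proof (rule set_integral_adapted[where H = "\<lambda>\<omega> s. mean (stopped_path t \<omega>) \<kappa> s"])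
  show "0 \<le> t" using u by simp
  then show "(\<lambda>y. mean (stopped_path t (fst y)) \<kappa> (snd y)) \<in> borel_measurable (\<F> t \<Otimes>\<^sub>M borel)"
    using \<kappa> by (rule mean_stopped_measurable)
qed (use u in \<open>auto simp: process_def mean_stopped[where t = t]\<close>)

subsection \<open>Moments of increments\<close>

lemma increment_nn_bound:
  assumes s: "0 \<le> s" "s \<le> t" and h: "h \<in> borel_measurable borel" "h 0 = 0"
      "\<And>z. h (sqrt (t - s) * z) \<le> b * exp (a * \<bar>z\<bar>)" and b: "0 \<le> b"
  shows "(\<integral>\<^sup>+\<omega>. ennreal (h (W t \<omega> - W s \<omega>)) \<partial>M) \<le> ennreal (b * gauss_exp a)"
proof (cases "s = t")
  case False
  then show ?thesis using s b by (intro normal_nn_bound[OF W_normal _ h(1,3)]) auto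
qed (simp add: h)

lemma increment_power_bound:
  assumes s: "0 \<le> s" "s \<le> t" and n: "0 < n"
  shows "(\<integral>\<^sup>+\<omega>. ennreal (\<bar>W t \<omega> - W s \<omega>\<bar> ^ n) \<partial>M) \<le> ennreal (sqrt (t - s) ^ n * gauss_exp (real n))"
proof (rule increment_nn_bound[OF s])
  show "\<bar>sqrt (t - s) * z\<bar> ^ n \<le> sqrt (t - s) ^ n * exp (real n * \<bar>z\<bar>)" for z
    unfolding abs_mult power_mult_distrib using s abs_power_le_exp[of z n] by (simp add: mult_left_mono)
qed (use s n in auto)

text \<open>Over at most unit time the exponential in \<open>eta\<close> costs no more than
  \<open>exp (K * \<bar>z\<bar>)\<close> in the standardized variable, so the n-th moment keeps the
  scaling \<open>sqrt (t - s) ^ n\<close>.\<close>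

lemma eta_increment_bound:
  assumes s: "0 \<le> s" "s \<le> t" "t - s \<le> 1" and n: "0 < n"
  shows "(\<integral>\<^sup>+\<omega>. ennreal (eta (W t \<omega> - W s \<omega>) ^ n) \<partial>M) \<le> ennreal (sqrt (t - s) ^ n * gauss_exp (real n * (1 + K)))"
proof (rule increment_nn_bound[OF s(1,2)])
  fix z
  have r: "sqrt (t - s) \<le> 1" "0 \<le> sqrt (t - s)" using s by auto
  have "eta (sqrt (t - s) * z) \<le> sqrt (t - s) * exp ((1 + K) * \<bar>z\<bar>)"
  proof -
    have "K * (sqrt (t - s) * \<bar>z\<bar>) \<le> K * (1 * \<bar>z\<bar>)"
      using r K_pos by (intro mult_left_mono mult_right_mono) auto
    then have "\<bar>z\<bar> * exp (K * (sqrt (t - s) * \<bar>z\<bar>)) \<le> exp \<bar>z\<bar> * exp (K * \<bar>z\<bar>)"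
      using abs_le_exp_abs[of z] by (intro mult_mono) auto
    also have "\<dots> = exp ((1 + K) * \<bar>z\<bar>)" by (simp add: distrib_right exp_add)
    finally show ?thesis
      unfolding eta_def abs_mult using r mult_left_mono[of _ _ "sqrt (t - s)"] by (simp add: mult.assoc)
  qed
  then have "eta (sqrt (t - s) * z) ^ n \<le> (sqrt (t - s) * exp ((1 + K) * \<bar>z\<bar>)) ^ n"
    by (intro power_mono eta_nonneg)
  also have "\<dots> = sqrt (t - s) ^ n * exp (real n * (1 + K) * \<bar>z\<bar>)"
    by (simp add: power_mult_distrib exp_of_nat_mult[symmetric] mult.assoc)
  finally show "eta (sqrt (t - s) * z) ^ n \<le> sqrt (t - s) ^ n * exp (real n * (1 + K) * \<bar>z\<bar>)" .
qed (use s n in \<open>auto simp: eta_def\<close>)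

definition eta_integral :: "nat \<Rightarrow> real \<Rightarrow> real \<Rightarrow> 'a \<Rightarrow> real" where
  "eta_integral n u v \<omega> = (LINT s:{u..v}|lborel. eta (bpath \<omega> v - bpath \<omega> s) ^ n)"

lemma eta_path_continuous: "\<omega> \<in> space M \<Longrightarrow> continuous_on S (\<lambda>s. eta (bpath \<omega> v - bpath \<omega> s) ^ n)"
  by (intro continuous_intros continuous_on_subset[OF bpath_continuous]) auto

lemma eta_integral_nonneg: "0 \<le> eta_integral n u v \<omega>"
  unfolding eta_integral_def set_lebesgue_integral_def
  by (intro Bochner_Integration.integral_nonneg) (auto simp: eta_nonneg)

text \<open>Tonelli: integration over time contributes one more power of the interval length to the
  moment bound.\<close>

lemma eta_integral_nn_bound:
  assumes u: "0 \<le> u" "u \<le> v" "v - u \<le> 1" and n: "0 < n"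
  shows "(\<integral>\<^sup>+\<omega>. ennreal (eta_integral n u v \<omega>) \<partial>M) \<le> ennreal ((v - u) * (sqrt (v - u) ^ n * gauss_exp (real n * (1 + K))))"
proof -
  let ?c = "sqrt (v - u) ^ n * gauss_exp (real n * (1 + K))"
  interpret P: pair_sigma_finite M "lborel :: real measure" ..
  have pm: "(\<lambda>y. bpath (fst y) (snd y)) \<in> borel_measurable (M \<Otimes>\<^sub>M lborel)"
    using path_family_measurable2[OF path_family_path] by (simp cong: measurable_cong_sets)
  have pv: "(\<lambda>y. bpath (fst y) v) \<in> borel_measurable (M \<Otimes>\<^sub>M lborel)"
    using path_family_path by (auto simp: path_family_def intro: measurable_compose[OF measurable_fst])
  have em: "eta \<in> borel_measurable borel"
    by (rule borel_measurable_continuous_onI) (intro continuous_intros)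
  have jm: "(\<lambda>y. ennreal (eta (bpath (fst y) v - bpath (fst y) (snd y)) ^ n) * indicator {u..v} (snd y))
      \<in> borel_measurable (M \<Otimes>\<^sub>M lborel)"
    using measurable_compose[OF borel_measurable_diff[OF pv pm] em] by measurable
  have "(\<integral>\<^sup>+\<omega>. ennreal (eta_integral n u v \<omega>) \<partial>M)
      = (\<integral>\<^sup>+\<omega>. (\<integral>\<^sup>+s. ennreal (eta (bpath \<omega> v - bpath \<omega> s) ^ n) * indicator {u..v} s \<partial>lborel) \<partial>M)"
  proof (rule nn_integral_cong)
    fix \<omega> assume \<omega>: "\<omega> \<in> space M"
    have "integrable lborel (\<lambda>s. indicator {u..v} s *\<^sub>R eta (bpath \<omega> v - bpath \<omega> s) ^ n)"
      using borel_integrable_atLeastAtMost'[OF eta_path_continuous[OF \<omega>, of "{u..v}" v n]]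
      by (simp add: set_integrable_def)
    then have "(\<integral>\<^sup>+s. ennreal (indicator {u..v} s *\<^sub>R eta (bpath \<omega> v - bpath \<omega> s) ^ n) \<partial>lborel)
        = ennreal (\<integral>s. indicator {u..v} s *\<^sub>R eta (bpath \<omega> v - bpath \<omega> s) ^ n \<partial>lborel)"
      by (rule nn_integral_eq_integral) (auto simp: eta_nonneg)
    then show "ennreal (eta_integral n u v \<omega>)
        = (\<integral>\<^sup>+s. ennreal (eta (bpath \<omega> v - bpath \<omega> s) ^ n) * indicator {u..v} s \<partial>lborel)"
      unfolding eta_integral_def set_lebesgue_integral_def
      by (simp add: ennreal_mult'' ennreal_indicator mult.commute eta_nonneg flip: ennreal_indicator)
  qed
  also have "\<dots> = (\<integral>\<^sup>+s. (\<integral>\<^sup>+\<omega>. ennreal (eta (bpath \<omega> v - bpath \<omega> s) ^ n) * indicator {u..v} s \<partial>M) \<partial>lborel)"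
    by (rule P.Fubini'[symmetric]) (use jm in \<open>simp add: case_prod_beta\<close>)
  also have "\<dots> \<le> (\<integral>\<^sup>+s. ennreal ?c * indicator {u..v} s \<partial>lborel)"
  proof (rule nn_integral_mono)
    fix s
    show "(\<integral>\<^sup>+\<omega>. ennreal (eta (bpath \<omega> v - bpath \<omega> s) ^ n) * indicator {u..v} s \<partial>M) \<le> ennreal ?c * indicator {u..v} s"
    proof (cases "s \<in> {u..v}")
      case True
      have "(\<integral>\<^sup>+\<omega>. ennreal (eta (W v \<omega> - W s \<omega>) ^ n) \<partial>M) \<le> ennreal (sqrt (v - s) ^ n * gauss_exp (real n * (1 + K)))"
        using True u n by (intro eta_increment_bound) auto
      also have "\<dots> \<le> ennreal ?c"
        using True u by (intro ennreal_leI mult_right_mono power_mono) (auto simp: gauss_exp_def)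
      finally show ?thesis using True u by (simp add: bpath_nonneg)
    qed simp
  qed
  also have "\<dots> = ennreal ?c * ennreal (v - u)"
    using u by (subst nn_integral_cmult_indicator) auto
  also have "\<dots> = ennreal ((v - u) * ?c)"
    using u by (subst mult.commute, subst ennreal_mult) (auto simp: gauss_exp_def)
  finally show ?thesis .
qed

text \<open>Independence of increments enters here: after this factorization only mean and variance
  of the increment are needed.\<close>

lemma expectation_increment:
  fixes h :: "real \<Rightarrow> real"
  assumes s: "0 \<le> s" "s < t" and \<xi>: "\<xi> \<in> borel_measurable (\<F> s)" "\<And>\<omega>. \<omega> \<in> space M \<Longrightarrow> \<bar>\<xi> \<omega>\<bar> \<le> C"
    and h[measurable]: "h \<in> borel_measurable borel" and hi: "integrable M (\<lambda>\<omega>. h (W t \<omega> - W s \<omega>))"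
  shows "integrable M (\<lambda>\<omega>. \<xi> \<omega> * h (W t \<omega> - W s \<omega>))"
    "expectation (\<lambda>\<omega>. \<xi> \<omega> * h (W t \<omega> - W s \<omega>)) = expectation \<xi> * expectation (\<lambda>\<omega>. h (W t \<omega> - W s \<omega>))"
proof -
  let ?\<delta> = "\<lambda>\<omega>. W t \<omega> - W s \<omega>"
  let ?B = "{?\<delta> -` B \<inter> space M | B. B \<in> sets borel}"
  have \<xi>M[measurable]: "\<xi> \<in> borel_measurable M" by (rule F_measurable_M[OF s(1) \<xi>(1)])
  have [measurable]: "W t \<in> borel_measurable M" "W s \<in> borel_measurable M" using s by (auto intro: W_measurable)
  have dM: "(\<lambda>\<omega>. h (?\<delta> \<omega>)) \<in> borel_measurable M" by measurable
  have stB: "Int_stable ?B"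
    unfolding Int_stable_def
  proof clarsimp
    fix B C :: "real set" assume "B \<in> sets borel" "C \<in> sets borel"
    then show "\<exists>D. ?\<delta> -` B \<inter> space M \<inter> (?\<delta> -` C \<inter> space M) = ?\<delta> -` D \<inter> space M \<and> D \<in> sets borel"
      by (intro exI[of _ "B \<inter> C"]) auto
  qed
  have ind: "indep_set (sigma_sets (space M) (sets (\<F> s))) (sigma_sets (space M) ?B)"
    by (rule indep_set_sigma_sets[OF W_indep[OF s] sets.Int_stable stB])
  have "indep_var borel \<xi> borel (\<lambda>\<omega>. h (?\<delta> \<omega>))"
    unfolding indep_var_eq
  proof (intro conjI \<xi>M dM)
    let ?A1 = "sigma_sets (space M) {\<xi> -` A \<inter> space M | A. A \<in> sets borel}"
    let ?B1 = "sigma_sets (space M) {(\<lambda>\<omega>. h (?\<delta> \<omega>)) -` A \<inter> space M | A. A \<in> sets borel}"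
    have A1: "?A1 \<subseteq> sigma_sets (space M) (sets (\<F> s))"
      using measurable_sets[OF \<xi>(1)] s by (intro sigma_sets_mono') (auto simp: space_F)
    have B1: "?B1 \<subseteq> sigma_sets (space M) ?B"
    proof (rule sigma_sets_mono', clarify)
      fix A :: "real set" assume A: "A \<in> sets borel"
      have "(\<lambda>\<omega>. h (?\<delta> \<omega>)) -` A \<inter> space M = ?\<delta> -` (h -` A) \<inter> space M" by auto
      moreover have "h -` A \<in> sets borel" using measurable_sets[OF h A] by simp
      ultimately show "\<exists>B. (\<lambda>\<omega>. h (?\<delta> \<omega>)) -` A \<inter> space M = ?\<delta> -` B \<inter> space M \<and> B \<in> sets borel" by blast
    qed
    show "indep_set ?A1 ?B1"
      unfolding indep_set_def
      by (rule indep_sets_mono_sets[OF ind[unfolded indep_set_def]]) (use A1 B1 in \<open>auto split: bool.split\<close>)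
  qed
  moreover have "integrable M \<xi>" by (rule integrable_const_bound[where B = C]) (use \<xi>(2) in auto)
  ultimately show "integrable M (\<lambda>\<omega>. \<xi> \<omega> * h (?\<delta> \<omega>))"
    "expectation (\<lambda>\<omega>. \<xi> \<omega> * h (?\<delta> \<omega>)) = expectation \<xi> * expectation (\<lambda>\<omega>. h (?\<delta> \<omega>))"
    using hi by (auto intro: indep_var_integrable indep_var_lebesgue_integral)
qed

lemma increment_integrable:
  assumes "0 \<le> s" "s \<le> t" "0 < n"
  shows "integrable M (\<lambda>\<omega>. \<bar>W t \<omega> - W s \<omega>\<bar> ^ n)"
proof (rule integrableI_bounded)
  have [measurable]: "W t \<in> borel_measurable M" "W s \<in> borel_measurable M" using assms by (auto intro: W_measurable)
  show "(\<lambda>\<omega>. \<bar>W t \<omega> - W s \<omega>\<bar> ^ n) \<in> borel_measurable M" by measurable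
  show "(\<integral>\<^sup>+\<omega>. ennreal (norm (\<bar>W t \<omega> - W s \<omega>\<bar> ^ n)) \<partial>M) < \<infinity>"
    using order_le_less_trans[OF increment_power_bound[OF assms] ennreal_less_top] by simp
qed

lemma increment_moments:
  assumes s: "0 \<le> s" "s < t"
  shows "integrable M (\<lambda>\<omega>. W t \<omega> - W s \<omega>)" "expectation (\<lambda>\<omega>. W t \<omega> - W s \<omega>) = 0"
    "integrable M (\<lambda>\<omega>. (W t \<omega> - W s \<omega>)\<^sup>2)" "expectation (\<lambda>\<omega>. (W t \<omega> - W s \<omega>)\<^sup>2) = t - s"
proof -
  have [measurable]: "W t \<in> borel_measurable M" "W s \<in> borel_measurable M" using s by (auto intro: W_measurable)
  have \<sigma>: "0 < sqrt (t - s)" using s by simp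
  have "integrable M (\<lambda>\<omega>. \<bar>W t \<omega> - W s \<omega>\<bar>)" using increment_integrable[of s t 1] s by simp
  then show "integrable M (\<lambda>\<omega>. W t \<omega> - W s \<omega>)" by (intro integrable_norm_cancel[where f = "\<lambda>\<omega>. W t \<omega> - W s \<omega>"]) auto
  show E: "expectation (\<lambda>\<omega>. W t \<omega> - W s \<omega>) = 0"
    by (rule normal_distributed_expectation[OF \<sigma> W_normal[OF s]])
  show "integrable M (\<lambda>\<omega>. (W t \<omega> - W s \<omega>)\<^sup>2)" using increment_integrable[of s t 2] s by simp
  show "expectation (\<lambda>\<omega>. (W t \<omega> - W s \<omega>)\<^sup>2) = t - s"
    using normal_distributed_variance[OF \<sigma> W_normal[OF s]] E s by simp
qed

end

section \<open>Time integrals and sums over partitions\<close>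

lemma set_integral_signed_integral:
  fixes f :: "real \<Rightarrow> real"
  assumes f: "continuous_on {0..} f" and uv: "0 \<le> u" "u \<le> v"
  shows "(LINT s:{u..v}|lborel. f s) = signed_integral 0 v (\<lambda>r. f (max 0 r)) - signed_integral 0 u (\<lambda>r. f (max 0 r))"
proof -
  \<comment> \<open>Extension to negative times by the value at 0, where the oriented integral needs
    a function that is continuous on the whole line.\<close>
  have c: "continuous_on UNIV (\<lambda>r. f (max 0 r))"
    by (rule continuous_on_compose2[OF f]) (auto intro!: continuous_intros)
  have i: "(\<lambda>r. f (max 0 r)) integrable_on {a..b}" for a b
    by (rule integrable_continuous_interval) (rule continuous_on_subset[OF c], simp)
  have "(LINT s:{u..v}|lborel. f s) = integral {u..v} f"
    using set_borel_integral_eq_integral(2)[OF borel_integrable_atLeastAtMost'[OF continuous_on_subset[OF f]]] uv by simp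
  also have "\<dots> = integral {u..v} (\<lambda>r. f (max 0 r))"
    by (rule Henstock_Kurzweil_Integration.integral_cong) (use uv in auto)
  also have "\<dots> = integral {0..v} (\<lambda>r. f (max 0 r)) - integral {0..u} (\<lambda>r. f (max 0 r))"
    using Henstock_Kurzweil_Integration.integral_combine[OF uv i] by simp
  also have "\<dots> = signed_integral 0 v (\<lambda>r. f (max 0 r)) - signed_integral 0 u (\<lambda>r. f (max 0 r))"
    using signed_integral_split[OF c, of 0 0 v] signed_integral_split[OF c, of 0 0 u] uv by simp
  finally show ?thesis .
qed

lemma set_integral_combine:
  fixes f :: "real \<Rightarrow> real"
  assumes "continuous_on {0..} f" "0 \<le> u" "u \<le> v" "v \<le> w"
  shows "(LINT s:{u..v}|lborel. f s) + (LINT s:{v..w}|lborel. f s) = (LINT s:{u..w}|lborel. f s)"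
  using assms by (simp add: set_integral_signed_integral)

lemma set_integral_upto_continuous:
  fixes f :: "real \<Rightarrow> real"
  assumes f: "continuous_on {0..} f"
  shows "continuous_on {0..} (\<lambda>t. LINT s:{0..t}|lborel. f s)"
proof -
  have c: "continuous_on UNIV (\<lambda>r. f (max 0 r))"
    by (rule continuous_on_compose2[OF f]) (auto intro!: continuous_intros)
  show ?thesis
    by (rule continuous_on_eq[OF signed_integral_continuous[OF c, of "{0..}" 0]])
       (simp add: set_integral_signed_integral[OF f])
qed

lemma set_integral_abs_bound:
  fixes f :: "real \<Rightarrow> real"
  assumes f: "continuous_on {0..} f" and uv: "0 \<le> u" "u \<le> v" and bd: "\<And>s. s \<in> {u..v} \<Longrightarrow> \<bar>f s\<bar> \<le> C"
  shows "\<bar>LINT s:{u..v}|lborel. f s\<bar> \<le> C * (v - u)"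
proof -
  have c: "continuous_on {u..v} f" by (rule continuous_on_subset[OF f]) (use uv in auto)
  have "(LINT s:{u..v}|lborel. f s) = integral {u..v} f"
    using set_borel_integral_eq_integral(2)[OF borel_integrable_atLeastAtMost'[OF c]] by simp
  moreover have "norm (integral {u..v} f) \<le> C * (v - u)"
    by (rule integral_bound[OF uv(2) c]) (use bd in auto)
  ultimately show ?thesis by simp
qed

lemma partition_points_bounds:
  assumes "partition_points t n p"
  shows "i \<le> n \<Longrightarrow> 0 \<le> p i" "i \<le> n \<Longrightarrow> p i \<le> t"
proof -
  have m: "i \<le> j \<Longrightarrow> j \<le> n \<Longrightarrow> p i \<le> p j" for i j
  proof (induction j)
    case (Suc j)
    show ?case
    proof (cases "i = Suc j")
      case False
      then have "p i \<le> p j" using Suc by simp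
      also have "p j \<le> p (Suc j)" using assms Suc.prems by (simp add: partition_points_def)
      finally show ?thesis .
    qed simp
  qed simp
  show "i \<le> n \<Longrightarrow> 0 \<le> p i" "i \<le> n \<Longrightarrow> p i \<le> t"
    using m[of 0 i] m[of i n] assms by (auto simp: partition_points_def)
qed

lemma partition_points_sum:
  assumes p: "partition_points t n p" and F: "\<And>u v w. 0 \<le> u \<Longrightarrow> u \<le> v \<Longrightarrow> v \<le> w \<Longrightarrow> F u v + F v w = (F u w :: real)"
    and F0: "F 0 0 = 0"
  shows "(\<Sum>i<n. F (p i) (p (Suc i))) = F 0 t"
proof -
  have "j \<le> n \<Longrightarrow> (\<Sum>i<j. F (p i) (p (Suc i))) = F 0 (p j)" for j
  proof (induction j)
    case 0
    then show ?case using p F0 by (simp add: partition_points_def)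
  next
    case (Suc j)
    then show ?case using F[of 0 "p j" "p (Suc j)"] partition_points_bounds(1)[OF p, of j] p
      by (simp add: partition_points_def)
  qed
  from this[of n] p show ?thesis by (simp add: partition_points_def)
qed

section \<open>Trapezoidal sums for the derivative of a test function along V\<close>

context stochastic_transport
begin

lemma eta_integral_measurable: "eta_integral n u v \<in> borel_measurable M"
  unfolding eta_integral_def[abs_def] set_lebesgue_integral_def
proof (rule lborel.borel_measurable_lebesgue_integral)
  have pm: "(\<lambda>y. bpath (fst y) (snd y)) \<in> borel_measurable (M \<Otimes>\<^sub>M lborel)"
    using path_family_measurable2[OF path_family_path] by (simp cong: measurable_cong_sets)
  have pv: "(\<lambda>y. bpath (fst y) v) \<in> borel_measurable (M \<Otimes>\<^sub>M lborel)"
    using path_family_path by (auto simp: path_family_def intro: measurable_compose[OF measurable_fst])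
  have em: "eta \<in> borel_measurable borel"
    by (rule borel_measurable_continuous_onI) (intro continuous_intros)
  show "(\<lambda>(\<omega>, s). indicat_real {u..v} s *\<^sub>R eta (bpath \<omega> v - bpath \<omega> s) ^ n) \<in> borel_measurable (M \<Otimes>\<^sub>M lborel)"
    using measurable_compose[OF borel_measurable_diff[OF pv pm] em] by (simp add: case_prod_beta)
qed

context
  fixes \<phi> D\<phi> \<phi>1 D\<phi>1 \<phi>2 \<phi>3 C
  assumes test0: "test_function \<phi> D\<phi> C" and test1: "test_function \<phi>1 D\<phi>1 C"
    and deriv0: "\<And>q x. ((\<lambda>t. \<phi> (Phi t x)) has_real_derivative \<phi>1 (Phi q x)) (at q)"
    and deriv1: "\<And>q x. ((\<lambda>t. \<phi>1 (Phi t x)) has_real_derivative \<phi>2 (Phi q x)) (at q)"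
    and deriv2: "\<And>q x. ((\<lambda>t. \<phi>2 (Phi t x)) has_real_derivative \<phi>3 (Phi q x)) (at q)"
    and \<phi>2: "periodic2 L \<phi>2" "continuous_on UNIV \<phi>2" "\<And>x. \<bar>\<phi>2 x\<bar> \<le> C"
    and \<phi>3: "periodic2 L \<phi>3" "continuous_on UNIV \<phi>3" "\<And>x. \<bar>\<phi>3 x\<bar> \<le> C" "uniformly_continuous_on UNIV \<phi>3"
begin

lemma C_pos: "0 < C" using test0 by (simp add: test_function_def)

lemma periodic01: "periodic2 L \<phi>" "periodic2 L \<phi>1" and bound01: "\<bar>\<phi> x\<bar> \<le> C" "\<bar>\<phi>1 x\<bar> \<le> C"
  using test0 test1 unfolding test_function_def by blast+

text \<open>The constant path 0 instantiates the path of the context in which these facts were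
  proved.\<close>

lemmas continuous0 = test_continuous[OF continuous_on_const[where c = 0] test0]
  and continuous1 = test_continuous[OF continuous_on_const[where c = 0] test1]

lemma measurable0123 [measurable]:
  "\<phi> \<in> borel_measurable borel" "\<phi>1 \<in> borel_measurable borel" "\<phi>2 \<in> borel_measurable borel" "\<phi>3 \<in> borel_measurable borel"
  by (rule borel_measurable_continuous_onI, rule continuous0 continuous1 \<phi>2(2) \<phi>3(2))+

lemma process_bound:
  assumes "0 \<le> s" "\<omega> \<in> space M"
  shows "\<bar>process \<phi> s \<omega>\<bar> \<le> F0 * C * L\<^sup>2" "\<bar>process \<phi>1 s \<omega>\<bar> \<le> F0 * C * L\<^sup>2"
    "\<bar>process \<phi>2 s \<omega>\<bar> \<le> F0 * C * L\<^sup>2" "\<bar>process \<phi>3 s \<omega>\<bar> \<le> F0 * C * L\<^sup>2"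
  unfolding process_def using assms
  by (auto intro!: mean_bound[OF bpath_continuous] periodic01 bound01 \<phi>2 \<phi>3)

lemma process_continuous:
  assumes "\<omega> \<in> space M"
  shows "continuous_on {0..} (\<lambda>s. process \<phi>1 s \<omega>)" "continuous_on {0..} (\<lambda>s. process \<phi>3 s \<omega>)"
  unfolding process_def
  by (rule mean_continuous[OF bpath_continuous[OF assms] periodic01(2) continuous1 bound01(2)],
      rule mean_continuous[OF bpath_continuous[OF assms] \<phi>3(1,2,3)])

definition gbound :: "real \<Rightarrow> real" where
  "gbound T = (C * K * F0 + C * (R0 * (F0\<^sup>2 * exp (2 * K * T)))) * L\<^sup>2"

lemma gbound_nonneg: "0 \<le> gbound T"
  unfolding gbound_def using C_pos K_pos F0_nonneg R0_pos by simp

definition dbound :: "real \<Rightarrow> real" where "dbound T = drift_const C T * L\<^sup>2"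

lemma dbound_nonneg: "0 \<le> dbound T"
  unfolding dbound_def using drift_const_nonneg[OF C_pos] by simp

text \<open>The pathwise separation of noise and drift, read for the Brownian path and for both the
  test function and its first derivative along \<open>V\<close>.\<close>

lemma drift_process:
  assumes uv: "0 \<le> u" "u \<le> v" "v \<le> T" and \<omega>: "\<omega> \<in> space M"
  shows "\<bar>process \<phi> v \<omega> - mean (bpath \<omega>) (\<lambda>x. \<phi> (Phi (W v \<omega> - W u \<omega>) x)) u - (LINT s:{u..v}|lborel. gen \<phi> D\<phi> (bpath \<omega>) s)\<bar>
      \<le> dbound T * eta_integral 1 u v \<omega>"
    "\<bar>process \<phi>1 v \<omega> - mean (bpath \<omega>) (\<lambda>x. \<phi>1 (Phi (W v \<omega> - W u \<omega>) x)) u - (LINT s:{u..v}|lborel. gen \<phi>1 D\<phi>1 (bpath \<omega>) s)\<bar>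
      \<le> dbound T * eta_integral 1 u v \<omega>"
  using drift_estimate[OF bpath_continuous[OF \<omega>] test0 uv] drift_estimate[OF bpath_continuous[OF \<omega>] test1 uv] uv
  by (simp_all add: process_def eta_integral_def dbound_def bpath_nonneg ac_simps)

lemma shifted_periodic: "periodic2 L \<kappa> \<Longrightarrow> periodic2 L (\<lambda>x. \<kappa> (Phi \<delta> x))"
proof -
  assume \<kappa>: "periodic2 L \<kappa>"
  have "Phi \<delta> (x + k) = Phi \<delta> x + k" if "k = (L, 0) \<or> k = (0, L)" for x k
    by (rule Phi_translate) (use V_periodic that in \<open>unfold periodic2_def, metis\<close>)
  then show ?thesis using \<kappa> unfolding periodic2_def by metis
qed

text \<open>Increment and \<open>eta\<close> are dependent, so the expectation of their product does
  not factor; a product is at most the sum of the squares, and two separate moments suffice.\<close>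

lemma eta_integral_product:
  assumes uv: "0 \<le> u" "u \<le> v" and \<omega>: "\<omega> \<in> space M"
  shows "\<bar>W v \<omega> - W u \<omega>\<bar> * eta_integral 1 u v \<omega> \<le> (v - u) * \<bar>W v \<omega> - W u \<omega>\<bar> ^ 2 + eta_integral 2 u v \<omega>"
proof -
  let ?d = "\<bar>W v \<omega> - W u \<omega>\<bar>" and ?e = "\<lambda>s. eta (bpath \<omega> v - bpath \<omega> s)"
  have i: "set_integrable lborel {u..v} (\<lambda>s. ?e s ^ n)" for n
    by (rule borel_integrable_atLeastAtMost'[OF eta_path_continuous[OF \<omega>]])
  have ci: "set_integrable lborel {u..v} (\<lambda>s. ?d ^ 2)"
    by (rule borel_integrable_atLeastAtMost') (intro continuous_intros)
  have "?d * eta_integral 1 u v \<omega> = (LINT s:{u..v}|lborel. ?d * ?e s ^ 1)"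
    unfolding eta_integral_def by simp
  also have "\<dots> \<le> (LINT s:{u..v}|lborel. ?d ^ 2 + ?e s ^ 2)"
  proof (rule set_integral_mono)
    show "set_integrable lborel {u..v} (\<lambda>s. ?d * ?e s ^ 1)" using i[of 1] by simp
    show "set_integrable lborel {u..v} (\<lambda>s. ?d ^ 2 + ?e s ^ 2)" by (rule set_integral_add(1)[OF ci i])
    show "?d * ?e s ^ 1 \<le> ?d ^ 2 + ?e s ^ 2" for s
    proof -
      have "0 \<le> (?d - ?e s) ^ 2" "0 \<le> ?d * ?e s" by (auto simp: eta_nonneg)
      then show ?thesis by (simp add: power2_diff)
    qed
  qed
  also have "\<dots> = (v - u) * ?d ^ 2 + eta_integral 2 u v \<omega>"
  proof -
    have "(LINT s:{u..v}|lborel. ?d ^ 2) = (v - u) * ?d ^ 2"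
      using uv unfolding set_lebesgue_integral_def by simp
    then show ?thesis unfolding eta_integral_def set_integral_add(2)[OF ci i] by simp
  qed
  finally show ?thesis .
qed

text \<open>The trapezoidal rule is exact to second order in \<open>W v - W u\<close>, so that the expected error is of order
  \<open>(v - u)\<^sup>3\<^sup>/\<^sup>2\<close> and the errors sum to zero with the mesh.\<close>

definition strat_error :: "real \<Rightarrow> real \<Rightarrow> 'a \<Rightarrow> real" where
  "strat_error u v \<omega> = process \<phi> v \<omega> - process \<phi> u \<omega> - (process \<phi>1 u \<omega> + process \<phi>1 v \<omega>) / 2 * (W v \<omega> - W u \<omega>)
     - (LINT s:{u..v}|lborel. gen \<phi> D\<phi> (bpath \<omega>) s)"

text \<open>The error splits into the drift remainder of \<open>\<phi>\<close>, the mean of the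
  deterministic trapezoidal remainder of \<open>\<phi>\<close> along the flow, and half the
  increment times what the drift changes in \<open>\<phi>1\<close>. The last is a product of two
  small factors.\<close>

lemma strat_error_bound:
  assumes uv: "0 \<le> u" "u \<le> v" "v \<le> T" and \<omega>: "\<omega> \<in> space M"
  shows "\<bar>strat_error u v \<omega>\<bar> \<le> dbound T * eta_integral 1 u v \<omega> + F0 * C * L\<^sup>2 * \<bar>W v \<omega> - W u \<omega>\<bar> ^ 3
     + gbound T * (v - u) * \<bar>W v \<omega> - W u \<omega>\<bar> ^ 1
     + dbound T * ((v - u) * \<bar>W v \<omega> - W u \<omega>\<bar> ^ 2 + eta_integral 2 u v \<omega>)"
proof -
  define \<delta> where "\<delta> = W v \<omega> - W u \<omega>"
  let ?p = "bpath \<omega>"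
  note p = bpath_continuous[OF \<omega>]
  let ?\<phi>' = "\<lambda>x. \<phi> (Phi \<delta> x)" and ?\<phi>1' = "\<lambda>x. \<phi>1 (Phi \<delta> x)"
  have [measurable]: "Phi \<delta> \<in> borel_measurable borel"
    by (rule borel_measurable_continuous_onI) (intro continuous_intros)
  have m: "?\<phi>' \<in> borel_measurable borel" "?\<phi>1' \<in> borel_measurable borel" by measurable
  define \<mu> where "\<mu> x = \<phi>1 x + 1 * ?\<phi>1' x" for x
  define \<nu> where "\<nu> x = 1 * ?\<phi>' x + (-1) * \<phi> x" for x
  \<comment> \<open>The trapezoidal remainder of \<open>\<phi> (Phi t x)\<close> at time \<delta>,
    bounded by the third derivative \<open>\<phi>3\<close>. The explicit coefficients match the
    shape of \<open>mean_diff\<close>.\<close>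
  define \<rho> where "\<rho> x = 1 * \<nu> x + (- (\<delta> / 2)) * \<mu> x" for x
  have m\<mu>: "periodic2 L \<mu>" "\<mu> \<in> borel_measurable borel" "\<bar>\<mu> x\<bar> \<le> 2 * C" for x
    using periodic01(2) shifted_periodic[OF periodic01(2), of \<delta>] bound01(2)[of x] bound01(2)[of "Phi \<delta> x"] m
    unfolding \<mu>_def[abs_def] by (auto simp: periodic2_def)
  have m\<nu>: "periodic2 L \<nu>" "\<nu> \<in> borel_measurable borel" "\<bar>\<nu> x\<bar> \<le> 2 * C" for x
    using periodic01(1) shifted_periodic[OF periodic01(1), of \<delta>] bound01(1)[of x] bound01(1)[of "Phi \<delta> x"] m
    unfolding \<nu>_def[abs_def] by (auto simp: periodic2_def)
  have e\<mu>: "mean ?p \<mu> u = process \<phi>1 u \<omega> + mean ?p ?\<phi>1' u"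
    unfolding \<mu>_def process_def
    using mean_diff[OF p uv(1) periodic01(2) _ bound01(2) shifted_periodic[OF periodic01(2)] m(2) bound01(2), of 1 1] by simp
  have e\<nu>: "mean ?p \<nu> u = mean ?p ?\<phi>' u - process \<phi> u \<omega>"
    unfolding \<nu>_def process_def
    using mean_diff[OF p uv(1) shifted_periodic[OF periodic01(1)] m(1) bound01(1) periodic01(1) _ bound01(1), of 1 "-1"] by simp
  have e\<rho>: "mean ?p \<rho> u = (mean ?p ?\<phi>' u - process \<phi> u \<omega>) - \<delta> / 2 * (process \<phi>1 u \<omega> + mean ?p ?\<phi>1' u)"
    unfolding \<rho>_def using mean_diff[OF p uv(1) m\<nu> m\<mu>, of 1 "- (\<delta> / 2)"] by (simp add: e\<mu> e\<nu>)
  have b\<rho>: "\<bar>\<rho> x\<bar> \<le> C * \<bar>\<delta>\<bar> ^ 3" for x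
    using trapezoid_remainder[where u = "\<lambda>t. \<phi> (Phi t x)" and t = \<delta>, OF deriv0 deriv1 deriv2 \<phi>3(3)]
    by (simp add: \<rho>_def \<mu>_def \<nu>_def)
  have "\<bar>mean ?p \<rho> u\<bar> \<le> F0 * (C * \<bar>\<delta>\<bar> ^ 3) * L\<^sup>2"
  proof (rule mean_bound[OF p uv(1) _ _ b\<rho>])
    show "periodic2 L \<rho>" using m\<mu>(1) m\<nu>(1) by (simp add: \<rho>_def periodic2_def)
    show "\<rho> \<in> borel_measurable borel" unfolding \<rho>_def[abs_def] using m\<mu>(2) m\<nu>(2) by measurable
  qed
  then have 1: "\<bar>mean ?p \<rho> u\<bar> \<le> F0 * C * L\<^sup>2 * \<bar>\<delta>\<bar> ^ 3" by (simp add: ac_simps)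
  let ?J = "LINT s:{u..v}|lborel. gen \<phi> D\<phi> ?p s" and ?J1 = "LINT s:{u..v}|lborel. gen \<phi>1 D\<phi>1 ?p s"
  have 2: "\<bar>process \<phi> v \<omega> - mean ?p ?\<phi>' u - ?J\<bar> \<le> dbound T * eta_integral 1 u v \<omega>"
    and 3: "\<bar>process \<phi>1 v \<omega> - mean ?p ?\<phi>1' u - ?J1\<bar> \<le> dbound T * eta_integral 1 u v \<omega>"
    using drift_process[OF uv \<omega>] by (simp_all add: \<delta>_def)
  have 4: "\<bar>?J1\<bar> \<le> gbound T * (v - u)"
    by (rule set_integral_abs_bound[OF gen_continuous[OF p test1] uv(1,2)])
       (use gen_bound[OF p test1] uv in \<open>auto simp: gbound_def\<close>)
  have "\<bar>\<delta> / 2 * (process \<phi>1 v \<omega> - mean ?p ?\<phi>1' u)\<bar>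
      \<le> \<bar>\<delta>\<bar> / 2 * (gbound T * (v - u) + dbound T * eta_integral 1 u v \<omega>)"
    unfolding abs_mult using 3 4 by (intro mult_mono) auto
  also have "\<dots> \<le> \<bar>\<delta>\<bar> * (gbound T * (v - u) + dbound T * eta_integral 1 u v \<omega>)"
    using gbound_nonneg[of T] dbound_nonneg[of T] eta_integral_nonneg[of 1 u v \<omega>] uv by (intro mult_right_mono) auto
  also have "\<dots> = gbound T * (v - u) * \<bar>\<delta>\<bar> ^ 1 + dbound T * (\<bar>\<delta>\<bar> * eta_integral 1 u v \<omega>)"
    by (simp add: algebra_simps)
  also have "\<dots> \<le> gbound T * (v - u) * \<bar>\<delta>\<bar> ^ 1 + dbound T * ((v - u) * \<bar>\<delta>\<bar> ^ 2 + eta_integral 2 u v \<omega>)"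
    using eta_integral_product[OF uv(1,2) \<omega>] dbound_nonneg[of T]
    by (intro add_left_mono mult_left_mono) (auto simp: \<delta>_def)
  finally have 5: "\<bar>\<delta> / 2 * (process \<phi>1 v \<omega> - mean ?p ?\<phi>1' u)\<bar>
      \<le> gbound T * (v - u) * \<bar>\<delta>\<bar> ^ 1 + dbound T * ((v - u) * \<bar>\<delta>\<bar> ^ 2 + eta_integral 2 u v \<omega>)" .
  have "strat_error u v \<omega> = (process \<phi> v \<omega> - mean ?p ?\<phi>' u - ?J) + mean ?p \<rho> u
      - \<delta> / 2 * (process \<phi>1 v \<omega> - mean ?p ?\<phi>1' u)"
    unfolding e\<rho> strat_error_def \<delta>_def[symmetric] by (simp add: field_simps)
  then show ?thesis using 1 2 5 unfolding \<delta>_def by linarith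
qed

lemma gauss_exp_pos: "0 < gauss_exp a" by (simp add: gauss_exp_def)

definition strat_const :: "real \<Rightarrow> real" where
  "strat_const T = dbound T * gauss_exp (1 + K) + F0 * C * L\<^sup>2 * gauss_exp 3 + gbound T * gauss_exp 1
     + dbound T * (gauss_exp 2 + gauss_exp (2 * (1 + K)))"

lemma strat_const_nonneg: "0 \<le> strat_const T"
  unfolding strat_const_def
  using dbound_nonneg[of T] gbound_nonneg[of T] F0_nonneg C_pos gauss_exp_pos by (intro add_nonneg_nonneg mult_nonneg_nonneg) (auto simp: less_imp_le)

lemma sqrt_powers:
  assumes "0 \<le> h" "h \<le> (1::real)"
  shows "sqrt h ^ 3 = h * sqrt h" "sqrt h ^ 2 = h" "h * h \<le> h * sqrt h"
proof -
  show "sqrt h ^ 2 = h" using assms by simp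
  then show "sqrt h ^ 3 = h * sqrt h" by (simp add: power3_eq_cube power2_eq_square)
  have "sqrt h * sqrt h \<le> 1 * sqrt h" using assms by (intro mult_right_mono) auto
  then have "h \<le> sqrt h" using assms by simp
  then show "h * h \<le> h * sqrt h" using assms by (intro mult_left_mono)
qed

lemma process_measurable_M:
  assumes t: "0 \<le> t"
  shows "process \<phi> t \<in> borel_measurable M" "process \<phi>1 t \<in> borel_measurable M"
    "process \<phi>2 t \<in> borel_measurable M" "process \<phi>3 t \<in> borel_measurable M"
  by (rule F_measurable_M[OF t process_adapted[OF t]], measurable)+

lemma gen_measurable_M:
  assumes u: "0 \<le> u" "u \<le> v"
  shows "(\<lambda>\<omega>. LINT s:{u..v}|lborel. gen \<phi> D\<phi> (bpath \<omega>) s) \<in> borel_measurable (\<F> v)"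
    "(\<lambda>\<omega>. LINT s:{u..v}|lborel. gen \<phi>1 D\<phi>1 (bpath \<omega>) s) \<in> borel_measurable (\<F> v)"
  by (rule gen_integral_adapted[OF u], measurable,
      rule borel_measurable_continuous_onI[OF test_g_continuous[OF continuous_on_const[where c = 0] test0]]
        borel_measurable_continuous_onI[OF test_g_continuous[OF continuous_on_const[where c = 0] test1]])+

lemma nn_integral_add_real:
  assumes "a \<in> borel_measurable M" "b \<in> borel_measurable M" "\<And>\<omega>. 0 \<le> a \<omega>" "\<And>\<omega>. 0 \<le> b \<omega>"
    and "(\<integral>\<^sup>+\<omega>. ennreal (a \<omega>) \<partial>M) \<le> ennreal A" "(\<integral>\<^sup>+\<omega>. ennreal (b \<omega>) \<partial>M) \<le> ennreal B" "0 \<le> A" "0 \<le> B"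
  shows "(\<integral>\<^sup>+\<omega>. ennreal (a \<omega> + b \<omega>) \<partial>M) \<le> ennreal (A + B)"
proof -
  have "(\<integral>\<^sup>+\<omega>. ennreal (a \<omega> + b \<omega>) \<partial>M) = (\<integral>\<^sup>+\<omega>. ennreal (a \<omega>) \<partial>M) + (\<integral>\<^sup>+\<omega>. ennreal (b \<omega>) \<partial>M)"
    using assms(1-4) by (subst nn_integral_add[symmetric]) (auto simp: ennreal_plus)
  also have "\<dots> \<le> ennreal A + ennreal B" by (intro add_mono assms)
  finally show ?thesis using assms by (simp add: ennreal_plus)
qed

lemma nn_integral_cmult_real:
  assumes "a \<in> borel_measurable M" "0 \<le> c" "(\<integral>\<^sup>+\<omega>. ennreal (a \<omega>) \<partial>M) \<le> ennreal A"
  shows "(\<integral>\<^sup>+\<omega>. ennreal (c * a \<omega>) \<partial>M) \<le> ennreal (c * A)"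
proof -
  have "(\<integral>\<^sup>+\<omega>. ennreal (c * a \<omega>) \<partial>M) = ennreal c * (\<integral>\<^sup>+\<omega>. ennreal (a \<omega>) \<partial>M)"
    using assms by (subst nn_integral_cmult[symmetric]) (auto simp: ennreal_mult')
  also have "\<dots> \<le> ennreal c * ennreal A" by (intro mult_left_mono assms) auto
  finally show ?thesis using assms by (simp add: ennreal_mult')
qed

text \<open>With h = \<open>v - u\<close> the terms have expected size h * sqrt h or h * h, and the
  latter is at most the former since h is at most 1.\<close>

lemma strat_error_expectation:
  assumes uv: "0 \<le> u" "u \<le> v" "v \<le> T" "v - u \<le> 1"
  shows "(\<integral>\<^sup>+\<omega>. ennreal \<bar>strat_error u v \<omega>\<bar> \<partial>M) \<le> ennreal (strat_const T * ((v - u) * sqrt (v - u)))"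
proof -
  let ?h = "v - u" and ?d = "\<lambda>\<omega>. \<bar>W v \<omega> - W u \<omega>\<bar>"
  have h: "0 \<le> ?h" "?h \<le> 1" using uv by auto
  note sq = sqrt_powers[OF h]
  have [measurable]: "W v \<in> borel_measurable M" "W u \<in> borel_measurable M" using uv by (auto intro: W_measurable)
  note [measurable] = eta_integral_measurable
  note nn = gauss_exp_pos[THEN less_imp_le] dbound_nonneg gbound_nonneg eta_integral_nonneg F0_nonneg C_pos[THEN less_imp_le] h
  have dn: "(\<integral>\<^sup>+\<omega>. ennreal (?d \<omega> ^ n) \<partial>M) \<le> ennreal (sqrt ?h ^ n * gauss_exp (real n))" if "0 < n" for n
    by (rule increment_power_bound[OF uv(1,2) that])
  have en: "(\<integral>\<^sup>+\<omega>. ennreal (eta_integral n u v \<omega>) \<partial>M) \<le> ennreal (?h * (sqrt ?h ^ n * gauss_exp (real n * (1 + K))))" if "0 < n" for n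
    by (rule eta_integral_nn_bound[OF uv(1,2,4) that])
  let ?E = "dbound T * (?h * (sqrt ?h ^ 1 * gauss_exp (real 1 * (1 + K)))) + F0 * C * L\<^sup>2 * (sqrt ?h ^ 3 * gauss_exp (real 3))
     + gbound T * ?h * (sqrt ?h ^ 1 * gauss_exp (real 1))
     + dbound T * (?h * (sqrt ?h ^ 2 * gauss_exp (real 2)) + ?h * (sqrt ?h ^ 2 * gauss_exp (real 2 * (1 + K))))"
  have "(\<integral>\<^sup>+\<omega>. ennreal \<bar>strat_error u v \<omega>\<bar> \<partial>M)
      \<le> (\<integral>\<^sup>+\<omega>. ennreal (dbound T * eta_integral 1 u v \<omega> + F0 * C * L\<^sup>2 * ?d \<omega> ^ 3 + gbound T * ?h * ?d \<omega> ^ 1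
           + dbound T * (?h * ?d \<omega> ^ 2 + eta_integral 2 u v \<omega>)) \<partial>M)"
    by (intro nn_integral_mono ennreal_leI strat_error_bound uv)
  also have "\<dots> \<le> ennreal ?E"
  proof -
    have ms: "(\<lambda>\<omega>. c * ?d \<omega> ^ n) \<in> borel_measurable M" "(\<lambda>\<omega>. c * eta_integral n u v \<omega>) \<in> borel_measurable M" for c n
      by measurable
    have pd: "0 \<le> ?d \<omega> ^ n" "0 \<le> sqrt ?h ^ n" for \<omega> n using h by auto
    show ?thesis
      by (intro nn_integral_add_real nn_integral_cmult_real dn en add_nonneg_nonneg mult_nonneg_nonneg nn pd
          borel_measurable_add ms eta_integral_measurable zero_less_one zero_less_numeral zero_le_power2) measurable
  qed
  also have "?E \<le> strat_const T * (?h * sqrt ?h)"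
  proof -
    have "dbound T * (?h * (sqrt ?h ^ 2 * gauss_exp (real 2)) + ?h * (sqrt ?h ^ 2 * gauss_exp (real 2 * (1 + K))))
        = dbound T * (gauss_exp 2 + gauss_exp (2 * (1 + K))) * (?h * ?h)"
      unfolding sq(2) by (simp add: algebra_simps)
    also have "\<dots> \<le> dbound T * (gauss_exp 2 + gauss_exp (2 * (1 + K))) * (?h * sqrt ?h)"
      by (intro mult_left_mono sq(3) mult_nonneg_nonneg add_nonneg_nonneg nn)
    finally show ?thesis unfolding sq(1) strat_const_def by (simp add: algebra_simps)
  qed
  then have "ennreal ?E \<le> ennreal (strat_const T * (?h * sqrt ?h))" by (rule ennreal_leI)
  finally show ?thesis .
qed

text \<open>The value that the weak equation prescribes for the integral. What has to be shown is
  that trapezoidal sums converge to it.\<close>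

definition strat_limit :: "real \<Rightarrow> 'a \<Rightarrow> real" where
  "strat_limit t \<omega> = process \<phi> t \<omega> - process \<phi> 0 \<omega> - (LINT s:{0..t}|lborel. gen \<phi> D\<phi> (bpath \<omega>) s)"

lemma strat_limit_measurable: "0 \<le> t \<Longrightarrow> strat_limit t \<in> borel_measurable M"
  unfolding strat_limit_def[abs_def]
  by (intro borel_measurable_diff process_measurable_M F_measurable_M[OF _ gen_measurable_M(1)]) auto

lemma trapezoid_error:
  assumes p: "partition_points t n p" and t: "0 \<le> t" and \<omega>: "\<omega> \<in> space M"
  shows "trapezoid_sum (process \<phi>1) W n p \<omega> - strat_limit t \<omega> = - (\<Sum>i<n. strat_error (p i) (p (Suc i)) \<omega>)"
proof -
  have 1: "(\<Sum>i<n. process \<phi> (p (Suc i)) \<omega> - process \<phi> (p i) \<omega>) = process \<phi> t \<omega> - process \<phi> 0 \<omega>"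
    using partition_points_sum[OF p, of "\<lambda>u v. process \<phi> v \<omega> - process \<phi> u \<omega>"] by simp
  have 2: "(\<Sum>i<n. LINT s:{p i..p (Suc i)}|lborel. gen \<phi> D\<phi> (bpath \<omega>) s) = (LINT s:{0..t}|lborel. gen \<phi> D\<phi> (bpath \<omega>) s)"
  proof (rule partition_points_sum[OF p])
    note c = gen_continuous[OF bpath_continuous[OF \<omega>] test0]
    show "(LINT s:{0..0}|lborel. gen \<phi> D\<phi> (bpath \<omega>) s) = 0"
      using set_integral_signed_integral[OF c order_refl order_refl] by simp
  qed (intro set_integral_combine gen_continuous[OF bpath_continuous[OF \<omega>] test0])
  show ?thesis
    unfolding strat_error_def trapezoid_sum_def strat_limit_def sum_subtractf
    using 1 2 by (simp add: sum_subtractf)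
qed

text \<open>Summing local errors of order h^(3/2) over the partition leaves
  \<open>sqrt \<delta>\<close> times the length of the interval, so convergence holds even in mean;
  Markov's inequality turns it into convergence in probability.\<close>

lemma trapezoid_convergence:
  assumes t: "0 \<le> t" and \<epsilon>: "\<epsilon> > 0"
  shows "\<exists>\<delta>>0. \<forall>n p. partition_points t n p \<and> (\<forall>i<n. p (Suc i) - p i < \<delta>) \<longrightarrow>
    measure M {\<omega>\<in>space M. \<bar>trapezoid_sum (process \<phi>1) W n p \<omega> - strat_limit t \<omega>\<bar> > \<epsilon>} < \<epsilon>"
proof -
  define c where "c = strat_const t * t + 1"
  have c: "c > 0" using strat_const_nonneg[of t] t by (simp add: c_def add_nonneg_pos)
  \<comment> \<open>Chosen so that the mean error is at most half of \<epsilon> squared; the minimum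
    with 1 serves the moment bounds, and the summand 1 in \<open>c\<close> keeps the denominator
    positive.\<close>
  define \<delta> where "\<delta> = min 1 ((\<epsilon>\<^sup>2 / (2 * c))\<^sup>2)"
  have \<delta>: "\<delta> > 0" using \<epsilon> c by (simp add: \<delta>_def)
  have c\<delta>: "c * sqrt \<delta> \<le> \<epsilon>\<^sup>2 / 2"
  proof -
    have "sqrt \<delta> \<le> sqrt ((\<epsilon>\<^sup>2 / (2 * c))\<^sup>2)" by (rule real_sqrt_le_mono) (simp add: \<delta>_def)
    also have "\<dots> = \<epsilon>\<^sup>2 / (2 * c)" using c by simp
    finally have "c * sqrt \<delta> \<le> c * (\<epsilon>\<^sup>2 / (2 * c))" using c by (intro mult_left_mono) auto
    then show ?thesis using c by simp
  qed
  have "measure M {\<omega>\<in>space M. \<bar>trapezoid_sum (process \<phi>1) W n p \<omega> - strat_limit t \<omega>\<bar> > \<epsilon>} < \<epsilon>"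
    if p: "partition_points t n p" and mesh: "\<And>i. i < n \<Longrightarrow> p (Suc i) - p i < \<delta>" for n p
  proof -
    note pb = partition_points_bounds[OF p]
    have pm: "p i \<le> p (Suc i)" if "i < n" for i using p that by (simp add: partition_points_def)
    let ?D = "\<lambda>\<omega>. \<bar>trapezoid_sum (process \<phi>1) W n p \<omega> - strat_limit t \<omega>\<bar>"
    have [measurable]: "trapezoid_sum (process \<phi>1) W n p \<in> borel_measurable M"
      unfolding trapezoid_sum_def[abs_def]
      by (intro borel_measurable_sum borel_measurable_times borel_measurable_divide borel_measurable_add borel_measurable_diff
          process_measurable_M W_measurable borel_measurable_const pb) auto
    have [measurable]: "strat_limit t \<in> borel_measurable M" by (rule strat_limit_measurable[OF t])
    have em: "strat_error (p i) (p (Suc i)) \<in> borel_measurable M" if "i < n" for i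
      unfolding strat_error_def[abs_def] using that pm[OF that] pb[of i] pb[of "Suc i"]
      by (intro borel_measurable_diff borel_measurable_times borel_measurable_divide borel_measurable_add
          process_measurable_M W_measurable borel_measurable_const F_measurable_M[OF _ gen_measurable_M(1)]) auto
    have "(\<integral>\<^sup>+\<omega>. ennreal (?D \<omega>) \<partial>M) \<le> (\<integral>\<^sup>+\<omega>. (\<Sum>i<n. ennreal \<bar>strat_error (p i) (p (Suc i)) \<omega>\<bar>) \<partial>M)"
    proof (rule nn_integral_mono)
      fix \<omega> assume \<omega>: "\<omega> \<in> space M"
      have "?D \<omega> \<le> (\<Sum>i<n. \<bar>strat_error (p i) (p (Suc i)) \<omega>\<bar>)"
        unfolding trapezoid_error[OF p t \<omega>] by (simp add: sum_abs)
      then show "ennreal (?D \<omega>) \<le> (\<Sum>i<n. ennreal \<bar>strat_error (p i) (p (Suc i)) \<omega>\<bar>)"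
        by (simp add: sum_ennreal ennreal_leI)
    qed
    also have "\<dots> = (\<Sum>i<n. \<integral>\<^sup>+\<omega>. ennreal \<bar>strat_error (p i) (p (Suc i)) \<omega>\<bar> \<partial>M)"
      by (rule nn_integral_sum) (use em in auto)
    also have "\<dots> \<le> (\<Sum>i<n. ennreal (strat_const t * sqrt \<delta> * (p (Suc i) - p i)))"
    proof (rule sum_mono)
      fix i assume "i \<in> {..<n}"
      then have i: "i < n" by simp
      let ?h = "p (Suc i) - p i"
      have h: "0 \<le> ?h" "?h \<le> \<delta>" "\<delta> \<le> 1" using pm[OF i] mesh[OF i] by (auto simp: \<delta>_def)
      have "(\<integral>\<^sup>+\<omega>. ennreal \<bar>strat_error (p i) (p (Suc i)) \<omega>\<bar> \<partial>M) \<le> ennreal (strat_const t * (?h * sqrt ?h))"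
        using i pb[of i] pb[of "Suc i"] pm[OF i] h by (intro strat_error_expectation) auto
      also have "strat_const t * (?h * sqrt ?h) \<le> strat_const t * (?h * sqrt \<delta>)"
        using h strat_const_nonneg by (intro mult_left_mono) auto
      then have "ennreal (strat_const t * (?h * sqrt ?h)) \<le> ennreal (strat_const t * sqrt \<delta> * ?h)"
        by (intro ennreal_leI) (simp add: ac_simps)
      finally show "(\<integral>\<^sup>+\<omega>. ennreal \<bar>strat_error (p i) (p (Suc i)) \<omega>\<bar> \<partial>M) \<le> ennreal (strat_const t * sqrt \<delta> * ?h)" .
    qed
    also have "\<dots> = ennreal (\<Sum>i<n. strat_const t * sqrt \<delta> * (p (Suc i) - p i))"
      using strat_const_nonneg \<delta> pm by (intro sum_ennreal mult_nonneg_nonneg) (auto simp: less_imp_le)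
    also have "(\<Sum>i<n. strat_const t * sqrt \<delta> * (p (Suc i) - p i)) = strat_const t * sqrt \<delta> * t"
      using partition_points_sum[OF p, of "\<lambda>u v. v - u"] by (simp flip: sum_distrib_left)
    finally have E: "(\<integral>\<^sup>+\<omega>. ennreal (?D \<omega>) \<partial>M) \<le> ennreal (strat_const t * sqrt \<delta> * t)" .
    have "strat_const t * sqrt \<delta> * t \<le> c * sqrt \<delta>" using \<delta> by (simp add: c_def algebra_simps less_imp_le)
    also have "\<dots> \<le> \<epsilon>\<^sup>2 / 2" by (rule c\<delta>)
    finally have E': "(\<integral>\<^sup>+\<omega>. ennreal (?D \<omega>) \<partial>M) \<le> ennreal (\<epsilon>\<^sup>2 / 2)" using E by (meson ennreal_leI order_trans)
    \<comment> \<open>Markov's inequality divides the mean error by \<epsilon>, leaving half of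
      \<epsilon> and thus the strict inequality required.\<close>
    have "emeasure M {\<omega>\<in>space M. ?D \<omega> > \<epsilon>} \<le> emeasure M {\<omega>\<in>space M. 1 \<le> ennreal (1 / \<epsilon>) * ennreal (?D \<omega>)}"
    proof (rule emeasure_mono)
      show "{\<omega>\<in>space M. ?D \<omega> > \<epsilon>} \<subseteq> {\<omega>\<in>space M. 1 \<le> ennreal (1 / \<epsilon>) * ennreal (?D \<omega>)}"
        using \<epsilon> by (auto simp flip: ennreal_mult' ennreal_1 simp: ennreal_leI)
    qed measurable
    also have "\<dots> \<le> ennreal (1 / \<epsilon>) * (\<integral>\<^sup>+\<omega>. ennreal (?D \<omega>) * indicator (space M) \<omega> \<partial>M)"
      by (rule nn_integral_Markov_inequality[where A = "space M", simplified]) measurable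
    also have "\<dots> = ennreal (1 / \<epsilon>) * (\<integral>\<^sup>+\<omega>. ennreal (?D \<omega>) \<partial>M)"
      by (intro arg_cong2[where f = times] refl nn_integral_cong) simp
    also have "\<dots> \<le> ennreal (1 / \<epsilon>) * ennreal (\<epsilon>\<^sup>2 / 2)" by (intro mult_left_mono E') auto
    also have "\<dots> = ennreal (\<epsilon> / 2)" using \<epsilon> by (simp add: power2_eq_square flip: ennreal_mult')
    finally have "ennreal (measure M {\<omega>\<in>space M. ?D \<omega> > \<epsilon>}) \<le> ennreal (\<epsilon> / 2)" by (simp add: emeasure_eq_measure)
    then have "measure M {\<omega>\<in>space M. ?D \<omega> > \<epsilon>} \<le> \<epsilon> / 2" using \<epsilon> by simp
    then show ?thesis using \<epsilon> by simp
  qed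
  with \<delta> show ?thesis by blast
qed

subsection \<open>The martingale part\<close>

definition compensated :: "real \<Rightarrow> 'a \<Rightarrow> real" where
  "compensated t \<omega> = process \<phi>1 t \<omega> - (LINT s:{0..t}|lborel. gen \<phi>1 D\<phi>1 (bpath \<omega>) s)"

text \<open>Half the integral of \<open>\<phi>3\<close> is the Ito correction, since
  \<open>\<phi>3\<close> is the second derivative of \<open>\<phi>1\<close> along \<open>V\<close>;
  what remains after drift and correction is the martingale part.\<close>

definition mart :: "real \<Rightarrow> 'a \<Rightarrow> real" where
  "mart t \<omega> = compensated t \<omega> - process \<phi>1 0 \<omega> - (LINT s:{0..t}|lborel. process \<phi>3 s \<omega>) / 2"

definition fv_part :: "real \<Rightarrow> 'a \<Rightarrow> real" where
  "fv_part t \<omega> = process \<phi>1 0 \<omega> + (LINT s:{0..t}|lborel. gen \<phi>1 D\<phi>1 (bpath \<omega>) s)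
     + (LINT s:{0..t}|lborel. process \<phi>3 s \<omega>) / 2"

lemma decomposition: "process \<phi>1 t \<omega> = mart t \<omega> + fv_part t \<omega>"
  by (simp add: mart_def fv_part_def compensated_def)

lemma generator_integral_bound:
  assumes uv: "0 \<le> u" "u \<le> v" "v \<le> T" and \<omega>: "\<omega> \<in> space M"
  shows "\<bar>LINT s:{u..v}|lborel. gen \<phi>1 D\<phi>1 (bpath \<omega>) s\<bar> \<le> gbound T * (v - u)"
    "\<bar>LINT s:{u..v}|lborel. process \<phi>3 s \<omega>\<bar> \<le> F0 * C * L\<^sup>2 * (v - u)"
proof -
  show "\<bar>LINT s:{u..v}|lborel. gen \<phi>1 D\<phi>1 (bpath \<omega>) s\<bar> \<le> gbound T * (v - u)"
    by (rule set_integral_abs_bound[OF gen_continuous[OF bpath_continuous[OF \<omega>] test1] uv(1,2)])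
       (use gen_bound[OF bpath_continuous[OF \<omega>] test1] uv in \<open>auto simp: gbound_def\<close>)
  show "\<bar>LINT s:{u..v}|lborel. process \<phi>3 s \<omega>\<bar> \<le> F0 * C * L\<^sup>2 * (v - u)"
    by (rule set_integral_abs_bound[OF process_continuous(2)[OF \<omega>] uv(1,2)])
       (use process_bound(4) uv \<omega> in auto)
qed

lemma compensated_bound:
  assumes t: "0 \<le> t" and \<omega>: "\<omega> \<in> space M"
  shows "\<bar>compensated t \<omega>\<bar> \<le> F0 * C * L\<^sup>2 + gbound t * t"
  using process_bound(2)[OF t \<omega>] generator_integral_bound(1)[OF order_refl t order_refl \<omega>]
  by (simp add: compensated_def)

lemma compensated_adapted: "0 \<le> t \<Longrightarrow> compensated t \<in> borel_measurable (\<F> t)"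
  unfolding compensated_def[abs_def]
  by (intro borel_measurable_diff process_adapted gen_measurable_M(2)) auto

lemma mart_adapted:
  assumes t: "0 \<le> t" shows "mart t \<in> borel_measurable (\<F> t)"
proof -
  have "process \<phi>1 0 \<in> borel_measurable (\<F> t)"
    by (rule F_mono_measurable[OF order_refl t process_adapted]) auto
  then show ?thesis
    unfolding mart_def[abs_def]
    using t by (intro borel_measurable_diff borel_measurable_divide borel_measurable_const compensated_adapted process_integral_adapted) auto
qed

lemma fv_part_adapted:
  assumes t: "0 \<le> t" shows "fv_part t \<in> borel_measurable (\<F> t)"
proof -
  have "process \<phi>1 0 \<in> borel_measurable (\<F> t)"
    by (rule F_mono_measurable[OF order_refl t process_adapted]) auto
  then show ?thesis
    unfolding fv_part_def[abs_def]
    using t by (intro borel_measurable_add borel_measurable_divide borel_measurable_const process_integral_adapted gen_measurable_M(2)) auto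
qed

lemma mart_bound:
  assumes t: "0 \<le> t" and \<omega>: "\<omega> \<in> space M"
  shows "\<bar>mart t \<omega>\<bar> \<le> 2 * (F0 * C * L\<^sup>2) + gbound t * t + F0 * C * L\<^sup>2 * t"
  using compensated_bound[OF t \<omega>] process_bound(2)[OF order_refl \<omega>]
    generator_integral_bound(2)[OF order_refl t order_refl \<omega>]
  unfolding mart_def by (simp add: abs_le_iff)

lemma mart_integrable: "0 \<le> t \<Longrightarrow> integrable M (mart t)"
  by (rule integrable_const_bound[OF AE_I2]) (use mart_bound F_measurable_M[OF _ mart_adapted] in \<open>auto simp: real_norm_def\<close>)

text \<open>The function \<open>\<phi>3\<close> is only uniformly continuous, so the quadratic
  remainder has an arbitrarily small coefficient \<epsilon> instead of a higher order. Large
  increments are charged to the cubic term.\<close>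

definition second_order :: "real \<Rightarrow> real \<Rightarrow> bool" where
  "second_order \<epsilon> C' \<longleftrightarrow> (\<forall>\<delta> x. \<bar>\<phi>1 (Phi \<delta> x) - \<phi>1 x - \<delta> * \<phi>2 x - \<delta>\<^sup>2 / 2 * \<phi>3 x\<bar> \<le> \<epsilon> * \<bar>\<delta>\<bar> ^ 2 + C' * \<bar>\<delta>\<bar> ^ 3)"

lemma second_order_remainder:
  assumes \<epsilon>: "\<epsilon> > 0"
  obtains C' where "0 \<le> C'"
    "second_order \<epsilon> C'"
proof -
  obtain d where d: "d > 0" "\<And>x y. norm (x - y) < d \<Longrightarrow> \<bar>\<phi>3 x - \<phi>3 y\<bar> < \<epsilon>"
    using \<phi>3(4) \<epsilon> unfolding uniformly_continuous_on_def dist_norm by (metis UNIV_I real_norm_def)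
  \<comment> \<open>If \<delta> is so large that the flow may move a point by \<open>d\<close>, the
    trivial bound \<open>2 * C\<close> on the change of \<open>\<phi>3\<close> is at most
    \<open>C' * \<bar>\<delta>\<bar>\<close>.\<close>
  define C' where "C' = 2 * C * K / d"
  have C': "0 \<le> C'" using C_pos K_pos d by (simp add: C'_def)
  have near: "\<bar>\<phi>3 (Phi q x) - \<phi>3 x\<bar> \<le> \<epsilon> + C' * \<bar>\<delta>\<bar>" if q: "\<bar>q\<bar> \<le> \<bar>\<delta>\<bar>" for q \<delta> x
  proof (cases "K * \<bar>q\<bar> < d")
    case True
    then have "norm (Phi q x - x) < d" using Phi_move[of q x] by linarith
    then show ?thesis using d(2)[of "Phi q x" x] C' by (smt (verit) mult_nonneg_nonneg abs_ge_zero)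
  next
    case False
    have "K * \<bar>q\<bar> \<le> K * \<bar>\<delta>\<bar>" using q K_pos by simp
    then have "d \<le> K * \<bar>\<delta>\<bar>" using False by linarith
    then have "2 * C * d \<le> 2 * C * (K * \<bar>\<delta>\<bar>)" using C_pos by simp
    then have "2 * C \<le> C' * \<bar>\<delta>\<bar>" using d(1) by (simp add: C'_def field_simps)
    then show ?thesis using \<phi>3(3)[of x] \<phi>3(3)[of "Phi q x"] \<epsilon> by linarith
  qed
  have "\<bar>\<phi>1 (Phi \<delta> x) - \<phi>1 x - \<delta> * \<phi>2 x - \<delta>\<^sup>2 / 2 * \<phi>3 x\<bar> \<le> \<epsilon> * \<bar>\<delta>\<bar> ^ 2 + C' * \<bar>\<delta>\<bar> ^ 3" for \<delta> x
  proof -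
    have "\<bar>\<phi>1 (Phi \<delta> x) - \<phi>1 (Phi 0 x) - \<delta> * \<phi>2 (Phi 0 x) - \<delta>\<^sup>2 / 2 * \<phi>3 (Phi 0 x)\<bar> \<le> (\<epsilon> + C' * \<bar>\<delta>\<bar>) * \<delta>\<^sup>2"
      by (rule taylor2_remainder[where u = "\<lambda>t. \<phi>1 (Phi t x)", OF deriv1 deriv2])
         (use near C' \<epsilon> in auto)
    also have "\<dots> = \<epsilon> * \<bar>\<delta>\<bar> ^ 2 + C' * \<bar>\<delta>\<bar> ^ 3"
    proof -
      have "\<delta>\<^sup>2 = \<bar>\<delta>\<bar> ^ 2" by simp
      then show ?thesis by (simp only: distrib_right power3_eq_cube power2_eq_square mult.assoc)
    qed
    finally show ?thesis by simp
  qed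
  then have "second_order \<epsilon> C'" by (simp add: second_order_def)
  with C' show ?thesis by (rule that)
qed

text \<open>Remainder of the second-order expansion of \<open>compensated\<close> in the Brownian
  increment, with coefficients taken at the left end point so that they are independent of the
  increment.\<close>

definition ito_error :: "real \<Rightarrow> real \<Rightarrow> 'a \<Rightarrow> real" where
  "ito_error u v \<omega> = compensated v \<omega> - compensated u \<omega> - process \<phi>2 u \<omega> * (W v \<omega> - W u \<omega>)
     - process \<phi>3 u \<omega> / 2 * (W v \<omega> - W u \<omega>)\<^sup>2"

lemma ito_error_bound:
  assumes C': "second_order \<epsilon> C'"
    and uv: "0 \<le> u" "u \<le> v" "v \<le> T" and \<omega>: "\<omega> \<in> space M"
  shows "\<bar>ito_error u v \<omega>\<bar> \<le> dbound T * eta_integral 1 u v \<omega>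
    + (F0 * L\<^sup>2 * \<epsilon> * \<bar>W v \<omega> - W u \<omega>\<bar> ^ 2 + F0 * L\<^sup>2 * C' * \<bar>W v \<omega> - W u \<omega>\<bar> ^ 3)"
proof -
  define \<delta> where "\<delta> = W v \<omega> - W u \<omega>"
  let ?p = "bpath \<omega>"
  note p = bpath_continuous[OF \<omega>]
  let ?\<phi>1' = "\<lambda>x. \<phi>1 (Phi \<delta> x)"
  have [measurable]: "Phi \<delta> \<in> borel_measurable borel"
    by (rule borel_measurable_continuous_onI) (intro continuous_intros)
  have m: "?\<phi>1' \<in> borel_measurable borel" by measurable
  define \<mu> where "\<mu> x = \<delta> * \<phi>2 x + \<delta>\<^sup>2 / 2 * \<phi>3 x" for x
  define \<nu> where "\<nu> x = 1 * ?\<phi>1' x + (-1) * \<phi>1 x" for x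
  define \<rho> where "\<rho> x = 1 * \<nu> x + (- 1) * \<mu> x" for x
  have "\<bar>\<mu> x\<bar> \<le> \<bar>\<delta>\<bar> * C + \<delta>\<^sup>2 / 2 * C" for x
  proof -
    have "\<bar>\<delta> * \<phi>2 x\<bar> \<le> \<bar>\<delta>\<bar> * C"
      unfolding abs_mult by (rule mult_left_mono[OF \<phi>2(3)]) simp
    moreover have "\<bar>\<delta>\<^sup>2 / 2 * \<phi>3 x\<bar> \<le> \<bar>\<delta>\<^sup>2 / 2\<bar> * C"
      unfolding abs_mult by (rule mult_left_mono[OF \<phi>3(3)]) simp
    moreover have "\<bar>\<delta>\<^sup>2 / 2\<bar> = \<delta>\<^sup>2 / 2" by simp
    ultimately show ?thesis unfolding \<mu>_def by linarith
  qed
  moreover have "periodic2 L \<mu>" using \<phi>2(1) \<phi>3(1) by (simp add: \<mu>_def periodic2_def)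
  moreover have "\<mu> \<in> borel_measurable borel" unfolding \<mu>_def[abs_def] by measurable
  ultimately have m\<mu>: "periodic2 L \<mu>" "\<mu> \<in> borel_measurable borel" "\<And>x. \<bar>\<mu> x\<bar> \<le> \<bar>\<delta>\<bar> * C + \<delta>\<^sup>2 / 2 * C" by blast+
  have m\<nu>: "periodic2 L \<nu>" "\<nu> \<in> borel_measurable borel" "\<bar>\<nu> x\<bar> \<le> 2 * C" for x
    using periodic01(2) shifted_periodic[OF periodic01(2), of \<delta>] bound01(2)[of x] bound01(2)[of "Phi \<delta> x"] m
    unfolding \<nu>_def[abs_def] by (auto simp: periodic2_def)
  have e\<mu>: "mean ?p \<mu> u = \<delta> * process \<phi>2 u \<omega> + \<delta>\<^sup>2 / 2 * process \<phi>3 u \<omega>"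
    unfolding \<mu>_def process_def by (rule mean_diff[OF p uv(1) \<phi>2(1) _ \<phi>2(3) \<phi>3(1) _ \<phi>3(3)]) measurable
  have e\<nu>: "mean ?p \<nu> u = mean ?p ?\<phi>1' u - process \<phi>1 u \<omega>"
    unfolding \<nu>_def process_def
    using mean_diff[OF p uv(1) shifted_periodic[OF periodic01(2)] m bound01(2) periodic01(2) _ bound01(2), of 1 "-1"] by simp
  have e\<rho>: "mean ?p \<rho> u = mean ?p ?\<phi>1' u - process \<phi>1 u \<omega> - (\<delta> * process \<phi>2 u \<omega> + \<delta>\<^sup>2 / 2 * process \<phi>3 u \<omega>)"
    unfolding \<rho>_def using mean_diff[OF p uv(1) m\<nu> m\<mu>, of 1 "-1"] by (simp add: e\<mu> e\<nu>)
  have b\<rho>: "\<bar>\<rho> x\<bar> \<le> \<epsilon> * \<bar>\<delta>\<bar> ^ 2 + C' * \<bar>\<delta>\<bar> ^ 3" for x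
    using C'[unfolded second_order_def, rule_format, of \<delta> x] by (simp add: \<rho>_def \<mu>_def \<nu>_def algebra_simps)
  have "\<bar>mean ?p \<rho> u\<bar> \<le> F0 * (\<epsilon> * \<bar>\<delta>\<bar> ^ 2 + C' * \<bar>\<delta>\<bar> ^ 3) * L\<^sup>2"
  proof (rule mean_bound[OF p uv(1) _ _ b\<rho>])
    show "periodic2 L \<rho>" using m\<mu>(1) m\<nu>(1) by (simp add: \<rho>_def periodic2_def)
    show "\<rho> \<in> borel_measurable borel" unfolding \<rho>_def[abs_def] using m\<mu>(2) m\<nu>(2) by measurable
  qed
  then have 1: "\<bar>mean ?p \<rho> u\<bar> \<le> F0 * L\<^sup>2 * \<epsilon> * \<bar>\<delta>\<bar> ^ 2 + F0 * L\<^sup>2 * C' * \<bar>\<delta>\<bar> ^ 3"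
    by (simp add: algebra_simps)
  have 2: "\<bar>process \<phi>1 v \<omega> - mean ?p ?\<phi>1' u - (LINT s:{u..v}|lborel. gen \<phi>1 D\<phi>1 ?p s)\<bar> \<le> dbound T * eta_integral 1 u v \<omega>"
    using drift_process(2)[OF uv \<omega>] by (simp add: \<delta>_def)
  have "(LINT s:{0..v}|lborel. gen \<phi>1 D\<phi>1 ?p s) = (LINT s:{0..u}|lborel. gen \<phi>1 D\<phi>1 ?p s) + (LINT s:{u..v}|lborel. gen \<phi>1 D\<phi>1 ?p s)"
    by (rule set_integral_combine[symmetric, OF gen_continuous[OF p test1]]) (use uv in auto)
  then have "ito_error u v \<omega> = (process \<phi>1 v \<omega> - mean ?p ?\<phi>1' u - (LINT s:{u..v}|lborel. gen \<phi>1 D\<phi>1 ?p s)) + mean ?p \<rho> u"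
    by (simp add: ito_error_def compensated_def e\<rho> flip: \<delta>_def)
  then show ?thesis using 1 2 unfolding \<delta>_def by linarith
qed

lemma ito_error_expectation:
  assumes \<epsilon>: "0 \<le> \<epsilon>" and C': "0 \<le> C'" "second_order \<epsilon> C'"
    and uv: "0 \<le> u" "u \<le> v" "v \<le> T" "v - u \<le> 1"
  shows "(\<integral>\<^sup>+\<omega>. ennreal \<bar>ito_error u v \<omega>\<bar> \<partial>M) \<le> ennreal (F0 * L\<^sup>2 * gauss_exp 2 * \<epsilon> * (v - u)
     + (dbound T * gauss_exp (1 + K) + F0 * L\<^sup>2 * C' * gauss_exp 3) * ((v - u) * sqrt (v - u)))"
proof -
  let ?h = "v - u" and ?d = "\<lambda>\<omega>. \<bar>W v \<omega> - W u \<omega>\<bar>"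
  have h: "0 \<le> ?h" "?h \<le> 1" using uv by auto
  note sq = sqrt_powers[OF h]
  have [measurable]: "W v \<in> borel_measurable M" "W u \<in> borel_measurable M" using uv by (auto intro: W_measurable)
  note nn = gauss_exp_pos[THEN less_imp_le] dbound_nonneg eta_integral_nonneg F0_nonneg h \<epsilon> C'(1)
  have dn: "(\<integral>\<^sup>+\<omega>. ennreal (?d \<omega> ^ n) \<partial>M) \<le> ennreal (sqrt ?h ^ n * gauss_exp (real n))" if "0 < n" for n
    by (rule increment_power_bound[OF uv(1,2) that])
  have en: "(\<integral>\<^sup>+\<omega>. ennreal (eta_integral n u v \<omega>) \<partial>M) \<le> ennreal (?h * (sqrt ?h ^ n * gauss_exp (real n * (1 + K))))" if "0 < n" for n
    by (rule eta_integral_nn_bound[OF uv(1,2,4) that])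
  have ms: "(\<lambda>\<omega>. c * ?d \<omega> ^ n) \<in> borel_measurable M" "(\<lambda>\<omega>. ?d \<omega> ^ n) \<in> borel_measurable M" for c n by measurable
  have me: "(\<lambda>\<omega>. c * eta_integral n u v \<omega>) \<in> borel_measurable M" for c n
    using eta_integral_measurable by measurable
  have pd: "0 \<le> ?d \<omega> ^ n" "0 \<le> sqrt ?h ^ n" for \<omega> n using h by auto
  have "(\<integral>\<^sup>+\<omega>. ennreal \<bar>ito_error u v \<omega>\<bar> \<partial>M)
      \<le> (\<integral>\<^sup>+\<omega>. ennreal (dbound T * eta_integral 1 u v \<omega> + (F0 * L\<^sup>2 * \<epsilon> * ?d \<omega> ^ 2 + F0 * L\<^sup>2 * C' * ?d \<omega> ^ 3)) \<partial>M)"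
    by (intro nn_integral_mono ennreal_leI ito_error_bound[OF C'(2)] uv)
  also have "\<dots> \<le> ennreal (dbound T * (?h * (sqrt ?h ^ 1 * gauss_exp (real 1 * (1 + K))))
      + (F0 * L\<^sup>2 * \<epsilon> * (sqrt ?h ^ 2 * gauss_exp (real 2)) + F0 * L\<^sup>2 * C' * (sqrt ?h ^ 3 * gauss_exp (real 3))))"
    by (intro nn_integral_add_real nn_integral_cmult_real dn en add_nonneg_nonneg mult_nonneg_nonneg nn pd
        borel_measurable_add ms me eta_integral_measurable zero_less_one zero_less_numeral zero_le_power2)
  also have "dbound T * (?h * (sqrt ?h ^ 1 * gauss_exp (real 1 * (1 + K))))
      + (F0 * L\<^sup>2 * \<epsilon> * (sqrt ?h ^ 2 * gauss_exp (real 2)) + F0 * L\<^sup>2 * C' * (sqrt ?h ^ 3 * gauss_exp (real 3)))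
      = F0 * L\<^sup>2 * gauss_exp 2 * \<epsilon> * ?h + (dbound T * gauss_exp (1 + K) + F0 * L\<^sup>2 * C' * gauss_exp 3) * (?h * sqrt ?h)"
    unfolding sq(1,2) by (simp add: algebra_simps)
  finally show ?thesis .
qed

lemma expectation_abs_le:
  assumes Y: "integrable M Y" and A: "(\<integral>\<^sup>+\<omega>. ennreal \<bar>Y \<omega>\<bar> \<partial>M) \<le> ennreal A" "0 \<le> A"
  shows "\<bar>expectation Y\<bar> \<le> A"
proof -
  have "\<bar>expectation Y\<bar> \<le> expectation (\<lambda>\<omega>. \<bar>Y \<omega>\<bar>)" by (rule integral_abs_bound)
  moreover have "ennreal (expectation (\<lambda>\<omega>. \<bar>Y \<omega>\<bar>)) \<le> ennreal A"
    using nn_integral_eq_integral[OF integrable_abs[OF Y]] A(1) by simp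
  ultimately show ?thesis using A(2) by (simp only: ennreal_le_iff)
qed

context
  fixes B a b
  assumes a: "0 \<le> a" and ab: "a \<le> b" and B: "B \<in> sets (\<F> a)"
begin

text \<open>The martingale property is read off from the differential equation \<open>Gf' = qf / 2\<close>.\<close>

definition Gf :: "real \<Rightarrow> real" where "Gf t = expectation (\<lambda>\<omega>. indicator B \<omega> * compensated t \<omega>)"
definition qf :: "real \<Rightarrow> real" where "qf t = expectation (\<lambda>\<omega>. indicator B \<omega> * process \<phi>3 t \<omega>)"

lemma B_events: "B \<in> events"
  using B subalg[OF a] by (auto simp: subalgebra_def)

lemma indicator_product_integrable:
  fixes Y :: "'a \<Rightarrow> real"
  assumes "Y \<in> borel_measurable M" "\<And>\<omega>. \<omega> \<in> space M \<Longrightarrow> \<bar>Y \<omega>\<bar> \<le> c"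
  shows "integrable M (\<lambda>\<omega>. indicator B \<omega> * Y \<omega>)"
proof (rule integrable_const_bound[OF AE_I2])
  show "norm (indicator B \<omega> * Y \<omega>) \<le> c" if "\<omega> \<in> space M" for \<omega>
    using assms(2)[OF that] by (auto simp: indicator_def intro: order_trans[OF abs_ge_zero])
  show "(\<lambda>\<omega>. indicator B \<omega> * Y \<omega>) \<in> borel_measurable M"
    using B_events assms(1) by measurable
qed

text \<open>Both \<open>B\<close> and the coefficients are known at time \<open>u\<close>, so the
  linear term of the expansion has expectation zero and the squared increment contributes its
  variance \<open>v - u\<close>; the rest is the expected \<open>ito_error\<close>.\<close>

lemma Gf_step:
  assumes \<epsilon>: "0 \<le> \<epsilon>" and C': "0 \<le> C'" "second_order \<epsilon> C'"
    and uv: "a \<le> u" "u \<le> v" "v \<le> b" "v - u \<le> 1"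
  shows "\<bar>Gf v - Gf u - (v - u) / 2 * qf u\<bar> \<le> F0 * L\<^sup>2 * gauss_exp 2 * \<epsilon> * (v - u)
     + (dbound b * gauss_exp (1 + K) + F0 * L\<^sup>2 * C' * gauss_exp 3) * ((v - u) * sqrt (v - u))"
proof (cases "u = v")
  case False
  then have lt: "0 \<le> u" "u < v" using a uv by auto
  let ?\<delta> = "\<lambda>\<omega>. W v \<omega> - W u \<omega>"
  note Bm[measurable] = B_events
  have Bu: "B \<in> sets (\<F> u)" using B mono[OF a uv(1)] by auto
  have [measurable]: "W v \<in> borel_measurable M" "W u \<in> borel_measurable M" using lt by (auto intro: W_measurable)
  note [measurable] = process_measurable_M[OF lt(1)]
  have cm[measurable]: "compensated t \<in> borel_measurable M" if "0 \<le> t" for t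
    by (rule F_measurable_M[OF that compensated_adapted[OF that]])
  have x2: "(\<lambda>\<omega>. indicator B \<omega> * process \<phi>2 u \<omega>) \<in> borel_measurable (\<F> u)"
    "(\<lambda>\<omega>. indicator B \<omega> * process \<phi>3 u \<omega>) \<in> borel_measurable (\<F> u)"
    using Bu process_adapted[OF lt(1)] measurable0123(3,4) by measurable
  have b2: "\<bar>indicator B \<omega> * process \<phi>2 u \<omega>\<bar> \<le> F0 * C * L\<^sup>2" "\<bar>indicator B \<omega> * process \<phi>3 u \<omega>\<bar> \<le> F0 * C * L\<^sup>2"
    if "\<omega> \<in> space M" for \<omega>
    using process_bound(3,4)[OF lt(1) that] by (auto simp: indicator_def intro: order_trans[OF abs_ge_zero])
  note mom = increment_moments[OF lt]
  have "(\<lambda>x. x) \<in> borel_measurable (borel :: real measure)" "(\<lambda>x. x\<^sup>2) \<in> borel_measurable (borel :: real measure)" by auto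
  note e1 = expectation_increment[OF lt x2(1) b2(1) this(1) mom(1)]
    and e2 = expectation_increment[OF lt x2(2) b2(2) this(2) mom(3)]
  have i1: "integrable M (\<lambda>\<omega>. indicator B \<omega> * compensated v \<omega>)"
    by (rule indicator_product_integrable[OF cm compensated_bound]) (use lt in auto)
  have i2: "integrable M (\<lambda>\<omega>. indicator B \<omega> * compensated u \<omega>)"
    by (rule indicator_product_integrable[OF cm compensated_bound]) (use lt in auto)
  define R where "R \<omega> = indicator B \<omega> * compensated v \<omega> - indicator B \<omega> * compensated u \<omega>
    - (indicator B \<omega> * process \<phi>2 u \<omega>) * ?\<delta> \<omega> - (indicator B \<omega> * process \<phi>3 u \<omega>) * (?\<delta> \<omega>)\<^sup>2 / 2" for \<omega>
  have iR: "integrable M R" unfolding R_def[abs_def] using i1 i2 e1(1) e2(1) by simp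
  have "expectation R = Gf v - Gf u - expectation (\<lambda>\<omega>. indicator B \<omega> * process \<phi>2 u \<omega>) * expectation ?\<delta>
      - qf u * expectation (\<lambda>\<omega>. (?\<delta> \<omega>)\<^sup>2) / 2"
    unfolding R_def Gf_def qf_def using i1 i2 e1 e2 by simp
  then have ER: "expectation R = Gf v - Gf u - (v - u) / 2 * qf u" by (simp add: mom)
  have RI: "R \<omega> = indicator B \<omega> * ito_error u v \<omega>" for \<omega>
    by (simp add: R_def ito_error_def algebra_simps)
  have "(\<integral>\<^sup>+\<omega>. ennreal \<bar>R \<omega>\<bar> \<partial>M) \<le> (\<integral>\<^sup>+\<omega>. ennreal \<bar>ito_error u v \<omega>\<bar> \<partial>M)"
    by (intro nn_integral_mono ennreal_leI) (auto simp: RI indicator_def)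
  also note ito_error_expectation[OF \<epsilon> C' lt(1) less_imp_le[OF lt(2)] uv(3,4)]
  finally show ?thesis
    unfolding ER[symmetric]
    using \<epsilon> C'(1) lt F0_nonneg gauss_exp_pos[THEN less_imp_le] dbound_nonneg
    by (intro expectation_abs_le[OF iR]) (auto intro!: add_nonneg_nonneg mult_nonneg_nonneg)
qed simp

lemma qf_continuous: "continuous_on {0..} qf"
proof (rule continuous_on_sequentiallyI)
  fix r :: "nat \<Rightarrow> real" and s assume r: "\<forall>n. r n \<in> {0..}" and s: "s \<in> {0..}" and lim: "r \<longlonglongrightarrow> s"
  note [measurable] = B_events
  have m: "(\<lambda>\<omega>. indicator B \<omega> * process \<phi>3 t \<omega>) \<in> borel_measurable M" if "0 \<le> t" for t
    using process_measurable_M(4)[OF that] by measurable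
  show "(\<lambda>n. qf (r n)) \<longlonglongrightarrow> qf s"
    unfolding qf_def
  proof (rule integral_dominated_convergence[where w = "\<lambda>_. F0 * C * L\<^sup>2"])
    show "AE \<omega> in M. (\<lambda>n. indicator B \<omega> * process \<phi>3 (r n) \<omega>) \<longlonglongrightarrow> indicator B \<omega> * process \<phi>3 s \<omega>"
    proof (rule AE_I2)
      fix \<omega> assume "\<omega> \<in> space M"
      then have "(\<lambda>n. process \<phi>3 (r n) \<omega>) \<longlonglongrightarrow> process \<phi>3 s \<omega>"
        using continuous_on_tendsto_compose[OF process_continuous(2) lim] r s by auto
      then show "(\<lambda>n. indicator B \<omega> * process \<phi>3 (r n) \<omega>) \<longlonglongrightarrow> indicator B \<omega> * process \<phi>3 s \<omega>"
        by (intro tendsto_intros)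
    qed
    show "AE \<omega> in M. norm (indicator B \<omega> * process \<phi>3 (r n) \<omega>) \<le> F0 * C * L\<^sup>2" for n
    proof (rule AE_I2)
      fix \<omega> assume "\<omega> \<in> space M"
      then show "norm (indicator B \<omega> * process \<phi>3 (r n) \<omega>) \<le> F0 * C * L\<^sup>2"
        using process_bound(4)[of "r n" \<omega>] r by (auto simp: indicator_def intro: order_trans[OF abs_ge_zero])
    qed
  qed (use m r s in auto)
qed

text \<open>The step estimate is o(h), because \<epsilon> may be chosen after the target accuracy
  \<open>e\<close>. A differential equation thus replaces the summation over partitions.\<close>

lemma Gf_deriv:
  assumes t: "t \<in> {a..b}"
  shows "(Gf has_vector_derivative qf t / 2) (at t within {a..b})"
  unfolding has_vector_derivative_def has_derivative_within_alt
proof (intro conjI allI impI)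
  show "bounded_linear (\<lambda>x. x *\<^sub>R (qf t / 2))" by (rule bounded_linear_scaleR_left)
  fix e :: real assume e: "0 < e"
  let ?g = "F0 * L\<^sup>2 * gauss_exp 2"
  have g: "0 \<le> ?g" using F0_nonneg gauss_exp_pos by (simp add: less_imp_le)
  have quarter: "x * (e / (4 * x)) = e / 4" if "x \<noteq> 0" for x :: real using that by simp
  define \<epsilon> where "\<epsilon> = e / (4 * (?g + 1))"
  have \<epsilon>: "\<epsilon> > 0" "?g * \<epsilon> \<le> e / 4"
  proof -
    show "\<epsilon> > 0" using e g by (simp add: \<epsilon>_def add_nonneg_pos)
    have "?g * \<epsilon> \<le> (?g + 1) * \<epsilon>" using \<open>\<epsilon> > 0\<close> by (simp add: distrib_right)
    also have "\<dots> = e / 4" unfolding \<epsilon>_def using g by (intro quarter) simp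
    finally show "?g * \<epsilon> \<le> e / 4" .
  qed
  obtain C' where C': "0 \<le> C'" "second_order \<epsilon> C'"
    using second_order_remainder[OF \<epsilon>(1)] by blast
  define c where "c = dbound b * gauss_exp (1 + K) + F0 * L\<^sup>2 * C' * gauss_exp 3"
  have c: "0 \<le> c"
    unfolding c_def using dbound_nonneg[of b] C'(1) F0_nonneg gauss_exp_pos[THEN less_imp_le] by simp
  define d1 where "d1 = min 1 ((e / (4 * (c + 1)))\<^sup>2)"
  have d1: "d1 > 0" using e c by (simp add: d1_def)
  have step: "\<bar>Gf v - Gf u - (v - u) / 2 * qf u\<bar> \<le> e / 2 * (v - u)" if uv: "a \<le> u" "u \<le> v" "v \<le> b" "v - u \<le> d1" for u v
  proof -
    have "sqrt (v - u) \<le> sqrt ((e / (4 * (c + 1)))\<^sup>2)" using uv by (intro real_sqrt_le_mono) (simp add: d1_def)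
    also have "\<dots> = e / (4 * (c + 1))" using e c by simp
    finally have "(c + 1) * sqrt (v - u) \<le> (c + 1) * (e / (4 * (c + 1)))" using c by (intro mult_left_mono) auto
    also have "\<dots> = e / 4" using c by (intro quarter) simp
    finally have "c * sqrt (v - u) \<le> e / 4" using uv by (simp add: distrib_right) (smt (verit) real_sqrt_ge_zero)
    then have "c * sqrt (v - u) * (v - u) \<le> e / 4 * (v - u)" using uv by (intro mult_right_mono) auto
    then have "c * ((v - u) * sqrt (v - u)) \<le> e / 4 * (v - u)" by (simp only: ac_simps)
    moreover have "?g * \<epsilon> * (v - u) \<le> e / 4 * (v - u)" using uv \<epsilon>(2) by (intro mult_right_mono) auto
    moreover have "v - u \<le> 1" using uv by (simp add: d1_def)
    ultimately show ?thesis
      using Gf_step[OF less_imp_le[OF \<epsilon>(1)] C' uv(1,2,3)] unfolding c_def[symmetric] by linarith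
  qed
  have "continuous_on {a..b} qf" by (rule continuous_on_subset[OF qf_continuous]) (use a in auto)
  then obtain d2 where d2: "d2 > 0" "\<And>y. y \<in> {a..b} \<Longrightarrow> dist y t < d2 \<Longrightarrow> dist (qf y) (qf t) < e"
    unfolding continuous_on_iff using t e by metis
  show "\<exists>d>0. \<forall>y\<in>{a..b}. norm (y - t) < d \<longrightarrow> norm (Gf y - Gf t - (y - t) *\<^sub>R (qf t / 2)) \<le> e * norm (y - t)"
  proof (intro exI[of _ "min d1 d2"] conjI ballI impI)
    show "0 < min d1 d2" using d1 d2 by simp
    fix y assume y: "y \<in> {a..b}" and n: "norm (y - t) < min d1 d2"
    show "norm (Gf y - Gf t - (y - t) *\<^sub>R (qf t / 2)) \<le> e * norm (y - t)"
    proof (cases "t \<le> y")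
      case True
      have "\<bar>Gf y - Gf t - (y - t) / 2 * qf t\<bar> \<le> e / 2 * (y - t)" using t y n True by (intro step) auto
      also have "\<dots> \<le> e * (y - t)" using e True by (intro mult_right_mono) auto
      finally show ?thesis using True by simp
    next
      case False
      \<comment> \<open>To the left of \<open>t\<close> the step starts at \<open>y\<close>, so
        \<open>qf y\<close> appears instead of \<open>qf t\<close>; continuity of \<open>qf\<close>
        makes up the difference.\<close>
      have 1: "\<bar>Gf t - Gf y - (t - y) / 2 * qf y\<bar> \<le> e / 2 * (t - y)" using t y n False by (intro step) auto
      have "\<bar>qf y - qf t\<bar> \<le> e" using d2(2)[OF y] n by (auto simp: dist_norm)
      then have 2: "\<bar>(t - y) / 2 * (qf y - qf t)\<bar> \<le> (t - y) / 2 * e"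
        unfolding abs_mult using False by (intro mult_mono) auto
      have "Gf y - Gf t - (y - t) *\<^sub>R (qf t / 2) = - (Gf t - Gf y - (t - y) / 2 * qf y) - (t - y) / 2 * (qf y - qf t)"
        by (simp add: field_simps)
      then have "norm (Gf y - Gf t - (y - t) *\<^sub>R (qf t / 2)) \<le> e / 2 * (t - y) + (t - y) / 2 * e"
        using 1 2 by (simp only: real_norm_def)
      also have "\<dots> = e * norm (y - t)" using False by (simp add: algebra_simps)
      finally show ?thesis .
    qed
  qed
qed

text \<open>Integrating the differential equation and exchanging expectation with the time integral
  shows that the gain of \<open>compensated\<close> on \<open>B\<close> equals the expected Ito
  correction, which \<open>mart\<close> subtracts.\<close>

lemma mart_set_integral: "(\<integral>\<omega>\<in>B. mart b \<omega> \<partial>M) = (\<integral>\<omega>\<in>B. mart a \<omega> \<partial>M)"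
proof -
  note [measurable] = B_events
  have qc: "continuous_on {a..b} (\<lambda>t. qf t / 2)"
    by (intro continuous_intros continuous_on_subset[OF qf_continuous]) (use a in auto)
  have "((\<lambda>t. qf t / 2) has_integral (Gf b - Gf a)) {a..b}"
    by (rule fundamental_theorem_of_calculus[OF ab Gf_deriv])
  from integral_unique[OF this] have 1: "(LINT t:{a..b}|lborel. qf t / 2) = Gf b - Gf a"
    using set_borel_integral_eq_integral(2)[OF borel_integrable_atLeastAtMost'[OF qc]] by (simp only:)
  have sw: "(\<lambda>w. (snd w, fst w)) \<in> measurable (borel \<Otimes>\<^sub>M M) (M \<Otimes>\<^sub>M (borel :: real measure))" by measurable
  have pj: "(\<lambda>w. process \<phi>3 (fst w) (snd w)) \<in> borel_measurable (borel \<Otimes>\<^sub>M M)"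
    using measurable_compose[OF sw process_joint[OF measurable0123(4)]] by simp
  have "(LINT t:{a..b}|lborel. qf t / 2) = (LINT t:{a..b}|lborel. (\<integral>\<omega>. indicator B \<omega> * process \<phi>3 t \<omega> / 2 \<partial>M))"
    by (simp add: qf_def)
  also have "\<dots> = (\<integral>\<omega>. (LINT t:{a..b}|lborel. indicator B \<omega> * process \<phi>3 t \<omega> / 2) \<partial>M)"
  proof (rule set_integral_fubini[OF finite_measure_axioms, where C = "F0 * C * L\<^sup>2"])
    show "(\<lambda>w. indicator B (snd w) * process \<phi>3 (fst w) (snd w) / 2) \<in> borel_measurable (borel \<Otimes>\<^sub>M M)"
      using pj by measurable
    show "\<bar>indicator B \<omega> * process \<phi>3 s \<omega> / 2\<bar> \<le> F0 * C * L\<^sup>2" if "s \<in> {a..b}" "\<omega> \<in> space M" for s \<omega>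
      using process_bound(4)[of s \<omega>] that a by (auto simp: indicator_def abs_le_iff)
  qed
  also have "\<dots> = (\<integral>\<omega>. indicator B \<omega> * ((LINT t:{a..b}|lborel. process \<phi>3 t \<omega>) / 2) \<partial>M)"
    by (simp add: set_integral_mult_right set_integral_divide_zero)
  finally have 2: "Gf b - Gf a = (\<integral>\<omega>. indicator B \<omega> * ((LINT t:{a..b}|lborel. process \<phi>3 t \<omega>) / 2) \<partial>M)"
    using 1 by simp
  have b: "0 \<le> b" using a ab by simp
  have comp: "(LINT s:{0..b}|lborel. process \<phi>3 s \<omega>) = (LINT s:{0..a}|lborel. process \<phi>3 s \<omega>) + (LINT s:{a..b}|lborel. process \<phi>3 s \<omega>)"
    if "\<omega> \<in> space M" for \<omega>
    by (rule set_integral_combine[symmetric, OF process_continuous(2)[OF that] order_refl a ab])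
  have i: "integrable M (\<lambda>\<omega>. indicator B \<omega> * mart t \<omega>)" "integrable M (\<lambda>\<omega>. indicator B \<omega> * compensated t \<omega>)" if "0 \<le> t" for t
    by (rule indicator_product_integrable[OF F_measurable_M[OF that]], rule mart_adapted[OF that], rule mart_bound[OF that], assumption)
       (rule indicator_product_integrable[OF F_measurable_M[OF that]], rule compensated_adapted[OF that], rule compensated_bound[OF that])
  have im: "integrable M (\<lambda>\<omega>. indicator B \<omega> * ((LINT t:{a..b}|lborel. process \<phi>3 t \<omega>) / 2))"
  proof (rule indicator_product_integrable)
    show "(\<lambda>\<omega>. (LINT t:{a..b}|lborel. process \<phi>3 t \<omega>) / 2) \<in> borel_measurable M"
      using F_measurable_M[OF b process_integral_adapted[OF a ab measurable0123(4)]] by measurable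
    show "\<bar>(LINT t:{a..b}|lborel. process \<phi>3 t \<omega>) / 2\<bar> \<le> F0 * C * L\<^sup>2 * (b - a)" if "\<omega> \<in> space M" for \<omega>
      using generator_integral_bound(2)[OF a ab order_refl that] by (simp add: abs_le_iff)
  qed
  have "(\<integral>\<omega>. indicator B \<omega> * mart b \<omega> \<partial>M) - (\<integral>\<omega>. indicator B \<omega> * mart a \<omega> \<partial>M)
      = (\<integral>\<omega>. indicator B \<omega> * mart b \<omega> - indicator B \<omega> * mart a \<omega> \<partial>M)"
    using i(1)[OF a] i(1)[OF b] by simp
  also have "\<dots> = (\<integral>\<omega>. indicator B \<omega> * compensated b \<omega> - indicator B \<omega> * compensated a \<omega>
      - indicator B \<omega> * ((LINT t:{a..b}|lborel. process \<phi>3 t \<omega>) / 2) \<partial>M)"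
    by (rule Bochner_Integration.integral_cong[OF refl]) (simp add: mart_def comp field_simps)
  also have "\<dots> = Gf b - Gf a - (\<integral>\<omega>. indicator B \<omega> * ((LINT t:{a..b}|lborel. process \<phi>3 t \<omega>) / 2) \<partial>M)"
    unfolding Gf_def using i(2)[OF a] i(2)[OF b] im by simp
  finally show ?thesis using 2 by (simp add: set_lebesgue_integral_def)
qed

end

text \<open>The deterministic times \<open>n\<close> serve as localizing sequence, so the stopped
  process is the martingale itself up to time \<open>n\<close>.\<close>

lemma mart_martingale: "martingale M \<F> (\<lambda>t \<omega>. mart (min t (real n)) \<omega> - mart 0 \<omega>)"
  unfolding martingale_def adapted_def
proof (intro conjI allI impI)
  let ?N = "\<lambda>t \<omega>. mart (min t (real n)) \<omega> - mart 0 \<omega>"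
  have ad: "?N t \<in> borel_measurable (\<F> t)" if t: "0 \<le> t" for t
    by (intro borel_measurable_diff F_mono_measurable[OF _ _ mart_adapted]) (use t in auto)
  have int: "integrable M (?N t)" if "0 \<le> t" for t
    using mart_integrable that by (intro Bochner_Integration.integrable_diff) auto
  show "?N t \<in> borel_measurable (\<F> t)" "integrable M (?N t)" if "0 \<le> t" for t using ad int that by auto
  fix s t :: real assume s: "0 \<le> s" and st: "s \<le> t"
  interpret sub: sigma_finite_subalgebra M "\<F> s"
  proof -
    interpret fin: finite_measure_subalgebra M "\<F> s" by unfold_locales (rule subalg[OF s])
    show "sigma_finite_subalgebra M (\<F> s)" by unfold_locales
  qed
  show "AE \<omega> in M. real_cond_exp M (\<F> s) (?N t) \<omega> = ?N s \<omega>"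
  proof (rule sub.real_cond_exp_charact)
    show "integrable M (?N t)" "integrable M (?N s)" "?N s \<in> borel_measurable (\<F> s)" using int ad s st by auto
    fix A assume A: "A \<in> sets (\<F> s)"
    have AM: "A \<in> events" using A subalg[OF s] by (auto simp: subalgebra_def)
    have eq: "(\<integral>\<omega>\<in>A. mart (min t n) \<omega> \<partial>M) = (\<integral>\<omega>\<in>A. mart (min s n) \<omega> \<partial>M)"
    proof (cases "real n \<le> s")
      case True
      then show ?thesis using st by simp
    next
      case False
      then have "min s (real n) = s" "s \<le> min t (real n)" using st by auto
      then show ?thesis using mart_set_integral[OF s _ A, of "min t (real n)"] by simp
    qed
    have si: "set_integrable M A (mart r)" if "0 \<le> r" for r
      unfolding set_integrable_def using mart_integrable[OF that] AM by (rule integrable_mult_indicator[rotated])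
    show "(\<integral>\<omega>\<in>A. ?N t \<omega> \<partial>M) = (\<integral>\<omega>\<in>A. ?N s \<omega> \<partial>M)"
      using s st by (simp add: set_integral_diff(2)[OF si si] eq)
  qed
qed

lemma process_semimartingale: "continuous_semimartingale M \<F> (process \<phi>1)"
  unfolding continuous_semimartingale_def
proof (rule exI[of _ mart], rule exI[of _ fv_part], intro conjI allI impI)
  have lc: "continuous_on {0..} (\<lambda>t. LINT s:{0..t}|lborel. gen \<phi>1 D\<phi>1 (bpath \<omega>) s)"
      "continuous_on {0..} (\<lambda>t. LINT s:{0..t}|lborel. process \<phi>3 s \<omega>)" if "\<omega> \<in> space M" for \<omega>
    by (rule set_integral_upto_continuous, rule gen_continuous[OF bpath_continuous[OF that] test1] process_continuous(2)[OF that])+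
  have mc: "continuous_paths M mart"
    unfolding continuous_paths_def mart_def compensated_def
    by (intro AE_I2 continuous_intros lc process_continuous) auto
  have fc: "continuous_paths M fv_part"
    unfolding continuous_paths_def fv_part_def
    by (intro AE_I2 continuous_intros lc process_continuous) auto
  show "continuous_paths M fv_part" by (rule fc)
  show "adapted \<F> fv_part" by (simp add: adapted_def fv_part_adapted)
  show "AE \<omega> in M. process \<phi>1 t \<omega> = mart t \<omega> + fv_part t \<omega>" for t by (simp add: decomposition)
  show "AE \<omega> in M. finite_variation (\<lambda>t. fv_part t \<omega>)"
  proof (rule AE_I2)
    fix \<omega> assume \<omega>: "\<omega> \<in> space M"
    show "finite_variation (\<lambda>t. fv_part t \<omega>)"
      unfolding finite_variation_def
    proof (intro allI impI)
      fix t :: real assume t: "0 \<le> t"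
      \<comment> \<open>A Lipschitz constant of the finite-variation part on times up to
        \<open>t\<close>; the total variation is then at most \<open>c * t\<close>.\<close>
      define c where "c = gbound t + F0 * C * L\<^sup>2"
      have lip: "\<bar>fv_part v \<omega> - fv_part u \<omega>\<bar> \<le> c * (v - u)" if uv: "0 \<le> u" "u \<le> v" "v \<le> t" for u v
      proof -
        note g = set_integral_combine[OF gen_continuous[OF bpath_continuous[OF \<omega>] test1] order_refl uv(1,2)]
          and q = set_integral_combine[OF process_continuous(2)[OF \<omega>] order_refl uv(1,2)]
        have "fv_part v \<omega> - fv_part u \<omega> = (LINT s:{u..v}|lborel. gen \<phi>1 D\<phi>1 (bpath \<omega>) s) + (LINT s:{u..v}|lborel. process \<phi>3 s \<omega>) / 2"
          using g q by (simp add: fv_part_def field_simps)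
        then show ?thesis
          using generator_integral_bound[OF uv \<omega>] unfolding c_def distrib_right by linarith
      qed
      have "(\<Sum>i<n. \<bar>fv_part (p (Suc i)) \<omega> - fv_part (p i) \<omega>\<bar>) \<le> c * t" if p: "partition_points t n p" for n p
      proof -
        have "(\<Sum>i<n. \<bar>fv_part (p (Suc i)) \<omega> - fv_part (p i) \<omega>\<bar>) \<le> (\<Sum>i<n. c * (p (Suc i) - p i))"
        proof (intro sum_mono lip)
          fix i assume "i \<in> {..<n}"
          then show "0 \<le> p i" "p i \<le> p (Suc i)" "p (Suc i) \<le> t"
            using partition_points_bounds[OF p] p by (auto simp: partition_points_def)
        qed
        also have "\<dots> = c * t"
          using partition_points_sum[OF p, of "\<lambda>u v. v - u"] by (simp flip: sum_distrib_left)
        finally show ?thesis .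
      qed
      then show "\<exists>C. \<forall>n p. partition_points t n p \<longrightarrow> (\<Sum>i<n. \<bar>fv_part (p (Suc i)) \<omega> - fv_part (p i) \<omega>\<bar>) \<le> C" by blast
    qed
  qed
  show "continuous_local_martingale M \<F> mart"
    unfolding continuous_local_martingale_def
  proof (intro conjI exI[of _ "\<lambda>n \<omega>. real n"])
    show "adapted \<F> mart" by (simp add: adapted_def mart_adapted)
    show "AE \<omega> in M. incseq (\<lambda>n. real n) \<and> filterlim (\<lambda>n. real n) at_top sequentially"
      by (auto simp: incseq_def filterlim_real_sequentially)
  qed (auto intro: mc mart_martingale)
qed

theorem process_stratonovich:
  assumes t: "0 \<le> t"
  shows "has_stratonovich_integral M \<F> W (process \<phi>1) t (strat_limit t)"
  unfolding has_stratonovich_integral_def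
  using process_semimartingale strat_limit_measurable[OF t] trapezoid_convergence[OF t] by blast

end

end

section \<open>Functions of class \<open>C^k\<close>\<close>

lemma Ck_SucD: "Ck_on (Suc k) UNIV f \<Longrightarrow> Ck_on k UNIV f"
proof (induction k arbitrary: f)
  case 0
  then show ?case by (simp add: differentiable_imp_continuous_on)
next
  case (Suc k)
  from Suc.prems have d: "f differentiable_on UNIV" "\<And>v. Ck_on (Suc k) UNIV (\<lambda>x. fderiv f x v)"
    by (simp_all del: Ck_on.simps(2) add: Ck_on.simps(2)[of "Suc k"])
  then show ?case using Suc.IH by simp
qed

lemma Ck_le: "m \<le> k \<Longrightarrow> Ck_on k UNIV f \<Longrightarrow> Ck_on m UNIV f"
  by (induction k rule: nat_induct) (auto simp: le_Suc_eq simp del: Ck_on.simps dest: Ck_SucD)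

lemma Ck_continuous: "Ck_on k UNIV f \<Longrightarrow> continuous_on S f"
  using Ck_le[of 0 k f] by (auto intro: continuous_on_subset)

lemma Ck_deriv: "Ck_on (Suc k) UNIV f \<Longrightarrow> (f has_derivative fderiv f x) (at x)"
  by (auto simp: differentiable_on_def frechet_derivative_works)

lemma Ck_frechet: "Ck_on (Suc k) UNIV f \<Longrightarrow> Ck_on k UNIV (\<lambda>x. fderiv f x v)"
  by simp

lemma Ck_SucI:
  assumes der: "\<And>x. (f has_derivative f' x) (at x)" and Ck: "\<And>v. Ck_on k UNIV (\<lambda>x. f' x v)"
  shows "Ck_on (Suc k) UNIV f"
proof -
  have "fderiv f x = f' x" for x using frechet_derivative_at[OF der] by simp
  then show ?thesis using der Ck by (auto simp: differentiable_on_def differentiable_def)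
qed

lemma Ck_const: "Ck_on k UNIV (\<lambda>x. c)"
  by (induction k arbitrary: c) simp_all

lemma Ck_add: "Ck_on k UNIV f \<Longrightarrow> Ck_on k UNIV g \<Longrightarrow> Ck_on k UNIV (\<lambda>x. f x + g x)"
proof (induction k arbitrary: f g)
  case (Suc k)
  show ?case
    by (rule Ck_SucI[OF has_derivative_add[OF Ck_deriv Ck_deriv]])
       (rule Suc.prems Suc.IH Ck_frechet)+
qed (simp add: continuous_on_add)

lemma Ck_mult: "Ck_on k UNIV f \<Longrightarrow> Ck_on k UNIV g \<Longrightarrow> Ck_on k UNIV (\<lambda>x. f x * g x)"
proof (induction k arbitrary: f g)
  case (Suc k)
  have "Ck_on k UNIV (\<lambda>x. f x * fderiv g x v + fderiv f x v * g x)" for v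
    by (intro Ck_add Suc.IH Ck_frechet Suc.prems Ck_SucD)
  then show ?case by (rule Ck_SucI[OF has_derivative_mult[OF Ck_deriv[OF Suc.prems(1)] Ck_deriv[OF Suc.prems(2)]]])
qed (simp add: continuous_on_mult)

lemma Ck_minus: "Ck_on k UNIV f \<Longrightarrow> Ck_on k UNIV (\<lambda>x. - f x)"
  using Ck_mult[OF Ck_const[of k "-1"]] by simp

lemma Ck_inverse:
  assumes nz: "\<And>x. f x \<noteq> 0" shows "Ck_on k UNIV f \<Longrightarrow> Ck_on k UNIV (\<lambda>x. inverse (f x))"
proof (induction k)
  case (Suc k)
  have "Ck_on k UNIV (\<lambda>x. - (inverse (f x) * fderiv f x v * inverse (f x)))" for v
    by (intro Ck_minus Ck_mult Suc.IH Ck_frechet Suc.prems Ck_SucD)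
  then show ?case by (rule Ck_SucI[OF Deriv.has_derivative_inverse[OF nz Ck_deriv[OF Suc.prems]]])
qed (use nz in \<open>auto intro: continuous_on_inverse\<close>)

lemma Ck_divide: "(\<And>x. g x \<noteq> 0) \<Longrightarrow> Ck_on k UNIV f \<Longrightarrow> Ck_on k UNIV g \<Longrightarrow> Ck_on k UNIV (\<lambda>x. f x / g x)"
  unfolding divide_inverse by (intro Ck_mult Ck_inverse)

lemma Ck_linear_compose:
  fixes l :: "'a::euclidean_space \<Rightarrow> 'b::euclidean_space"
  assumes l: "bounded_linear l"
  shows "Ck_on k UNIV f \<Longrightarrow> Ck_on k UNIV (\<lambda>x. f (l x))"
proof (induction k arbitrary: f)
  case 0
  then show ?case using continuous_on_compose2[of UNIV f UNIV l] linear_continuous_on[OF l] by auto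
next
  case (Suc k)
  have "((\<lambda>x. f (l x)) has_derivative (\<lambda>v. fderiv f (l x) (l v))) (at x)" for x
    by (rule has_derivative_compose[OF bounded_linear_imp_has_derivative[OF l] Ck_deriv[OF Suc.prems]])
  then show ?case by (rule Ck_SucI) (rule Suc.IH[OF Ck_frechet[OF Suc.prems]])
qed

lemma Ck_real_deriv:
  fixes h :: "real \<Rightarrow> real"
  assumes "Ck_on (Suc k) UNIV h"
  shows "(h has_real_derivative deriv h x) (at x)" "Ck_on k UNIV (deriv h)"
proof -
  have d: "(h has_real_derivative fderiv h x 1) (at x)" for x
  proof -
    have "fderiv h x = (\<lambda>v. v * fderiv h x 1)"
    proof
      fix v
      show "fderiv h x v = v * fderiv h x 1"
        using linear_scale[OF has_derivative_linear[OF Ck_deriv[OF assms]], of x v 1] by simp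
    qed
    then show ?thesis using Ck_deriv[OF assms, of x] by (simp add: has_field_derivative_def mult_commute_abs)
  qed
  then have e: "deriv h = (\<lambda>x. fderiv h x 1)" using DERIV_imp_deriv by blast
  show "(h has_real_derivative deriv h x) (at x)" using d e by simp
  show "Ck_on k UNIV (deriv h)" unfolding e by (rule Ck_frechet[OF assms])
qed

section \<open>Periodic functions\<close>

lemma torus_representative:
  assumes "L > 0" obtains k where "x + lattice L k \<in> torus_square L"
  using lattice_unique[OF assms] by blast

lemma torus_square_compact_hull: "torus_square L \<subseteq> {0..L} \<times> {0..L}"
  by (auto simp: torus_square_def)

lemma periodic2_bounded:
  fixes u :: "plane \<Rightarrow> real"
  assumes L: "L > 0" and per: "periodic2 L u" and u: "continuous_on UNIV u"
  obtains C where "C > 0" "\<And>x. \<bar>u x\<bar> \<le> C"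
proof -
  have "compact (u ` ({0..L} \<times> {0..L}))"
    by (intro compact_continuous_image continuous_on_subset[OF u] compact_Times) auto
  then have "bounded (u ` ({0..L} \<times> {0..L}))" by (rule compact_imp_bounded)
  then have "\<exists>C>0. \<forall>y\<in>u ` ({0..L} \<times> {0..L}). \<bar>y\<bar> \<le> C" unfolding bounded_pos real_norm_def .
  then obtain C where C: "C > 0" "\<And>y. y \<in> {0..L} \<times> {0..L} \<Longrightarrow> \<bar>u y\<bar> \<le> C" by blast
  have "\<bar>u x\<bar> \<le> C" for x
  proof -
    obtain k where k: "x + lattice L k \<in> torus_square L" using torus_representative[OF L] .
    then have "\<bar>u (x + lattice L k)\<bar> \<le> C" using torus_square_compact_hull by (intro C) blast
    then show ?thesis by (simp add: periodic2_lattice[OF per])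
  qed
  with C(1) show ?thesis by (rule that)
qed

lemma periodic2_uniformly_continuous:
  fixes u :: "plane \<Rightarrow> real"
  assumes L: "L > 0" and per: "periodic2 L u" and u: "continuous_on UNIV u"
  shows "uniformly_continuous_on UNIV u"
  unfolding uniformly_continuous_on_def
proof (intro allI impI)
  fix e :: real assume e: "e > 0"
  \<comment> \<open>The square enlarged by one period on every side: two points closer than
    \<open>L\<close> can be moved into it by the same lattice vector.\<close>
  let ?S = "{-L..2*L} \<times> {-L..2*L}"
  have "uniformly_continuous_on ?S u"
    by (intro compact_uniformly_continuous continuous_on_subset[OF u] compact_Times) auto
  then obtain d where d: "d > 0" "\<And>x y. x \<in> ?S \<Longrightarrow> y \<in> ?S \<Longrightarrow> dist y x < d \<Longrightarrow> dist (u y) (u x) < e"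
    unfolding uniformly_continuous_on_def using e by metis
  show "\<exists>d>0. \<forall>x\<in>UNIV. \<forall>y\<in>UNIV. dist y x < d \<longrightarrow> dist (u y) (u x) < e"
  proof (intro exI[of _ "min d L"] conjI ballI impI)
    show "min d L > 0" using d L by simp
    fix x y :: "plane" assume xy: "dist y x < min d L"
    obtain k where k: "x + lattice L k \<in> torus_square L" using torus_representative[OF L] .
    let ?x = "x + lattice L k" and ?y = "y + lattice L k"
    have dd: "dist ?y ?x = dist y x" by (simp add: dist_norm)
    have f: "\<bar>fst ?y - fst ?x\<bar> \<le> dist ?y ?x" "\<bar>snd ?y - snd ?x\<bar> \<le> dist ?y ?x"
      using dist_fst_le[of ?y ?x] dist_snd_le[of ?y ?x] by (simp_all add: dist_real_def)
    have x: "0 \<le> fst ?x" "fst ?x < L" "0 \<le> snd ?x" "snd ?x < L" using k by (auto simp: torus_square_def mem_Times_iff)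
    have "?x \<in> ?S" using x L unfolding mem_Times_iff atLeastAtMost_iff by linarith
    moreover have "?y \<in> ?S" using x f dd xy L unfolding mem_Times_iff atLeastAtMost_iff by linarith
    ultimately have "dist (u ?y) (u ?x) < e" using xy dd by (intro d) auto
    then show "dist (u y) (u x) < e" by (simp add: periodic2_lattice[OF per])
  qed
qed

lemma periodic2_frechet:
  assumes per: "periodic2 L u" and u: "\<And>x. (u has_derivative u' x) (at x)"
  shows "periodic2 L (\<lambda>x. u' x v)"
proof -
  have "u' (x + k) = u' x" if k: "k = (L, 0) \<or> k = (0, L)" for x k
  proof -
    have p: "u (y + k) = u y" for y using per k unfolding periodic2_def by metis
    have "((\<lambda>y. y + k) has_derivative (\<lambda>h. h)) (at x)" by (auto intro!: derivative_eq_intros)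
    from has_derivative_compose[OF this u] have "(u has_derivative u' (x + k)) (at x)" by (simp add: p)
    with u show ?thesis using has_derivative_unique by blast
  qed
  then show ?thesis by (simp add: periodic2_def)
qed

lemma linear_plane_bound:
  fixes l :: "plane \<Rightarrow> real"
  assumes l: "linear l" and b: "\<bar>l (1, 0)\<bar> \<le> C" "\<bar>l (0, 1)\<bar> \<le> C"
  shows "l v = fst v * l (1, 0) + snd v * l (0, 1)" "\<bar>l v\<bar> \<le> 2 * C * norm v"
proof -
  have "v = fst v *\<^sub>R (1, 0) + snd v *\<^sub>R (0, 1)" by (simp add: prod_eq_iff)
  then have "l v = l (fst v *\<^sub>R (1, 0) + snd v *\<^sub>R (0, 1))" by simp
  also have "\<dots> = fst v * l (1, 0) + snd v * l (0, 1)" by (simp only: linear_add[OF l] linear_scale[OF l] real_scaleR_def)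
  finally show e: "l v = fst v * l (1, 0) + snd v * l (0, 1)" .
  have n: "\<bar>fst v\<bar> \<le> norm v" "\<bar>snd v\<bar> \<le> norm v"
    using norm_fst_le[of "fst v" "snd v"] norm_snd_le[of "snd v" "fst v"] by simp_all
  have "\<bar>fst v * l (1, 0)\<bar> \<le> norm v * C" "\<bar>snd v * l (0, 1)\<bar> \<le> norm v * C"
    unfolding abs_mult using n b by (auto intro!: mult_mono)
  then show "\<bar>l v\<bar> \<le> 2 * C * norm v" using e by (simp add: algebra_simps)
qed

lemma C1_periodic_bounds:
  fixes u :: "plane \<Rightarrow> real"
  assumes L: "L > 0" and per: "periodic2 L u" and u: "Ck_on (Suc k) UNIV u"
  obtains C where "C > 0" "\<And>x. \<bar>u x\<bar> \<le> C" "\<And>x v. \<bar>fderiv u x v\<bar> \<le> C * norm v"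
    "\<And>x y. \<bar>u x - u y\<bar> \<le> C * norm (x - y)"
proof -
  note der = Ck_deriv[OF u]
  have c: "continuous_on UNIV (\<lambda>x. fderiv u x v)" for v
    by (rule Ck_continuous[OF Ck_frechet[OF u]])
  obtain C0 where C0: "C0 > 0" "\<And>x. \<bar>u x\<bar> \<le> C0" using periodic2_bounded[OF L per Ck_continuous[OF u]] by metis
  obtain C1 where C1: "C1 > 0" "\<And>x. \<bar>fderiv u x (1, 0)\<bar> \<le> C1"
    using periodic2_bounded[OF L periodic2_frechet[OF per der] c] by metis
  obtain C2 where C2: "C2 > 0" "\<And>x. \<bar>fderiv u x (0, 1)\<bar> \<le> C2"
    using periodic2_bounded[OF L periodic2_frechet[OF per der] c] by metis
  define C where "C = C0 + 2 * (C1 + C2)"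
  have "\<bar>fderiv u x v\<bar> \<le> 2 * (C1 + C2) * norm v" for x v
    using C1(1) C1(2)[of x] C2(1) C2(2)[of x] by (intro linear_plane_bound(2)[OF has_derivative_linear[OF der]]) linarith+
  moreover have "2 * (C1 + C2) * norm v \<le> C * norm v" for v :: "plane"
    using C0 by (intro mult_right_mono) (auto simp: C_def)
  ultimately have b: "\<bar>fderiv u x v\<bar> \<le> C * norm v" for x v using order_trans by blast
  have lip: "norm (u x - u y) \<le> C * norm (x - y)" for x y
  proof (rule differentiable_bound[where S = UNIV and f' = "\<lambda>x. fderiv u x"])
    show "onorm (fderiv u x) \<le> C" for x by (rule onorm_le) (simp add: b)
  qed (use der in auto)
  show ?thesis
  proof (rule that[of C])
    show "C > 0" using C0 C1 C2 by (simp add: C_def)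
    show "\<bar>u x\<bar> \<le> C" for x using C0 C1 C2 by (simp add: C_def add_increasing2)
  qed (use b lip in auto)
qed

lemma C2_periodic_bounds:
  fixes u :: "plane \<Rightarrow> real"
  assumes L: "L > 0" and per: "periodic2 L u" and u: "Ck_on (Suc (Suc k)) UNIV u"
  obtains C where "C > 0" "\<And>x. \<bar>u x\<bar> \<le> C" "\<And>x v. \<bar>fderiv u x v\<bar> \<le> C * norm v"
    "\<And>x y v. \<bar>fderiv u x v - fderiv u y v\<bar> \<le> C * norm (x - y) * norm v"
proof -
  note der = Ck_deriv[OF u]
  obtain C0 where C0: "C0 > 0" "\<And>x. \<bar>u x\<bar> \<le> C0" "\<And>x v. \<bar>fderiv u x v\<bar> \<le> C0 * norm v"
    using C1_periodic_bounds[OF L per u] by metis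
  have ex: "\<exists>C>0. \<forall>x y. \<bar>fderiv u x v - fderiv u y v\<bar> \<le> C * norm (x - y)" for v
    using C1_periodic_bounds[OF L periodic2_frechet[OF per der] Ck_frechet[OF u]] by metis
  obtain C1 where C1: "C1 > 0" "\<And>x y. \<bar>fderiv u x (1, 0) - fderiv u y (1, 0)\<bar> \<le> C1 * norm (x - y)"
    using ex by blast
  obtain C2 where C2: "C2 > 0" "\<And>x y. \<bar>fderiv u x (0, 1) - fderiv u y (0, 1)\<bar> \<le> C2 * norm (x - y)"
    using ex by blast
  define C where "C = C0 + 2 * (C1 + C2)"
  have CC: "C0 \<le> C" "2 * (C1 + C2) \<le> C" "C > 0" using C0 C1 C2 by (auto simp: C_def)
  have "\<bar>fderiv u x v - fderiv u y v\<bar> \<le> C * norm (x - y) * norm v" for x y v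
  proof -
    let ?l = "\<lambda>v. fderiv u x v - fderiv u y v"
    have "linear ?l" by (intro linear_compose_sub has_derivative_linear[OF der])
    moreover have "C1 * norm (x - y) \<le> (C1 + C2) * norm (x - y)" "C2 * norm (x - y) \<le> (C1 + C2) * norm (x - y)"
      using C1 C2 by (auto intro!: mult_right_mono)
    then have "\<bar>?l (1, 0)\<bar> \<le> (C1 + C2) * norm (x - y)" "\<bar>?l (0, 1)\<bar> \<le> (C1 + C2) * norm (x - y)"
      using C1(2)[of x y] C2(2)[of x y] by linarith+
    ultimately have "\<bar>?l v\<bar> \<le> 2 * ((C1 + C2) * norm (x - y)) * norm v" by (rule linear_plane_bound(2))
    also have "\<dots> = 2 * (C1 + C2) * (norm (x - y) * norm v)" by simp
    also have "\<dots> \<le> C * (norm (x - y) * norm v)" using CC by (intro mult_right_mono) auto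
    finally show ?thesis by (simp add: mult.assoc)
  qed
  moreover have "\<bar>u x\<bar> \<le> C" for x using C0(2)[of x] CC by linarith
  moreover have "\<bar>fderiv u x v\<bar> \<le> C * norm v" for x v
    using C0(3)[of x v] mult_right_mono[OF CC(1), of "norm v"] by simp
  ultimately show ?thesis using CC(3) by (intro that[of C]) auto
qed

section \<open>Geometry of the Hamiltonian\<close>

locale ham_factor =
  fixes L :: real and h :: "real \<Rightarrow> real"
  assumes factor: "hamiltonian_factor L h" and L_positive: "L > 0"
begin

definition "h' = deriv h"
definition "h'' = deriv h'"

lemma h_Ck: "Ck_on 3 UNIV h" using factor by (simp add: hamiltonian_factor_def)

lemma h_deriv: "(h has_real_derivative h' x) (at x)" and h'_Ck: "Ck_on 2 UNIV h'"
  using Ck_real_deriv[of 2 h] h_Ck unfolding h'_def by (simp_all add: eval_nat_numeral)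

lemma h'_deriv: "(h' has_real_derivative h'' x) (at x)" and h''_Ck: "Ck_on 1 UNIV h''"
  using Ck_real_deriv[of 1 h'] h'_Ck unfolding h''_def by (simp_all add: eval_nat_numeral)

lemma h_periodic: "h (x + L) = h x"
  using factor by (simp add: hamiltonian_factor_def periodic_fun_simple.plus_period)

lemma deriv_periodic:
  assumes u: "\<And>x. (u has_real_derivative u' x) (at x)" and per: "\<And>x. u (x + L) = u x"
  shows "u' (x + L) = (u' x :: real)"
proof -
  have "((\<lambda>x. u (x + L)) has_real_derivative u' (x + L)) (at x)"
    using DERIV_shift[of u "u' (x + L)" x L] u by simp
  then show ?thesis using DERIV_unique[OF u] by (simp add: per)
qed

lemma h'_periodic: "h' (x + L) = h' x" by (rule deriv_periodic[OF h_deriv h_periodic])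
lemma h''_periodic: "h'' (x + L) = h'' x" by (rule deriv_periodic[OF h'_deriv h'_periodic])

lemma h_le_1: "\<bar>h x\<bar> \<le> 1" and simple_zero: "h x = 0 \<Longrightarrow> h' x \<noteq> 0"
  and nondegenerate: "h' x = 0 \<Longrightarrow> h'' x \<noteq> 0" and concave: "h x * h'' x \<le> 0"
  using factor unfolding hamiltonian_factor_def h''_def h'_def by blast+

text \<open>A critical point is neither a zero of \<open>h\<close>, as zeros are simple, nor of
  \<open>h''\<close>, by nondegeneracy; the sign condition is therefore strict there.\<close>

lemma critical_strict: "h' b = 0 \<Longrightarrow> h b * h'' b < 0"
  using concave[of b] simple_zero[of b] nondegenerate[of b] by (cases "h b = 0") (auto simp: less_le)

text \<open>The derivative \<open>2 * (h x * h' x)\<close> of the square vanishes at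
  \<open>b\<close> with negative slope \<open>2 * (h b * h'' b)\<close>, so it changes sign from
  positive to negative. Squaring treats maxima of \<open>h\<close> and minima of negative value
  alike.\<close>

lemma strict_local_max:
  assumes b: "h' b = 0"
  obtains \<eta> where "\<eta> > 0" "\<And>x. \<bar>x - b\<bar> \<le> \<eta> \<Longrightarrow> x \<noteq> b \<Longrightarrow> (h x)\<^sup>2 < (h b)\<^sup>2"
proof -
  define u where "u x = 2 * (h x * h' x)" for x
  have sq: "((\<lambda>x. (h x)\<^sup>2) has_real_derivative u x) (at x)" for x
    unfolding u_def by (auto intro!: derivative_eq_intros h_deriv)
  have "(u has_real_derivative 2 * (h b * h'' b)) (at b)"
    unfolding u_def by (auto intro!: derivative_eq_intros h_deriv h'_deriv simp: b)
  moreover have "2 * (h b * h'' b) < 0" using critical_strict[OF b] by simp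
  ultimately have "\<exists>d>0. \<forall>r>0. r < d \<longrightarrow> u (b + r) < u b" "\<exists>d>0. \<forall>r>0. r < d \<longrightarrow> u b < u (b - r)"
    using DERIV_neg_dec_right DERIV_neg_dec_left by blast+
  then obtain d1 d2 where d1: "d1 > 0" "\<And>r. 0 < r \<Longrightarrow> r < d1 \<Longrightarrow> u (b + r) < u b"
    and d2: "d2 > 0" "\<And>r. 0 < r \<Longrightarrow> r < d2 \<Longrightarrow> u b < u (b - r)"
    by blast
  have u0: "u b = 0" by (simp add: u_def b)
  define \<eta> where "\<eta> = min d1 d2 / 2"
  have \<eta>: "\<eta> > 0" "\<eta> < d1" "\<eta> < d2" using d1 d2 by (auto simp: \<eta>_def)
  have "(h x)\<^sup>2 < (h b)\<^sup>2" if x: "\<bar>x - b\<bar> \<le> \<eta>" "x \<noteq> b" for x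
  proof (cases "b < x")
    case True
    obtain z where z: "b < z" "z < x" "(h x)\<^sup>2 - (h b)\<^sup>2 = (x - b) * u z"
      using MVT2[OF True, of "\<lambda>x. (h x)\<^sup>2" u] sq by blast
    then have "u z < 0" using d1(2)[of "z - b"] x \<eta> u0 by simp
    then have "(x - b) * u z < 0" using True by (simp add: mult_pos_neg)
    then show ?thesis using z(3) by linarith
  next
    case False
    then have xb: "x < b" using x by simp
    obtain z where z: "x < z" "z < b" "(h b)\<^sup>2 - (h x)\<^sup>2 = (b - x) * u z"
      using MVT2[OF xb, of "\<lambda>x. (h x)\<^sup>2" u] sq by blast
    then have "u z > 0" using d2(2)[of "b - z"] x \<eta> u0 by simp
    then have "(b - x) * u z > 0" using xb by simp
    then show ?thesis using z(3) by linarith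
  qed
  with \<eta>(1) show ?thesis by (rule that)
qed

lemma h_continuous: "continuous_on S h" and h'_continuous: "continuous_on S h'" and h''_continuous: "continuous_on S h''"
  using Ck_continuous h_Ck h'_Ck h''_Ck by blast+

lemma h_borel [measurable]: "h \<in> borel_measurable borel"
  by (rule borel_measurable_continuous_onI[OF h_continuous])

abbreviation thin :: "real set \<Rightarrow> real \<Rightarrow> real set" where
  "thin S \<delta> \<equiv> {x \<in> S. \<bar>h x\<bar> \<le> \<delta>}"

text \<open>Near a simple zero \<bar>h\<bar> grows at least linearly, so the set lies in an interval
  of length proportional to \<delta>. Near any other point \<bar>h\<bar> exceeds some
  \<open>c\<close>: the set is empty for small \<delta>, and the whole ball is affordable for larger
  \<delta>.\<close>

lemma small_set_local:
  obtains e C where "e > 0" "C > 0"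
    "\<And>\<delta>. \<delta> > 0 \<Longrightarrow> emeasure lborel (thin (ball x0 e) \<delta>) \<le> ennreal (C * \<delta>)"
proof (cases "h x0 = 0")
  case True
  then have d0: "h' x0 \<noteq> 0" by (rule simple_zero)
  define c where "c = \<bar>h' x0\<bar> / 2"
  have c: "c > 0" using d0 by (simp add: c_def)
  have "isCont h' x0" using h'_continuous[of UNIV] by (simp add: continuous_on_eq_continuous_at)
  then obtain e where e: "e > 0" "\<And>x. dist x x0 < e \<Longrightarrow> dist (h' x) (h' x0) < c"
    unfolding continuous_at_eps_delta using c by metis
  have big: "\<bar>h' x\<bar> \<ge> c" if "x \<in> ball x0 e" for x
  proof -
    have "\<bar>h' x - h' x0\<bar> < c" using e(2)[of x] that by (simp add: dist_real_def dist_commute)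
    moreover have "\<bar>h' x0\<bar> = 2 * c" by (simp add: c_def)
    ultimately show ?thesis by linarith
  qed
  have lin: "c * \<bar>x - x0\<bar> \<le> \<bar>h x\<bar>" if x: "x \<in> ball x0 e" for x
  proof (cases "x = x0")
    case False
    obtain z where z: "z \<in> ball x0 e" "\<bar>h x\<bar> = \<bar>x - x0\<bar> * \<bar>h' z\<bar>"
    proof (cases "x0 < x")
      case True
      then obtain z where "x0 < z" "z < x" "h x - h x0 = (x - x0) * h' z" using MVT2[of x0 x h h'] h_deriv by blast
      then show ?thesis using x \<open>h x0 = 0\<close> by (intro that[of z]) (auto simp: dist_real_def abs_mult)
    next
      case False
      then have "x < x0" using \<open>x \<noteq> x0\<close> by simp
      then obtain z where "x < z" "z < x0" "h x0 - h x = (x0 - x) * h' z" using MVT2[of x x0 h h'] h_deriv by blast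
      then have "h x = (x - x0) * h' z" using \<open>h x0 = 0\<close> by (simp add: algebra_simps)
      then show ?thesis using x \<open>x < z\<close> \<open>z < x0\<close> by (intro that[of z]) (auto simp: dist_real_def abs_mult)
    qed
    have "\<bar>x - x0\<bar> * c \<le> \<bar>x - x0\<bar> * \<bar>h' z\<bar>" by (intro mult_left_mono big z) auto
    then show ?thesis using z(2) by (simp add: mult.commute)
  qed simp
  have "emeasure lborel (thin (ball x0 e) \<delta>) \<le> ennreal (2 / c * \<delta>)" if \<delta>: "\<delta> > 0" for \<delta>
  proof -
    have "(thin (ball x0 e) \<delta>) \<subseteq> {x0 - \<delta> / c..x0 + \<delta> / c}"
    proof
      fix x assume "x \<in> (thin (ball x0 e) \<delta>)"
      then have "c * \<bar>x - x0\<bar> \<le> \<delta>" using lin[of x] by auto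
      then have "\<bar>x - x0\<bar> \<le> \<delta> / c" using c by (simp add: le_divide_eq mult.commute)
      then show "x \<in> {x0 - \<delta> / c..x0 + \<delta> / c}" by auto
    qed
    then have "emeasure lborel (thin (ball x0 e) \<delta>) \<le> emeasure lborel {x0 - \<delta> / c..x0 + \<delta> / c}"
      by (intro emeasure_mono) auto
    also have "\<dots> = ennreal (2 / c * \<delta>)" using \<delta> c by (subst emeasure_lborel_Icc) auto
    finally show ?thesis .
  qed
  then show ?thesis using e c by (intro that[of e "2 / c"]) auto
next
  case False
  define c where "c = \<bar>h x0\<bar> / 2"
  have c: "c > 0" using False by (simp add: c_def)
  have "isCont h x0" using h_continuous[of UNIV] by (simp add: continuous_on_eq_continuous_at)
  then obtain e where e: "e > 0" "\<And>x. dist x x0 < e \<Longrightarrow> dist (h x) (h x0) < c"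
    unfolding continuous_at_eps_delta using c by metis
  have big: "\<bar>h x\<bar> > c" if "x \<in> ball x0 e" for x
  proof -
    have "\<bar>h x - h x0\<bar> < c" using e(2)[of x] that by (simp add: dist_real_def dist_commute)
    moreover have "\<bar>h x0\<bar> = 2 * c" by (simp add: c_def)
    ultimately show ?thesis by linarith
  qed
  have "emeasure lborel (thin (ball x0 e) \<delta>) \<le> ennreal (2 * e / c * \<delta>)" if \<delta>: "\<delta> > 0" for \<delta>
  proof (cases "\<delta> \<le> c")
    case True
    then have "(thin (ball x0 e) \<delta>) = {}" using big by fastforce
    then show ?thesis by (simp only: emeasure_empty) simp
  next
    case False
    have "emeasure lborel (thin (ball x0 e) \<delta>) \<le> emeasure lborel {x0 - e..x0 + e}"
      by (intro emeasure_mono) (auto simp: dist_real_def)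
    also have "\<dots> = ennreal (2 * e)" using e by simp
    also have "\<dots> \<le> ennreal (2 * e / c * \<delta>)" proof (rule ennreal_leI)
      have "2 * e * c \<le> 2 * e * \<delta>" using False e by (intro mult_left_mono) auto
      then show "2 * e \<le> 2 * e / c * \<delta>" using c by (simp add: pos_le_divide_eq)
    qed
    finally show ?thesis .
  qed
  then show ?thesis using e c by (intro that[of e "2 * e / c"]) auto
qed

lemma small_set_measure:
  obtains C where "C > 0" "\<And>\<delta>. \<delta> > 0 \<Longrightarrow> emeasure lborel (thin {0..L} \<delta>) \<le> ennreal (C * \<delta>)"
proof -
  have "\<exists>e C. e > 0 \<and> C > 0 \<and> (\<forall>\<delta>>0. emeasure lborel (thin (ball x0 e) \<delta>) \<le> ennreal (C * \<delta>))" for x0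
    by (rule small_set_local[of x0]) blast
  then obtain e C where eC: "\<And>x0. e x0 > 0" "\<And>x0. C x0 > 0"
    "\<And>x0 \<delta>. \<delta> > 0 \<Longrightarrow> emeasure lborel (thin (ball x0 (e x0)) \<delta>) \<le> ennreal (C x0 * \<delta>)"
    by metis
  obtain D where D: "finite D" "{0..L} \<subseteq> (\<Union>x\<in>D. ball x (e x))"
  proof (rule compactE_image[of "{0..L}" UNIV "\<lambda>x. ball x (e x)"])
    show "{0..L} \<subseteq> (\<Union>x. ball x (e x))"
    proof
      show "x \<in> (\<Union>x. ball x (e x))" for x using eC(1)[of x] by (intro UN_I[of x]) auto
    qed
  qed auto
  \<comment> \<open>The summand 1 makes the constant positive without discussing whether the finite
    cover is empty.\<close>
  have "emeasure lborel (thin {0..L} \<delta>) \<le> ennreal ((1 + (\<Sum>x\<in>D. C x)) * \<delta>)" if \<delta>: "\<delta> > 0" for \<delta>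
  proof -
    have "emeasure lborel (thin {0..L} \<delta>) \<le> emeasure lborel (\<Union>y\<in>D. (thin (ball y (e y)) \<delta>))"
    proof (rule emeasure_mono)
      show "(thin {0..L} \<delta>) \<subseteq> (\<Union>y\<in>D. (thin (ball y (e y)) \<delta>))"
        using D(2) by blast
      show "(\<Union>y\<in>D. (thin (ball y (e y)) \<delta>)) \<in> sets lborel"
        by (intro sets.finite_UN D(1)) auto
    qed
    also have "\<dots> \<le> (\<Sum>y\<in>D. emeasure lborel (thin (ball y (e y)) \<delta>))"
      by (rule emeasure_subadditive_finite[OF D(1)]) auto
    also have "\<dots> \<le> (\<Sum>y\<in>D. ennreal (C y * \<delta>))" by (intro sum_mono eC(3) \<delta>)
    also have "\<dots> = ennreal (\<Sum>y\<in>D. C y * \<delta>)"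
      using eC(2) \<delta> by (intro sum_ennreal) (auto simp: less_imp_le)
    also have "\<dots> \<le> ennreal ((1 + (\<Sum>x\<in>D. C x)) * \<delta>)"
      using \<delta> by (intro ennreal_leI) (simp add: sum_distrib_right distrib_right)
    finally show ?thesis .
  qed
  moreover have "1 + (\<Sum>x\<in>D. C x) > 0" using eC(2) by (intro add_pos_nonneg sum_nonneg) (auto simp: less_imp_le)
  ultimately show ?thesis by (intro that)
qed

end

context ham_factor
begin

lemma emeasure_plane_strip:
  "\<exists>C>0. \<forall>\<delta>>0. emeasure lborel {x \<in> torus_square L. \<bar>h (fst x)\<bar> \<le> \<delta>} \<le> ennreal (C * \<delta>)
    \<and> emeasure lborel {x \<in> torus_square L. \<bar>h (snd x)\<bar> \<le> \<delta>} \<le> ennreal (C * \<delta>)"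
proof -
  obtain C where C: "C > 0" "\<And>\<delta>. \<delta> > 0 \<Longrightarrow> emeasure lborel (thin {0..L} \<delta>) \<le> ennreal (C * \<delta>)"
    using small_set_measure by blast
  have 1: "emeasure lborel ((thin {0..L} \<delta>) \<times> {0..L}) \<le> ennreal (C * L * \<delta>)"
    and 2: "emeasure lborel ({0..L} \<times> (thin {0..L} \<delta>)) \<le> ennreal (C * L * \<delta>)" if \<delta>: "\<delta> > 0" for \<delta>
  proof -
    have "emeasure lborel (thin {0..L} \<delta>) * ennreal L \<le> ennreal (C * \<delta>) * ennreal L"
      by (intro mult_right_mono C(2) \<delta>) auto
    also have "\<dots> = ennreal (C * L * \<delta>)"
      using C L_positive \<delta> by (simp add: ennreal_mult[symmetric] mult_ac)
    finally have b: "emeasure lborel (thin {0..L} \<delta>) * ennreal L \<le> ennreal (C * L * \<delta>)" .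
    have "emeasure lborel ((thin {0..L} \<delta>) \<times> {0..L}) = emeasure lborel (thin {0..L} \<delta>) * emeasure lborel {0..L}"
      unfolding lborel_prod[symmetric] by (rule lborel.emeasure_pair_measure_Times) auto
    with b show "emeasure lborel ((thin {0..L} \<delta>) \<times> {0..L}) \<le> ennreal (C * L * \<delta>)" using L_positive by simp
    have "emeasure lborel ({0..L} \<times> (thin {0..L} \<delta>)) = emeasure lborel {0..L} * emeasure lborel (thin {0..L} \<delta>)"
      unfolding lborel_prod[symmetric] by (rule lborel.emeasure_pair_measure_Times) auto
    with b show "emeasure lborel ({0..L} \<times> (thin {0..L} \<delta>)) \<le> ennreal (C * L * \<delta>)" using L_positive by (simp add: mult.commute)
  qed
  show ?thesis
  proof (intro exI[of _ "C * L"] conjI allI impI)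
    show "C * L > 0" using C L_positive by simp
    fix \<delta> :: real assume \<delta>: "\<delta> > 0"
    have "emeasure lborel {x \<in> torus_square L. \<bar>h (fst x)\<bar> \<le> \<delta>} \<le> emeasure lborel ((thin {0..L} \<delta>) \<times> {0..L})"
      by (rule emeasure_mono) (auto simp: torus_square_def intro!: borel_Times)
    with 1[OF \<delta>] show "emeasure lborel {x \<in> torus_square L. \<bar>h (fst x)\<bar> \<le> \<delta>} \<le> ennreal (C * L * \<delta>)" by simp
    have "emeasure lborel {x \<in> torus_square L. \<bar>h (snd x)\<bar> \<le> \<delta>} \<le> emeasure lborel ({0..L} \<times> (thin {0..L} \<delta>))"
      by (rule emeasure_mono) (auto simp: torus_square_def intro!: borel_Times)
    with 2[OF \<delta>] show "emeasure lborel {x \<in> torus_square L. \<bar>h (snd x)\<bar> \<le> \<delta>} \<le> ennreal (C * L * \<delta>)" by simp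
  qed
qed

end

section \<open>The Hamiltonian field, its curvature, and the points that characteristics can
  reach\<close>

locale hamiltonian_system =
  fixes L l0 r0 :: real and h1 h2 l r :: "real \<Rightarrow> real" and H lam \<rho> :: "plane \<Rightarrow> real"
    and \<sigma> :: "plane \<Rightarrow> plane"
  assumes period: "L > 0" and factor1: "hamiltonian_factor L h1" and factor2: "hamiltonian_factor L h2"
    and H_def: "H = hamiltonian h1 h2" and \<sigma>_eq: "\<And>x. \<sigma> x = \<rho> x *\<^sub>R grad_perp H x"
    and \<rho>_periodic: "torus_periodic L \<rho>" and \<rho>_Ck: "Ck_on 2 UNIV \<rho>"
    and lam_periodic: "torus_periodic L lam" and lam_Ck: "Ck_on 2 UNIV lam"
    and l0_pos: "l0 > 0" and lam_ge: "\<And>x. lam x \<ge> l0"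
    and l_Ck: "Ck_on 2 {-1..1} l" and r_Ck: "Ck_on 2 {-1..1} r"
    and lam_eq: "\<And>x. lam x = l (H x)" and \<rho>_eq: "\<And>x. \<rho> x = r (H x)"
    and l_ge: "\<And>s. s \<in> {-1..1} \<Longrightarrow> l s \<ge> l0"
    and r0_pos: "r0 > 0" and r_ge: "\<And>s. s \<in> {-1..1} \<Longrightarrow> (r s)\<^sup>2 \<ge> r0"
begin

sublocale f1: ham_factor L h1 by unfold_locales (rule factor1 period)+
sublocale f2: ham_factor L h2 by unfold_locales (rule factor2 period)+

lemma H_eq: "H x = h1 (fst x) * h2 (snd x)" by (simp add: H_def hamiltonian_def)

definition DH :: "plane \<Rightarrow> plane \<Rightarrow> real" where
  "DH x v = f1.h' (fst x) * h2 (snd x) * fst v + h1 (fst x) * f2.h' (snd x) * snd v"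

lemma has_derivative_fst_arg: "(u has_real_derivative u') (at (fst x)) \<Longrightarrow>
    ((\<lambda>y. u (fst y)) has_derivative (\<lambda>v. u' * fst v)) (at x)"
  and has_derivative_snd_arg: "(u has_real_derivative u') (at (snd x)) \<Longrightarrow>
    ((\<lambda>y. u (snd y)) has_derivative (\<lambda>v. u' * snd v)) (at x)"
  for u :: "real \<Rightarrow> real" and x :: "plane"
  unfolding has_field_derivative_def
  by (rule has_derivative_compose[where g = u], auto intro!: derivative_eq_intros)+

lemma H_deriv: "(H has_derivative DH x) (at x)"
proof -
  have "((\<lambda>y. h1 (fst y) * h2 (snd y)) has_derivative
      (\<lambda>v. h1 (fst x) * (f2.h' (snd x) * snd v) + f1.h' (fst x) * fst v * h2 (snd x))) (at x)"
    by (rule has_derivative_mult[OF has_derivative_fst_arg[OF f1.h_deriv] has_derivative_snd_arg[OF f2.h_deriv]])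
  moreover have "DH x = (\<lambda>v. h1 (fst x) * (f2.h' (snd x) * snd v) + f1.h' (fst x) * fst v * h2 (snd x))"
    by (auto simp: DH_def)
  moreover have "H = (\<lambda>y. h1 (fst y) * h2 (snd y))" by (auto simp: H_eq)
  ultimately show ?thesis by simp
qed

lemma grad_perp_H: "grad_perp H x = (- (h1 (fst x) * f2.h' (snd x)), f1.h' (fst x) * h2 (snd x))"
proof -
  have "fderiv H x = DH x" by (rule frechet_derivative_at[OF H_deriv, symmetric])
  then show ?thesis by (simp add: grad_perp_def grad_def DH_def)
qed

lemma DH_grad_perp: "DH x (grad_perp H x) = 0" by (simp add: DH_def grad_perp_H)

lemma H_range: "H x \<in> {-1..1}"
proof -
  have "\<bar>H x\<bar> \<le> 1 * 1" unfolding H_eq abs_mult by (intro mult_mono f1.h_le_1 f2.h_le_1) auto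
  then show ?thesis by auto
qed

lemma H_continuous: "continuous_on S H"
  by (rule has_derivative_continuous_on[OF has_derivative_at_withinI[OF H_deriv]])

lemma H_borel [measurable]: "H \<in> borel_measurable borel"
  by (rule borel_measurable_continuous_onI[OF H_continuous])

lemma H_translate: "H (x + lattice L k) = H x"
proof -
  have "periodic2 L H" by (simp add: periodic2_def H_eq f1.h_periodic f2.h_periodic)
  then show ?thesis by (rule periodic2_lattice)
qed

text \<open>The profile is differentiable only within the compact interval, one-sidedly at its ends;
  the chain rule still applies because \<open>H\<close> takes its values there. The unspecified
  factor \<open>a\<close> is harmless: the gradient is parallel to that of \<open>H\<close>, hence
  zero along \<open>V\<close>.\<close>

lemma H_composite_deriv:
  assumes u: "\<And>x. u x = q (H x)" and q: "q differentiable_on {-1..1}"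
  obtains a where "(u has_derivative (\<lambda>v. a * DH x v)) (at x)"
proof -
  obtain q' where q': "(q has_derivative q') (at (H x) within {-1..1})"
    using bspec[OF q[unfolded differentiable_on_def] H_range] unfolding differentiable_def by blast
  have "(q has_derivative q') (at (H x) within range H)"
    by (rule has_derivative_subset[OF q']) (use H_range in auto)
  from has_derivative_in_compose[OF H_deriv this]
  have "((\<lambda>x. q (H x)) has_derivative (\<lambda>v. q' (DH x v))) (at x)" .
  moreover have "(\<lambda>v. q' (DH x v)) = (\<lambda>v. q' 1 * DH x v)"
  proof
    show "q' (DH x v) = q' 1 * DH x v" for v using linear_scale[OF has_derivative_linear[OF q'], of "DH x v" 1] by simp
  qed
  moreover have "u = (\<lambda>x. q (H x))" using u by blast
  ultimately have "(u has_derivative (\<lambda>v. q' 1 * DH x v)) (at x)" by simp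
  then show ?thesis by (rule that)
qed

lemma l_differentiable: "l differentiable_on {-1..1}" and r_differentiable: "r differentiable_on {-1..1}"
  using l_Ck r_Ck by (simp_all add: numeral_2_eq_2)

lemma l_pos: "s \<in> {-1..1} \<Longrightarrow> l s > 0" using l_ge[of s] l0_pos by linarith

lemma lam_pos: "lam x > 0" using lam_ge[of x] l0_pos by linarith

definition speed :: "plane \<Rightarrow> real" where "speed x = \<rho> x / lam x"

lemma speed_deriv: obtains a where "(speed has_derivative (\<lambda>v. a * DH x v)) (at x)"
proof (rule H_composite_deriv[of speed "\<lambda>s. r s / l s"])
  show "speed y = r (H y) / l (H y)" for y by (simp add: speed_def lam_eq \<rho>_eq)
  have "l s \<noteq> 0" if "s \<in> {-1..1}" for s using l_pos[OF that] by simp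
  then show "(\<lambda>s. r s / l s) differentiable_on {-1..1}"
    using l_differentiable r_differentiable unfolding differentiable_on_def by (blast intro: differentiable_divide)
qed

definition V :: "plane \<Rightarrow> plane" where "V = scaled_field lam \<sigma>"

definition V1 :: "plane \<Rightarrow> real" where "V1 x = - (speed x * (h1 (fst x) * f2.h' (snd x)))"
definition V2 :: "plane \<Rightarrow> real" where "V2 x = speed x * (f1.h' (fst x) * h2 (snd x))"

lemma V_eq: "V x = (V1 x, V2 x)"
  by (simp add: V_def scaled_field_def \<sigma>_eq grad_perp_H V1_def V2_def speed_def)

lemma V_eq_grad_perp: "V x = speed x *\<^sub>R grad_perp H x"
  by (simp add: V_eq V1_def V2_def grad_perp_H)

lemma DH_scale: "DH x (c *\<^sub>R v) = c * DH x v" by (simp add: DH_def algebra_simps)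

lemma DH_V: "DH x (V x) = 0" by (simp add: V_eq_grad_perp DH_scale DH_grad_perp)

lemma Ck_fst: "Ck_on k UNIV u \<Longrightarrow> Ck_on k UNIV (\<lambda>x. u (fst x))"
  and Ck_snd: "Ck_on k UNIV u \<Longrightarrow> Ck_on k UNIV (\<lambda>x. u (snd x))"
  for u :: "real \<Rightarrow> real"
  by (rule Ck_linear_compose[OF bounded_linear_fst], assumption, rule Ck_linear_compose[OF bounded_linear_snd])

lemma speed_Ck: "Ck_on 2 UNIV speed"
  unfolding speed_def[abs_def]
proof (rule Ck_divide[OF _ \<rho>_Ck lam_Ck])
  show "lam x \<noteq> 0" for x using lam_pos[of x] by simp
qed

lemma V1_Ck: "Ck_on 2 UNIV V1" and V2_Ck: "Ck_on 2 UNIV V2"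
  unfolding V1_def[abs_def] V2_def[abs_def]
  by (intro Ck_minus Ck_mult speed_Ck Ck_fst Ck_snd f1.h'_Ck f2.h'_Ck Ck_le[OF _ f1.h_Ck] Ck_le[OF _ f2.h_Ck]; simp)+

lemma speed_periodic: "periodic2 L speed"
  using lam_periodic \<rho>_periodic unfolding torus_periodic_iff periodic2_def speed_def by simp

lemma V1_periodic: "periodic2 L V1" and V2_periodic: "periodic2 L V2"
  using speed_periodic unfolding periodic2_def V1_def V2_def
  by (simp_all add: f1.h_periodic f2.h_periodic f1.h'_periodic f2.h'_periodic)

definition DV :: "plane \<Rightarrow> plane \<Rightarrow> plane" where
  "DV x v = (fderiv V1 x v, fderiv V2 x v)"

lemma V1_Ck': "Ck_on (Suc 1) UNIV V1" and V2_Ck': "Ck_on (Suc 1) UNIV V2"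
  using V1_Ck V2_Ck by (simp_all add: numeral_2_eq_2)

lemma V_has_derivative: "(V has_derivative DV x) (at x)"
proof -
  have "((\<lambda>x. (V1 x, V2 x)) has_derivative DV x) (at x)"
    unfolding DV_def by (intro has_derivative_Pair Ck_deriv[OF V1_Ck'] Ck_deriv[OF V2_Ck'])
  then show ?thesis using V_eq by presburger
qed

definition DV_form :: "real \<Rightarrow> plane \<Rightarrow> plane \<Rightarrow> plane" where
  "DV_form a x v = ((- (a * DH x v * (h1 (fst x) * f2.h' (snd x))
      + speed x * (f1.h' (fst x) * f2.h' (snd x) * fst v + h1 (fst x) * f2.h'' (snd x) * snd v))),
      a * DH x v * (f1.h' (fst x) * h2 (snd x))
      + speed x * (f1.h'' (fst x) * h2 (snd x) * fst v + f1.h' (fst x) * f2.h' (snd x) * snd v))"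

lemma DV_eq:
  obtains a where "\<And>v. DV x v = DV_form a x v"
proof -
  obtain a where a: "(speed has_derivative (\<lambda>v. a * DH x v)) (at x)" by (rule speed_deriv)
  have "(V1 has_derivative (\<lambda>v. - (speed x * (h1 (fst x) * (f2.h'' (snd x) * snd v) + f1.h' (fst x) * fst v * f2.h' (snd x))
      + a * DH x v * (h1 (fst x) * f2.h' (snd x))))) (at x)"
    unfolding V1_def[abs_def]
    by (intro has_derivative_minus has_derivative_mult a has_derivative_fst_arg has_derivative_snd_arg f1.h_deriv f2.h'_deriv)
  then have 1: "fderiv V1 x = (\<lambda>v. - (speed x * (h1 (fst x) * (f2.h'' (snd x) * snd v) + f1.h' (fst x) * fst v * f2.h' (snd x))
      + a * DH x v * (h1 (fst x) * f2.h' (snd x))))"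
    by (rule frechet_derivative_at[symmetric])
  have "(V2 has_derivative (\<lambda>v. speed x * (f1.h' (fst x) * (f2.h' (snd x) * snd v) + f1.h'' (fst x) * fst v * h2 (snd x))
      + a * DH x v * (f1.h' (fst x) * h2 (snd x)))) (at x)"
    unfolding V2_def[abs_def]
    by (intro has_derivative_mult a has_derivative_fst_arg has_derivative_snd_arg f2.h_deriv f1.h'_deriv)
  then have 2: "fderiv V2 x = (\<lambda>v. speed x * (f1.h' (fst x) * (f2.h' (snd x) * snd v) + f1.h'' (fst x) * fst v * h2 (snd x))
      + a * DH x v * (f1.h' (fst x) * h2 (snd x)))"
    by (rule frechet_derivative_at[symmetric])
  show ?thesis by (rule that[of a]) (simp add: DV_def DV_form_def 1 2 algebra_simps)
qed

text \<open>The derivative of \<open>speed\<close> contributes a multiple of \<open>DH\<close>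
  applied to \<open>grad_perp H\<close>, which is zero, and the mixed second derivatives of
  \<open>H\<close> cancel.\<close>

lemma V_divergence: "fst (DV x (1, 0)) + snd (DV x (0, 1)) = 0"
proof -
  obtain a where a: "\<And>v. DV x v = DV_form a x v"
    by (rule DV_eq) blast
  show ?thesis unfolding a DV_form_def by (simp add: DH_def algebra_simps)
qed

text \<open>The rate at which the flow of \<open>DV V\<close> changes \<open>H\<close>, up to the factor \<open>speed\<^sup>2 H\<close>.\<close>

definition curv :: "plane \<Rightarrow> real" where
  "curv x = 2 * (f1.h' (fst x))\<^sup>2 * (f2.h' (snd x))\<^sup>2
     - (f1.h' (fst x))\<^sup>2 * (h2 (snd x) * f2.h'' (snd x)) - (f2.h' (snd x))\<^sup>2 * (h1 (fst x) * f1.h'' (fst x))"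

text \<open>Differentiating \<open>DH x (V x) = 0\<close> in the direction of \<open>V\<close> shows
  that this number is minus the Hessian of \<open>H\<close> evaluated twice on \<open>V\<close>. For
  a product Hamiltonian it is a multiple of \<open>H\<close> itself; the term with the derivative of
  \<open>speed\<close> carries the factor \<open>DH x (V x)\<close> and vanishes.\<close>

lemma DH_DV_V: "DH x (DV x (V x)) = (speed x)\<^sup>2 * curv x * H x"
proof -
  obtain a where a: "\<And>v. DV x v = DV_form a x v"
    by (rule DV_eq) blast
  show ?thesis
    unfolding a DV_form_def DH_V
    by (simp add: DH_def V_eq V1_def V2_def H_eq curv_def power2_eq_square algebra_simps)
qed

text \<open>The correction involving the gradient of \<open>lam\<close> vanishes, because
  \<open>lam\<close> is constant on the level sets of \<open>H\<close> and \<sigma> is tangent to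
  them.\<close>

lemma Gamma_eq: "Gamma_field lam \<sigma> x = DV x (V x)"
proof -
  obtain a where a: "(lam has_derivative (\<lambda>v. a * DH x v)) (at x)"
    by (rule H_composite_deriv[OF lam_eq l_differentiable])
  have "grad_perp H x \<bullet> grad lam x = a * DH x (grad_perp H x)"
    using frechet_derivative_at[OF a, symmetric]
    by (simp add: grad_def grad_perp_H DH_def inner_prod_def algebra_simps)
  then have "\<sigma> x \<bullet> grad lam x = 0" by (simp add: \<sigma>_eq DH_grad_perp)
  moreover have "frechet_derivative (scaled_field lam \<sigma>) (at x) = DV x"
    using frechet_derivative_at[OF V_has_derivative, symmetric] by (simp add: V_def)
  ultimately show ?thesis by (simp add: Gamma_field_def V_def)
qed

lemma curv_nonneg: "curv x \<ge> 0"
proof -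
  have "(f1.h' (fst x))\<^sup>2 * (h2 (snd x) * f2.h'' (snd x)) \<le> 0" "(f2.h' (snd x))\<^sup>2 * (h1 (fst x) * f1.h'' (fst x)) \<le> 0"
    using f1.concave f2.concave by (auto simp: mult_nonneg_nonpos)
  moreover have "0 \<le> 2 * (f1.h' (fst x))\<^sup>2 * (f2.h' (snd x))\<^sup>2" by simp
  ultimately show ?thesis unfolding curv_def by linarith
qed

text \<open>Three nonnegative summands vanish together. The first forces one of the two derivatives
  to be zero; at that critical point the strict sign condition makes another summand force the
  second derivative factor to be zero as well.\<close>

lemma curv_zero:
  assumes "curv x = 0" shows "f1.h' (fst x) = 0 \<and> f2.h' (snd x) = 0"
proof -
  have a: "(f1.h' (fst x))\<^sup>2 * (h2 (snd x) * f2.h'' (snd x)) \<le> 0" "(f2.h' (snd x))\<^sup>2 * (h1 (fst x) * f1.h'' (fst x)) \<le> 0"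
    using f1.concave f2.concave by (auto simp: mult_nonneg_nonpos)
  have b: "0 \<le> 2 * (f1.h' (fst x))\<^sup>2 * (f2.h' (snd x))\<^sup>2" by simp
  have z: "(f1.h' (fst x))\<^sup>2 * (h2 (snd x) * f2.h'' (snd x)) = 0"
    "(f2.h' (snd x))\<^sup>2 * (h1 (fst x) * f1.h'' (fst x)) = 0"
    "2 * (f1.h' (fst x))\<^sup>2 * (f2.h' (snd x))\<^sup>2 = 0"
    using assms a b unfolding curv_def by linarith+
  from z(3) consider "f1.h' (fst x) = 0" | "f2.h' (snd x) = 0" by auto
  then show ?thesis
  proof cases
    case 1
    with f1.critical_strict[OF 1] z(2) show ?thesis by auto
  next
    case 2
    with f2.critical_strict[OF 2] z(1) show ?thesis by auto
  qed
qed

lemma curv_continuous: "continuous_on S curv"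
proof -
  have c: "continuous_on S (\<lambda>x. u (fst x))" "continuous_on S (\<lambda>x. u (snd x))" if "continuous_on UNIV u" for u :: "real \<Rightarrow> real"
    by (rule continuous_on_compose2[OF that]; auto intro: continuous_intros)+
  show ?thesis unfolding curv_def[abs_def]
    by (intro continuous_intros c f1.h_continuous f1.h'_continuous f1.h''_continuous f2.h_continuous f2.h'_continuous f2.h''_continuous)
qed

lemma curv_translate: "curv (x + lattice L k) = curv x"
proof -
  have "periodic2 L curv"
    by (simp add: periodic2_def curv_def f1.h_periodic f2.h_periodic f1.h'_periodic f2.h'_periodic f1.h''_periodic f2.h''_periodic)
  then show ?thesis by (rule periodic2_lattice)
qed

lemma H_strict_local_max:
  assumes b: "f1.h' (fst b) = 0" "f2.h' (snd b) = 0"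
  obtains \<eta> where "\<eta> > 0" "\<And>x. dist x b \<le> \<eta> \<Longrightarrow> x \<noteq> b \<Longrightarrow> (H x)\<^sup>2 < (H b)\<^sup>2"
proof -
  obtain \<eta>1 where 1: "\<eta>1 > 0" "\<And>x. \<bar>x - fst b\<bar> \<le> \<eta>1 \<Longrightarrow> x \<noteq> fst b \<Longrightarrow> (h1 x)\<^sup>2 < (h1 (fst b))\<^sup>2"
    using f1.strict_local_max[OF b(1)] by blast
  obtain \<eta>2 where 2: "\<eta>2 > 0" "\<And>x. \<bar>x - snd b\<bar> \<le> \<eta>2 \<Longrightarrow> x \<noteq> snd b \<Longrightarrow> (h2 x)\<^sup>2 < (h2 (snd b))\<^sup>2"
    using f2.strict_local_max[OF b(2)] by blast
  have pos: "(h1 (fst b))\<^sup>2 > 0" "(h2 (snd b))\<^sup>2 > 0"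
    using f1.critical_strict[OF b(1)] f2.critical_strict[OF b(2)] by auto
  have "(H x)\<^sup>2 < (H b)\<^sup>2" if x: "dist x b \<le> min \<eta>1 \<eta>2" "x \<noteq> b" for x
  proof -
    have d: "\<bar>fst x - fst b\<bar> \<le> \<eta>1" "\<bar>snd x - snd b\<bar> \<le> \<eta>2"
      using dist_fst_le[of x b] dist_snd_le[of x b] x(1) by (auto simp: dist_real_def)
    have le: "(h1 (fst x))\<^sup>2 \<le> (h1 (fst b))\<^sup>2" "(h2 (snd x))\<^sup>2 \<le> (h2 (snd b))\<^sup>2"
      using 1(2)[OF d(1)] 2(2)[OF d(2)] by (cases "fst x = fst b"; cases "snd x = snd b"; simp)+
    from x(2) consider "fst x \<noteq> fst b" | "snd x \<noteq> snd b" by (auto simp: prod_eq_iff)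
    then have "(h1 (fst x))\<^sup>2 * (h2 (snd x))\<^sup>2 < (h1 (fst b))\<^sup>2 * (h2 (snd b))\<^sup>2"
    proof cases
      case 1
      have "(h1 (fst x))\<^sup>2 * (h2 (snd x))\<^sup>2 \<le> (h1 (fst x))\<^sup>2 * (h2 (snd b))\<^sup>2" using le by (intro mult_left_mono) auto
      also have "\<dots> < (h1 (fst b))\<^sup>2 * (h2 (snd b))\<^sup>2" using \<open>\<eta>1 > 0\<close> pos by (intro mult_strict_right_mono assms) (rule \<open>\<And>x. \<bar>x - fst b\<bar> \<le> \<eta>1 \<Longrightarrow> x \<noteq> fst b \<Longrightarrow> (h1 x)\<^sup>2 < (h1 (fst b))\<^sup>2\<close>[OF d(1) 1])
      finally show ?thesis .
    next
      case 2
      have "(h1 (fst x))\<^sup>2 * (h2 (snd x))\<^sup>2 \<le> (h1 (fst b))\<^sup>2 * (h2 (snd x))\<^sup>2" using le by (intro mult_right_mono) auto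
      also have "\<dots> < (h1 (fst b))\<^sup>2 * (h2 (snd b))\<^sup>2" using pos by (intro mult_strict_left_mono) (rule \<open>\<And>x. \<bar>x - snd b\<bar> \<le> \<eta>2 \<Longrightarrow> x \<noteq> snd b \<Longrightarrow> (h2 x)\<^sup>2 < (h2 (snd b))\<^sup>2\<close>[OF d(2) 2])
      finally show ?thesis .
    qed
    then show ?thesis by (simp add: H_eq power_mult_distrib)
  qed
  then show ?thesis using 1(1) 2(1) by (intro that[of "min \<eta>1 \<eta>2"]) auto
qed

text \<open>Contains every point that a characteristic can visit, yet mentions neither noise nor
  drift nor \<alpha>: end points of continuous curves along which the square of \<open>H\<close> is
  smallest at the end. A lower bound on \<open>curv\<close> over this set is therefore uniform in
  all of them.\<close>

definition reach :: "(plane) set \<Rightarrow> (plane) set" where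
  "reach S = {y. \<exists>\<gamma> (t::real). 0 \<le> t \<and> continuous_on {0..t} \<gamma> \<and> \<gamma> 0 \<in> S \<and> y = \<gamma> t
      \<and> (\<forall>s\<in>{0..t}. (H y)\<^sup>2 \<le> (H (\<gamma> s))\<^sup>2)}"

lemma reachE:
  assumes "y \<in> reach S"
  obtains \<gamma> and t :: real where "0 \<le> t" "continuous_on {0..t} \<gamma>" "\<gamma> 0 \<in> S" "y = \<gamma> t" "\<And>s. s \<in> {0..t} \<Longrightarrow> (H y)\<^sup>2 \<le> (H (\<gamma> s))\<^sup>2"
proof -
  from assms obtain \<gamma> and t :: real where "0 \<le> t \<and> continuous_on {0..t} \<gamma> \<and> \<gamma> 0 \<in> S \<and> y = \<gamma> t
      \<and> (\<forall>s\<in>{0..t}. (H y)\<^sup>2 \<le> (H (\<gamma> s))\<^sup>2)"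
    unfolding reach_def mem_Collect_eq by (elim exE)
  then show ?thesis by (intro that[of t \<gamma>]) blast+
qed

text \<open>A path along which \<open>H\<^sup>2\<close> decreases cannot climb into the peak of \<open>H\<^sup>2\<close> at a center.\<close>

lemma reach_avoids_center:
  assumes b: "f1.h' (fst b) = 0" "f2.h' (snd b) = 0" and S: "b \<notin> closure S"
  shows "b \<notin> closure (reach S)"
proof -
  obtain \<eta>1 where \<eta>1: "\<eta>1 > 0" "\<And>x. dist x b \<le> \<eta>1 \<Longrightarrow> x \<noteq> b \<Longrightarrow> (H x)\<^sup>2 < (H b)\<^sup>2"
    using H_strict_local_max[OF b] by blast
  obtain \<eta>2 where \<eta>2: "\<eta>2 > 0" "\<And>x. x \<in> S \<Longrightarrow> \<not> dist x b < \<eta>2"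
    using S unfolding closure_approachable by blast
  define \<eta> where "\<eta> = min \<eta>1 \<eta>2 / 2"
  have \<eta>: "\<eta> > 0" "\<eta> \<le> \<eta>1" "\<eta> < \<eta>2" using \<eta>1(1) \<eta>2(1) by (auto simp: \<eta>_def)
  have "(fst b + \<eta>, snd b) \<in> sphere b \<eta>" using \<eta>(1) by (cases b) (simp add: dist_Pair_Pair dist_real_def)
  then have ne: "sphere b \<eta> \<noteq> {}" by blast
  have "\<exists>x\<in>sphere b \<eta>. \<forall>y\<in>sphere b \<eta>. (H y)\<^sup>2 \<le> (H x)\<^sup>2"
    by (intro continuous_attains_sup ne compact_sphere continuous_intros H_continuous)
  then obtain x0 where x0: "x0 \<in> sphere b \<eta>" "\<And>y. y \<in> sphere b \<eta> \<Longrightarrow> (H y)\<^sup>2 \<le> (H x0)\<^sup>2" by blast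
  have "(H x0)\<^sup>2 < (H b)\<^sup>2" using x0(1) \<eta> by (intro \<eta>1(2)) (auto simp: dist_commute)
  moreover have "isCont (\<lambda>x. (H x)\<^sup>2) b"
    by (intro continuous_intros has_derivative_continuous[OF H_deriv])
  ultimately obtain d where d: "d > 0" "\<And>x. dist x b < d \<Longrightarrow> dist ((H x)\<^sup>2) ((H b)\<^sup>2) < (H b)\<^sup>2 - (H x0)\<^sup>2"
    unfolding continuous_at_eps_delta by (metis diff_gt_0_iff_gt)
  have "\<not> dist y b < min d \<eta>" if y: "y \<in> reach S" for y
  proof
    assume near: "dist y b < min d \<eta>"
    then have big: "(H y)\<^sup>2 > (H x0)\<^sup>2" using d(2)[of y] by (auto simp: dist_real_def abs_if split: if_splits)
    obtain \<gamma> and t :: real where \<gamma>: "0 \<le> t" "continuous_on {0..t} \<gamma>" "\<gamma> 0 \<in> S" "y = \<gamma> t" "\<And>s. s \<in> {0..t} \<Longrightarrow> (H y)\<^sup>2 \<le> (H (\<gamma> s))\<^sup>2"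
      by (rule reachE[OF y]) blast
    have "dist (\<gamma> t) b \<le> \<eta>" "\<eta> \<le> dist (\<gamma> 0) b" using near \<gamma>(4) \<eta>2(2)[OF \<gamma>(3)] \<eta>(3) by auto
    moreover have "continuous_on {0..t} (\<lambda>s. dist (\<gamma> s) b)" by (intro continuous_intros \<gamma>(2))
    \<comment> \<open>The curve starts outside the ball of radius \<eta> around \<open>b\<close> and
      ends inside, so it crosses the sphere, where the square of \<open>H\<close> is below its value
      at the end point.\<close>
    ultimately obtain s where s: "0 \<le> s" "s \<le> t" "dist (\<gamma> s) b = \<eta>"
      using IVT2'[of "\<lambda>s. dist (\<gamma> s) b" t \<eta> 0] \<gamma>(1) by blast
    have "(H (\<gamma> s))\<^sup>2 \<le> (H x0)\<^sup>2" using s(3) by (intro x0(2)) (simp add: dist_commute)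
    then show False using \<gamma>(5)[of s] s big by auto
  qed
  moreover have "min d \<eta> > 0" using d \<eta> by simp
  ultimately show ?thesis unfolding closure_approachable by blast
qed

lemma reach_translate:
  assumes S: "\<And>x. x \<in> S \<Longrightarrow> x + lattice L k \<in> S" and y: "y \<in> reach S"
  shows "y + lattice L k \<in> reach S"
proof -
  obtain \<gamma> and t :: real where \<gamma>: "0 \<le> t" "continuous_on {0..t} \<gamma>" "\<gamma> 0 \<in> S" "y = \<gamma> t" "\<And>s. s \<in> {0..t} \<Longrightarrow> (H y)\<^sup>2 \<le> (H (\<gamma> s))\<^sup>2"
    by (rule reachE[OF y]) blast
  have "continuous_on {0..t} (\<lambda>s. \<gamma> s + lattice L k)" by (intro continuous_intros \<gamma>(2))
  then show ?thesis unfolding reach_def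
    using \<gamma> S by (intro CollectI exI[of _ "\<lambda>s. \<gamma> s + lattice L k"] exI[of _ t]) (simp add: H_translate)
qed

text \<open>Outside the centers \<open>curv\<close> is positive, and the closure of the reachable
  set contains no center; periodicity reduces the infimum to a compact set.\<close>

lemma curv_reach_bound:
  assumes S: "\<And>x k. x \<in> S \<Longrightarrow> x + lattice L k \<in> S"
    and centers: "closure S \<inter> {b. f1.h' (fst b) = 0 \<and> f2.h' (snd b) = 0} = {}"
  obtains k0 where "k0 > 0" "\<And>y. y \<in> reach S \<Longrightarrow> k0 \<le> curv y"
proof -
  let ?A = "closure (reach S) \<inter> ({0..L} \<times> {0..L})"
  have "compact ?A" by (intro closed_Int_compact compact_Times) auto
  have pos: "curv x > 0" if "x \<in> ?A" for x
  proof -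
    have "curv x \<noteq> 0" using curv_zero[of x] reach_avoids_center[of x S] centers that by blast
    then show ?thesis using curv_nonneg[of x] by simp
  qed
  obtain k0 where k0: "k0 > 0" "\<And>x. x \<in> ?A \<Longrightarrow> k0 \<le> curv x"
  proof (cases "?A = {}")
    case True
    \<comment> \<open>Nothing is reachable inside the period square, so any positive number will
      do.\<close>
    show ?thesis by (rule that[of 1], simp) (simp only: True empty_iff)
  next
    case False
    have "\<exists>x\<in>?A. \<forall>y\<in>?A. curv x \<le> curv y"
      by (rule continuous_attains_inf[OF \<open>compact ?A\<close> False curv_continuous])
    then obtain x where x: "x \<in> ?A" "\<forall>y\<in>?A. curv x \<le> curv y" ..
    show ?thesis by (rule that[OF pos[OF x(1)]]) (rule bspec[OF x(2)])
  qed
  have "k0 \<le> curv y" if y: "y \<in> reach S" for y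
  proof -
    obtain k where k: "y + lattice L k \<in> torus_square L" using torus_representative[OF period] .
    have "y + lattice L k \<in> reach S" using S y by (rule reach_translate)
    then have "y + lattice L k \<in> closure (reach S)" by (rule subsetD[OF closure_subset])
    then have "y + lattice L k \<in> ?A" using k torus_square_compact_hull[of L] by blast
    from k0(2)[OF this] show ?thesis by (simp add: curv_translate)
  qed
  with k0(1) show ?thesis by (rule that)
qed

text \<open>If a product is at most \<epsilon> in absolute value, one factor is at most
  \<open>sqrt \<epsilon>\<close>. This crude power of \<epsilon> costs half of the decay
  rate.\<close>

lemma level_set_measure:
  obtains C where "C > 0" "\<And>\<epsilon>. \<epsilon> > 0 \<Longrightarrow> emeasure lborel {x \<in> torus_square L. \<bar>H x\<bar> \<le> \<epsilon>} \<le> ennreal (C * sqrt \<epsilon>)"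
proof -
  obtain C1 where C1: "C1 > 0" "\<And>\<delta>. \<delta> > 0 \<Longrightarrow> emeasure lborel {x \<in> torus_square L. \<bar>h1 (fst x)\<bar> \<le> \<delta>} \<le> ennreal (C1 * \<delta>)"
    using f1.emeasure_plane_strip by meson
  obtain C2 where C2: "C2 > 0" "\<And>\<delta>. \<delta> > 0 \<Longrightarrow> emeasure lborel {x \<in> torus_square L. \<bar>h2 (snd x)\<bar> \<le> \<delta>} \<le> ennreal (C2 * \<delta>)"
    using f2.emeasure_plane_strip by meson
  have "emeasure lborel {x \<in> torus_square L. \<bar>H x\<bar> \<le> \<epsilon>} \<le> ennreal ((C1 + C2) * sqrt \<epsilon>)" if \<epsilon>: "\<epsilon> > 0" for \<epsilon>
  proof -
    let ?A = "{x \<in> torus_square L. \<bar>h1 (fst x)\<bar> \<le> sqrt \<epsilon>}" and ?B = "{x \<in> torus_square L. \<bar>h2 (snd x)\<bar> \<le> sqrt \<epsilon>}"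
    have sq: "torus_square L \<in> sets borel" unfolding torus_square_def by (intro borel_Times) auto
    have m1: "(\<lambda>x::plane. h1 (fst x)) \<in> borel_measurable borel"
      by (rule borel_measurable_continuous_onI[OF Ck_continuous[OF Ck_fst[OF f1.h_Ck]]])
    have m2: "(\<lambda>x::plane. h2 (snd x)) \<in> borel_measurable borel"
      by (rule borel_measurable_continuous_onI[OF Ck_continuous[OF Ck_snd[OF f2.h_Ck]]])
    have m: "?A \<in> sets lborel" "?B \<in> sets lborel" using sq m1 m2 by measurable
    have "{x \<in> torus_square L. \<bar>H x\<bar> \<le> \<epsilon>} \<subseteq> ?A \<union> ?B"
    proof
      fix x assume x: "x \<in> {x \<in> torus_square L. \<bar>H x\<bar> \<le> \<epsilon>}"
      show "x \<in> ?A \<union> ?B"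
      proof (rule ccontr)
        assume "x \<notin> ?A \<union> ?B"
        then have "sqrt \<epsilon> < \<bar>h1 (fst x)\<bar>" "sqrt \<epsilon> < \<bar>h2 (snd x)\<bar>" using x by auto
        then have "sqrt \<epsilon> * sqrt \<epsilon> < \<bar>h1 (fst x)\<bar> * \<bar>h2 (snd x)\<bar>" using \<epsilon> by (intro mult_strict_mono') auto
        then show False using x \<epsilon> by (simp add: H_eq abs_mult)
      qed
    qed
    then have "emeasure lborel {x \<in> torus_square L. \<bar>H x\<bar> \<le> \<epsilon>} \<le> emeasure lborel (?A \<union> ?B)"
      using m by (intro emeasure_mono) auto
    also have "\<dots> \<le> emeasure lborel ?A + emeasure lborel ?B" using m by (rule emeasure_subadditive)
    also have "\<dots> \<le> ennreal (C1 * sqrt \<epsilon>) + ennreal (C2 * sqrt \<epsilon>)"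
      using \<epsilon> by (intro add_mono C1(2) C2(2)) auto
    also have "\<dots> = ennreal ((C1 + C2) * sqrt \<epsilon>)"
      using C1(1) C2(1) \<epsilon> by (simp add: ennreal_plus[symmetric] distrib_right del: ennreal_plus)
    finally show ?thesis .
  qed
  then show ?thesis using C1(1) C2(1) by (intro that[of "C1 + C2"]) auto
qed

text \<open>The maximum of \<open>l\<close> over the whole interval, so that the same number bounds
  \<open>lam\<close> and the value \<open>l 0\<close> occurring in the claimed rate.\<close>

lemma lam_bound: obtains lmax where "lmax > 0" "\<And>x. lam x \<le> lmax" "l 0 \<le> lmax"
proof -
  have "continuous_on {-1..1} l" using l_differentiable by (rule differentiable_imp_continuous_on)
  then have "\<exists>s0\<in>{-1..1}. \<forall>s\<in>{-1..1}. l s \<le> l s0" by (intro continuous_attains_sup) auto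
  then obtain s0 where s0: "s0 \<in> {-1..1}" "\<forall>s\<in>{-1..1}. l s \<le> l s0" ..
  show ?thesis
  proof (rule that[of "l s0"])
    show "l s0 > 0" by (rule l_pos[OF s0(1)])
    show "lam x \<le> l s0" for x unfolding lam_eq by (rule bspec[OF s0(2) H_range])
    show "l 0 \<le> l s0" by (rule bspec[OF s0(2)]) simp
  qed
qed

section \<open>Derivatives along the field and their regularity\<close>

definition Lie :: "(plane \<Rightarrow> real) \<Rightarrow> plane \<Rightarrow> real" where
  "Lie u x = fderiv u x (V x)"

lemma Lie_eq:
  assumes "Ck_on (Suc k) UNIV u"
  shows "Lie u x = V1 x * fderiv u x (1, 0) + V2 x * fderiv u x (0, 1)"
  unfolding Lie_def V_eq
  using linear_plane_bound(1)[OF has_derivative_linear[OF Ck_deriv[OF assms]] max.cobounded1 max.cobounded2, of x "(V1 x, V2 x)"]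
  by simp

text \<open>One derivative is lost and the regularity is capped by that of \<open>V\<close>.
  Starting from a smooth function, three applications give classes 2, 1 and 0, just what the
  trapezoidal and Ito expansions use.\<close>

lemma Lie_Ck:
  assumes u: "Ck_on (Suc k) UNIV u" and k: "k \<le> 2" shows "Ck_on k UNIV (Lie u)"
proof -
  have "Lie u = (\<lambda>x. V1 x * fderiv u x (1, 0) + V2 x * fderiv u x (0, 1))"
    using Lie_eq[OF u] by blast
  then show ?thesis using u k by (simp only:) (intro Ck_add Ck_mult Ck_frechet Ck_le[OF k V1_Ck] Ck_le[OF k V2_Ck])
qed

lemma V_periodic: "periodic2 L V"
  using V1_periodic V2_periodic by (simp add: periodic2_def V_eq)

lemma Lie_periodic:
  assumes u: "Ck_on (Suc k) UNIV u" and per: "periodic2 L u" shows "periodic2 L (Lie u)"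
  using V_periodic periodic2_frechet[OF per Ck_deriv[OF u]] by (simp add: periodic2_def Lie_def)

lemma V_bounds:
  obtains K where "K > 0" "\<And>x. norm (V x) \<le> K" "\<And>x v. norm (DV x v) \<le> K * norm v"
    "\<And>x y v. norm (DV x v - DV y v) \<le> K * norm (x - y) * norm v"
proof -
  have V12: "Ck_on (Suc (Suc 0)) UNIV V1" "Ck_on (Suc (Suc 0)) UNIV V2" using V1_Ck V2_Ck by (simp_all only: numeral_2_eq_2)
  obtain A where A: "A > 0" "\<And>x. \<bar>V1 x\<bar> \<le> A" "\<And>x v. \<bar>fderiv V1 x v\<bar> \<le> A * norm v"
    "\<And>x y v. \<bar>fderiv V1 x v - fderiv V1 y v\<bar> \<le> A * norm (x - y) * norm v"
    using C2_periodic_bounds[OF period V1_periodic V12(1)] by blast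
  obtain B where B: "B > 0" "\<And>x. \<bar>V2 x\<bar> \<le> B" "\<And>x v. \<bar>fderiv V2 x v\<bar> \<le> B * norm v"
    "\<And>x y v. \<bar>fderiv V2 x v - fderiv V2 y v\<bar> \<le> B * norm (x - y) * norm v"
    using C2_periodic_bounds[OF period V2_periodic V12(2)] by blast
  have n: "norm (a, b) \<le> \<bar>a\<bar> + \<bar>b\<bar>" for a b :: real using norm_Pair_le[of a b] by simp
  show ?thesis
  proof (rule that[of "A + B"])
    show "A + B > 0" using A B by simp
    show "norm (V x) \<le> A + B" for x unfolding V_eq using n[of "V1 x" "V2 x"] A(2)[of x] B(2)[of x] by linarith
    show "norm (DV x v) \<le> (A + B) * norm v" for x v
      unfolding DV_def distrib_right using A(3)[of x v] B(3)[of x v] by (intro order_trans[OF n]) linarith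
    show "norm (DV x v - DV y v) \<le> (A + B) * norm (x - y) * norm v" for x y v
      unfolding DV_def distrib_right diff_Pair using A(4)[of x v y] B(4)[of x v y] by (intro order_trans[OF n]) linarith
  qed
qed

end

section \<open>The inertial drift as data for the transport equation\<close>

locale inertial_system = hamiltonian_system L l0 r0 h1 h2 l r H lam \<rho> \<sigma>
  for L l0 r0 h1 h2 l r H lam \<rho> \<sigma> +
  fixes \<alpha> :: real
  assumes \<alpha>_pos: "\<alpha> > 0"
begin

definition g :: "plane \<Rightarrow> plane" where "g = inertial_drift \<alpha> lam \<sigma>"

definition cf :: "plane \<Rightarrow> real" where "cf x = \<alpha> / (2 * (lam x + \<alpha>))"

lemma g_eq: "g x = (cf x * Lie V1 x, cf x * Lie V2 x)"
  by (simp add: g_def inertial_drift_def Gamma_eq cf_def DV_def Lie_def)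

lemma g_eq_scale: "g x = cf x *\<^sub>R DV x (V x)" by (simp add: g_def inertial_drift_def Gamma_eq cf_def)

lemma cf_Ck: "Ck_on 2 UNIV cf"
  unfolding cf_def[abs_def]
proof (rule Ck_divide)
  show "2 * (lam x + \<alpha>) \<noteq> 0" for x using lam_pos[of x] \<alpha>_pos by simp
qed (intro Ck_const Ck_mult Ck_add lam_Ck)+

definition g1 where "g1 x = cf x * Lie V1 x"
definition g2 where "g2 x = cf x * Lie V2 x"

lemma g12_Ck: "Ck_on (Suc 0) UNIV g1" "Ck_on (Suc 0) UNIV g2"
  unfolding g1_def[abs_def] g2_def[abs_def]
  using Lie_Ck[OF V1_Ck'] Lie_Ck[OF V2_Ck'] Ck_le[of 1 2 cf] cf_Ck by (auto intro!: Ck_mult simp del: Ck_on.simps)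

lemma g12_periodic: "periodic2 L g1" "periodic2 L g2"
  using Lie_periodic[OF V1_Ck' V1_periodic] Lie_periodic[OF V2_Ck' V2_periodic] lam_periodic
  unfolding torus_periodic_iff by (simp_all add: periodic2_def g1_def g2_def cf_def)

definition Dg :: "plane \<Rightarrow> plane \<Rightarrow> plane" where
  "Dg x v = (fderiv g1 x v, fderiv g2 x v)"

text \<open>The drift contains one derivative of \<open>V\<close> and is thus of class 1.
  Periodicity makes all bounds finite, and their sum serves as the single constant of the transport
  locale.\<close>

lemma transport_data:
  assumes f0: "periodic2 L f0" "f0 \<in> borel_measurable borel" "\<And>x. 0 \<le> f0 x" "\<And>x. f0 x \<le> F0" and R0: "R0 > 0"
  obtains K where "transport V DV K g Dg L f0 F0 R0"
proof -
  obtain K where K: "K > 0" "\<And>x. norm (V x) \<le> K" "\<And>x v. norm (DV x v) \<le> K * norm v"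
    "\<And>x y v. norm (DV x v - DV y v) \<le> K * norm (x - y) * norm v"
    using V_bounds by blast
  obtain A where A: "A > 0" "\<And>x. \<bar>g1 x\<bar> \<le> A" "\<And>x v. \<bar>fderiv g1 x v\<bar> \<le> A * norm v"
    using C1_periodic_bounds[OF period g12_periodic(1) g12_Ck(1)] by metis
  obtain B where B: "B > 0" "\<And>x. \<bar>g2 x\<bar> \<le> B" "\<And>x v. \<bar>fderiv g2 x v\<bar> \<le> B * norm v"
    using C1_periodic_bounds[OF period g12_periodic(2) g12_Ck(2)] by metis
  have n: "norm (a, b) \<le> \<bar>a\<bar> + \<bar>b\<bar>" for a b :: real using norm_Pair_le[of a b] by simp
  have gp: "g = (\<lambda>x. (g1 x, g2 x))" by (auto simp: g_eq g1_def g2_def)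
  define M where "M = K + (A + B)"
  have M: "K \<le> M" "A + B \<le> M" "M > 0" using K A B by (auto simp: M_def)
  show ?thesis
  proof (rule that[of M], unfold_locales)
    show "0 < M" by (rule M)
    show "(V has_derivative DV x) (at x)" for x by (rule V_has_derivative)
    show "norm (V x) \<le> M" for x using K(2)[of x] M by linarith
    show "norm (DV x v) \<le> M * norm v" for x v
      using K(3)[of x v] mult_right_mono[OF M(1), of "norm v"] by simp
    show "norm (DV x v - DV y v) \<le> M * norm (x - y) * norm v" for x y v
      using K(4)[of x v y] mult_right_mono[OF M(1), of "norm (x - y) * norm v"] by (simp add: mult.assoc)
    show "periodic2 L V" by (rule V_periodic)
    show "periodic2 L g" using g12_periodic by (simp add: gp periodic2_def)
    show "fst (DV x (1, 0)) + snd (DV x (0, 1)) = 0" for x by (rule V_divergence)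
    show "(g has_derivative Dg x) (at x)" for x
      unfolding gp Dg_def by (intro has_derivative_Pair Ck_deriv[OF g12_Ck(1)] Ck_deriv[OF g12_Ck(2)])
    show "norm (g x) \<le> M" for x unfolding gp using n[of "g1 x" "g2 x"] A(2)[of x] B(2)[of x] M by linarith
    show "norm (Dg x v) \<le> M * norm v" for x v
    proof -
      have "norm (Dg x v) \<le> (A + B) * norm v"
        unfolding Dg_def distrib_right using A(3)[of x v] B(3)[of x v] by (intro order_trans[OF n]) linarith
      also have "\<dots> \<le> M * norm v" using M by (intro mult_right_mono) auto
      finally show ?thesis .
    qed
    show "continuous_on UNIV (\<lambda>x. Dg x v)" for v
      unfolding Dg_def by (intro continuous_on_Pair Ck_continuous[OF Ck_frechet[OF g12_Ck(1)]] Ck_continuous[OF Ck_frechet[OF g12_Ck(2)]])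
  qed (use period f0 R0 in auto)
qed

end

section \<open>Brownian motion with everywhere continuous paths\<close>

context stochastic_basis
begin

text \<open>The path is replaced by 0 on a null set of bad \<omega>. The filtration contains the
  null sets from time 0 on, so adaptedness is kept; laws and independence do not see the
  change.\<close>

lemma brownian_modification:
  assumes w: "brownian_motion M F w"
  obtains W where "AE \<omega> in M. \<forall>t. W t \<omega> = w t \<omega>" "continuous_brownian M F W"
proof -
  have "AE \<omega> in M. continuous_on {0..} (\<lambda>t. w t \<omega>) \<and> w 0 \<omega> = 0"
    using w unfolding brownian_motion_def continuous_paths_def by auto
  then obtain N where N: "{\<omega> \<in> space M. \<not> (continuous_on {0..} (\<lambda>t. w t \<omega>) \<and> w 0 \<omega> = 0)} \<subseteq> N" "N \<in> null_sets M"
    by (rule AE_E) auto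
  define W where "W t \<omega> = (if \<omega> \<in> N then 0 else w t \<omega>)" for t \<omega>
  have sp: "space (F t) = space M" if "0 \<le> t" for t using subalg[OF that] by (simp add: subalgebra_def)
  have NF: "N \<in> sets (F t)" if "0 \<le> t" for t using N(2) null mono[of 0 t] that by auto
  have wF: "w t \<in> borel_measurable (F t)" if "0 \<le> t" for t
    using w that by (simp add: brownian_motion_def adapted_def)
  have WF: "W t \<in> borel_measurable (F t)" if t: "0 \<le> t" for t
  proof -
    have "{\<omega> \<in> space (F t). \<omega> \<in> N} = N" using sets.sets_into_space[OF NF[OF t]] by blast
    then show ?thesis unfolding W_def[abs_def] by (intro measurable_If wF t) (auto simp: NF t)
  qed
  have WM: "W t \<in> borel_measurable M" and wM: "w t \<in> borel_measurable M" if "0 \<le> t" for t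
    using measurable_from_subalg[OF subalg[OF that]] WF[OF that] wF[OF that] by blast+
  have ae: "AE \<omega> in M. \<forall>t. W t \<omega> = w t \<omega>"
    using AE_not_in[OF N(2)] by eventually_elim (simp add: W_def)
  show ?thesis
  proof (rule that[OF ae], unfold_locales)
    show "continuous_on {0..} (\<lambda>t. W t \<omega>)" if "\<omega> \<in> space M" for \<omega>
      using N(1) that by (cases "\<omega> \<in> N") (auto simp: W_def)
    show "W 0 \<omega> = 0" if "\<omega> \<in> space M" for \<omega> using N(1) that by (auto simp: W_def)
    show "W t \<in> borel_measurable (F t)" if "0 \<le> t" for t by (rule WF[OF that])
    fix s t :: real assume st: "0 \<le> s" "s < t"
    then have t: "0 \<le> t" by simp
    note [measurable] = WM[OF st(1)] WM[OF t] wM[OF st(1)] wM[OF t]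
    have wd: "distributed M lborel (\<lambda>\<omega>. w t \<omega> - w s \<omega>) (normal_density 0 (sqrt (t - s)))"
      and wi: "indep_set (sets (F s)) {(\<lambda>\<omega>. w t \<omega> - w s \<omega>) -` B \<inter> space M | B. B \<in> sets borel}"
      using w st unfolding brownian_motion_def by blast+
    have "distr M lborel (\<lambda>\<omega>. W t \<omega> - W s \<omega>) = distr M lborel (\<lambda>\<omega>. w t \<omega> - w s \<omega>)"
      by (rule distr_cong_AE) (use ae in \<open>auto elim: eventually_mono\<close>)
    then show "distributed M lborel (\<lambda>\<omega>. W t \<omega> - W s \<omega>) (normal_density 0 (sqrt (t - s)))"
      using wd unfolding distributed_def by simp
    show "indep_set (sets (F s)) {(\<lambda>\<omega>. W t \<omega> - W s \<omega>) -` B \<inter> space M | B. B \<in> sets borel}"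
      unfolding indep_sets2_eq
    proof (intro conjI ballI)
      show "sets (F s) \<subseteq> events" using subalg[OF st(1)] by (simp add: subalgebra_def)
      show "{(\<lambda>\<omega>. W t \<omega> - W s \<omega>) -` B \<inter> space M |B. B \<in> sets borel} \<subseteq> events"
      proof clarify
        fix B :: "real set" assume [measurable]: "B \<in> sets borel"
        show "(\<lambda>\<omega>. W t \<omega> - W s \<omega>) -` B \<inter> space M \<in> events" by measurable
      qed
      fix a b assume a: "a \<in> sets (F s)" and "b \<in> {(\<lambda>\<omega>. W t \<omega> - W s \<omega>) -` B \<inter> space M |B. B \<in> sets borel}"
      then obtain B where b: "b = (\<lambda>\<omega>. W t \<omega> - W s \<omega>) -` B \<inter> space M" and [measurable]: "B \<in> sets borel" by blast
      have [measurable]: "a \<in> events" using a subalg[OF st(1)] by (auto simp: subalgebra_def)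
      let ?b = "(\<lambda>\<omega>. w t \<omega> - w s \<omega>) -` B \<inter> space M"
      have "prob (a \<inter> ?b) = prob a * prob ?b"
        using wi a \<open>B \<in> sets borel\<close> unfolding indep_sets2_eq by blast
      moreover have "prob (a \<inter> b) = prob (a \<inter> ?b)" unfolding b
        by (rule measure_eq_AE) (use ae in \<open>auto elim: eventually_mono\<close>)
      moreover have "prob b = prob ?b" unfolding b
        by (rule measure_eq_AE) (use ae in \<open>auto elim: eventually_mono\<close>)
      ultimately show "prob (a \<inter> b) = prob a * prob b" by simp
    qed
  qed
qed

lemma has_stratonovich_integral_modification:
  assumes S: "has_stratonovich_integral M F W Y t I" and ae: "AE \<omega> in M. \<forall>t. W t \<omega> = w t \<omega>"
  shows "has_stratonovich_integral M F w Y t I"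
  unfolding has_stratonovich_integral_def
proof (intro conjI allI impI)
  show "continuous_semimartingale M F Y" "I \<in> borel_measurable M"
    using S by (simp_all add: has_stratonovich_integral_def)
  fix \<epsilon> :: real assume \<epsilon>: "0 < \<epsilon>"
  have eq: "trapezoid_sum Y w n p \<omega> = trapezoid_sum Y W n p \<omega>" if "\<forall>t. W t \<omega> = w t \<omega>" for n p \<omega>
    using that by (simp add: trapezoid_sum_def)
  have "measure M {\<omega> \<in> space M. \<epsilon> < \<bar>trapezoid_sum Y w n p \<omega> - I \<omega>\<bar>} < \<epsilon>"
    if b: "measure M {\<omega> \<in> space M. \<epsilon> < \<bar>trapezoid_sum Y W n p \<omega> - I \<omega>\<bar>} < \<epsilon>" for n p
  \<comment> \<open>A set that is not an event has \<open>measure\<close> 0 by convention, which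
    settles that case.\<close>
  proof (cases "{\<omega> \<in> space M. \<epsilon> < \<bar>trapezoid_sum Y w n p \<omega> - I \<omega>\<bar>} \<in> events")
    case True
    have e: "AE \<omega> in M. \<omega> \<in> {\<omega> \<in> space M. \<epsilon> < \<bar>trapezoid_sum Y w n p \<omega> - I \<omega>\<bar>} \<longleftrightarrow>
        \<omega> \<in> {\<omega> \<in> space M. \<epsilon> < \<bar>trapezoid_sum Y W n p \<omega> - I \<omega>\<bar>}"
      using ae by eventually_elim (simp add: eq)
    have "{\<omega> \<in> space M. \<epsilon> < \<bar>trapezoid_sum Y W n p \<omega> - I \<omega>\<bar>} \<in> events"
      by (rule in_sets_AE[OF e True]) blast
    with measure_eq_AE[OF e True] b show ?thesis by simp
  qed (use \<epsilon> in \<open>simp add: measure_notin_sets\<close>)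
  then show "\<exists>\<delta>>0. \<forall>n p. partition_points t n p \<and> (\<forall>i<n. p (Suc i) - p i < \<delta>) \<longrightarrow>
      measure M {\<omega> \<in> space M. \<epsilon> < \<bar>trapezoid_sum Y w n p \<omega> - I \<omega>\<bar>} < \<epsilon>"
    using S \<epsilon> unfolding has_stratonovich_integral_def by meson
qed

end

section \<open>Decay of the Hamiltonian along characteristics\<close>

lemma has_derivative_along_path:
  fixes u :: "'a::real_normed_vector \<Rightarrow> real"
  assumes "(\<gamma> has_vector_derivative v) (at s)" and u: "(u has_derivative D) (at (\<gamma> s))"
  shows "((\<lambda>s. u (\<gamma> s)) has_real_derivative D v) (at s)"
proof -
  have "((\<lambda>s. u (\<gamma> s)) has_derivative (\<lambda>h. D (h *\<^sub>R v))) (at s)"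
    using assms(1) unfolding has_vector_derivative_def by (rule has_derivative_compose[where f = \<gamma> and g = u, OF _ u])
  moreover have "(\<lambda>h. D (h *\<^sub>R v)) = (*) (D v)"
    by (auto simp: linear_scale[OF has_derivative_linear[OF u]])
  ultimately show ?thesis by (simp add: has_field_derivative_def)
qed

context inertial_system
begin

definition rate :: "plane \<Rightarrow> real" where "rate y = cf y * (speed y)\<^sup>2 * curv y"

lemma rate_nonneg: "0 \<le> rate y"
  unfolding rate_def cf_def using \<alpha>_pos lam_pos[of y] curv_nonneg[of y] by (intro mult_nonneg_nonneg divide_nonneg_pos) auto

lemma DH_g: "DH y (g y) = rate y * H y"
  by (simp add: g_eq_scale DH_scale DH_DV_V rate_def mult.assoc)

text \<open>Each factor is bounded separately: the prefactor by the largest \<open>lam\<close>, the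
  squared speed by \<open>r0\<close> over the largest squared \<open>lam\<close>, and the curvature
  by \<open>k0\<close>. No derivative of \<rho> or \<open>lam\<close> enters.\<close>

lemma rate_bound:
  assumes k: "k0 \<le> curv y" "0 \<le> k0" and lmax: "lam y \<le> lmax"
  shows "\<alpha> / (2 * (lmax + \<alpha>)) * (r0 / lmax\<^sup>2) * k0 \<le> rate y"
proof -
  have lm: "lmax > 0" using lam_pos[of y] lmax by linarith
  have 1: "\<alpha> / (2 * (lmax + \<alpha>)) \<le> cf y"
    unfolding cf_def using \<alpha>_pos lam_pos[of y] lmax by (intro divide_left_mono) auto
  have "r0 / lmax\<^sup>2 \<le> (\<rho> y)\<^sup>2 / (lam y)\<^sup>2"
    using r_ge[OF H_range[of y]] r0_pos lam_pos[of y] lmax lm by (intro frac_le power_mono) (auto simp: \<rho>_eq)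
  then have 2: "r0 / lmax\<^sup>2 \<le> (speed y)\<^sup>2" by (simp add: speed_def power_divide)
  have "0 \<le> cf y" unfolding cf_def using \<alpha>_pos lam_pos[of y] by simp
  then show ?thesis unfolding rate_def
    using 1 2 k \<alpha>_pos lm r0_pos by (intro mult_mono) auto
qed

context
  fixes K F0 R0 :: real and f0 :: "plane \<Rightarrow> real"
  assumes T: "transport V DV K g Dg L f0 F0 R0"
begin

interpretation T: transport V DV K g Dg L f0 F0 R0 by (rule T)

lemma H_Phi: "H (T.Phi t x) = H x"
proof -
  have "((\<lambda>t. H (T.Phi t x)) has_real_derivative 0) (at t)" for t
    using has_derivative_along_path[OF T.Phi_deriv[of x t] H_deriv] by (simp add: DH_V)
  then have "H (T.Phi t x) = H (T.Phi 0 x)" using DERIV_isconst_all[of "\<lambda>t. H (T.Phi t x)" t 0] by blast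
  then show ?thesis by simp
qed

text \<open>Differentiation of the invariance of \<open>H\<close> under the flow.\<close>

lemma DH_DPhi: "DH (T.Phi t y) (T.DPhi t y v) = DH y v"
proof -
  have "((\<lambda>y. H (T.Phi t y)) has_derivative (\<lambda>v. DH (T.Phi t y) (T.DPhi t y v))) (at y)"
    by (rule has_derivative_compose[OF T.Phi_has_derivative H_deriv])
  then have "(H has_derivative (\<lambda>v. DH (T.Phi t y) (T.DPhi t y v))) (at y)" by (simp add: H_Phi)
  from has_derivative_unique[OF this H_deriv] show ?thesis by (rule fun_cong)
qed

context
  fixes p :: "real \<Rightarrow> real"
  assumes p: "continuous_on UNIV p"
begin

text \<open>As \<open>H\<close> is invariant under \<open>Phi\<close>, it takes the same value at
  \<open>X\<close> and at the differentiable curve \<open>zeta\<close>; the pull-back in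
  \<open>drift\<close> cancels under \<open>DH\<close>, leaving the drift \<open>- g\<close> at
  \<open>X\<close>.\<close>

lemma H_X_deriv: "((\<lambda>s. H (T.X p s z)) has_real_derivative - (rate (T.X p s z) * H (T.X p s z))) (at s)"
proof -
  let ?y = "T.X p s z"
  have "DH (T.zeta p s z) (T.drift (p s) (T.zeta p s z)) = - DH (T.Phi (- p s) ?y) (T.DPhi (- p s) ?y (g ?y))"
    by (simp add: T.drift_def T.X_def DH_def)
  also have "\<dots> = - (rate ?y * H ?y)" by (simp add: DH_DPhi DH_g)
  finally have e: "DH (T.zeta p s z) (T.drift (p s) (T.zeta p s z)) = - (rate ?y * H ?y)" .
  show ?thesis
    using has_derivative_along_path[OF T.zeta_deriv[OF p, of z s] H_deriv] unfolding e by (simp add: T.X_def H_Phi)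
qed

lemma H_X_antimono:
  assumes "s \<le> t" shows "(H (T.X p t z))\<^sup>2 \<le> (H (T.X p s z))\<^sup>2"
proof (rule DERIV_nonpos_imp_nonincreasing[OF assms])
  fix q
  have "((\<lambda>s. (H (T.X p s z))\<^sup>2) has_real_derivative - (2 * rate (T.X p q z) * (H (T.X p q z))\<^sup>2)) (at q)"
    by (auto intro!: derivative_eq_intros H_X_deriv simp: power2_eq_square)
  moreover have "- (2 * rate (T.X p q z) * (H (T.X p q z))\<^sup>2) \<le> 0" using rate_nonneg[of "T.X p q z"] by simp
  ultimately show "\<exists>y. ((\<lambda>s. (H (T.X p s z))\<^sup>2) has_real_derivative y) (at q) \<and> y \<le> 0" by blast
qed

lemma X_reach:
  assumes "z \<in> S" "p 0 = 0" "0 \<le> t" shows "T.X p t z \<in> reach S"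
  unfolding reach_def
proof (intro CollectI exI conjI)
  show "continuous_on {0..t} (\<lambda>s. T.X p s z)" by (intro T.X_continuous_compose[OF p] continuous_intros)
  show "T.X p 0 z \<in> S" using assms by (simp add: T.X_def T.zeta_0[OF p])
qed (use assms H_X_antimono in auto)

text \<open>The square of \<open>H\<close> is used because the absolute value is not differentiable;
  multiplied by the growing exponential it decreases, starting from at most 1.\<close>

lemma H_X_decay:
  assumes t: "0 \<le> t" and rate: "\<And>s. 0 \<le> s \<Longrightarrow> \<kappa> \<le> rate (T.X p s z)"
  shows "\<bar>H (T.X p t z)\<bar> \<le> exp (- \<kappa> * t)"
proof -
  let ?u = "\<lambda>s. (H (T.X p s z))\<^sup>2 * exp (2 * \<kappa> * s)"
  have "?u t \<le> ?u 0"
  proof (rule DERIV_nonpos_imp_nonincreasing[OF t])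
    fix q :: real assume q: "0 \<le> q" "q \<le> t"
    have "(?u has_real_derivative 2 * ((H (T.X p q z))\<^sup>2 * exp (2 * \<kappa> * q)) * (\<kappa> - rate (T.X p q z))) (at q)"
      by (auto intro!: derivative_eq_intros H_X_deriv simp: power2_eq_square algebra_simps)
    moreover have "2 * ((H (T.X p q z))\<^sup>2 * exp (2 * \<kappa> * q)) * (\<kappa> - rate (T.X p q z)) \<le> 0"
      using rate[OF q(1)] by (intro mult_nonneg_nonpos) auto
    ultimately show "\<exists>y. (?u has_real_derivative y) (at q) \<and> y \<le> 0" by blast
  qed
  also have "?u 0 \<le> 1" using H_range[of "T.X p 0 z"] by (simp add: abs_square_le_1 abs_le_iff)
  finally have "(H (T.X p t z))\<^sup>2 * exp (2 * \<kappa> * t) \<le> 1" .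
  then have "(H (T.X p t z))\<^sup>2 \<le> 1 / exp (2 * \<kappa> * t)" by (simp add: pos_le_divide_eq)
  also have "\<dots> = (exp (- \<kappa> * t))\<^sup>2" by (simp add: exp_minus inverse_eq_divide power_divide exp_double[symmetric] mult.assoc)
  finally show ?thesis using abs_le_square_iff[of "H (T.X p t z)" "exp (- \<kappa> * t)"] by simp
qed

text \<open>A nonzero density at \<open>x\<close> means that the characteristic through
  \<open>x\<close> started where \<open>f0\<close> is nonzero, so it has stayed in the reachable set
  and the rate bound applies at all earlier times.\<close>

lemma sol_support:
  assumes t: "0 \<le> t" and p0: "p 0 = 0" and nz: "T.sol p t x \<noteq> 0"
    and k0: "0 \<le> k0" "\<And>y. y \<in> reach {z. f0 z \<noteq> 0} \<Longrightarrow> k0 \<le> curv y" and lmax: "\<And>x. lam x \<le> lmax"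
  shows "\<bar>H x\<bar> \<le> exp (- (\<alpha> / (2 * (lmax + \<alpha>)) * (r0 / lmax\<^sup>2) * k0) * t)"
proof -
  let ?z = "T.Xinv p t x"
  have "f0 ?z \<noteq> 0" using nz by (auto simp: T.sol_def T.amp_def)
  then have "\<alpha> / (2 * (lmax + \<alpha>)) * (r0 / lmax\<^sup>2) * k0 \<le> rate (T.X p s ?z)" if "0 \<le> s" for s
    by (intro rate_bound k0 lmax X_reach p0 that) simp
  from H_X_decay[OF t this] show ?thesis by (simp add: T.X_Xinv[OF p])
qed

text \<open>Height times area: the absorption bound supplies the factor \<open>1 / R0\<close>, the
  thin level region the exponential. The square root in the area estimate halves the
  exponent.\<close>

lemma mass_decay:
  assumes t: "1 \<le> t" and p0: "p 0 = 0"
    and k0: "0 \<le> k0" "\<And>y. y \<in> reach {z. f0 z \<noteq> 0} \<Longrightarrow> k0 \<le> curv y" and lmax: "\<And>x. lam x \<le> lmax"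
    and C: "C > 0" "\<And>\<epsilon>. \<epsilon> > 0 \<Longrightarrow> emeasure lborel {x \<in> torus_square L. \<bar>H x\<bar> \<le> \<epsilon>} \<le> ennreal (C * sqrt \<epsilon>)"
  shows "torus_integral L (T.sol p t) \<le> exp (2 * K) / R0 * (C * exp (- (\<alpha> / (2 * (lmax + \<alpha>)) * (r0 / lmax\<^sup>2) * k0) * t / 2))"
proof -
  define \<epsilon> where "\<epsilon> = exp (- (\<alpha> / (2 * (lmax + \<alpha>)) * (r0 / lmax\<^sup>2) * k0) * t)"
  let ?A = "{x \<in> torus_square L. \<bar>H x\<bar> \<le> \<epsilon>}" and ?B = "exp (2 * K) / R0"
  have B: "0 \<le> ?B" using T.R0_pos by simp
  have sq: "torus_square L \<in> sets borel" unfolding torus_square_def by (intro borel_Times) auto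
  have A: "?A \<in> sets lborel" using sq by measurable
  have eA: "emeasure lborel ?A \<le> ennreal (C * sqrt \<epsilon>)" by (rule C(2)) (simp add: \<epsilon>_def)
  then have fA: "emeasure lborel ?A < \<infinity>" by (rule le_less_trans) simp
  have "torus_integral L (T.sol p t) = (LINT x|lborel. indicator (torus_square L) x * T.sol p t x)"
    by (simp add: torus_integral_def set_lebesgue_integral_def torus_square_def)
  also have "\<dots> \<le> (LINT x|lborel. ?B * indicator ?A x)"
  proof (rule integral_mono')
    show "integrable lborel (\<lambda>x. ?B * indicator ?A x)" using A fA by simp
    show nn: "0 \<le> ?B * indicator ?A x" for x using B by (simp add: indicator_def)
    show "indicator (torus_square L) x * T.sol p t x \<le> ?B * indicator ?A x" for x
    proof (cases "x \<in> torus_square L \<and> T.sol p t x \<noteq> 0")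
      case True
      then have "\<bar>H x\<bar> \<le> \<epsilon>" unfolding \<epsilon>_def using t by (intro sol_support p0 k0 lmax) auto
      then show ?thesis using True T.sol_absorption_bound[OF p t, of x] by simp
    next
      case False
      then have e: "indicator (torus_square L) x * T.sol p t x = 0" by (auto simp: indicator_def)
      show ?thesis unfolding e by (rule nn)
    qed
  qed
  also have "\<dots> = ?B * measure lborel ?A" using A by simp
  also have "\<dots> \<le> ?B * (C * sqrt \<epsilon>)"
    using eA C(1) B by (intro mult_left_mono) (auto simp: measure_def \<epsilon>_def intro!: enn2real_leI)
  also have "sqrt \<epsilon> = exp (- (\<alpha> / (2 * (lmax + \<alpha>)) * (r0 / lmax\<^sup>2) * k0) * t / 2)"
  proof -
    have "sqrt (exp (q * t)) = exp (q * t / 2)" for q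
      by (rule real_sqrt_unique) (simp_all add: power2_eq_square flip: exp_add)
    then show ?thesis unfolding \<epsilon>_def .
  qed
  finally show ?thesis .
qed

end

lemma Lie_along_flow:
  assumes "Ck_on (Suc k) UNIV u"
  shows "((\<lambda>t. u (T.Phi t x)) has_real_derivative Lie u (T.Phi q x)) (at q)"
  unfolding Lie_def by (rule has_derivative_along_path[OF T.Phi_deriv Ck_deriv[OF assms]])

lemma test_functionI:
  assumes per: "periodic2 L u" and u: "Ck_on (Suc (Suc k)) UNIV u"
  obtains C where "\<And>C'. C \<le> C' \<Longrightarrow> T.test_function u (\<lambda>x. fderiv u x) C'"
proof -
  obtain C where C: "C > 0" "\<And>x. \<bar>u x\<bar> \<le> C" "\<And>x v. \<bar>fderiv u x v\<bar> \<le> C * norm v"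
    "\<And>x y v. \<bar>fderiv u x v - fderiv u y v\<bar> \<le> C * norm (x - y) * norm v"
    using C2_periodic_bounds[OF period per u] by metis
  show ?thesis
  proof (rule that[of C])
    fix C' assume le: "C \<le> C'"
    have "C * norm v \<le> C' * norm v" for v :: "plane" using le by (intro mult_right_mono) auto
    moreover have "C * norm (x - y) * norm v \<le> C' * norm (x - y) * norm v" for x y v :: "plane" using le by (intro mult_right_mono) auto
    ultimately show "T.test_function u (\<lambda>x. fderiv u x) C'"
      unfolding T.test_function_def
      using C le per Ck_deriv[OF u] by (intro conjI allI) (assumption | (rule order_trans, rule C, assumption) | force)+
  qed
qed

end

end

section \<open>Identification of the explicit density with the given solution\<close>

context inertial_system
begin

lemma grad_inner:
  assumes "(\<phi> has_derivative D) (at x)"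
  shows "v \<bullet> grad \<phi> x = D v"
proof -
  have "D v = fst v * D (1, 0) + snd v * D (0, 1)"
    by (rule linear_plane_bound(1)[OF has_derivative_linear[OF assms] max.cobounded1 max.cobounded2])
  then show ?thesis
    by (simp add: grad_def inner_prod_def frechet_derivative_at[OF assms, symmetric])
qed

context
  fixes K F0 R0 :: real and f0 :: "plane \<Rightarrow> real" and M :: "'a measure" and \<F> :: "real \<Rightarrow> 'a measure"
    and W :: "real \<Rightarrow> 'a \<Rightarrow> real"
  assumes S: "stochastic_transport V DV K g Dg L f0 F0 R0 M \<F> W"
begin

interpretation S: stochastic_transport V DV K g Dg L f0 F0 R0 M \<F> W by (rule S)

lemma particle_mass_bound:
  assumes t: "0 \<le> t" and \<omega>: "\<omega> \<in> space M" shows "torus_integral L (S.particle_density t \<omega>) \<le> F0 * L\<^sup>2"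
proof -
  have "\<bar>S.mean (S.bpath \<omega>) (\<lambda>_. 1) t\<bar> \<le> F0 * 1 * L\<^sup>2"
    by (rule S.mean_bound[OF S.bpath_continuous[OF \<omega>] t]) (auto simp: periodic2_def)
  then show ?thesis by (simp add: S.mean_def S.particle_density_def[abs_def])
qed

lemma particle_mass_decay:
  assumes "1 \<le> t" "\<omega> \<in> space M"
    and "0 \<le> k0" "\<And>y. y \<in> reach {z. f0 z \<noteq> 0} \<Longrightarrow> k0 \<le> curv y" and "\<And>x. lam x \<le> lmax"
    and "C > 0" "\<And>\<epsilon>. \<epsilon> > 0 \<Longrightarrow> emeasure lborel {x \<in> torus_square L. \<bar>H x\<bar> \<le> \<epsilon>} \<le> ennreal (C * sqrt \<epsilon>)"
  shows "torus_integral L (S.particle_density t \<omega>)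
    \<le> exp (2 * K) / R0 * (C * exp (- (\<alpha> / (2 * (lmax + \<alpha>)) * (r0 / lmax\<^sup>2) * k0) * t / 2))"
  unfolding S.particle_density_def[abs_def]
  by (rule mass_decay[OF S.transport_axioms S.bpath_continuous[OF assms(2)] assms(1) _ assms(3-)])
     (simp add: S.bpath_def S.W_0[OF assms(2)])

context
  fixes w :: "real \<Rightarrow> 'a \<Rightarrow> real"
  assumes ae: "AE \<omega> in M. \<forall>t. W t \<omega> = w t \<omega>"
begin

text \<open>With \<open>strat_limit\<close> as the integral the equation holds by rearrangement; the
  substance is that \<open>strat_limit\<close> is the Stratonovich integral of the mean of
  \<open>\<phi>1\<close>, the derivative of \<phi> along \<open>V\<close>, first for the continuous
  version \<open>W\<close> and then for \<open>w\<close>.\<close>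

lemma weak_identity:
  assumes \<phi>: "smooth_torus L \<phi>" and t: "0 \<le> t"
  shows "\<exists>I. has_stratonovich_integral M \<F> w
        (\<lambda>s \<omega>. torus_integral L (\<lambda>x. S.particle_density s \<omega> x * (scaled_field lam \<sigma> x \<bullet> grad \<phi> x))) t I \<and>
      (AE \<omega> in M. torus_integral L (\<lambda>x. S.particle_density t \<omega> x * \<phi> x)
        = torus_integral L (\<lambda>x. f0 x * \<phi> x) + I \<omega>
          - (LINT s:{0..t}|lborel. torus_integral L (\<lambda>x. S.particle_density s \<omega> x * (inertial_drift \<alpha> lam \<sigma> x \<bullet> grad \<phi> x)))
          - R0 * (LINT s:{0..t}|lborel. torus_integral L (\<lambda>x. (S.particle_density s \<omega> x)\<^sup>2 * \<phi> x)))"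
proof -
  have smooth: "Ck_on k UNIV \<phi>" for k using \<phi> by (simp add: smooth_torus_def)
  have per: "periodic2 L \<phi>" using \<phi> by (simp add: smooth_torus_def torus_periodic_iff)
  let ?D = "\<lambda>x. fderiv \<phi> x"
  define \<phi>1 where "\<phi>1 = Lie \<phi>"
  define \<phi>2 where "\<phi>2 = Lie \<phi>1"
  define \<phi>3 where "\<phi>3 = Lie \<phi>2"
  let ?D1 = "\<lambda>x. fderiv \<phi>1 x"
  have Ck1: "Ck_on (Suc (Suc 0)) UNIV \<phi>1" unfolding \<phi>1_def by (rule Lie_Ck[OF smooth]) simp
  have Ck2: "Ck_on (Suc 0) UNIV \<phi>2" unfolding \<phi>2_def by (rule Lie_Ck[OF Ck1]) simp
  have Ck3: "Ck_on 0 UNIV \<phi>3" unfolding \<phi>3_def by (rule Lie_Ck[OF Ck2]) simp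
  have per1: "periodic2 L \<phi>1" unfolding \<phi>1_def by (rule Lie_periodic[OF smooth per])
  have per2: "periodic2 L \<phi>2" unfolding \<phi>2_def by (rule Lie_periodic[OF Ck1 per1])
  have per3: "periodic2 L \<phi>3" unfolding \<phi>3_def by (rule Lie_periodic[OF Ck2 per2])
  obtain A0 where A0: "\<And>C. A0 \<le> C \<Longrightarrow> S.test_function \<phi> ?D C"
    using test_functionI[OF S.transport_axioms per smooth] by blast
  obtain A1 where A1: "\<And>C. A1 \<le> C \<Longrightarrow> S.test_function \<phi>1 ?D1 C"
    using test_functionI[OF S.transport_axioms per1 Ck1] by blast
  obtain A2 where A2: "A2 > 0" "\<And>x. \<bar>\<phi>2 x\<bar> \<le> A2"
    using periodic2_bounded[OF period per2 Ck_continuous[OF Ck2]] by metis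
  obtain A3 where A3: "A3 > 0" "\<And>x. \<bar>\<phi>3 x\<bar> \<le> A3"
    using periodic2_bounded[OF period per3 Ck_continuous[OF Ck3]] by metis
  define C where "C = max (max A0 A1) (max A2 A3)"
  have C: "A0 \<le> C" "A1 \<le> C" "A2 \<le> C" "A3 \<le> C" by (auto simp: C_def)
  note test0 = A0[OF C(1)] and test1 = A1[OF C(2)]
  have along: "((\<lambda>t. \<phi> (S.Phi t x)) has_real_derivative \<phi>1 (S.Phi q x)) (at q)"
    "((\<lambda>t. \<phi>1 (S.Phi t x)) has_real_derivative \<phi>2 (S.Phi q x)) (at q)"
    "((\<lambda>t. \<phi>2 (S.Phi t x)) has_real_derivative \<phi>3 (S.Phi q x)) (at q)" for q x
    unfolding \<phi>1_def \<phi>2_def \<phi>3_def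
    using Lie_along_flow[OF S.transport_axioms smooth] Lie_along_flow[OF S.transport_axioms Ck1]
      Lie_along_flow[OF S.transport_axioms Ck2] by (simp_all only: \<phi>1_def \<phi>2_def)
  have bd: "\<bar>\<phi>2 x\<bar> \<le> C" "\<bar>\<phi>3 x\<bar> \<le> C" for x using A2(2)[of x] A3(2)[of x] C by linarith+
  \<comment> \<open>In the order of the assumptions of the context of
    \<open>process_stratonovich\<close>; outside that context they are also premises of
    \<open>strat_limit_def\<close>.\<close>
  note hyps = test0 test1 along per2 Ck_continuous[OF Ck2] bd(1) per3 Ck_continuous[OF Ck3] bd(2)
    periodic2_uniformly_continuous[OF period per3 Ck_continuous[OF Ck3]]
  have strat: "has_stratonovich_integral M \<F> W (S.process \<phi>1) t (S.strat_limit \<phi> ?D t)"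
    by (rule S.process_stratonovich[OF hyps t])
  have der: "(\<phi> has_derivative ?D x) (at x)" for x by (rule Ck_deriv[OF smooth])
  have tr: "torus_integral L (\<lambda>x. S.particle_density s \<omega> x * (scaled_field lam \<sigma> x \<bullet> grad \<phi> x)) = S.process \<phi>1 s \<omega>" for s \<omega>
    by (simp add: S.process_def S.mean_def S.particle_density_def grad_inner[OF der] \<phi>1_def Lie_def flip: V_def)
  have dr: "torus_integral L (\<lambda>x. S.particle_density s \<omega> x * (inertial_drift \<alpha> lam \<sigma> x \<bullet> grad \<phi> x))
      = S.mean (S.bpath \<omega>) (\<lambda>x. ?D x (g x)) s" for s \<omega>
    by (simp add: S.mean_def S.particle_density_def grad_inner[OF der] flip: g_def)
  have sqr: "torus_integral L (\<lambda>x. (S.particle_density s \<omega> x)\<^sup>2 * \<phi> x) = S.mean2 (S.bpath \<omega>) \<phi> s" for s \<omega>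
    by (simp add: S.mean2_def S.particle_density_def)
  have mass: "torus_integral L (\<lambda>x. S.particle_density s \<omega> x * \<phi> x) = S.process \<phi> s \<omega>" for s \<omega>
    by (simp add: S.process_def S.mean_def S.particle_density_def)
  show ?thesis
    unfolding tr dr sqr mass
  proof (intro exI[of _ "S.strat_limit \<phi> ?D t"] conjI AE_I2)
    show "has_stratonovich_integral M \<F> w (S.process \<phi>1) t (S.strat_limit \<phi> ?D t)"
      by (rule S.has_stratonovich_integral_modification[OF strat ae])
    fix \<omega> assume \<omega>: "\<omega> \<in> space M"
    let ?m1 = "S.mean (S.bpath \<omega>) (\<lambda>x. ?D x (g x))" and ?m2 = "S.mean2 (S.bpath \<omega>) \<phi>"
    let ?I1 = "LINT s:{0..t}|lborel. ?m1 s" and ?I2 = "LINT s:{0..t}|lborel. ?m2 s"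
    note p = S.bpath_continuous[OF \<omega>]
    have p0: "S.bpath \<omega> 0 = 0" using S.W_0[OF \<omega>] by (simp add: S.bpath_def)
    have init: "S.process \<phi> 0 \<omega> = torus_integral L (\<lambda>x. f0 x * \<phi> x)"
      by (simp add: S.process_def S.mean_def S.sol_0[OF p] p0)
    have c1: "continuous_on {0..t} (?m1)"
      by (rule continuous_on_subset[OF S.mean_continuous[OF p S.test_g_periodic[OF p test0] S.test_g_continuous[OF p test0] S.test_g_bound[OF p test0]]]) auto
    have c2: "continuous_on {0..t} (?m2)"
      by (rule continuous_on_subset[OF S.mean2_continuous[OF p S.test_periodic[OF p test0] S.test_continuous[OF p test0] S.test_bound[OF p test0]]]) auto
    have i1: "set_integrable lborel {0..t} (?m1)"
      and i2: "set_integrable lborel {0..t} (?m2)"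
      by (rule borel_integrable_atLeastAtMost'[OF c1], rule borel_integrable_atLeastAtMost'[OF c2])
    have "(LINT s:{0..t}|lborel. S.gen \<phi> ?D (S.bpath \<omega>) s)
        = - ?I1 - R0 * ?I2"
    proof -
      have i3: "set_integrable lborel {0..t} (\<lambda>s. R0 * ?m2 s)"
        by (intro set_integrable_mult_right i2)
      have "S.gen \<phi> ?D (S.bpath \<omega>) s = - (?m1 s + R0 * ?m2 s)" for s
        by (simp add: S.gen_def)
      then have "(LINT s:{0..t}|lborel. S.gen \<phi> ?D (S.bpath \<omega>) s)
          = (LINT s:{0..t}|lborel. - (?m1 s + R0 * ?m2 s))"
        by (simp only:)
      also have "\<dots> = - (LINT s:{0..t}|lborel. ?m1 s + R0 * ?m2 s)"
        by (rule set_integral_uminus[OF set_integral_add(1)[OF i1 i3]])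
      also have "(LINT s:{0..t}|lborel. ?m1 s + R0 * ?m2 s)
          = ?I1 + (LINT s:{0..t}|lborel. R0 * ?m2 s)"
        by (rule set_integral_add(2)[OF i1 i3])
      finally show ?thesis by simp
    qed
    then show "S.process \<phi> t \<omega> = torus_integral L (\<lambda>x. f0 x * \<phi> x) + S.strat_limit \<phi> ?D t \<omega>
        - ?I1 - R0 * ?I2"
      unfolding S.strat_limit_def[OF hyps] init by simp
  qed
qed

lemma particle_density_weak_solution: "bounded_weak_solution M \<F> w L lam \<sigma> \<alpha> R0 f0 S.particle_density"
  unfolding bounded_weak_solution_def
proof (intro conjI allI ballI impI)
  fix t :: real assume t: "0 \<le> t"
  show "torus_periodic L (S.particle_density t \<omega>)" if "\<omega> \<in> space M" for \<omega>
    using S.sol_periodic[OF S.bpath_continuous[OF that]]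
    by (simp add: torus_periodic_iff S.particle_density_def[abs_def])
  show "(\<lambda>(\<omega>, x). S.particle_density t \<omega> x) \<in> borel_measurable (\<F> t \<Otimes>\<^sub>M borel)"
    by (rule S.particle_density_adapted[OF t])
  show "AE \<omega> in M. AE x in lborel. 0 \<le> S.particle_density t \<omega> x"
    by (intro AE_I2) (simp add: S.particle_density_def S.sol_nonneg[OF S.bpath_continuous t])
next
  fix T :: real assume "0 \<le> T"
  show "\<exists>C. \<forall>t\<in>{0..T}. AE \<omega> in M. AE x in lborel. S.particle_density t \<omega> x \<le> C"
  proof (intro exI[of _ "F0 * exp (2 * K * T)"] ballI AE_I2)
    fix t \<omega> and x :: "plane" assume t: "t \<in> {0..T}" and \<omega>: "\<omega> \<in> space M"
    have "S.particle_density t \<omega> x \<le> F0 * exp (2 * K * t)"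
      unfolding S.particle_density_def using t by (intro S.sol_bound[OF S.bpath_continuous[OF \<omega>]]) simp
    also have "\<dots> \<le> F0 * exp (2 * K * T)"
      using t S.F0_nonneg S.K_pos by (intro mult_left_mono) auto
    finally show "S.particle_density t \<omega> x \<le> F0 * exp (2 * K * T)" .
  qed
next
  show "(\<lambda>(t, \<omega>, x). S.particle_density t \<omega> x) \<in> borel_measurable (restrict_space borel {0..} \<Otimes>\<^sub>M (M \<Otimes>\<^sub>M borel))"
    by (rule S.particle_density_measurable)
qed (rule weak_identity)

text \<open>Uniqueness enters here: the given solution agrees with the explicit density almost
  everywhere at each time, so a pathwise mass bound for the latter passes to the
  expectation.\<close>

lemma unique_solution_mass:
  assumes f: "unique_bounded_weak_solution M \<F> w L lam \<sigma> \<alpha> R0 f0 f" and t: "0 \<le> t"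
    and B: "\<And>\<omega>. \<omega> \<in> space M \<Longrightarrow> torus_integral L (S.particle_density t \<omega>) \<le> B"
  shows "(LINT \<omega>|M. torus_integral L (f t \<omega>)) \<le> B"
proof -
  have fm: "(\<lambda>(\<omega>, x). f t \<omega> x) \<in> borel_measurable (\<F> t \<Otimes>\<^sub>M borel)"
    using f t by (simp add: unique_bounded_weak_solution_def bounded_weak_solution_def)
  have "(\<lambda>\<omega>. torus_integral L (f t \<omega>)) \<in> borel_measurable (\<F> t)"
    by (rule torus_integral_measurable) (use fm in \<open>simp add: case_prod_beta\<close>)
  then have m1: "(\<lambda>\<omega>. torus_integral L (f t \<omega>)) \<in> borel_measurable M" by (rule S.F_measurable_M[OF t])
  have "(\<lambda>\<omega>. torus_integral L (S.particle_density t \<omega>)) \<in> borel_measurable (\<F> t)"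
    by (rule torus_integral_measurable) (use S.particle_density_adapted[OF t] in \<open>simp add: case_prod_beta\<close>)
  then have m2: "(\<lambda>\<omega>. torus_integral L (S.particle_density t \<omega>)) \<in> borel_measurable M" by (rule S.F_measurable_M[OF t])
  have "AE \<omega> in M. AE x in lborel. S.particle_density t \<omega> x = f t \<omega> x"
    using f t particle_density_weak_solution unfolding unique_bounded_weak_solution_def by blast
  then have ae: "AE \<omega> in M. torus_integral L (f t \<omega>) = torus_integral L (S.particle_density t \<omega>)"
  proof (rule AE_mp, intro AE_I2 impI)
    fix \<omega> assume \<omega>: "\<omega> \<in> space M" and e: "AE x in lborel. S.particle_density t \<omega> x = f t \<omega> x"
    have sec: "h \<omega> \<in> borel_measurable borel" if "(\<lambda>(\<omega>, x). h \<omega> x) \<in> borel_measurable (\<F> t \<Otimes>\<^sub>M borel)"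
      for h :: "'a \<Rightarrow> plane \<Rightarrow> real"
      using measurable_Pair2[OF that, of \<omega>] \<omega> by (simp add: S.space_F[OF t])
    have [measurable]: "f t \<omega> \<in> borel_measurable borel" "S.particle_density t \<omega> \<in> borel_measurable borel"
      using sec[OF fm] sec[OF S.particle_density_adapted[OF t]] .
    have [measurable]: "{0..<L} \<times> {0..<L} \<in> sets (borel :: (plane) measure)" by (intro borel_Times) auto
    show "torus_integral L (f t \<omega>) = torus_integral L (S.particle_density t \<omega>)"
      unfolding torus_integral_def set_lebesgue_integral_def
      by (rule integral_cong_AE) (use e in \<open>auto elim: eventually_mono\<close>)
  qed
  have "(LINT \<omega>|M. torus_integral L (f t \<omega>)) = (LINT \<omega>|M. torus_integral L (S.particle_density t \<omega>))"
    by (rule integral_cong_AE[OF m1 m2 ae])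
  also have "\<dots> \<le> (LINT \<omega>|M. B)"
  proof (rule integral_mono)
    have "0 \<le> torus_integral L (S.particle_density t \<omega>)" if "\<omega> \<in> space M" for \<omega>
      unfolding torus_integral_def set_lebesgue_integral_def S.particle_density_def
      by (intro Bochner_Integration.integral_nonneg) (simp add: S.sol_nonneg[OF S.bpath_continuous[OF that] t])
    then show "integrable M (\<lambda>\<omega>. torus_integral L (S.particle_density t \<omega>))"
      using B by (intro S.integrable_const_bound[where B = B] m2 AE_I2) auto
  qed (auto intro: B)
  finally show ?thesis by (simp add: S.prob_space)
qed

end

end

end

theorem theorem2p2:
  fixes M :: "'a measure" and F :: "real \<Rightarrow> 'a measure" and w :: "real \<Rightarrow> 'a \<Rightarrow> real"
    and L l0 r0 :: real and h1 h2 l r :: "real \<Rightarrow> real"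
    and H lam \<rho> f0 :: "real \<times> real \<Rightarrow> real" and \<sigma> :: "real \<times> real \<Rightarrow> real \<times> real"
  assumes "stochastic_basis M F"
    and "brownian_motion M F w"
    and "L > 0"
    and "hamiltonian_factor L h1" and "hamiltonian_factor L h2"
    and "H = hamiltonian h1 h2"
    and "\<And>x. \<sigma> x \<bullet> grad H x = 0"
    and "\<And>x. \<sigma> x = \<rho> x *\<^sub>R grad_perp H x"
    and "torus_periodic L \<rho>" and "Ck_on 2 UNIV \<rho>"
    and "torus_periodic L lam" and "Ck_on 2 UNIV lam"
    and "l0 > 0" and "\<And>x. lam x \<ge> l0"
    and "Ck_on 2 {-1..1} l" and "Ck_on 2 {-1..1} r"
    and "\<And>x. lam x = l (H x)" and "\<And>x. \<rho> x = r (H x)"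
    and "\<And>s. s \<in> {-1..1} \<Longrightarrow> l s \<ge> l0"
    and "r0 > 0" and "\<And>s. s \<in> {-1..1} \<Longrightarrow> (r s)\<^sup>2 \<ge> r0"
    and "torus_periodic L f0" and "f0 \<in> borel_measurable borel"
    and "bounded (range f0)" and "\<And>x. f0 x \<ge> 0"
    and "closure {x. f0 x \<noteq> 0} \<inter> (critical_points h1 \<times> critical_points h2) = {}"
  shows "\<exists>\<kappa>>0. \<forall>R0>0. \<forall>\<alpha>>0. \<forall>f. unique_bounded_weak_solution M F w L lam \<sigma> \<alpha> R0 f0 f \<longrightarrow>
           (\<exists>c>0. \<forall>t\<ge>0.
              (LINT \<omega>|M. torus_integral L (f t \<omega>))
              \<le> c / R0 * exp (- (\<alpha> * (r 0)\<^sup>2 / ((l 0)\<^sup>2 * (l 0 + \<alpha>)) * \<kappa> * t)))"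
proof -
  interpret B: stochastic_basis M F by (rule assms)
  interpret hamiltonian_system L l0 r0 h1 h2 l r H lam \<rho> \<sigma>
    by unfold_locales (rule assms; assumption?)+
  obtain W where W: "AE \<omega> in M. \<forall>t. W t \<omega> = w t \<omega>" "continuous_brownian M F W"
    using B.brownian_modification[OF assms(2)] .
  have per: "periodic2 L f0" using assms(22) by (simp add: torus_periodic_iff)
  obtain F0 where "F0 > 0" and F0: "\<And>x. f0 x \<le> F0"
  proof -
    obtain b where "b > 0" "\<And>y. y \<in> range f0 \<Longrightarrow> norm y \<le> b" using assms(24) unfolding bounded_pos by blast
    then show ?thesis using abs_le_D1 by (intro that[of b]) force+
  qed
  let ?S = "{z. f0 z \<noteq> 0}"
  have Strans: "x + lattice L k \<in> ?S" if "x \<in> ?S" for x k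
    using that by (simp add: periodic2_lattice[OF per])
  have centers: "closure ?S \<inter> {b. f1.h' (fst b) = 0 \<and> f2.h' (snd b) = 0} = {}"
    using assms(26) by (force simp: critical_points_def f1.h'_def f2.h'_def)
  obtain k0 where k0: "k0 > 0" "\<And>y. y \<in> reach ?S \<Longrightarrow> k0 \<le> curv y"
    using curv_reach_bound[OF Strans centers] by metis
  obtain lmax where lmax: "lmax > 0" "\<And>x. lam x \<le> lmax" "l 0 \<le> lmax" using lam_bound by metis
  obtain C where C: "C > 0" "\<And>\<epsilon>. \<epsilon> > 0 \<Longrightarrow> emeasure lborel {x \<in> torus_square L. \<bar>H x\<bar> \<le> \<epsilon>} \<le> ennreal (C * sqrt \<epsilon>)"
    using level_set_measure by metis
  have l00: "l 0 > 0" using l_pos[of 0] by simp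
  have r00: "(r 0)\<^sup>2 > 0" using r_ge[of 0] r0_pos by (intro less_le_trans[OF r0_pos]) simp
  have rn: "r 0 \<noteq> 0" using r00 by auto
  \<comment> \<open>Fixed before \<open>R0\<close> and \<alpha>. The factors \<open>(l 0)^3\<close>
    and \<open>(r 0)\<^sup>2\<close> trade the constants of the claimed rate for the crude ones
    \<open>r0\<close> and \<open>lmax\<close>; 4 combines the 2 of the drift coefficient with the 2
    lost in the area estimate.\<close>
  define \<kappa> where "\<kappa> = r0 * k0 * (l 0)^3 / (4 * lmax^3 * (r 0)\<^sup>2)"
  have \<kappa>: "\<kappa> > 0" unfolding \<kappa>_def using r0_pos k0 l00 lmax r00 by simp
  show ?thesis
  proof (rule exI[of _ \<kappa>], intro conjI allI impI)
    show "\<kappa> > 0" by (rule \<kappa>)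
    fix R0 \<alpha> :: real and f
    assume R0: "0 < R0" and \<alpha>: "0 < \<alpha>" and f: "unique_bounded_weak_solution M F w L lam \<sigma> \<alpha> R0 f0 f"
    interpret inertial_system L l0 r0 h1 h2 l r H lam \<rho> \<sigma> \<alpha> by unfold_locales (rule \<alpha>)
    obtain K where T: "transport V DV K g Dg L f0 F0 R0"
      using transport_data[OF per assms(23,25) F0 R0] .
    have S: "stochastic_transport V DV K g Dg L f0 F0 R0 M F W"
      by (rule stochastic_transport.intro[OF T W(2)])
    define a where "a = \<alpha> * (r 0)\<^sup>2 / ((l 0)\<^sup>2 * (l 0 + \<alpha>)) * \<kappa>"
    have a0: "a \<ge> 0" unfolding a_def using \<kappa> \<alpha> l00 by simp
    define b where "b = \<alpha> / (2 * (lmax + \<alpha>)) * (r0 / lmax\<^sup>2) * k0"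
    \<comment> \<open>The dependence on \<alpha> is removed by
      \<open>l 0 / lmax \<le> (l 0 + \<alpha>) / (lmax + \<alpha>)\<close>, which holds because
      \<open>l 0 \<le> lmax\<close>.\<close>
    have ab: "a \<le> b / 2"
    proof -
      have "l 0 / lmax \<le> (l 0 + \<alpha>) / (lmax + \<alpha>)"
        using lmax l00 \<alpha> by (simp add: field_simps mult_right_mono)
      then have "(l 0 / lmax) / (l 0 + \<alpha>) \<le> ((l 0 + \<alpha>) / (lmax + \<alpha>)) / (l 0 + \<alpha>)"
        using l00 \<alpha> by (intro divide_right_mono) auto
      also have "\<dots> = 1 / (lmax + \<alpha>)" using l00 \<alpha> by simp
      finally have le: "(l 0 / lmax) / (l 0 + \<alpha>) \<le> 1 / (lmax + \<alpha>)" .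
      have "a = \<alpha> * r0 * k0 / (4 * lmax\<^sup>2) * ((l 0 / lmax) / (l 0 + \<alpha>))"
      proof -
        have "\<alpha> * Q / (A\<^sup>2 * d) * (r0 * k0 * A ^ 3 / (4 * m ^ 3 * Q)) = \<alpha> * r0 * k0 / (4 * m\<^sup>2) * (A / m / d)"
          if "A \<noteq> 0" "Q \<noteq> 0" "m \<noteq> 0" "d \<noteq> 0" for A Q m d :: real
          using that by (simp add: field_simps power2_eq_square power3_eq_cube)
        from this[of "l 0" "(r 0)\<^sup>2" lmax "l 0 + \<alpha>"] show ?thesis
          unfolding a_def \<kappa>_def using rn l00 lmax(1) \<alpha> by simp
      qed
      also have "\<dots> \<le> \<alpha> * r0 * k0 / (4 * lmax\<^sup>2) * (1 / (lmax + \<alpha>))"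
        using le \<alpha> r0_pos k0 by (intro mult_left_mono) auto
      also have "\<dots> = b / 2" unfolding b_def using lmax(1) \<alpha> by (simp add: field_simps)
      finally show ?thesis .
    qed
    \<comment> \<open>The first summand serves for \<open>t \<ge> 1\<close>, where absorption has
      acted for a unit of time. The second serves for \<open>t < 1\<close>: the initial mass bound
      \<open>F0 * L\<^sup>2\<close> is used, \<open>exp a\<close> makes up for the decay over at
      most unit time, and \<open>R0\<close> cancels the denominator.\<close>
    define c where "c = exp (2 * K) * C + R0 * (F0 * L\<^sup>2) * exp a"
    have c: "c > 0" unfolding c_def using C R0 \<open>F0 > 0\<close> by (intro add_pos_nonneg) auto
    have "(LINT \<omega>|M. torus_integral L (f t \<omega>)) \<le> c / R0 * exp (- (a * t))" if t: "0 \<le> t" for t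
    proof (rule unique_solution_mass[OF S W(1) f t])
      fix \<omega> assume \<omega>: "\<omega> \<in> space M"
      let ?m = "torus_integral L (stochastic_transport.particle_density V DV g Dg f0 R0 W t \<omega>)"
      show "?m \<le> c / R0 * exp (- (a * t))"
      proof (cases "1 \<le> t")
        case True
        have "?m \<le> exp (2 * K) / R0 * (C * exp (- b * t / 2))"
          unfolding b_def by (rule particle_mass_decay[OF S True \<omega> less_imp_le[OF k0(1)] k0(2) lmax(2) C])
        also have "\<dots> \<le> exp (2 * K) / R0 * (C * exp (- (a * t)))"
        proof (intro mult_left_mono)
          have "a * t \<le> b / 2 * t" using ab t by (rule mult_right_mono)
          then show "exp (- b * t / 2) \<le> exp (- (a * t))" by simp
        qed (use C R0 in auto)
        also have "\<dots> = (exp (2 * K) * C) / R0 * exp (- (a * t))" by simp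
        also have "\<dots> \<le> c / R0 * exp (- (a * t))"
          unfolding c_def using R0 \<open>F0 > 0\<close> by (intro mult_right_mono divide_right_mono) auto
        finally show ?thesis .
      next
        case False
        have "?m \<le> F0 * L\<^sup>2" by (rule particle_mass_bound[OF S t \<omega>])
        also have "\<dots> \<le> F0 * L\<^sup>2 * (exp a * exp (- (a * t)))"
        proof -
          have "a * t \<le> a * 1" using False a0 by (intro mult_left_mono) auto
          then have "1 \<le> exp (a - a * t)" by simp
          then have "1 \<le> exp a * exp (- (a * t))" by (simp add: exp_diff exp_minus divide_inverse)
          from mult_left_mono[OF this, of "F0 * L\<^sup>2"] show ?thesis using \<open>F0 > 0\<close> by simp
        qed
        also have "\<dots> = (R0 * (F0 * L\<^sup>2) * exp a) / R0 * exp (- (a * t))" using R0 by simp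
        also have "\<dots> \<le> c / R0 * exp (- (a * t))"
          unfolding c_def using R0 C by (intro mult_right_mono divide_right_mono) auto
        finally show ?thesis .
      qed
    qed
    with c show "\<exists>c>0. \<forall>t\<ge>0. (LINT \<omega>|M. torus_integral L (f t \<omega>))
        \<le> c / R0 * exp (- (\<alpha> * (r 0)\<^sup>2 / ((l 0)\<^sup>2 * (l 0 + \<alpha>)) * \<kappa> * t))"
      unfolding a_def by blast
  qed
qed

end
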